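(* Let $k$ be an algebraically closed field of odd characteristic, let $n\ge 2$ and $G=Sp_{2n}(k)$. Let $x\in G\setminus Z(G)$, where $Z(G)=\{\pm I_{2n}\}$. Then the conjugacy class of $x$ is spherical if and only if $x$ or $-x$ is conjugate in $G$ to one of the following elements: (1) (semisimple) $\sigma_l=\mathrm{diag}(-I_l,I_{n-l},-I_l,I_{n-l})$ for some $l\in\{1,\ldots,\left[\frac n2\right]\}$; $a_\lambda=\mathrm{diag}(\lambda I_n,\lambda^{-1}I_n)$ for some $\lambda\in k$ with $\lambda^2\ne 0,1$; or $c_\lambda=\mathrm{diag}(\lambda,I_{n-1},\lambda^{-1},I_{n-1})$ for some $\lambda\in k$ with $\lambda^2\neq 0,1$; (2) (unipotent) a unipotent element whose Jordan block sizes form the partition $(2^m,1^{2n-2m})$ for some $m\in\{1,\ldots,n\}$; (3) (neither semisimple nor unipotent) $\sigma_l u$ for some $l\in\{1,\ldots,\left[\frac n2\right]\}$, where $u\in G_{\sigma_l}\cong Sp_{2l}(k)\times Sp_{2n-2l}(k)$ is a unipotent element whose Jordan block sizes as a $2n\times 2n$ matrix form the partition $(2,1^{2n-2})$.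
   Context: $Sp_{2n}(k)$ is the group of matrices preserving the bilinear form on $k^{2n}$ with matrix $\begin{pmatrix}0&I_n\\-I_n&0\end{pmatrix}$. $G_x$ denotes the centralizer of $x$ in $G$. A conjugacy class $\mathcal{O}_x\simeq G/G_x$ is called spherical if some Borel subgroup of $G$ has a dense orbit on it for the Zariski topology. In a partition, exponents denote multiplicities; $[\cdot]$ is the integer part. *)

theory Defs
  imports
    "HOL-Algebra.Solvable_Groups"
    "HOL-Algebra.Group_Action"
    "HOL-Analysis.Abstract_Topology"
    "HOL-Library.Multiset"
    "Jordan_Normal_Form.Jordan_Normal_Form"
begin

section \<open>The symplectic group\<close>

definition symp_form :: "nat \<Rightarrow> 'a :: field mat" where
  "symp_form n = four_block_mat (0\<^sub>m n n) (1\<^sub>m n) (- 1\<^sub>m n) (0\<^sub>m n n)"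

definition Sp :: "nat \<Rightarrow> 'a :: field mat monoid" where
  "Sp n = \<lparr>carrier = {A \<in> carrier_mat (2 * n) (2 * n).
                        transpose_mat A * symp_form n * A = symp_form n},
           monoid.mult = (*), one = 1\<^sub>m (2 * n)\<rparr>"

lemma symp_form_carrier [simp]: "symp_form n \<in> carrier_mat (2 * n) (2 * n)"
  by (simp add: symp_form_def mult_2)

lemma symp_form_square:
  "symp_form n * symp_form n = - (1\<^sub>m (2 * n) :: 'a :: field mat)"
proof -
  have "symp_form n * symp_form n =
     four_block_mat (0\<^sub>m n n * 0\<^sub>m n n + 1\<^sub>m n * (- 1\<^sub>m n)) (0\<^sub>m n n * 1\<^sub>m n + 1\<^sub>m n * 0\<^sub>m n n)
       (- 1\<^sub>m n * 0\<^sub>m n n + 0\<^sub>m n n * (- 1\<^sub>m n)) (- 1\<^sub>m n * 1\<^sub>m n + 0\<^sub>m n n * (0\<^sub>m n n :: 'a mat))"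
    unfolding symp_form_def by (rule mult_four_block_mat[of _ n n _ n _ n _ _ n _ n]) auto
  also have "\<dots> = four_block_mat (- 1\<^sub>m n) (0\<^sub>m n n) (0\<^sub>m n n) (- 1\<^sub>m n)"
    by (auto intro!: eq_matI)
  also have "\<dots> = - 1\<^sub>m (2 * n)"
    by (rule eq_matI) auto
  finally show ?thesis .
qed

lemma Sp_group: "group (Sp n :: 'a :: field mat monoid)"
proof (rule groupI)
  let ?G = "Sp n :: 'a mat monoid" and ?J = "symp_form n :: 'a mat"
  let ?N = "2 * n"
  have J: "?J \<in> carrier_mat ?N ?N" by simp
  show "\<one>\<^bsub>?G\<^esub> \<in> carrier ?G"
    using J by (simp add: Sp_def left_mult_one_mat[OF J] right_mult_one_mat[OF J])
  fix A assume A: "A \<in> carrier ?G"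
  hence Ac: "A \<in> carrier_mat ?N ?N" and AJ: "transpose_mat A * ?J * A = ?J"
    by (auto simp: Sp_def)
  show "\<one>\<^bsub>?G\<^esub> \<otimes>\<^bsub>?G\<^esub> A = A"
    using Ac by (simp add: Sp_def)
  {
    fix B assume B: "B \<in> carrier ?G"
    hence Bc: "B \<in> carrier_mat ?N ?N" and BJ: "transpose_mat B * ?J * B = ?J"
      by (auto simp: Sp_def)
    have "transpose_mat (A * B) * ?J * (A * B)
        = (transpose_mat B * transpose_mat A) * ?J * (A * B)"
      using Ac Bc by (simp add: transpose_mult)
    also have "\<dots> = transpose_mat B * (transpose_mat A * ?J * A) * B"
      using Ac Bc J by (simp add: assoc_mult_mat[of _ ?N ?N _ ?N _ ?N] mult_carrier_mat[of _ ?N ?N _ ?N])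
    finally show "A \<otimes>\<^bsub>?G\<^esub> B \<in> carrier ?G"
      using Ac Bc AJ BJ by (simp add: Sp_def)
    fix C assume "C \<in> carrier ?G"
    hence "C \<in> carrier_mat ?N ?N" by (auto simp: Sp_def)
    thus "A \<otimes>\<^bsub>?G\<^esub> B \<otimes>\<^bsub>?G\<^esub> C = A \<otimes>\<^bsub>?G\<^esub> (B \<otimes>\<^bsub>?G\<^esub> C)"
      using Ac Bc by (simp add: Sp_def)
  }
  define D where "D = - ?J * transpose_mat A * ?J"
  have Dc: "D \<in> carrier_mat ?N ?N"
    using Ac J by (simp add: D_def mult_carrier_mat[of _ ?N ?N _ ?N])
  have "D * A = - ?J * (transpose_mat A * ?J * A)"
    using Ac J by (simp add: D_def assoc_mult_mat[of _ ?N ?N _ ?N _ ?N] mult_carrier_mat[of _ ?N ?N _ ?N])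
  also have "\<dots> = - (?J * ?J)"
    using uminus_mult_left_mat[of ?J ?J] J by (simp add: AJ carrier_matD[OF J])
  finally have DA: "D * A = 1\<^sub>m ?N"
    by (simp add: symp_form_square)
  have AD: "A * D = 1\<^sub>m ?N"
    using mat_mult_left_right_inverse[OF Dc Ac DA] .
  have "transpose_mat D * ?J * D
      = transpose_mat D * (transpose_mat A * ?J * A) * D"
    by (simp add: AJ)
  also have "\<dots> = (transpose_mat D * transpose_mat A) * ?J * (A * D)"
    using Ac Dc J by (simp add: assoc_mult_mat[of _ ?N ?N _ ?N _ ?N] mult_carrier_mat[of _ ?N ?N _ ?N])
  also have "transpose_mat D * transpose_mat A = transpose_mat (A * D)"
    using Ac Dc by (simp add: transpose_mult)
  finally have "transpose_mat D * ?J * D = ?J"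
    using J by (simp add: AD)
  hence "D \<in> carrier ?G" "D \<otimes>\<^bsub>?G\<^esub> A = \<one>\<^bsub>?G\<^esub>"
    using Dc DA by (auto simp: Sp_def)
  thus "\<exists>D\<in>carrier ?G. D \<otimes>\<^bsub>?G\<^esub> A = \<one>\<^bsub>?G\<^esub>" by blast
qed


section \<open>Conjugation\<close>

definition group_center :: "('a, 'b) monoid_scheme \<Rightarrow> 'a set" where
  "group_center G = {z \<in> carrier G. \<forall>g\<in>carrier G. g \<otimes>\<^bsub>G\<^esub> z = z \<otimes>\<^bsub>G\<^esub> g}"

definition centralizer :: "('a, 'b) monoid_scheme \<Rightarrow> 'a \<Rightarrow> 'a set" where
  "centralizer G x = {g \<in> carrier G. g \<otimes>\<^bsub>G\<^esub> x = x \<otimes>\<^bsub>G\<^esub> g}"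

definition conj_action :: "('a, 'b) monoid_scheme \<Rightarrow> 'a \<Rightarrow> 'a \<Rightarrow> 'a" where
  "conj_action G g y = g \<otimes>\<^bsub>G\<^esub> y \<otimes>\<^bsub>G\<^esub> inv\<^bsub>G\<^esub> g"

definition conj_class :: "('a, 'b) monoid_scheme \<Rightarrow> 'a \<Rightarrow> 'a set" where
  "conj_class G x = orbit G (conj_action G) x"

definition conjugate_in :: "('a, 'b) monoid_scheme \<Rightarrow> 'a \<Rightarrow> 'a \<Rightarrow> bool" where
  "conjugate_in G x y \<longleftrightarrow> y \<in> conj_class G x"


section \<open>The Zariski topology on square matrices\<close>

text \<open>Polynomial functions in the \<open>N\<^sup>2\<close> matrix entries.\<close>

inductive_set poly_funs :: "nat \<Rightarrow> ('a :: field mat \<Rightarrow> 'a) set" for N :: nat where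
  const: "(\<lambda>A. c) \<in> poly_funs N"
| coord: "i < N \<Longrightarrow> j < N \<Longrightarrow> (\<lambda>A. A $$ (i, j)) \<in> poly_funs N"
| add: "f \<in> poly_funs N \<Longrightarrow> g \<in> poly_funs N \<Longrightarrow> (\<lambda>A. f A + g A) \<in> poly_funs N"
| mult: "f \<in> poly_funs N \<Longrightarrow> g \<in> poly_funs N \<Longrightarrow> (\<lambda>A. f A * g A) \<in> poly_funs N"

definition zero_locus :: "nat \<Rightarrow> ('a :: field mat \<Rightarrow> 'a) set \<Rightarrow> 'a mat set" where
  "zero_locus N F = {A \<in> carrier_mat N N. \<forall>f\<in>F. f A = 0}"

definition zariski_open :: "nat \<Rightarrow> 'a :: field mat set \<Rightarrow> bool" where
  "zariski_open N U \<longleftrightarrow> (\<exists>F \<subseteq> poly_funs N. U = carrier_mat N N - zero_locus N F)"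

definition zariski :: "nat \<Rightarrow> 'a :: field mat topology" where
  "zariski N = topology (zariski_open N)"

lemma istopology_zariski: "istopology (zariski_open N :: 'a :: field mat set \<Rightarrow> bool)"
  unfolding istopology_def
proof (intro conjI allI impI)
  fix S T :: "'a mat set"
  assume "zariski_open N S" "zariski_open N T"
  then obtain F G where F: "F \<subseteq> poly_funs N" "S = carrier_mat N N - zero_locus N F"
    and G: "G \<subseteq> poly_funs N" "T = carrier_mat N N - zero_locus N G"
    unfolding zariski_open_def by blast
  define H where "H = {\<lambda>A. f A * g A | f g. f \<in> F \<and> g \<in> G}"
  have "H \<subseteq> poly_funs N"
    using F(1) G(1) by (auto simp: H_def intro!: poly_funs.mult)
  moreover have "S \<inter> T = carrier_mat N N - zero_locus N H"
  proof (intro equalityI subsetI)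
    fix A assume "A \<in> S \<inter> T"
    then obtain f g where A: "A \<in> carrier_mat N N" and "f \<in> F" "f A \<noteq> 0" "g \<in> G" "g A \<noteq> 0"
      by (auto simp: F(2) G(2) zero_locus_def)
    hence "(\<lambda>A. f A * g A) \<in> H" "f A * g A \<noteq> 0" by (auto simp: H_def)
    thus "A \<in> carrier_mat N N - zero_locus N H"
      using A by (force simp: zero_locus_def)
  next
    fix A assume "A \<in> carrier_mat N N - zero_locus N H"
    then obtain h where A: "A \<in> carrier_mat N N" and "h \<in> H" "h A \<noteq> 0"
      by (auto simp: zero_locus_def)
    then obtain f g where "f \<in> F" "g \<in> G" "f A \<noteq> 0" "g A \<noteq> 0"
      by (auto simp: H_def)
    thus "A \<in> S \<inter> T"
      using A by (auto simp: F(2) G(2) zero_locus_def)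
  qed
  ultimately show "zariski_open N (S \<inter> T)"
    unfolding zariski_open_def by blast
next
  fix K :: "'a mat set set"
  assume "\<forall>S\<in>K. zariski_open N S"
  then obtain F where F: "\<And>S. S \<in> K \<Longrightarrow> F S \<subseteq> poly_funs N"
      "\<And>S. S \<in> K \<Longrightarrow> S = carrier_mat N N - zero_locus N (F S)"
    unfolding zariski_open_def by metis
  have "\<Union>K = (\<Union>S\<in>K. carrier_mat N N - zero_locus N (F S))"
    using F(2) by auto
  also have "\<dots> = carrier_mat N N - zero_locus N (\<Union>(F ` K))"
    by (auto simp: zero_locus_def)
  finally have "\<Union>K = carrier_mat N N - zero_locus N (\<Union>(F ` K))" .
  moreover have "\<Union>(F ` K) \<subseteq> poly_funs N"
    using F(1) by blast
  ultimately show "zariski_open N (\<Union>K)"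
    unfolding zariski_open_def by blast
qed

lemma openin_zariski: "openin (zariski N) U \<longleftrightarrow> zariski_open N U"
  unfolding zariski_def by (simp add: istopology_zariski)

lemma topspace_zariski [simp]: "topspace (zariski N) = (carrier_mat N N :: 'a :: field mat set)"
proof -
  have "zariski_open N (carrier_mat N N :: 'a mat set)"
    unfolding zariski_open_def
    by (rule exI[of _ "{\<lambda>A. 1}"]) (auto simp: zero_locus_def intro: poly_funs.const)
  moreover have "U \<subseteq> carrier_mat N N" if "zariski_open N U" for U :: "'a mat set"
    using that by (auto simp: zariski_open_def)
  ultimately show ?thesis
    unfolding topspace_def openin_zariski by blast
qed


section \<open>Borel subgroups and spherical conjugacy classes\<close>

definition closed_connected_solvable :: "nat \<Rightarrow> 'a :: field mat set \<Rightarrow> bool" where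
  "closed_connected_solvable n B \<longleftrightarrow>
     subgroup B (Sp n) \<and>
     closedin (subtopology (zariski (2 * n)) (carrier (Sp n))) B \<and>
     connectedin (zariski (2 * n)) B \<and>
     solvable (Sp n \<lparr>carrier := B\<rparr>)"

definition borel_subgroup :: "nat \<Rightarrow> 'a :: field mat set \<Rightarrow> bool" where
  "borel_subgroup n B \<longleftrightarrow>
     closed_connected_solvable n B \<and>
     (\<forall>H. closed_connected_solvable n H \<longrightarrow> B \<subseteq> H \<longrightarrow> H = B)"

definition spherical_class :: "nat \<Rightarrow> 'a :: field mat set \<Rightarrow> bool" where
  "spherical_class n C \<longleftrightarrow>
     (\<exists>B. borel_subgroup n B \<and>
       (\<exists>y\<in>C. subtopology (zariski (2 * n)) C closure_of
                orbit (Sp n \<lparr>carrier := B\<rparr>) (conj_action (Sp n)) y = C))"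


section \<open>Unipotent elements, Jordan types and the semisimple representatives\<close>

definition unipotent_mat :: "'a :: field mat \<Rightarrow> bool" where
  "unipotent_mat u \<longleftrightarrow>
     square_mat u \<and> (\<exists>k. (u - 1\<^sub>m (dim_row u)) ^\<^sub>m k = 0\<^sub>m (dim_row u) (dim_row u))"

text \<open>The multiset of sizes of all Jordan blocks (for all eigenvalues together) is \<open>P\<close>.\<close>

definition has_jordan_type :: "'a :: field mat \<Rightarrow> nat multiset \<Rightarrow> bool" where
  "has_jordan_type A P \<longleftrightarrow> (\<exists>n_as. jordan_nf A n_as \<and> mset (map fst n_as) = P)"

definition sigma_mat :: "nat \<Rightarrow> nat \<Rightarrow> 'a :: field mat" where
  "sigma_mat n l = diag_block_mat [- 1\<^sub>m l, 1\<^sub>m (n - l), - 1\<^sub>m l, 1\<^sub>m (n - l)]"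

definition a_mat :: "nat \<Rightarrow> 'a :: field \<Rightarrow> 'a mat" where
  "a_mat n c = diag_block_mat [c \<cdot>\<^sub>m 1\<^sub>m n, inverse c \<cdot>\<^sub>m 1\<^sub>m n]"

definition c_mat :: "nat \<Rightarrow> 'a :: field \<Rightarrow> 'a mat" where
  "c_mat n c = diag_block_mat [c \<cdot>\<^sub>m 1\<^sub>m 1, 1\<^sub>m (n - 1), inverse c \<cdot>\<^sub>m 1\<^sub>m 1, 1\<^sub>m (n - 1)]"

end

theory Submission
  imports Defs "HOL-Library.Function_Algebras"
begin

text \<open>Suppose that a Borel subgroup \<open>B\<close> has a dense orbit on the class of \<open>x\<close>. By the Lie--Kolchin
  theorem \<open>B\<close> stabilises a line spanned by some \<open>v\<close>, and a totally isotropic plane containing it. For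
  \<open>z\<close> in the class, \<open>om v (z v)\<close> and \<open>om v (z\<^sup>2 v)\<close> are semi-invariants of \<open>B\<close> of the same weight, hence
  linearly dependent. Moving the line by the symplectic group gives a relation \<open>\<alpha> X + \<beta> X Y = 0\<close> for
  \<open>X = x - x\<inverse>\<close> and \<open>Y = x + x\<inverse>\<close>; two semi-invariants attached to the plane give a further quadratic
  relation (\<open>R2\<close> below). Linear algebra shows that only the listed elements satisfy both.

  Conversely, for each listed \<open>x\<close> a generic complete isotropic flag has an adapted symplectic basis in
  which the entries of \<open>x\<close> lie in a fixed finite set. Hence finitely many \<open>B\<close>-orbits cover a dense subset
  of the class, which is irreducible since any two symplectic matrices are joined by a polynomial
  curve; so one of these orbits is dense.\<close>

section \<open>Vectors, matrices and the symplectic form\<close>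

text \<open>Sphericity asks for some Borel subgroup, so the conjugacy of Borel subgroups never has
  to be proved: a given dense orbit is exploited through the flag that its own group fixes, and
  density is established for the standard group. Dimensions of orbits are avoided too; the main
  geometric input is that a nonzero polynomial in one variable has a nonzero value, applied along
  polynomial curves inside the group. This is why frames are moved by products of transvections that
  depend polynomially on a parameter.

  The linear relation between \<open>X\<close> and \<open>X Y\<close> leaves at most one pair of
  eigenvalues \<kappa>, 1/\<kappa> besides 1 and -1, and it bounds the sizes of the Jordan blocks.
  What remains is to exclude combinations, and this is done by evaluating the quadratic relation on
  a few explicit isotropic pairs, chosen so that they isolate one coefficient or the other. Passing
  from \<open>x\<close> to its negative changes the signs of both \<open>X\<close> and
  \<open>Y\<close>, which is the origin of the alternative \<open>- x\<close> in the
  theorem.\<close>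

text \<open>Vectors of length \<open>m\<close> are functions on \<open>nat\<close> vanishing from \<open>m\<close> on: unlike \<open>vec\<close>, their
  type is an abelian group, so that bilinear computations carry no side conditions.\<close>

definition vs :: "nat \<Rightarrow> (nat \<Rightarrow> 'k::field) set" where
  "vs m = {v. \<forall>i\<ge>m. v i = 0}"

definition scl :: "'k::field \<Rightarrow> (nat \<Rightarrow> 'k) \<Rightarrow> nat \<Rightarrow> 'k" (infixr "\<star>" 75) where
  "c \<star> v = (\<lambda>i. c * v i)"

definition bv :: "nat \<Rightarrow> nat \<Rightarrow> 'k::field" where
  "bv i = (\<lambda>j. if j = i then 1 else 0)"

text \<open>Coordinates of \<open>v\<close> from \<open>m\<close> on are ignored and those of the
  result are zero, so \<open>act m A v\<close> lies in \<open>vs m\<close> for every argument. Many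
  equations below carry no membership hypotheses for this reason.\<close>

definition act :: "nat \<Rightarrow> 'k::field mat \<Rightarrow> (nat \<Rightarrow> 'k) \<Rightarrow> nat \<Rightarrow> 'k" where
  "act m A v = (\<lambda>i. if i < m then \<Sum>j<m. A $$ (i, j) * v j else 0)"

lemma scl_apply [simp]: "(c \<star> v) i = c * v i" by (simp add: scl_def)

lemma scl_add: "c \<star> (v + w) = c \<star> v + c \<star> w"
  and scl_diff: "c \<star> (v - w) = c \<star> v - c \<star> w"
  and scl_left_add: "(a + b) \<star> v = a \<star> v + b \<star> v"
  and scl_left_diff: "(a - b) \<star> v = a \<star> v - b \<star> v"
  by (auto simp: fun_eq_iff algebra_simps)

lemma scl_scl [simp]: "a \<star> b \<star> v = (a * b) \<star> v"
  and scl_one [simp]: "1 \<star> v = v"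
  and scl_zero [simp]: "0 \<star> v = 0"
  and scl_zero_right [simp]: "c \<star> 0 = 0"
  and scl_minus [simp]: "c \<star> (- v) = - (c \<star> v)" "(- c) \<star> v = - (c \<star> v)"
  and scl_minus_one: "(- 1) \<star> v = - v"
  by (auto simp: fun_eq_iff)

lemma scl_eq_0 [simp]: "c \<star> v = 0 \<longleftrightarrow> c = 0 \<or> v = 0"
  by (auto simp: fun_eq_iff)

lemma vs_closed [simp, intro]:
  "0 \<in> vs m" "v \<in> vs m \<Longrightarrow> w \<in> vs m \<Longrightarrow> v + w \<in> vs m" "v \<in> vs m \<Longrightarrow> w \<in> vs m \<Longrightarrow> v - w \<in> vs m"
  "v \<in> vs m \<Longrightarrow> c \<star> v \<in> vs m" "v \<in> vs m \<Longrightarrow> - v \<in> vs m" "act m A v \<in> vs m" "i < m \<Longrightarrow> bv i \<in> vs m"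
  by (auto simp: vs_def act_def bv_def)

lemma act_add [simp]: "act m A (v + w) = act m A v + act m A w"
  and act_scl [simp]: "act m A (c \<star> v) = c \<star> act m A v"
  and act_diff [simp]: "act m A (v - w) = act m A v - act m A w"
  and act_uminus [simp]: "act m A (- v) = - act m A v"
  and act_zero [simp]: "act m A 0 = 0"
  by (auto simp: act_def fun_eq_iff algebra_simps sum.distrib sum_distrib_left sum_subtractf sum_negf)

lemma mult_carrier_mat_sq [simp, intro]:
  "A \<in> carrier_mat m m \<Longrightarrow> B \<in> carrier_mat m m \<Longrightarrow> A * B \<in> carrier_mat m m"
  by (rule mult_carrier_mat)

lemma act_mult:
  assumes "A \<in> carrier_mat m m" "B \<in> carrier_mat m m"
  shows "act m (A * B) v = act m A (act m B v)"
proof (rule ext)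
  fix i
  show "act m (A * B) v i = act m A (act m B v) i"
  proof (cases "i < m")
    case True
    have "(\<Sum>j<m. (A * B) $$ (i, j) * v j) = (\<Sum>j<m. \<Sum>k<m. A $$ (i, k) * B $$ (k, j) * v j)"
      using assms True by (intro sum.cong) (auto simp: scalar_prod_def sum_distrib_right atLeast0LessThan)
    also have "\<dots> = (\<Sum>k<m. \<Sum>j<m. A $$ (i, k) * B $$ (k, j) * v j)" by (rule sum.swap)
    also have "\<dots> = (\<Sum>k<m. A $$ (i, k) * (\<Sum>j<m. B $$ (k, j) * v j))"
      by (simp add: sum_distrib_left mult.assoc)
    finally show ?thesis using True by (simp add: act_def)
  qed (simp add: act_def)
qed

lemma act_one [simp]: "v \<in> vs m \<Longrightarrow> act m (1\<^sub>m m) v = v"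
  by (auto simp: act_def fun_eq_iff vs_def if_distrib if_distribR cong: if_cong)

lemma act_uminus_mat [simp]: "A \<in> carrier_mat m m \<Longrightarrow> act m (- A) v = - act m A v"
  and act_add_mat: "A \<in> carrier_mat m m \<Longrightarrow> B \<in> carrier_mat m m \<Longrightarrow> act m (A + B) v = act m A v + act m B v"
  and act_diff_mat: "A \<in> carrier_mat m m \<Longrightarrow> B \<in> carrier_mat m m \<Longrightarrow> act m (A - B) v = act m A v - act m B v"
  and act_zero_mat [simp]: "act m (0\<^sub>m m m) v = 0"
  by (auto simp: act_def fun_eq_iff sum_distrib_left sum_negf sum.distrib sum_subtractf algebra_simps)

lemma act_bv: "i < m \<Longrightarrow> j < m \<Longrightarrow> act m A (bv j) i = A $$ (i, j)"
  by (simp add: act_def bv_def if_distrib cong: if_cong)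

lemma vs_expand: "v \<in> vs m \<Longrightarrow> v = (\<Sum>j<m. v j \<star> bv j)"
proof (rule ext)
  fix i assume "v \<in> vs m"
  have "(\<Sum>j\<in>S. v j \<star> bv j) i = (\<Sum>j\<in>S. v j * bv j i)" for S :: "nat set"
    by (induction S rule: infinite_finite_induct) auto
  thus "v i = (\<Sum>j<m. v j \<star> bv j) i"
    using \<open>v \<in> vs m\<close> by (auto simp: bv_def if_distrib vs_def cong: if_cong)
qed

section \<open>Linear maps and their matrices\<close>

definition lin :: "((nat \<Rightarrow> 'k::field) \<Rightarrow> (nat \<Rightarrow> 'k)) \<Rightarrow> bool" where
  "lin T \<longleftrightarrow> (\<forall>v w. T (v + w) = T v + T w) \<and> (\<forall>c v. T (c \<star> v) = c \<star> T v)"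

lemma lin_act [simp]: "lin (act m A)" by (simp add: lin_def)

lemma lin_0: "lin T \<Longrightarrow> T 0 = 0"
  using scl_zero[of "T 0"] unfolding lin_def by (metis scl_zero_right)

lemma lin_minus: "lin T \<Longrightarrow> T (- v) = - T v" using scl_minus_one[of v] scl_minus_one[of "T v"] unfolding lin_def by metis

lemma lin_diff: "lin T \<Longrightarrow> T (v - w) = T v - T w"
  using lin_minus[of T w] by (simp add: lin_def diff_conv_add_uminus del: add_uminus_conv_diff)

lemma lin_sum: "lin T \<Longrightarrow> T (\<Sum>i\<in>S. f i) = (\<Sum>i\<in>S. T (f i))"
  by (induction S rule: infinite_finite_induct) (auto simp: lin_def lin_0)

lemma lin_eq_on_basis:
  assumes "lin S" "lin T" "\<And>j. j < m \<Longrightarrow> S (bv j) = T (bv j)" "v \<in> vs m"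
  shows "S v = T v"
proof -
  have "S (\<Sum>j<m. v j \<star> bv j) = T (\<Sum>j<m. v j \<star> bv j)"
    using assms by (simp add: lin_sum) (simp add: lin_def)
  thus ?thesis using vs_expand[OF assms(4)] by simp
qed

definition mof :: "nat \<Rightarrow> ((nat \<Rightarrow> 'k::field) \<Rightarrow> (nat \<Rightarrow> 'k)) \<Rightarrow> 'k mat" where
  "mof m T = mat m m (\<lambda>(i, j). T (bv j) i)"

lemma mof_carrier [simp]: "mof m T \<in> carrier_mat m m" by (simp add: mof_def)

lemma act_mof_bv: "j < m \<Longrightarrow> T (bv j) \<in> vs m \<Longrightarrow> act m (mof m T) (bv j) = T (bv j)"
  by (rule ext) (auto simp: vs_def mof_def act_bv[simplified] act_def bv_def if_distrib cong: if_cong)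

lemma act_mof:
  assumes "lin T" "\<And>v. v \<in> vs m \<Longrightarrow> T v \<in> vs m" "v \<in> vs m"
  shows "act m (mof m T) v = T v"
  by (rule lin_eq_on_basis[OF lin_act assms(1) _ assms(3)]) (simp add: act_mof_bv assms(2))

lemma mat_eq_act:
  assumes "A \<in> carrier_mat m m" "B \<in> carrier_mat m m" "\<And>j. j < m \<Longrightarrow> act m A (bv j) = act m B (bv j)"
  shows "A = B"
  using assms by (intro eq_matI) (auto simp: act_bv[symmetric])

subsection \<open>The symplectic form\<close>

text \<open>Row \<open>i\<close> of \<open>symp_form n\<close> has one nonzero entry,
  \<open>eps n i\<close> in column \<open>swp n i\<close>. Since \<open>swp n\<close> is an
  involution of the indices that reverses \<open>eps n\<close>, the form becomes a single sum that
  can be reindexed.\<close>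

definition eps :: "nat \<Rightarrow> nat \<Rightarrow> 'k::field" where "eps n i = (if i < n then 1 else - 1)"

definition swp :: "nat \<Rightarrow> nat \<Rightarrow> nat" where "swp n i = (if i < n then i + n else i - n)"

definition om :: "nat \<Rightarrow> (nat \<Rightarrow> 'k::field) \<Rightarrow> (nat \<Rightarrow> 'k) \<Rightarrow> 'k" where
  "om n v w = (\<Sum>i<2*n. eps n i * v i * w (swp n i))"

lemma swp_lt [simp]: "i < 2*n \<Longrightarrow> swp n i < 2*n"
  and swp_swp [simp]: "i < 2*n \<Longrightarrow> swp n (swp n i) = i"
  and eps_swp [simp]: "i < 2*n \<Longrightarrow> eps n (swp n i) = - eps n i"
  and eps_eps [simp]: "eps n i * eps n i = 1" "eps n i * (eps n i * c) = c"
  by (auto simp: swp_def eps_def)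

lemma eps_neq_0 [simp]: "eps n i \<noteq> 0" by (simp add: eps_def)

lemma bij_swp: "bij_betw (swp n) {..<2*n} {..<2*n}"
  by (rule bij_betw_byWitness[where f' = "swp n"]) auto

lemma sum_swp: "(\<Sum>i<2*n. f (swp n i)) = (\<Sum>i<2*n. f i)"
  by (rule sum.reindex_bij_betw[OF bij_swp])

lemma om_simps [simp]:
  "om n (u + v) w = om n u w + om n v w" "om n u (v + w) = om n u v + om n u w"
  "om n (u - v) w = om n u w - om n v w" "om n u (v - w) = om n u v - om n u w"
  "om n (- v) w = - om n v w" "om n v (- w) = - om n v w"
  "om n (c \<star> v) w = c * om n v w" "om n v (c \<star> w) = c * om n v w"
  "om n 0 w = 0" "om n v 0 = 0"
  by (auto simp: om_def algebra_simps sum.distrib sum_distrib_left sum_subtractf sum_negf)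

lemma om_skew: "om n w v = - om n v w"
proof -
  have "om n w v = (\<Sum>i<2*n. eps n (swp n i) * w (swp n i) * v (swp n (swp n i)))"
    unfolding om_def by (rule sum_swp[symmetric])
  also have "\<dots> = (\<Sum>i<2*n. - (eps n i * v i * w (swp n i)))"
    by (intro sum.cong) auto
  finally show ?thesis by (simp add: om_def sum_negf)
qed

text \<open>Skewness gives this only after division by 2; here the terms for \<open>i\<close> and
  \<open>n + i\<close> cancel directly, in every characteristic.\<close>

lemma om_self [simp]: "om n v v = 0"
proof -
  have "om n v v = (\<Sum>i<n. eps n i * v i * v (swp n i)) + (\<Sum>i\<in>{n..<2*n}. eps n i * v i * v (swp n i))"
    unfolding om_def by (subst sum.union_disjoint[symmetric]) (auto intro!: sum.cong)
  also have "(\<Sum>i\<in>{n..<2*n}. eps n i * v i * v (swp n i)) = (\<Sum>i<n. eps n (i + n) * v (i + n) * v (swp n (i + n)))"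
    by (rule sum.reindex_bij_witness[of _ "\<lambda>i. i + n" "\<lambda>i. i - n"]) auto
  also have "\<dots> = (\<Sum>i<n. - (eps n i * v i * v (swp n i)))"
    by (intro sum.cong) (auto simp: eps_def swp_def)
  finally show ?thesis by (simp add: sum_negf)
qed

lemma om_bv_left: "j < 2*n \<Longrightarrow> om n (bv j) v = eps n j * v (swp n j)"
  by (simp add: om_def bv_def if_distrib if_distribR cong: if_cong)

lemma om_bv: "i < 2*n \<Longrightarrow> j < 2*n \<Longrightarrow> om n (bv i) (bv j) = (if j = swp n i then eps n i else 0)"
  by (auto simp: om_bv_left) (auto simp: bv_def)

lemma om_nondeg: "v \<in> vs (2*n) \<Longrightarrow> (\<And>w. w \<in> vs (2*n) \<Longrightarrow> om n v w = 0) \<Longrightarrow> v = 0"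
proof (rule ext)
  fix i assume v: "v \<in> vs (2*n)" "\<And>w. w \<in> vs (2*n) \<Longrightarrow> om n v w = 0"
  show "v i = 0 i"
  proof (cases "i < 2*n")
    case True
    have "om n (bv (swp n i)) v = 0" using True v(2)[of "bv (swp n i)"] om_skew[of n "bv (swp n i)" v] by auto
    thus ?thesis using True by (simp add: om_bv_left)
  qed (use v in \<open>auto simp: vs_def\<close>)
qed

lemma symp_form_index: "i < 2*n \<Longrightarrow> j < 2*n \<Longrightarrow> symp_form n $$ (i, j) = (if j = swp n i then eps n i else 0)"
  by (auto simp: symp_form_def swp_def eps_def)

lemma symp_gram:
  fixes A :: "'k::field mat"
  assumes A: "A \<in> carrier_mat (2*n) (2*n)" and ij: "i < 2*n" "j < 2*n"
  shows "(transpose_mat A * symp_form n * A) $$ (i, j) = om n (act (2*n) A (bv i)) (act (2*n) A (bv j))"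
proof -
  have J: "(symp_form n :: 'k mat) \<in> carrier_mat (2*n) (2*n)" by simp
  have *: "(transpose_mat A * symp_form n) $$ (i, k) = eps n (swp n k) * A $$ (swp n k, i)" if k: "k < 2*n" for k
  proof -
    have "(transpose_mat A * symp_form n) $$ (i, k) = (\<Sum>l<2*n. A $$ (l, i) * symp_form n $$ (l, k))"
      using ij k carrier_matD[OF J] carrier_matD[OF A] by (simp add: scalar_prod_def atLeast0LessThan)
    also have "\<dots> = (\<Sum>l<2*n. if l = swp n k then A $$ (l, i) * eps n l else 0)"
    proof (rule sum.cong)
      fix l assume "l \<in> {..<2*n}"
      hence "k = swp n l \<longleftrightarrow> l = swp n k" using k by auto
      thus "A $$ (l, i) * symp_form n $$ (l, k) = (if l = swp n k then A $$ (l, i) * eps n l else 0)"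
        using \<open>l \<in> {..<2*n}\<close> k by (auto simp: symp_form_index)
    qed simp
    finally show ?thesis using swp_lt[OF k] by (simp add: mult.commute[of "A $$ _"] del: swp_lt)
  qed
  have "(transpose_mat A * symp_form n * A) $$ (i, j) =
      (\<Sum>k<2*n. (transpose_mat A * symp_form n) $$ (i, k) * A $$ (k, j))"
    using ij carrier_matD[OF J] carrier_matD[OF A] by (simp add: scalar_prod_def atLeast0LessThan)
  also have "\<dots> = (\<Sum>k<2*n. eps n (swp n k) * A $$ (swp n k, i) * A $$ (swp n (swp n k), j))"
    by (intro sum.cong) (auto simp: *)
  also have "\<dots> = (\<Sum>k<2*n. eps n k * A $$ (k, i) * A $$ (swp n k, j))"
    by (rule sum_swp)
  also have "\<dots> = om n (act (2*n) A (bv i)) (act (2*n) A (bv j))"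
    unfolding om_def using ij by (intro sum.cong) (auto simp: act_bv)
  finally show ?thesis .
qed

section \<open>Group elements as isometries\<close>

lemma Sp_carrier_mat [simp, dest]: "A \<in> carrier (Sp n) \<Longrightarrow> A \<in> carrier_mat (2*n) (2*n)"
  by (simp add: Sp_def)

lemma om_expand: "v \<in> vs (2*n) \<Longrightarrow> w \<in> vs (2*n) \<Longrightarrow>
  om n (T v) (T w) = (\<Sum>i<2*n. \<Sum>j<2*n. v i * w j * om n (T (bv i)) (T (bv j)))" if T: "lin T"
proof -
  assume vw: "v \<in> vs (2*n)" "w \<in> vs (2*n)"
  have s: "om n (\<Sum>i\<in>S. f i) u = (\<Sum>i\<in>S. om n (f i) u)" "om n u (\<Sum>i\<in>S. f i) = (\<Sum>i\<in>S. om n u (f i))" for S :: "nat set" and f u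
    by (induction S rule: infinite_finite_induct) auto
  have "om n (T v) (T w) = om n (T (\<Sum>i<2*n. v i \<star> bv i)) (T (\<Sum>i<2*n. w i \<star> bv i))"
    using vs_expand[OF vw(1)] vs_expand[OF vw(2)] by simp
  also have "\<dots> = (\<Sum>i<2*n. \<Sum>j<2*n. v i * w j * om n (T (bv i)) (T (bv j)))"
    using T by (subst (1 2) lin_sum[OF T]) (simp add: lin_def s sum_distrib_left mult.assoc mult.left_commute, rule sum.swap)
  finally show ?thesis .
qed

text \<open>Together with \<open>om_cut\<close> this frees \<open>Sp_om\<close> from membership
  hypotheses, so that it can serve as a simplification rule.\<close>

lemma act_cut: "act m A v = act m A (\<lambda>i. if i < m then v i else 0)"
  by (auto simp: act_def intro!: sum.cong)

lemma om_cut: "om n v w = om n (\<lambda>i. if i < 2*n then v i else 0) (\<lambda>i. if i < 2*n then w i else 0)"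
  by (auto simp: om_def intro!: sum.cong)

lemma Sp_iff_basis:
  fixes A :: "'k::field mat"
  shows "A \<in> carrier (Sp n) \<longleftrightarrow> A \<in> carrier_mat (2*n) (2*n) \<and>
  (\<forall>i<2*n. \<forall>j<2*n. om n (act (2*n) A (bv i)) (act (2*n) A (bv j)) = om n (bv i) (bv j))"
proof -
  have J: "(symp_form n :: 'k mat) \<in> carrier_mat (2*n) (2*n)" by simp
  show ?thesis
  proof (cases "A \<in> carrier_mat (2*n) (2*n)")
    case True
    have "transpose_mat A * symp_form n * A = symp_form n \<longleftrightarrow>
      (\<forall>i<2*n. \<forall>j<2*n. (transpose_mat A * symp_form n * A) $$ (i, j) = symp_form n $$ (i, j))"
      unfolding mat_eq_iff using carrier_matD[OF True] carrier_matD[OF J] by (simp del: index_mult_mat(1))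
    thus ?thesis using True by (simp add: Sp_def symp_gram symp_form_index om_bv del: Sp_carrier_mat index_mult_mat(1))
  qed (simp add: Sp_def del: Sp_carrier_mat)
qed

lemma Sp_om [simp]: "A \<in> carrier (Sp n) \<Longrightarrow> om n (act (2*n) A v) (act (2*n) A w) = om n v w"
proof -
  assume A: "A \<in> carrier (Sp n)"
  let ?v = "\<lambda>i. if i < 2*n then v i else 0" and ?w = "\<lambda>i. if i < 2*n then w i else 0"
  have vw: "?v \<in> vs (2*n)" "?w \<in> vs (2*n)" by (auto simp: vs_def)
  have "om n (act (2*n) A ?v) (act (2*n) A ?w) = om n ?v ?w"
    using A om_expand[OF lin_act vw] om_expand[OF _ vw, of "\<lambda>x. x"] by (simp add: lin_def Sp_iff_basis)
  thus ?thesis using act_cut[of "2*n" A v] act_cut[of "2*n" A w] om_cut[of n v w] by simp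
qed

lemma SpI: "A \<in> carrier_mat (2*n) (2*n) \<Longrightarrow>
  (\<And>v w. v \<in> vs (2*n) \<Longrightarrow> w \<in> vs (2*n) \<Longrightarrow> om n (act (2*n) A v) (act (2*n) A w) = om n v w) \<Longrightarrow> A \<in> carrier (Sp n)"
  unfolding Sp_iff_basis by auto

text \<open>The adjoint of \<open>A\<close> with respect to the symplectic form.\<close>

definition sinv :: "nat \<Rightarrow> 'k::field mat \<Rightarrow> 'k mat" where
  "sinv n A = mat (2*n) (2*n) (\<lambda>(i, j). eps n i * eps n j * A $$ (swp n j, swp n i))"

lemma sinv_carrier [simp]: "sinv n A \<in> carrier_mat (2*n) (2*n)" by (simp add: sinv_def)

lemma om_sinv: "om n (act (2*n) (sinv n A) v) w = om n v (act (2*n) A w)"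
proof -
  have "om n (act (2*n) (sinv n A) v) w =
      (\<Sum>i<2*n. \<Sum>k<2*n. eps n k * A $$ (swp n k, swp n i) * v k * w (swp n i))"
    unfolding om_def by (intro sum.cong) (auto simp: act_def sinv_def sum_distrib_left sum_distrib_right mult.assoc)
  also have "\<dots> = (\<Sum>i<2*n. \<Sum>k<2*n. eps n k * A $$ (swp n k, i) * v k * w i)"
    by (rule sum_swp)
  also have "\<dots> = (\<Sum>k<2*n. \<Sum>i<2*n. eps n k * A $$ (swp n k, i) * v k * w i)"
    by (rule sum.swap)
  also have "\<dots> = om n v (act (2*n) A w)"
    unfolding om_def by (intro sum.cong) (auto simp: act_def sum_distrib_left mult.assoc mult.left_commute)
  finally show ?thesis .
qed

lemma om_eqI:
  assumes "v \<in> vs (2*n)" "w \<in> vs (2*n)" "\<And>u. u \<in> vs (2*n) \<Longrightarrow> om n v u = om n w u"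
  shows "v = w"
proof -
  have "v - w = 0" by (rule om_nondeg[of _ n]) (use assms in auto)
  thus ?thesis by simp
qed

lemma sinv_left: "A \<in> carrier (Sp n) \<Longrightarrow> sinv n A * A = 1\<^sub>m (2*n)"
  by (intro mat_eq_act[of _ "2*n"] om_eqI[of _ n]) (auto simp: act_mult om_sinv Sp_carrier_mat)

lemma sinv_right: "A \<in> carrier (Sp n) \<Longrightarrow> A * sinv n A = 1\<^sub>m (2*n)"
  using mat_mult_left_right_inverse[OF sinv_carrier Sp_carrier_mat sinv_left] by blast

lemma act_sinv [simp]:
  assumes "A \<in> carrier (Sp n)" "v \<in> vs (2*n)"
  shows "act (2*n) (sinv n A) (act (2*n) A v) = v" "act (2*n) A (act (2*n) (sinv n A) v) = v"
  using assms act_mult[of "sinv n A" "2*n" A v] act_mult[of A "2*n" "sinv n A" v]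
  by (auto simp: sinv_left sinv_right)

lemma sinv_Sp [simp]: "A \<in> carrier (Sp n) \<Longrightarrow> sinv n A \<in> carrier (Sp n)"
  by (rule SpI) (auto simp: om_sinv)

lemma one_Sp [simp]: "1\<^sub>m (2*n) \<in> carrier (Sp n)"
  by (rule SpI) auto

lemma mult_Sp [simp]: "A \<in> carrier (Sp n) \<Longrightarrow> B \<in> carrier (Sp n) \<Longrightarrow> A * B \<in> carrier (Sp n)"
  by (rule SpI) (auto simp: act_mult intro: mult_carrier_mat)

lemma uminus_Sp [simp]: "A \<in> carrier (Sp n) \<Longrightarrow> - A \<in> carrier (Sp n)"
  by (rule SpI) (auto simp: Sp_carrier_mat)

lemma Sp_sel [simp]: "(\<otimes>\<^bsub>Sp n\<^esub>) = (*)" "\<one>\<^bsub>Sp n\<^esub> = 1\<^sub>m (2*n)"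
  unfolding Sp_def by (rule monoid.select_convs)+

lemma inv_Sp [simp]: "A \<in> carrier (Sp n) \<Longrightarrow> inv\<^bsub>Sp n\<^esub> A = sinv n A"
  by (rule group.inv_equality[OF Sp_group]) (auto simp: sinv_left)

lemma om_sinv_right: "A \<in> carrier (Sp n) \<Longrightarrow> w \<in> vs (2*n) \<Longrightarrow> om n v (act (2*n) (sinv n A) w) = om n (act (2*n) A v) w"
  using Sp_om[of A n v "act (2*n) (sinv n A) w"] by simp

text \<open>The columns of a symplectic matrix form a symplectic basis in which column
  \<open>i < n\<close> is dual to column \<open>n + i\<close>. A group element is used throughout as
  such a frame; right multiplication by an element of the standard Borel subgroup changes the basis
  but keeps its flag.\<close>

abbreviation fcol :: "nat \<Rightarrow> 'k::field mat \<Rightarrow> nat \<Rightarrow> nat \<Rightarrow> 'k" where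
  "fcol n g j \<equiv> act (2*n) g (bv j)"

lemma om_col: "g \<in> carrier (Sp n) \<Longrightarrow> i < 2*n \<Longrightarrow> j < 2*n \<Longrightarrow>
    om n (fcol n g i) (fcol n g j) = (if j = swp n i then eps n i else 0)"
  by (simp add: om_bv)

lemma om_col_eqI:
  assumes g: "g \<in> carrier (Sp n)" and vw: "v \<in> vs (2*n)" "w \<in> vs (2*n)"
    and eq: "\<And>j. j < 2*n \<Longrightarrow> om n (fcol n g j) v = om n (fcol n g j) w"
  shows "v = w"
proof -
  let ?u = "act (2*n) (sinv n g) (v - w)"
  have "?u (swp n j) = 0" if "j < 2*n" for j
  proof -
    have "om n (bv j) ?u = om n (fcol n g j) (v - w)" using g vw by (intro om_sinv_right) auto
    thus ?thesis using eq[OF that] that by (simp add: om_bv_left)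
  qed
  hence "?u j = 0" if "j < 2*n" for j using that swp_swp[OF that] swp_lt[OF that] by metis
  moreover have "?u j = 0" if "\<not> j < 2*n" for j using that by (auto simp: act_def)
  ultimately have "?u = 0" unfolding fun_eq_iff zero_fun_def by blast
  hence "act (2*n) g ?u = 0" by simp
  thus ?thesis using g vw by (subst (asm) act_sinv) auto
qed


section \<open>Polynomial functions and curves\<close>

text \<open>\<open>poly_funs\<close> contains functions on matrices of all sizes. Asking only for
  agreement on square matrices of size \<open>N\<close> makes the class closed under rewriting the
  function there.\<close>

definition pf :: "nat \<Rightarrow> ('k::field mat \<Rightarrow> 'k) \<Rightarrow> bool" where
  "pf N f \<longleftrightarrow> (\<exists>p\<in>poly_funs N. \<forall>A\<in>carrier_mat N N. f A = p A)"

lemma pf_cong: "pf N f \<Longrightarrow> (\<And>A. A \<in> carrier_mat N N \<Longrightarrow> f A = g A) \<Longrightarrow> pf N g"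
  unfolding pf_def by metis

lemma pf_const [simp]: "pf N (\<lambda>A. c)"
  unfolding pf_def by (intro bexI[OF _ poly_funs.const]) auto

lemma pf_coord [simp]: "i < N \<Longrightarrow> j < N \<Longrightarrow> pf N (\<lambda>A. A $$ (i, j))"
  unfolding pf_def by (intro bexI[OF _ poly_funs.coord[of i N j]]) auto

lemma pf_add [simp]: "pf N f \<Longrightarrow> pf N g \<Longrightarrow> pf N (\<lambda>A. f A + g A)"
proof -
  assume "pf N f" "pf N g"
  then obtain p q where "p \<in> poly_funs N" "q \<in> poly_funs N"
    "\<forall>A\<in>carrier_mat N N. f A = p A" "\<forall>A\<in>carrier_mat N N. g A = q A" unfolding pf_def by blast
  thus ?thesis unfolding pf_def by (intro bexI[OF _ poly_funs.add[of p _ q]]) auto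
qed

lemma pf_mult [simp]: "pf N f \<Longrightarrow> pf N g \<Longrightarrow> pf N (\<lambda>A. f A * g A)"
proof -
  assume "pf N f" "pf N g"
  then obtain p q where "p \<in> poly_funs N" "q \<in> poly_funs N"
    "\<forall>A\<in>carrier_mat N N. f A = p A" "\<forall>A\<in>carrier_mat N N. g A = q A" unfolding pf_def by blast
  thus ?thesis unfolding pf_def by (intro bexI[OF _ poly_funs.mult[of p _ q]]) auto
qed

lemma pf_uminus [simp]: "pf N f \<Longrightarrow> pf N (\<lambda>A. - f A)"
  using pf_mult[OF pf_const[of N "- 1"], of f] by simp

lemma pf_diff [simp]: "pf N f \<Longrightarrow> pf N g \<Longrightarrow> pf N (\<lambda>A. f A - g A)"
  using pf_add[OF _ pf_uminus, of N f g] by simp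

lemma pf_sum [simp]: "(\<And>i. i \<in> S \<Longrightarrow> pf N (f i)) \<Longrightarrow> pf N (\<lambda>A. \<Sum>i\<in>S. f i A)"
  by (induction S rule: infinite_finite_induct) auto

lemma pf_prod [simp]: "(\<And>i. i \<in> S \<Longrightarrow> pf N (f i)) \<Longrightarrow> pf N (\<lambda>A. \<Prod>i\<in>S. f i A)"
  by (induction S rule: infinite_finite_induct) auto

definition pm :: "nat \<Rightarrow> nat \<Rightarrow> ('k::field mat \<Rightarrow> 'k mat) \<Rightarrow> bool" where
  "pm N M h \<longleftrightarrow> (\<forall>A\<in>carrier_mat N N. h A \<in> carrier_mat M M) \<and>
     (\<forall>i<M. \<forall>j<M. pf N (\<lambda>A. h A $$ (i, j)))"

lemma pf_comp: "pf M f \<Longrightarrow> pm N M h \<Longrightarrow> pf N (\<lambda>A. f (h A))"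
proof -
  assume "pf M f" and h: "pm N M h"
  then obtain p where p: "p \<in> poly_funs M" and fp: "\<forall>A\<in>carrier_mat M M. f A = p A" unfolding pf_def by blast
  have "pf N (\<lambda>A. p (h A))" using p by induction (use h in \<open>auto simp: pm_def\<close>)
  thus ?thesis by (rule pf_cong) (use h fp in \<open>auto simp: pm_def\<close>)
qed

lemma pm_id [simp]: "pm N N (\<lambda>A. A)" by (simp add: pm_def)

lemma pm_const [simp]: "C \<in> carrier_mat M M \<Longrightarrow> pm N M (\<lambda>A. C)" by (simp add: pm_def)

lemma pm_mult [simp]:
  assumes "pm N M g" "pm N M h" shows "pm N M (\<lambda>A. g A * h A)"
  unfolding pm_def
proof (intro conjI ballI allI impI)
  fix i j assume ij: "i < M" "j < M"
  have "pf N (\<lambda>A. \<Sum>k<M. g A $$ (i, k) * h A $$ (k, j))"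
    using assms ij by (intro pf_sum pf_mult) (auto simp: pm_def)
  thus "pf N (\<lambda>A. (g A * h A) $$ (i, j))"
  proof (rule pf_cong)
    fix A :: "'a mat" assume "A \<in> carrier_mat N N"
    hence "g A \<in> carrier_mat M M" "h A \<in> carrier_mat M M" using assms by (auto simp: pm_def)
    thus "(\<Sum>k<M. g A $$ (i, k) * h A $$ (k, j)) = (g A * h A) $$ (i, j)"
      using ij by (auto simp: scalar_prod_def atLeast0LessThan)
  qed
qed (use assms in \<open>auto simp: pm_def\<close>)

lemma pm_sinv [simp]: "pm N (2*n) h \<Longrightarrow> pm N (2*n) (\<lambda>A. sinv n (h A))"
  by (auto simp: pm_def sinv_def)

lemma pf_act [simp]:
  assumes h: "pm N M h" and v: "\<And>i. i < M \<Longrightarrow> pf N (\<lambda>A. v A i)"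
  shows "pf N (\<lambda>A. act M (h A) (v A) i)"
proof (cases "i < M")
  case True
  have "pf N (\<lambda>A. \<Sum>j<M. h A $$ (i, j) * v A j)"
    using h v True by (intro pf_sum pf_mult) (auto simp: pm_def)
  thus ?thesis using True by (simp add: act_def)
qed (simp add: act_def)

lemma pf_om [simp]:
  assumes "\<And>i. i < 2*n \<Longrightarrow> pf N (\<lambda>A. v A i)" "\<And>i. i < 2*n \<Longrightarrow> pf N (\<lambda>A. w A i)"
  shows "pf N (\<lambda>A. om n (v A) (w A))"
  unfolding om_def using assms by (intro pf_sum pf_mult) auto

section \<open>Polynomial curves of matrices\<close>

definition pcurve :: "nat \<Rightarrow> ('k::field \<Rightarrow> 'k mat) \<Rightarrow> bool" where
  "pcurve m \<gamma> \<longleftrightarrow> (\<forall>t. \<gamma> t \<in> carrier_mat m m) \<and> (\<forall>i<m. \<forall>j<m. \<exists>p. \<forall>t. \<gamma> t $$ (i, j) = poly p t)"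

lemma pf_pcurve: "pf m f \<Longrightarrow> pcurve m \<gamma> \<Longrightarrow> \<exists>p. \<forall>t. f (\<gamma> t) = poly p t"
proof -
  assume "pf m f" and g: "pcurve m \<gamma>"
  then obtain q where q: "q \<in> poly_funs m" and fq: "\<forall>A\<in>carrier_mat m m. f A = q A" unfolding pf_def by blast
  have "\<exists>p. \<forall>t. q (\<gamma> t) = poly p t" using q
  proof induction
    case (const c) thus ?case by (intro exI[of _ "[:c:]"]) simp
  next
    case (coord i j) thus ?case using g by (auto simp: pcurve_def)
  next
    case (add f h) thus ?case by (metis poly_add)
  next
    case (mult f h) thus ?case by (metis poly_mult)
  qed
  thus ?thesis using fq g by (auto simp: pcurve_def)
qed

lemma pcurve_const [simp]: "C \<in> carrier_mat m m \<Longrightarrow> pcurve m (\<lambda>t. C)"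
  unfolding pcurve_def
proof (intro conjI allI impI)
  fix i j show "\<exists>p. \<forall>t. C $$ (i, j) = poly p t" by (intro exI[of _ "[:C $$ (i, j):]"]) simp
qed auto

lemma pcurve_mult [simp]:
  assumes "pcurve m \<gamma>" "pcurve m \<delta>" shows "pcurve m (\<lambda>t. \<gamma> t * \<delta> t)"
  unfolding pcurve_def
proof (intro conjI allI impI)
  fix i j assume ij: "i < m" "j < m"
  obtain p q where p: "\<And>i j t. i < m \<Longrightarrow> j < m \<Longrightarrow> \<gamma> t $$ (i, j) = poly (p i j) t"
    and q: "\<And>i j t. i < m \<Longrightarrow> j < m \<Longrightarrow> \<delta> t $$ (i, j) = poly (q i j) t"
    using assms unfolding pcurve_def by metis
  have "\<forall>t. (\<gamma> t * \<delta> t) $$ (i, j) = poly (\<Sum>k<m. p i k * q k j) t"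
  proof
    fix t
    have "\<gamma> t \<in> carrier_mat m m" "\<delta> t \<in> carrier_mat m m" using assms by (auto simp: pcurve_def)
    thus "(\<gamma> t * \<delta> t) $$ (i, j) = poly (\<Sum>k<m. p i k * q k j) t"
      using ij by (auto simp: scalar_prod_def atLeast0LessThan poly_sum p q intro!: sum.cong)
  qed
  thus "\<exists>p. \<forall>t. (\<gamma> t * \<delta> t) $$ (i, j) = poly p t" by blast
qed (use assms in \<open>auto simp: pcurve_def\<close>)

text \<open>Over a finite field, 1 plus the product of all \<open>[:- a, 1:]\<close> would be a
  nonconstant polynomial without a root.\<close>

lemma infinite_UNIV_alg_closed: "infinite (UNIV :: 'k::alg_closed_field set)"
proof
  assume fin: "finite (UNIV :: 'k set)"
  let ?p = "(\<Prod>a\<in>UNIV. [:- a, 1 :: 'k:]) + 1"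
  have "degree (\<Prod>a\<in>(UNIV :: 'k set). [:- a, 1:]) = card (UNIV :: 'k set)"
    by (subst degree_prod_eq_sum_degree) auto
  moreover have "card (UNIV :: 'k set) > 0" using fin by (simp add: card_gt_0_iff)
  ultimately have "degree ?p > 0" by (subst degree_add_eq_left) auto
  then obtain x where "poly ?p x = 0" using alg_closed_imp_poly_has_root by blast
  moreover have "(\<Prod>a\<in>UNIV. x - a) = (0 :: 'k)" using fin by (intro prod_zero) auto
  ultimately show False by (simp add: poly_prod)
qed

lemma poly_zero_all: "(\<And>t. poly p t = 0) \<Longrightarrow> p = (0 :: 'k::alg_closed_field poly)"
  using poly_roots_finite[of p] infinite_UNIV_alg_closed by auto

section \<open>Transvections\<close>

definition trv :: "nat \<Rightarrow> (nat \<Rightarrow> 'k::field) \<Rightarrow> 'k \<Rightarrow> 'k mat" where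
  "trv n v a = mof (2*n) (\<lambda>u. u + (a * om n v u) \<star> v)"

lemma act_trv: "v \<in> vs (2*n) \<Longrightarrow> u \<in> vs (2*n) \<Longrightarrow> act (2*n) (trv n v a) u = u + (a * om n v u) \<star> v"
  unfolding trv_def by (intro act_mof) (auto simp: lin_def scl_add scl_left_add algebra_simps)

lemma trv_carrier [simp]: "trv n v a \<in> carrier_mat (2*n) (2*n)" by (simp add: trv_def)

lemma trv_Sp:
  fixes v :: "nat \<Rightarrow> 'k::field"
  shows "v \<in> vs (2*n) \<Longrightarrow> trv n v a \<in> carrier (Sp n)"
proof (rule SpI)
  fix u w :: "nat \<Rightarrow> 'k" assume "v \<in> vs (2*n)" "u \<in> vs (2*n)" "w \<in> vs (2*n)"
  thus "om n (act (2*n) (trv n v a) u) (act (2*n) (trv n v a) w) = om n u w"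
    by (simp add: act_trv om_skew[of n u v])
qed (simp add: trv_def)

lemma pcurve_trv: "pcurve (2*n) (\<lambda>t. trv n v (t * a))"
  unfolding pcurve_def
proof (intro conjI allI impI)
  fix i j assume "i < 2*n" "j < 2*n"
  thus "\<exists>p. \<forall>t. trv n v (t * a) $$ (i, j) = poly p t"
    by (intro exI[of _ "[:bv j i, a * om n v (bv j) * v i:]"]) (auto simp: trv_def mof_def algebra_simps)
qed (simp add: trv_def)

section \<open>Curves through the identity that fix given vectors, and transitivity on
  frames\<close>

definition tcurve :: "nat \<Rightarrow> (nat \<Rightarrow> 'k::field) set \<Rightarrow> ('k \<Rightarrow> 'k mat) \<Rightarrow> bool" where
  "tcurve n K \<gamma> \<longleftrightarrow> pcurve (2*n) \<gamma> \<and> (\<forall>t. \<gamma> t \<in> carrier (Sp n)) \<and> \<gamma> 0 = 1\<^sub>m (2*n) \<and>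
     (\<forall>t. \<forall>u\<in>K. act (2*n) (\<gamma> t) u = u)"

lemma tcurve_Sp: "tcurve n K \<gamma> \<Longrightarrow> \<gamma> t \<in> carrier (Sp n)" by (simp add: tcurve_def)

lemma tcurve_mono: "tcurve n K \<gamma> \<Longrightarrow> L \<subseteq> K \<Longrightarrow> tcurve n L \<gamma>" by (auto simp: tcurve_def)

lemma tcurve_one: "K \<subseteq> vs (2*n) \<Longrightarrow> tcurve n K (\<lambda>t. 1\<^sub>m (2*n))" by (auto simp: tcurve_def)

lemma tcurve_mult:
  assumes "tcurve n K \<gamma>" "tcurve n K \<delta>" "K \<subseteq> vs (2*n)" shows "tcurve n K (\<lambda>t. \<gamma> t * \<delta> t)"
proof -
  have "act (2*n) (\<gamma> t * \<delta> t) u = u" if "u \<in> K" for t u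
    using assms that by (subst act_mult) (auto simp: tcurve_def)
  thus ?thesis using assms by (auto simp: tcurve_def)
qed

text \<open>When \<open>om n v w\<close> is nonzero, one transvection along \<open>w - v\<close> is
  enough, and it fixes everything perpendicular to its direction.\<close>

lemma trans1:
  assumes "v \<in> vs (2*n)" "w \<in> vs (2*n)" "om n v w \<noteq> 0" "K \<subseteq> vs (2*n)"
    and K: "\<And>k. k \<in> K \<Longrightarrow> om n k (w - v) = 0"
  shows "\<exists>\<gamma>. tcurve n K \<gamma> \<and> act (2*n) (\<gamma> 1) v = w"
proof -
  \<comment> \<open>At parameter 1 the transvection adds \<open>a * om n (w - v) v\<close> times
    \<open>w - v\<close> to \<open>v\<close>, and \<open>om n (w - v) v = om n w v\<close>.\<close>
  define a where "a = 1 / om n w v"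
  have nz: "om n w v \<noteq> 0" using assms(3) om_skew[of n v w] by simp
  let ?\<gamma> = "\<lambda>t. trv n (w - v) (t * a)"
  have "om n (w - v) k = 0" if "k \<in> K" for k using K[OF that] om_skew[of n "w - v" k] by simp
  hence "act (2*n) (?\<gamma> t) k = k" if "k \<in> K" for k t
    using that assms(1,2,4) by (subst act_trv) auto
  moreover have "?\<gamma> 0 = 1\<^sub>m (2*n)"
    using assms(1,2) by (intro mat_eq_act[of _ "2*n"]) (auto simp: act_trv)
  ultimately have "tcurve n K ?\<gamma>"
    using assms(1,2) by (auto simp: tcurve_def pcurve_trv trv_Sp)
  moreover have "act (2*n) (?\<gamma> 1) v = w"
    using assms(1,2) nz by (subst act_trv) (auto simp: a_def)
  ultimately show ?thesis by blast
qed

text \<open>If \<open>v\<close> and \<open>w\<close> are perpendicular, a detour over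
  \<open>v + d\<close> uses two transvections; both directions are perpendicular to
  \<open>K\<close>.\<close>

lemma trans2:
  assumes "v \<in> vs (2*n)" "w \<in> vs (2*n)" "d \<in> vs (2*n)" "om n v d \<noteq> 0" "om n w d \<noteq> 0" "K \<subseteq> vs (2*n)"
    and K: "\<And>k. k \<in> K \<Longrightarrow> om n k (w - v) = 0" "\<And>k. k \<in> K \<Longrightarrow> om n k d = 0"
  shows "\<exists>\<gamma>. tcurve n K \<gamma> \<and> act (2*n) (\<gamma> 1) v = w"
proof (cases "om n v w = 0")
  case False thus ?thesis using trans1 assms by blast
next
  case True
  have "om n d w \<noteq> 0" using assms(5) om_skew[of n d w] by simp
  obtain \<gamma> where g: "tcurve n K \<gamma>" "act (2*n) (\<gamma> 1) v = v + d"
    using trans1[of v n "v + d" K] assms by auto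
  obtain \<delta> where d: "tcurve n K \<delta>" "act (2*n) (\<delta> 1) (v + d) = w"
    using trans1[of "v + d" n w K] assms True \<open>om n d w \<noteq> 0\<close> by (auto simp: algebra_simps)
  have "act (2*n) (\<delta> 1 * \<gamma> 1) v = w"
    using g d by (subst act_mult) (auto dest!: tcurve_Sp[of _ _ _ 1])
  thus ?thesis using tcurve_mult[OF d(1) g(1) assms(6)] by blast
qed

text \<open>If neither \<open>d\<close> nor \<open>e\<close> is usable for both vectors, then
  \<open>d + e\<close> is: in that case \<open>d\<close> is perpendicular to \<open>w\<close> and
  \<open>e\<close> to \<open>v\<close>, so nothing cancels.\<close>

lemma transK:
  assumes v: "v \<in> vs (2*n)" and w: "w \<in> vs (2*n)" and Ks: "K \<subseteq> vs (2*n)"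
    and d: "d \<in> vs (2*n)" "om n v d \<noteq> 0" "\<And>k. k \<in> K \<Longrightarrow> om n k d = 0"
    and e: "e \<in> vs (2*n)" "om n w e \<noteq> 0" "\<And>k. k \<in> K \<Longrightarrow> om n k e = 0"
    and K: "\<And>k. k \<in> K \<Longrightarrow> om n k (w - v) = 0"
  shows "\<exists>\<gamma>. tcurve n K \<gamma> \<and> act (2*n) (\<gamma> 1) v = w"
proof (cases "om n w d = 0")
  case False
  show ?thesis by (rule trans2[OF v w d(1,2) False Ks K d(3)])
next
  case True
  show ?thesis
  proof (cases "om n v e = 0")
    case False
    show ?thesis by (rule trans2[OF v w e(1) False e(2) Ks K e(3)])
  next
    case T: True
    show ?thesis using trans2[OF v w, of "d + e" K] True T d e Ks K by auto
  qed
qed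

definition pairs :: "nat \<Rightarrow> 'k::field mat \<Rightarrow> nat \<Rightarrow> (nat \<Rightarrow> 'k) set" where
  "pairs n g i = (\<Union>j<i. {fcol n g j, fcol n g (n + j)})"

lemma pairs_vs [simp]: "pairs n g i \<subseteq> vs (2*n)" by (auto simp: pairs_def)

lemma om_col_simps [simp]:
  assumes "g \<in> carrier (Sp n)" "i < n" "j < n"
  shows "om n (fcol n g i) (fcol n g j) = 0" "om n (fcol n g (n + i)) (fcol n g (n + j)) = 0"
    "om n (fcol n g i) (fcol n g (n + j)) = (if i = j then 1 else 0)"
    "om n (fcol n g (n + i)) (fcol n g j) = (if i = j then - 1 else 0)"
  using assms by (simp_all add: om_bv del: Sp_om) (auto simp: om_bv swp_def eps_def)

lemma pairs_perp:
  assumes "g \<in> carrier (Sp n)" "i \<le> j" "j < n" "k \<in> pairs n g i"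
  shows "om n k (fcol n g j) = 0" "om n k (fcol n g (n + j)) = 0"
  using assms by (auto simp: pairs_def simp del: Sp_om)

text \<open>The partner is corrected after the vector. The correction is perpendicular to
  \<open>v\<close> because the old and the new partner both pair to 1 with \<open>v\<close>; so
  \<open>v\<close> may join the fixed set, and it serves itself as the auxiliary vector in
  \<open>transK\<close>.\<close>

lemma frame_step:
  assumes h: "h \<in> carrier (Sp n)" and i: "i < n" and v: "v \<in> vs (2*n)" and u: "u \<in> vs (2*n)"
    and vu: "om n v u = 1" and K: "\<And>k. k \<in> pairs n h i \<Longrightarrow> om n k v = 0 \<and> om n k u = 0"
  shows "\<exists>\<gamma>. tcurve n (pairs n h i) \<gamma> \<and> act (2*n) (\<gamma> 1) (fcol n h i) = v \<and> act (2*n) (\<gamma> 1) (fcol n h (n + i)) = u"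
proof -
  obtain \<gamma> where g: "tcurve n (pairs n h i) \<gamma>" "act (2*n) (\<gamma> 1) (fcol n h i) = v"
    using transK[of "fcol n h i" n v "pairs n h i" "fcol n h (n + i)" u] h i v u vu K
      pairs_perp[OF h le_refl i] by (auto simp del: Sp_om)
  have gS: "\<gamma> 1 \<in> carrier (Sp n)" using tcurve_Sp[OF g(1)] .
  let ?f = "act (2*n) (\<gamma> 1) (fcol n h (n + i))"
  have vf: "om n v ?f = 1" using gS h i unfolding g(2)[symmetric] by (simp add: om_bv) (simp add: swp_def eps_def)
  have kf: "om n k ?f = 0" if "k \<in> pairs n h i" for k
  proof -
    have "act (2*n) (\<gamma> 1) k = k" using g(1) that by (auto simp: tcurve_def)
    thus ?thesis using Sp_om[OF gS, of k "fcol n h (n + i)"] pairs_perp(2)[OF h le_refl i that] by simp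
  qed
  have fv: "om n ?f v = -1" "om n u v = -1" using vf vu om_skew[of n v] by (metis minus_minus)+
  obtain \<delta> where d: "tcurve n (insert v (pairs n h i)) \<delta>" "act (2*n) (\<delta> 1) ?f = u"
  proof -
    have A: "om n k v = 0" "om n k (u - ?f) = 0" if "k \<in> insert v (pairs n h i)" for k
      using that vf vu kf K by auto
    have "\<exists>\<delta>. tcurve n (insert v (pairs n h i)) \<delta> \<and> act (2*n) (\<delta> 1) ?f = u"
      by (rule transK[of ?f n u _ v v, OF _ u _ v _ A(1) v _ A(1) A(2)]) (use fv v pairs_vs in auto)
    thus ?thesis using that by blast
  qed
  have d': "tcurve n (pairs n h i) \<delta>" by (rule tcurve_mono[OF d(1)]) auto
  have dS: "\<delta> 1 \<in> carrier (Sp n)" using tcurve_Sp[OF d(1)] .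
  have "act (2*n) (\<delta> 1) v = v" using d(1) by (auto simp: tcurve_def)
  hence "act (2*n) (\<delta> 1 * \<gamma> 1) (fcol n h i) = v" "act (2*n) (\<delta> 1 * \<gamma> 1) (fcol n h (n + i)) = u"
    using gS dS g(2) d(2) by (auto simp: act_mult)
  thus ?thesis using tcurve_mult[OF d' g(1) pairs_vs] by blast
qed

text \<open>The frame of \<open>g\<close> is reached pair by pair. Each new curve fixes the pairs
  already in place, so the product of the curves keeps them at parameter 1.\<close>

lemma Sp_tcurve:
  assumes g: "g \<in> carrier (Sp n)"
  shows "\<exists>\<gamma>. tcurve n {} \<gamma> \<and> \<gamma> 1 = g"
proof -
  have "i \<le> n \<Longrightarrow> \<exists>\<gamma>. tcurve n {} \<gamma> \<and> (\<forall>j<i. fcol n (\<gamma> 1) j = fcol n g j \<and> fcol n (\<gamma> 1) (n + j) = fcol n g (n + j))" for i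
  proof (induction i)
    case 0 thus ?case using tcurve_one[of "{}" n] by auto
  next
    case (Suc i)
    then obtain \<gamma> where ga: "tcurve n {} \<gamma>"
      and j: "\<And>j. j < i \<Longrightarrow> fcol n (\<gamma> 1) j = fcol n g j \<and> fcol n (\<gamma> 1) (n + j) = fcol n g (n + j)" by auto
    have gS: "\<gamma> 1 \<in> carrier (Sp n)" using tcurve_Sp[OF ga] .
    have P: "pairs n (\<gamma> 1) i = pairs n g i" using j by (auto simp: pairs_def)
    obtain \<delta> where d: "tcurve n (pairs n (\<gamma> 1) i) \<delta>" "act (2*n) (\<delta> 1) (fcol n (\<gamma> 1) i) = fcol n g i"
      "act (2*n) (\<delta> 1) (fcol n (\<gamma> 1) (n + i)) = fcol n g (n + i)"
      using frame_step[OF gS, of i "fcol n g i" "fcol n g (n + i)"] Suc.prems g pairs_perp[OF g, of i i]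
      by (auto simp: P simp del: Sp_om)
    have dS: "\<delta> 1 \<in> carrier (Sp n)" using tcurve_Sp[OF d(1)] .
    have fix': "act (2*n) (\<delta> 1) k = k" if "k \<in> pairs n (\<gamma> 1) i" for k using d(1) that by (auto simp: tcurve_def)
    have "fcol n (\<delta> 1 * \<gamma> 1) j = fcol n g j \<and> fcol n (\<delta> 1 * \<gamma> 1) (n + j) = fcol n g (n + j)" if "j < Suc i" for j
    proof (cases "j = i")
      case True thus ?thesis using d(2,3) gS dS by (simp add: act_mult)
    next
      case False
      hence "fcol n (\<gamma> 1) j \<in> pairs n (\<gamma> 1) i" "fcol n (\<gamma> 1) (n + j) \<in> pairs n (\<gamma> 1) i"
        using that by (auto simp: pairs_def)
      thus ?thesis using False that j[of j] gS dS fix' by (simp add: act_mult)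
    qed
    thus ?case using tcurve_mult[OF tcurve_mono[OF d(1)] ga] by fastforce
  qed
  then obtain \<gamma> where ga: "tcurve n {} \<gamma>"
    and j: "\<And>j. j < n \<Longrightarrow> fcol n (\<gamma> 1) j = fcol n g j \<and> fcol n (\<gamma> 1) (n + j) = fcol n g (n + j)" by blast
  have "\<gamma> 1 = g"
  proof (rule mat_eq_act[of _ "2*n"])
    fix j assume "j < 2*n"
    thus "fcol n (\<gamma> 1) j = fcol n g j" using j[of j] j[of "j - n"] by (cases "j < n") auto
  qed (use tcurve_Sp[OF ga] g in auto)
  thus ?thesis using ga by blast
qed

lemma Sp_curve:
  assumes "g \<in> carrier (Sp n)" "h \<in> carrier (Sp n)"
  shows "\<exists>\<gamma>. pcurve (2*n) \<gamma> \<and> (\<forall>t. \<gamma> t \<in> carrier (Sp n)) \<and> \<gamma> 0 = g \<and> \<gamma> 1 = h"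
proof -
  obtain \<gamma> where ga: "tcurve n {} \<gamma>" "\<gamma> 1 = h * sinv n g" using Sp_tcurve[of "h * sinv n g" n] assms by auto
  have "h * sinv n g * g = h * (sinv n g * g)"
    using assms by (intro assoc_mult_mat[of _ "2*n" "2*n" _ "2*n" _ "2*n"]) auto
  hence "h * sinv n g * g = h" using assms right_mult_one_mat[of h "2*n" "2*n"] by (simp add: sinv_left Sp_carrier_mat del: right_mult_one_mat)
  thus ?thesis using ga assms by (intro exI[of _ "\<lambda>t. \<gamma> t * g"]) (auto simp: tcurve_def Sp_carrier_mat)
qed

text \<open>Along a curve from \<open>g\<close> to \<open>h\<close> the two functions become
  polynomials that are nonzero at 0 and at 1 respectively, so their product is not the zero
  polynomial.\<close>

lemma Sp_irreducible:
  fixes F :: "'k::alg_closed_field mat \<Rightarrow> 'k"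
  assumes "pf (2*n) F" "pf (2*n) G" "g \<in> carrier (Sp n)" "h \<in> carrier (Sp n)" "F g \<noteq> 0" "G h \<noteq> 0"
  shows "\<exists>x\<in>carrier (Sp n). F x \<noteq> 0 \<and> G x \<noteq> 0"
proof -
  obtain \<gamma> where c: "pcurve (2*n) \<gamma>" "\<And>t. \<gamma> t \<in> carrier (Sp n)" "\<gamma> 0 = g" "\<gamma> 1 = h"
    using Sp_curve[OF assms(3,4)] by blast
  obtain p q where p: "\<And>t. F (\<gamma> t) = poly p t" and q: "\<And>t. G (\<gamma> t) = poly q t"
    using pf_pcurve[OF assms(1) c(1)] pf_pcurve[OF assms(2) c(1)] by auto
  have "p \<noteq> 0" "q \<noteq> 0" using assms(5,6) c(3,4) p[of 0] q[of 1] by auto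
  hence "p * q \<noteq> 0" by simp
  then obtain t where "poly (p * q) t \<noteq> 0" using poly_zero_all by blast
  thus ?thesis using c(2)[of t] p[of t] q[of t] by (intro bexI[of _ "\<gamma> t"]) auto
qed

text \<open>Membership in the Zariski closure of \<open>S\<close> inside the group.\<close>

definition zc :: "nat \<Rightarrow> 'k::field mat set \<Rightarrow> 'k mat \<Rightarrow> bool" where
  "zc n S g \<longleftrightarrow> g \<in> carrier (Sp n) \<and> (\<forall>f. pf (2*n) f \<longrightarrow> (\<forall>s\<in>S. f s = 0) \<longrightarrow> f g = 0)"

text \<open>A function vanishing on \<open>S\<close> vanishes along the curve for all but finitely
  many parameters, hence also at 0.\<close>

lemma zc_curve:
  fixes q :: "'k::alg_closed_field poly"
  assumes "pcurve (2*n) \<gamma>" "\<gamma> 0 \<in> carrier (Sp n)" "q \<noteq> 0" "\<And>t. poly q t \<noteq> 0 \<Longrightarrow> zc n S (\<gamma> t)"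
  shows "zc n S (\<gamma> 0)"
  unfolding zc_def
proof (intro conjI allI impI)
  fix f assume f: "pf (2*n) f" "\<forall>s\<in>S. f s = 0"
  obtain p where p: "\<And>t. f (\<gamma> t) = poly p t" using pf_pcurve[OF f(1) assms(1)] by auto
  have "poly (p * q) t = 0" for t
    using assms(4)[of t] f p[of t] by (cases "poly q t = 0") (auto simp: zc_def)
  hence "p * q = 0" by (rule poly_zero_all)
  thus "f (\<gamma> 0) = 0" using assms(3) p by simp
qed (fact assms(2))


section \<open>Zariski topology\<close>

lemma openin_pf: "pf N f \<Longrightarrow> openin (zariski N) {A \<in> carrier_mat N N. f A \<noteq> 0}"
proof -
  assume "pf N f"
  then obtain p where p: "p \<in> poly_funs N" "\<forall>A\<in>carrier_mat N N. f A = p A" unfolding pf_def by blast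
  thus ?thesis unfolding openin_zariski zariski_open_def
    by (intro exI[of _ "{p}"]) (auto simp: zero_locus_def)
qed

lemma openin_zariski_base:
  assumes "openin (zariski N) U" "A \<in> U"
  obtains f where "pf N f" "f A \<noteq> 0" "\<And>B. B \<in> carrier_mat N N \<Longrightarrow> f B \<noteq> 0 \<Longrightarrow> B \<in> U"
proof -
  obtain F where F: "F \<subseteq> poly_funs N" "U = carrier_mat N N - zero_locus N F"
    using assms(1) unfolding openin_zariski zariski_open_def by blast
  then obtain f where f: "f \<in> F" "f A \<noteq> 0" using assms(2) by (auto simp: zero_locus_def)
  moreover have "pf N f" unfolding pf_def using f F by blast
  ultimately show ?thesis using that[of f] F by (auto simp: zero_locus_def)
qed

lemma continuous_map_pm:
  fixes h :: "'k::field mat \<Rightarrow> 'k mat"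
  assumes "pm N M h" shows "continuous_map (zariski N) (zariski M) h"
  unfolding continuous_map_def
proof (intro conjI allI impI)
  show "h \<in> topspace (zariski N) \<rightarrow> topspace (zariski M)" using assms by (auto simp: pm_def)
  fix U :: "'k mat set" assume U: "openin (zariski M) U"
  show "openin (zariski N) {x \<in> topspace (zariski N). h x \<in> U}"
  proof (subst openin_subopen, rule ballI)
    fix A assume A: "A \<in> {x \<in> topspace (zariski N). h x \<in> U}"
    then obtain f where f: "pf M f" "f (h A) \<noteq> 0" "\<And>B. B \<in> carrier_mat M M \<Longrightarrow> f B \<noteq> 0 \<Longrightarrow> B \<in> U"
      using openin_zariski_base[OF U] by blast
    have "openin (zariski N) {B \<in> carrier_mat N N. f (h B) \<noteq> 0}"
      by (rule openin_pf[OF pf_comp[OF f(1) assms]])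
    thus "\<exists>T. openin (zariski N) T \<and> A \<in> T \<and> T \<subseteq> {x \<in> topspace (zariski N). h x \<in> U}"
      using A f assms by (intro exI[of _ "{B \<in> carrier_mat N N. f (h B) \<noteq> 0}"]) (auto simp: pm_def)
  qed
qed

lemma connectedin_pm: "pm N M h \<Longrightarrow> connectedin (zariski N) S \<Longrightarrow> connectedin (zariski M) (h ` S)"
  by (rule connectedin_continuous_map_image[OF continuous_map_pm])

text \<open>Curves in a torus have entries with denominators; a power of \<open>d\<close> clears
  them from any polynomial function along the curve.\<close>

lemma pf_rational_curve:
  fixes d :: "'k::field poly"
  assumes f: "pf m f" and g: "\<And>t. poly d t \<noteq> 0 \<Longrightarrow> \<gamma> t \<in> carrier_mat m m"
    and e: "\<And>i j. i < m \<Longrightarrow> j < m \<Longrightarrow> \<exists>p k. \<forall>t. poly d t \<noteq> 0 \<longrightarrow> \<gamma> t $$ (i, j) * poly d t ^ k = poly p t"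
  shows "\<exists>p k. \<forall>t. poly d t \<noteq> 0 \<longrightarrow> f (\<gamma> t) * poly d t ^ k = poly p t"
proof -
  obtain q where q: "q \<in> poly_funs m" and fq: "\<forall>A\<in>carrier_mat m m. f A = q A" using f unfolding pf_def by blast
  have "\<exists>p k. \<forall>t. poly d t \<noteq> 0 \<longrightarrow> q (\<gamma> t) * poly d t ^ k = poly p t" using q
  proof induction
    case (const c) thus ?case by (intro exI[of _ "[:c:]"] exI[of _ 0]) simp
  next
    case (coord i j) thus ?case using e by blast
  next
    case (add f h)
    then obtain p k p' k' where "\<And>t. poly d t \<noteq> 0 \<Longrightarrow> f (\<gamma> t) * poly d t ^ k = poly p t"
      "\<And>t. poly d t \<noteq> 0 \<Longrightarrow> h (\<gamma> t) * poly d t ^ k' = poly p' t" by blast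
    thus ?case
      by (intro exI[of _ "p * d ^ k' + p' * d ^ k"] exI[of _ "k + k'"]) (auto simp: algebra_simps power_add)
  next
    case (mult f h)
    then obtain p k p' k' where "\<And>t. poly d t \<noteq> 0 \<Longrightarrow> f (\<gamma> t) * poly d t ^ k = poly p t"
      "\<And>t. poly d t \<noteq> 0 \<Longrightarrow> h (\<gamma> t) * poly d t ^ k' = poly p' t" by blast
    hence "f (\<gamma> t) * h (\<gamma> t) * poly d t ^ (k + k') = poly (p * p') t" if "poly d t \<noteq> 0" for t
      using that by (simp flip: \<open>\<And>t. poly d t \<noteq> 0 \<Longrightarrow> f (\<gamma> t) * poly d t ^ k = poly p t\<close>
        \<open>\<And>t. poly d t \<noteq> 0 \<Longrightarrow> h (\<gamma> t) * poly d t ^ k' = poly p' t\<close> add: power_add ac_simps)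
    thus ?case by blast
  qed
  thus ?thesis using fq g by auto
qed

text \<open>Two open sets that meet the curve give polynomials \<open>p\<close> and
  \<open>q\<close>, each nonzero somewhere on it; a parameter where \<open>p * q * d\<close> is
  nonzero puts one point of the curve in both sets.\<close>

lemma connectedin_rational_curve:
  fixes d :: "'k::alg_closed_field poly"
  assumes "d \<noteq> 0" and g: "\<And>t. poly d t \<noteq> 0 \<Longrightarrow> \<gamma> t \<in> carrier_mat m m"
    and e: "\<And>i j. i < m \<Longrightarrow> j < m \<Longrightarrow> \<exists>p k. \<forall>t. poly d t \<noteq> 0 \<longrightarrow> \<gamma> t $$ (i, j) * poly d t ^ k = poly p t"
  shows "connectedin (zariski m) (\<gamma> ` {t. poly d t \<noteq> 0})"
  unfolding connectedin
proof (intro conjI notI)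
  show "\<gamma> ` {t. poly d t \<noteq> 0} \<subseteq> topspace (zariski m)" using g by auto
  assume "\<exists>E1 E2. openin (zariski m) E1 \<and> openin (zariski m) E2 \<and> \<gamma> ` {t. poly d t \<noteq> 0} \<subseteq> E1 \<union> E2 \<and>
     E1 \<inter> E2 \<inter> \<gamma> ` {t. poly d t \<noteq> 0} = {} \<and> E1 \<inter> \<gamma> ` {t. poly d t \<noteq> 0} \<noteq> {} \<and> E2 \<inter> \<gamma> ` {t. poly d t \<noteq> 0} \<noteq> {}"
  then obtain E1 E2 s t where E: "openin (zariski m) E1" "openin (zariski m) E2"
    "E1 \<inter> E2 \<inter> \<gamma> ` {t. poly d t \<noteq> 0} = {}" "\<gamma> s \<in> E1" "\<gamma> t \<in> E2" "poly d s \<noteq> 0" "poly d t \<noteq> 0" by blast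
  obtain f1 where f1: "pf m f1" "f1 (\<gamma> s) \<noteq> 0" "\<And>B. B \<in> carrier_mat m m \<Longrightarrow> f1 B \<noteq> 0 \<Longrightarrow> B \<in> E1"
    using openin_zariski_base[OF E(1,4)] by blast
  obtain f2 where f2: "pf m f2" "f2 (\<gamma> t) \<noteq> 0" "\<And>B. B \<in> carrier_mat m m \<Longrightarrow> f2 B \<noteq> 0 \<Longrightarrow> B \<in> E2"
    using openin_zariski_base[OF E(2,5)] by blast
  obtain p k where p: "\<And>t. poly d t \<noteq> 0 \<Longrightarrow> f1 (\<gamma> t) * poly d t ^ k = poly p t"
    using pf_rational_curve[OF f1(1) g e] by blast
  obtain q l where q: "\<And>t. poly d t \<noteq> 0 \<Longrightarrow> f2 (\<gamma> t) * poly d t ^ l = poly q t"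
    using pf_rational_curve[OF f2(1) g e] by blast
  have "poly p s \<noteq> 0" "poly q t \<noteq> 0" using p[of s] q[of t] E f1 f2 by (metis mult_eq_0_iff power_not_zero)+
  hence "p * q * d \<noteq> 0" using \<open>d \<noteq> 0\<close> by auto
  then obtain r where r: "poly (p * q * d) r \<noteq> 0" using poly_zero_all by blast
  hence "f1 (\<gamma> r) \<noteq> 0" "f2 (\<gamma> r) \<noteq> 0" using p[of r] q[of r] by auto
  hence "\<gamma> r \<in> E1 \<inter> E2 \<inter> \<gamma> ` {t. poly d t \<noteq> 0}" using f1(3) f2(3) g r by auto
  thus False using E(3) by blast
qed

section \<open>The standard Borel subgroup\<close>

text \<open>The position of the \<open>k\<close>-th basis vector in the flag
  \<open>e\<^sub>0, \<dots>, e\<^sub>n\<^sub>-\<^sub>1, f\<^sub>n\<^sub>-\<^sub>1, \<dots>, f\<^sub>0\<close>, where \<open>f\<^sub>k\<close> is the basis vector with index \<open>n + k\<close>.\<close>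

definition pos :: "nat \<Rightarrow> nat \<Rightarrow> nat" where
  "pos n k = (if k < n then k else 3 * n - 1 - k)"

text \<open>For \<open>i = 0\<close> this is triangularity with respect to the flag. Positive
  \<open>i\<close>, applied to \<open>g\<close> minus the identity, measures how far
  \<open>g\<close> lies above the diagonal and gives the filtration \<open>Us\<close> behind
  solvability.\<close>

definition shf :: "nat \<Rightarrow> nat \<Rightarrow> 'k::field mat \<Rightarrow> bool" where
  "shf n i A \<longleftrightarrow> (\<forall>k<2*n. \<forall>j<2*n. A $$ (k, j) \<noteq> 0 \<longrightarrow> pos n k + i \<le> pos n j)"

definition Bstd :: "nat \<Rightarrow> 'k::field mat set" where
  "Bstd n = {b \<in> carrier (Sp n). shf n 0 b}"

lemma pos_lt: "k < 2*n \<Longrightarrow> pos n k < 2*n" by (auto simp: pos_def)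

lemma pos_inj: "j < 2*n \<Longrightarrow> k < 2*n \<Longrightarrow> pos n j = pos n k \<Longrightarrow> j = k"
  by (auto simp: pos_def split: if_splits)

lemma pos_swp: "k < 2*n \<Longrightarrow> pos n (swp n k) = 2*n - 1 - pos n k"
  by (auto simp: pos_def swp_def)

lemma shf_mult:
  assumes "A \<in> carrier_mat (2*n) (2*n)" "B \<in> carrier_mat (2*n) (2*n)" "shf n i A" "shf n j B"
  shows "shf n (i + j) (A * B)"
  unfolding shf_def
proof (intro allI impI)
  fix k l assume kl: "k < 2*n" "l < 2*n" "(A * B) $$ (k, l) \<noteq> 0"
  hence "(\<Sum>r<2*n. A $$ (k, r) * B $$ (r, l)) \<noteq> 0"
    using assms(1,2) by (auto simp: scalar_prod_def atLeast0LessThan)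
  then obtain r where "r < 2*n" "A $$ (k, r) * B $$ (r, l) \<noteq> 0" by (meson lessThan_iff sum.neutral)
  hence "pos n k + i \<le> pos n r" "pos n r + j \<le> pos n l" using assms(3,4) kl by (auto simp: shf_def)
  thus "pos n k + (i + j) \<le> pos n l" by simp
qed

text \<open>The adjoint is, up to signs, the transpose about the antidiagonal, because
  \<open>swp\<close> reverses positions (\<open>pos_swp\<close>).\<close>

lemma shf_sinv: "shf n i A \<Longrightarrow> shf n i (sinv n A)"
  unfolding shf_def
proof (intro allI impI)
  fix k j assume A: "\<forall>k<2*n. \<forall>j<2*n. A $$ (k, j) \<noteq> 0 \<longrightarrow> pos n k + i \<le> pos n j"
    and kj: "k < 2*n" "j < 2*n" "sinv n A $$ (k, j) \<noteq> 0"
  hence "A $$ (swp n j, swp n k) \<noteq> 0" by (simp add: sinv_def)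
  hence "pos n (swp n j) + i \<le> pos n (swp n k)" using A kj by simp
  thus "pos n k + i \<le> pos n j" using kj pos_lt[of k n] pos_lt[of j n] by (simp add: pos_swp)
qed

lemma Bstd_Sp [dest]: "b \<in> Bstd n \<Longrightarrow> b \<in> carrier (Sp n)" by (simp add: Bstd_def)

lemma Bstd_one [simp]: "1\<^sub>m (2*n) \<in> Bstd n" by (auto simp: Bstd_def shf_def)

lemma Bstd_mult [simp]: "a \<in> Bstd n \<Longrightarrow> b \<in> Bstd n \<Longrightarrow> a * b \<in> Bstd n"
  using shf_mult[of a n b 0 0] by (auto simp: Bstd_def)

lemma Bstd_sinv [simp]: "a \<in> Bstd n \<Longrightarrow> sinv n a \<in> Bstd n"
  by (auto simp: Bstd_def shf_sinv)

lemma Bstd_subgroup: "subgroup (Bstd n) (Sp n)"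
proof (rule subgroup.intro)
  show "Bstd n \<subseteq> carrier (Sp n)" by (rule subsetI) (rule Bstd_Sp)
  show "inv\<^bsub>Sp n\<^esub> x \<in> Bstd n" if "x \<in> Bstd n" for x
    using that inv_Sp[OF Bstd_Sp[OF that]] Bstd_sinv[OF that] by simp
qed simp_all

lemma Bstd_closed:
  "closedin (subtopology (zariski (2*n)) (carrier (Sp n))) (Bstd n :: 'k::field mat set)"
proof -
  define I where "I = {(k, j). k < 2*n \<and> j < 2*n \<and> \<not> pos n k \<le> pos n j}"
  have "openin (zariski (2*n)) (\<Union>(k, j)\<in>I. {A \<in> carrier_mat (2*n) (2*n). A $$ (k, j) \<noteq> (0::'k)})"
    by (rule openin_clauses(3)) (auto simp: I_def intro!: openin_pf)
  hence "openin (subtopology (zariski (2*n)) (carrier (Sp n)))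
      (carrier (Sp n) \<inter> (\<Union>(k, j)\<in>I. {A \<in> carrier_mat (2*n) (2*n). A $$ (k, j) \<noteq> (0::'k)}))"
    by (rule openin_subtopology_Int2)
  moreover have "carrier (Sp n) \<inter> (\<Union>(k, j)\<in>I. {A \<in> carrier_mat (2*n) (2*n). A $$ (k, j) \<noteq> (0::'k)}) = carrier (Sp n) - Bstd n"
    by (auto simp: I_def Bstd_def shf_def)
  moreover have "carrier (Sp n) \<inter> carrier_mat (2*n) (2*n) = (carrier (Sp n) :: 'k mat set)" by auto
  ultimately show ?thesis
    unfolding closedin_def by (auto simp: Int_commute)
qed

section \<open>Connectedness of the standard Borel subgroup\<close>

definition Bcon :: "nat \<Rightarrow> 'k::field mat set" where
  "Bcon n = {b. \<exists>S \<subseteq> Bstd n. connectedin (zariski (2*n)) S \<and> 1\<^sub>m (2*n) \<in> S \<and> b \<in> S}"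

lemma Bcon_Bstd [dest]: "b \<in> Bcon n \<Longrightarrow> b \<in> Bstd n" by (auto simp: Bcon_def)

lemma Bcon_Sp [dest]: "b \<in> Bcon n \<Longrightarrow> b \<in> carrier (Sp n)" by blast

lemma Bcon_one [simp]: "1\<^sub>m (2*n) \<in> Bcon n"
  unfolding Bcon_def by (intro CollectI exI[of _ "{1\<^sub>m (2*n)}"]) auto

text \<open>The connected set joining 1 to \<open>a\<close> is translated by \<open>b\<close> and
  then glued, at the point \<open>b\<close>, to the one joining 1 to \<open>b\<close>.\<close>

lemma Bcon_mult [simp]:
  assumes "a \<in> Bcon n" "b \<in> Bcon n" shows "a * b \<in> Bcon n"
proof -
  obtain S T where S: "S \<subseteq> Bstd n" "connectedin (zariski (2*n)) S" "1\<^sub>m (2*n) \<in> S" "a \<in> S"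
    and T: "T \<subseteq> Bstd n" "connectedin (zariski (2*n)) T" "1\<^sub>m (2*n) \<in> T" "b \<in> T"
    using assms by (auto simp: Bcon_def)
  have b: "b \<in> Bstd n" "b \<in> carrier_mat (2*n) (2*n)" using T by (auto dest!: Bstd_Sp)
  have "connectedin (zariski (2*n)) ((\<lambda>A. A * b) ` S)"
    by (rule connectedin_pm[OF _ S(2)]) (use b in auto)
  moreover have "b \<in> (\<lambda>A. A * b) ` S" using S(3) b by (auto intro!: image_eqI[of _ _ "1\<^sub>m (2*n)"])
  ultimately have "connectedin (zariski (2*n)) ((\<lambda>A. A * b) ` S \<union> T)"
    using T by (intro connectedin_Un) auto
  moreover have "(\<lambda>A. A * b) ` S \<union> T \<subseteq> Bstd n" using S(1) T(1) b by auto
  ultimately show ?thesis using S T unfolding Bcon_def by blast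
qed

text \<open>The symplectic analogue of an Eichler transformation. It is an isometry when
  \<open>om n e z = 0\<close>, and for \<open>z = c \<star> e\<close> it is the transvection along
  \<open>e\<close> with coefficient \<open>2 * c\<close>.\<close>

definition eic :: "nat \<Rightarrow> (nat \<Rightarrow> 'k::field) \<Rightarrow> (nat \<Rightarrow> 'k) \<Rightarrow> 'k mat" where
  "eic n e z = mof (2*n) (\<lambda>u. u + om n e u \<star> z + om n z u \<star> e)"

lemma eic_carrier [simp]: "eic n e z \<in> carrier_mat (2*n) (2*n)" by (simp add: eic_def)

lemma act_eic: "e \<in> vs (2*n) \<Longrightarrow> z \<in> vs (2*n) \<Longrightarrow> u \<in> vs (2*n) \<Longrightarrow>
    act (2*n) (eic n e z) u = u + om n e u \<star> z + om n z u \<star> e"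
  unfolding eic_def by (intro act_mof) (auto simp: lin_def scl_add scl_left_add algebra_simps)

lemma eic_Sp:
  fixes e :: "nat \<Rightarrow> 'k::field"
  assumes "e \<in> vs (2*n)" "z \<in> vs (2*n)" "om n e z = 0"
  shows "eic n e z \<in> carrier (Sp n)"
proof (rule SpI)
  fix u w :: "nat \<Rightarrow> 'k" assume "u \<in> vs (2*n)" "w \<in> vs (2*n)"
  thus "om n (act (2*n) (eic n e z) u) (act (2*n) (eic n e z) w) = om n u w"
    using assms om_skew[of n z e] by (simp add: act_eic om_skew[of n u e] om_skew[of n u z])
qed simp

text \<open>The condition on \<open>z\<close> says that its coordinates \<open>n, ..., n + i\<close>
  vanish, which is what triangularity asks of the two added terms. Scaling \<open>z\<close> joins
  the element to 1.\<close>

lemma eic_Bcon: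
  fixes z :: "nat \<Rightarrow> 'k::alg_closed_field"
  assumes i: "i < n" and z: "z \<in> vs (2*n)" "\<And>j. j \<le> i \<Longrightarrow> om n (bv j) z = 0"
  shows "eic n (bv i) z \<in> Bcon n"
proof -
  let ?\<gamma> = "\<lambda>t. eic n (bv i) (t \<star> z)"
  have zj: "z (n + j) = 0" if "j \<le> i" for j
    using z(2)[OF that] that i om_bv_left[of j n z] by (auto simp: swp_def eps_def add.commute)
  have B: "?\<gamma> t \<in> Bstd n" for t
  proof -
    have "shf n 0 (?\<gamma> t)"
      unfolding shf_def
    proof (intro allI impI)
      fix k j assume kj: "k < 2*n" "j < 2*n" and nz: "?\<gamma> t $$ (k, j) \<noteq> 0"
      have "?\<gamma> t $$ (k, j) = bv j k + om n (bv i) (bv j) * (t * z k) + t * om n z (bv j) * bv i k"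
        using kj by (simp add: eic_def mof_def)
      hence "bv j k \<noteq> (0::'k) \<or> om n (bv i) (bv j) * (t * z k) \<noteq> 0 \<or> t * om n z (bv j) * bv i k \<noteq> 0"
        using nz by auto
      moreover have "k = j" if "bv j k \<noteq> (0::'k)" using that by (simp add: bv_def split: if_splits)
      moreover have "pos n k \<le> pos n j" if "om n (bv i) (bv j) * (t * z k) \<noteq> 0"
      proof -
        have "j = n + i" using that kj i by (auto simp: om_bv swp_def split: if_splits)
        moreover have "\<not> (n \<le> k \<and> k \<le> n + i)"
        proof
          assume "n \<le> k \<and> k \<le> n + i"
          thus False using that zj[of "k - n"] by (metis add_diff_inverse_nat diff_le_mono diff_add_inverse linorder_not_less mult_zero_right)
        qed
        ultimately show ?thesis using kj i by (auto simp: pos_def)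
      qed
      moreover have "pos n k \<le> pos n j" if "t * om n z (bv j) * bv i k \<noteq> 0"
      proof -
        have "k = i" using that by (simp add: bv_def split: if_splits)
        moreover have "\<not> j \<le> i" using that z(2)[of j] om_skew[of n z "bv j"] by auto
        ultimately show ?thesis using kj i by (auto simp: pos_def)
      qed
      ultimately show "pos n k + 0 \<le> pos n j" by auto
    qed
    thus ?thesis using i z by (auto simp: Bstd_def intro!: eic_Sp)
  qed
  have "connectedin (zariski (2*n)) (?\<gamma> ` {t. poly 1 t \<noteq> 0})"
  proof (rule connectedin_rational_curve)
    fix k j assume "k < 2*n" "j < 2*n"
    thus "\<exists>p l. \<forall>t. poly 1 t \<noteq> 0 \<longrightarrow> ?\<gamma> t $$ (k, j) * poly 1 t ^ l = poly p t"
      by (intro exI[of _ "[:bv j k, om n (bv i) (bv j) * z k + om n z (bv j) * bv i k:]"] exI[of _ 0])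
        (auto simp: eic_def mof_def algebra_simps)
  qed auto
  moreover have "?\<gamma> 0 = 1\<^sub>m (2*n)" using i by (intro mat_eq_act[of _ "2*n"]) (auto simp: act_eic)
  ultimately show ?thesis
    unfolding Bcon_def using B by (intro CollectI exI[of _ "range ?\<gamma>"]) (auto simp: image_iff intro: exI[of _ 0] exI[of _ 1])
qed

text \<open>The Gram-Schmidt step behind all normalisations: inside the Borel subgroup the partner
  of column \<open>i\<close> can be exchanged for any admissible \<open>u\<close>, at the cost of
  adding multiples of column \<open>i\<close> to the other columns.\<close>

lemma move:
  fixes g :: "'k::alg_closed_field mat"
  assumes two: "(2::'k) \<noteq> 0" and g: "g \<in> carrier (Sp n)" and i: "i < n" and u: "u \<in> vs (2*n)"
    and u1: "om n (fcol n g i) u = 1" and u0: "\<And>j. j < i \<Longrightarrow> om n (fcol n g j) u = 0"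
  shows "\<exists>b\<in>Bcon n. fcol n (g * b) i = fcol n g i \<and> fcol n (g * b) (n + i) = u \<and>
    (\<forall>j<2*n. j \<noteq> i \<longrightarrow> j \<noteq> n + i \<longrightarrow> fcol n (g * b) j = fcol n g j + om n u (fcol n g j) \<star> fcol n g i)"
proof -
  \<comment> \<open>The map \<open>eic\<close> adds both \<open>z\<close> and
    \<open>om n z (bv (n + i)) \<star> bv i\<close> to \<open>bv (n + i)\<close>. This
    \<open>s\<close> lets the second term cancel the summand \<open>s \<star> bv i\<close> of
    \<open>z\<close>; here 2 is inverted.\<close>
  define s where "s = - om n u (fcol n g (n + i)) / 2"
  define z where "z = act (2*n) (sinv n g) u - bv (n + i) + s \<star> bv i"
  have zv: "z \<in> vs (2*n)" using i by (auto simp: z_def)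
  have gz: "act (2*n) g z = u - fcol n g (n + i) + s \<star> fcol n g i" using g u by (simp add: z_def)
  have zb: "om n z (bv j) = om n (act (2*n) g z) (fcol n g j)" for j using g by simp
  have z0: "om n (bv j) z = 0" if "j \<le> i" for j
  proof -
    have "om n (bv j) z = om n (fcol n g j) (act (2*n) g z)" using g by simp
    also have "\<dots> = 0" using that i g u1 u0[of j] unfolding gz by (cases "j = i") (auto simp del: Sp_om)
    finally show ?thesis .
  qed
  let ?b = "eic n (bv i) z"
  have B: "?b \<in> Bcon n" using i zv z0 by (rule eic_Bcon)
  hence bS: "?b \<in> carrier (Sp n)" by blast
  have c: "fcol n (g * ?b) j = fcol n g j + om n (bv i) (bv j) \<star> act (2*n) g z + om n z (bv j) \<star> fcol n g i" if "j < 2*n" for j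
    using that i g bS zv by (simp add: act_mult act_eic)
  have ui: "om n u (fcol n g i) = -1" using u1 om_skew[of n u] by simp
  have 1: "fcol n (g * ?b) i = fcol n g i"
    using c[of i] i g ui unfolding zb gz by (auto simp: om_bv swp_def simp del: Sp_om)
  have "om n u (fcol n g (n + i)) = - 2 * s" using two by (simp add: s_def)
  hence "om n z (bv (n + i)) = - s"
    using i g unfolding zb gz by (simp del: Sp_om)
  hence 2: "fcol n (g * ?b) (n + i) = u"
    using c[of "n + i"] i unfolding gz by (simp add: om_bv swp_def eps_def add.commute)
  have "om n (fcol n g (n + i)) (fcol n g j) = 0" "om n (fcol n g i) (fcol n g j) = 0" "om n (bv i) (bv j) = (0::'k)"
    if "j < 2*n" "j \<noteq> i" "j \<noteq> n + i" for j
    using that i g by (auto simp: om_bv swp_def)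
  hence 3: "fcol n (g * ?b) j = fcol n g j + om n u (fcol n g j) \<star> fcol n g i" if "j < 2*n" "j \<noteq> i" "j \<noteq> n + i" for j
    using c[of j] that unfolding zb gz by (simp del: Sp_om)
  show ?thesis using B 1 2 3 by blast
qed

definition tor :: "nat \<Rightarrow> nat \<Rightarrow> 'k::field \<Rightarrow> 'k mat" where
  "tor n i c = mof (2*n) (\<lambda>u k. (if k = i then c else if k = n + i then inverse c else 1) * u k)"

lemma tor_carrier [simp]: "tor n i c \<in> carrier_mat (2*n) (2*n)" by (simp add: tor_def)

lemma act_tor: "u \<in> vs (2*n) \<Longrightarrow>
    act (2*n) (tor n i c) u = (\<lambda>k. (if k = i then c else if k = n + i then inverse c else 1) * u k)"
  unfolding tor_def by (intro act_mof) (auto simp: lin_def fun_eq_iff algebra_simps vs_def)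

lemma act_tor_bv: "j < 2*n \<Longrightarrow>
    act (2*n) (tor n i c) (bv j) = (if j = i then c else if j = n + i then inverse c else 1) \<star> bv j"
  by (simp add: act_tor fun_eq_iff) (simp add: bv_def)

lemma tor_Sp:
  fixes c :: "'k::field"
  assumes "i < n" "c \<noteq> 0" shows "tor n i c \<in> carrier (Sp n)"
proof (rule SpI)
  fix u w :: "nat \<Rightarrow> 'k" assume uw: "u \<in> vs (2*n)" "w \<in> vs (2*n)"
  show "om n (act (2*n) (tor n i c) u) (act (2*n) (tor n i c) w) = om n u w"
    unfolding act_tor[OF uw(1)] act_tor[OF uw(2)] om_def
    using assms by (intro sum.cong) (auto simp: swp_def)
qed simp

lemma tor_Bcon:
  fixes c :: "'k::alg_closed_field"
  assumes i: "i < n" and c: "c \<noteq> 0" shows "tor n i c \<in> Bcon n"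
proof -
  let ?d = "[:0, 1:] :: 'k poly"
  have B: "tor n i t \<in> Bstd n" if "t \<noteq> 0" for t :: 'k
    using tor_Sp[OF i that] by (auto simp: Bstd_def shf_def tor_def mof_def bv_def)
  have "connectedin (zariski (2*n)) (tor n i ` {t. poly ?d t \<noteq> 0})"
  proof (rule connectedin_rational_curve)
    fix k j assume kj: "k < 2*n" "j < 2*n"
    have "tor n i t $$ (k, j) * poly ?d t ^ 1 =
      poly ((if k = i then [:0, 0, 1:] else if k = n + i then 1 else [:0, 1:]) * [:bv j k:]) t" if "t \<noteq> 0" for t
      using kj that by (auto simp: tor_def mof_def algebra_simps)
    thus "\<exists>p l. \<forall>t. poly ?d t \<noteq> 0 \<longrightarrow> tor n i t $$ (k, j) * poly ?d t ^ l = poly p t"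
      by (metis poly_pCons poly_0 add_0 mult_zero_right add.right_neutral mult.right_neutral)
  qed auto
  moreover have "tor n i 1 = (1\<^sub>m (2*n) :: 'k mat)"
    by (intro mat_eq_act[of _ "2*n"]) (auto simp: act_tor)
  ultimately show ?thesis
    unfolding Bcon_def using B c by (intro CollectI exI[of _ "tor n i ` {t. poly ?d t \<noteq> 0}"])
      (auto simp: image_iff intro: exI[of _ 1] exI[of _ c])
qed

lemma scale_step:
  fixes g :: "'k::alg_closed_field mat"
  assumes g: "g \<in> carrier (Sp n)" and i: "i < n" and c: "c \<noteq> 0"
  shows "\<exists>b\<in>Bcon n. fcol n (g * b) i = c \<star> fcol n g i \<and> fcol n (g * b) (n + i) = inverse c \<star> fcol n g (n + i) \<and>
    (\<forall>j<2*n. j \<noteq> i \<longrightarrow> j \<noteq> n + i \<longrightarrow> fcol n (g * b) j = fcol n g j)"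
  using tor_Bcon[OF i c] i g by (intro bexI[of _ "tor n i c"]) (auto simp: act_mult act_tor_bv)

lemma Bstd_col:
  assumes "b \<in> Bstd n" "i < n" "k < 2*n" "fcol n b i k \<noteq> 0" shows "k \<le> i"
proof -
  have "b $$ (k, i) \<noteq> 0" using assms by (simp add: act_bv)
  hence "pos n k \<le> pos n i" using assms by (auto simp: Bstd_def shf_def)
  thus ?thesis using assms by (auto simp: pos_def split: if_splits)
qed

text \<open>Torus elements and the elements from \<open>move\<close> turn \<open>b\<close> into 1
  one pair at a time, and all these factors lie in \<open>Bcon n\<close>.\<close>

lemma Bstd_Bcon:
  fixes b :: "'k::alg_closed_field mat"
  assumes two: "(2::'k) \<noteq> 0" and b: "b \<in> Bstd n"
  shows "b \<in> Bcon n"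
proof -
  have "i \<le> n \<Longrightarrow> b \<in> Bstd n \<Longrightarrow> (\<And>j. j < i \<Longrightarrow> fcol n b j = bv j \<and> fcol n b (n + j) = bv (n + j)) \<Longrightarrow> b \<in> Bcon n"
    for i and b :: "'k mat"
  proof (induction "n - i" arbitrary: i b)
    case 0
    have "b = 1\<^sub>m (2*n)"
    proof (rule mat_eq_act[of _ "2*n"])
      fix j assume "j < 2*n"
      thus "fcol n b j = fcol n (1\<^sub>m (2*n)) j" using 0(4)[of j] 0(4)[of "j - n"] 0(1,2) by (cases "j < n") auto
    qed (use 0 in \<open>auto dest!: Bstd_Sp\<close>)
    thus ?case by simp
  next
    case (Suc m)
    hence i: "i < n" and bS: "b \<in> carrier (Sp n)" by auto
    define c where "c = fcol n b i i"
    \<comment> \<open>Triangularity kills the entries after \<open>i\<close>. Those before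
      \<open>i\<close> vanish because column \<open>i\<close> is perpendicular to
      \<open>bv (n + k)\<close>, which is already column \<open>n + k\<close> of
      \<open>b\<close>.\<close>
    have bi: "fcol n b i = c \<star> bv i"
    proof (rule ext)
      fix k
      consider "k = i" | "k > i" "k < 2*n" | "k < i" | "k \<ge> 2*n" by linarith
      thus "fcol n b i k = (c \<star> bv i) k"
      proof cases
        case 2 thus ?thesis using Bstd_col[OF Suc(4) i, of k] by (auto simp: bv_def)
      next
        case 3
        have "om n (fcol n b (n + k)) (fcol n b i) = 0" using bS i 3 by (auto simp del: Sp_om)
        thus ?thesis using 3 i Suc(5)[of k] by (simp add: om_bv_left) (auto simp: swp_def bv_def)
      qed (auto simp: c_def bv_def act_def i)
    qed
    have c: "c \<noteq> 0"
    proof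
      assume "c = 0"
      hence "om n (fcol n b i) (fcol n b (n + i)) = 0" unfolding bi by simp
      thus False using bS i by (auto simp del: Sp_om)
    qed
    obtain t where t: "t \<in> Bcon n" "fcol n (b * t) i = bv i"
      "\<And>j. j < 2*n \<Longrightarrow> j \<noteq> i \<Longrightarrow> j \<noteq> n + i \<Longrightarrow> fcol n (b * t) j = fcol n b j" "t = tor n i (inverse c)"
      using that[of "tor n i (inverse c)"] tor_Bcon[OF i, of "inverse c"] c bS i bi
        by (auto simp: act_mult act_tor_bv)
    let ?b = "b * t"
    have b'S: "?b \<in> carrier (Sp n)" using bS Bcon_Sp[OF t(1)] by simp
    have old: "fcol n ?b j = bv j" "fcol n ?b (n + j) = bv (n + j)" if "j < i" for j
      using t(3)[of j] t(3)[of "n + j"] Suc(5)[OF that] that i by auto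
    define u where "u = fcol n ?b (n + i)"
    have u1: "om n (bv i) u = 1" using om_col_simps(3)[OF b'S i i] unfolding u_def t(2) by simp
    have u0: "om n (bv j) u = 0" "om n (bv (n + j)) u = 0" if "j < i" for j
      using om_col_simps(3)[OF b'S, of j i] om_col_simps(2)[OF b'S, of j i] that i unfolding u_def
      by (auto simp: old simp del: Sp_om)
    obtain m where m: "m \<in> Bcon n" "fcol n m i = bv i" "fcol n m (n + i) = u"
      "\<And>j. j < 2*n \<Longrightarrow> j \<noteq> i \<Longrightarrow> j \<noteq> n + i \<Longrightarrow> fcol n m j = bv j + om n u (bv j) \<star> bv i"
    proof -
      have one: "1\<^sub>m (2*n) * m = m" if "m \<in> Bcon n" for m :: "'k mat"
        using that by (intro left_mult_one_mat[of _ _ "2*n"]) auto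
      show ?thesis using move[OF two one_Sp i, of u] i u1 u0 that by (auto simp: u_def one)
    qed
    have mS: "m \<in> carrier (Sp n)" using m(1) by blast
    have mo: "fcol n m j = bv j" "fcol n m (n + j) = bv (n + j)" if "j < i" for j
      using m(4)[of j] m(4)[of "n + j"] that i u0[OF that] om_skew[of n u] by auto
    let ?r = "sinv n m * ?b"
    have rS: "?r \<in> carrier (Sp n)" using mS b'S by auto
    have "fcol n ?r j = bv j \<and> fcol n ?r (n + j) = bv (n + j)" if "j < Suc i" for j
    proof -
      have "fcol n ?b j = fcol n m j \<and> fcol n ?b (n + j) = fcol n m (n + j)"
        using that old[of j] mo[of j] m(2,3) t(2) by (cases "j = i") (auto simp: u_def)
      thus ?thesis using mS b'S that i by (simp add: act_mult)
    qed
    hence r: "?r \<in> Bcon n"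
      using Suc(1)[of "Suc i" ?r] Suc(2) i
        Bstd_mult[OF Bstd_sinv[OF Bcon_Bstd[OF m(1)]] Bstd_mult[OF Suc(4) Bcon_Bstd[OF t(1)]]] by auto
    have t': "tor n i c \<in> Bcon n" using tor_Bcon[OF i c] .
    have tS: "t \<in> carrier (Sp n)" "tor n i c \<in> carrier (Sp n)" using t(1) t' by auto
    have tt: "t * tor n i c = 1\<^sub>m (2*n)"
    proof (rule mat_eq_act[of _ "2*n"])
      fix j assume "j < 2*n"
      thus "fcol n (t * tor n i c) j = fcol n (1\<^sub>m (2*n)) j"
        using c i unfolding t(4) by (auto simp: act_mult act_tor_bv)
    qed (use tS in auto)
    have "m * ?r * tor n i c = b"
    proof (rule mat_eq_act[of _ "2*n"])
      fix j assume j: "j < 2*n"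
      have "fcol n (m * ?r * tor n i c) j = act (2*n) (b * (t * tor n i c)) (bv j)"
        using mS bS tS j by (simp add: act_mult del: mult_carrier_mat)
      thus "fcol n (m * ?r * tor n i c) j = fcol n b j" unfolding tt using bS j by (simp add: act_mult)
    qed (use mS rS tS bS in auto)
    thus ?case using m(1) r t' by (metis Bcon_mult)
  qed
  from this[of 0 b] b show ?thesis by simp
qed

lemma Bstd_connected:
  assumes "(2::'k::alg_closed_field) \<noteq> 0"
  shows "connectedin (zariski (2*n)) (Bstd n :: 'k mat set)"
proof -
  let ?F = "{S. S \<subseteq> Bstd n \<and> connectedin (zariski (2*n)) S \<and> (1\<^sub>m (2*n) :: 'k mat) \<in> S}"
  have "connectedin (zariski (2*n)) (\<Union>?F)"
    by (rule connectedin_Union) auto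
  moreover have "\<Union>?F = Bstd n"
    using Bstd_Bcon[OF assms, of _ n] by (fastforce simp: Bcon_def)
  ultimately show ?thesis by simp
qed


section \<open>Common eigenvectors\<close>

global_interpretation fv: vector_space "(\<star>) :: 'k::field \<Rightarrow> (nat \<Rightarrow> 'k) \<Rightarrow> nat \<Rightarrow> 'k"
  by unfold_locales (auto simp: scl_add scl_left_add)

lemma vs_span: "vs m \<subseteq> fv.span (bv ` {..<m})"
proof
  fix v :: "nat \<Rightarrow> 'k::field" assume "v \<in> vs m"
  have "(\<Sum>j<m. v j \<star> bv j) \<in> fv.span (bv ` {..<m})"
    by (intro fv.span_sum fv.span_scale fv.span_base) auto
  thus "v \<in> fv.span (bv ` {..<m})" using vs_expand[OF \<open>v \<in> vs m\<close>] by simp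
qed

lemma independent_vs:
  assumes "fv.independent S" "S \<subseteq> vs m" shows "finite S \<and> card S \<le> m"
proof -
  have "finite S \<and> card S \<le> card (bv ` {..<m} :: (nat \<Rightarrow> 'a) set)"
    using assms vs_span[of m] by (intro fv.independent_span_bound) auto
  moreover have "card (bv ` {..<m} :: (nat \<Rightarrow> 'a) set) \<le> m"
    using card_image_le[of "{..<m}" bv] by simp
  ultimately show ?thesis by linarith
qed

text \<open>A measure that drops on proper subspaces; it is used to choose a minimal invariant
  subspace.\<close>

definition rk :: "(nat \<Rightarrow> 'k::field) set \<Rightarrow> nat" where
  "rk W = Max (card ` {S. S \<subseteq> W \<and> fv.independent S})"

lemma rk_fin: "W \<subseteq> vs m \<Longrightarrow> finite (card ` {S. S \<subseteq> W \<and> fv.independent S})"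
proof (rule finite_subset[of _ "{..m}"])
  assume W: "W \<subseteq> vs m"
  show "card ` {S. S \<subseteq> W \<and> fv.independent S} \<subseteq> {..m}"
  proof
    fix k assume "k \<in> card ` {S. S \<subseteq> W \<and> fv.independent S}"
    then obtain S where S: "k = card S" "S \<subseteq> W" "fv.independent S" by (elim imageE CollectE conjE)
    show "k \<in> {..m}" using independent_vs[OF S(3) subset_trans[OF S(2) W]] S(1) by simp
  qed
qed simp

lemma rk_less:
  assumes W: "W \<subseteq> vs m" and U: "fv.subspace U" "U \<subseteq> W" "U \<noteq> W"
  shows "rk U < rk W"
proof -
  have Um: "U \<subseteq> vs m" using U W by blast
  have "{} \<in> {S. S \<subseteq> U \<and> fv.independent S}" using fv.independent_empty by simp
  hence "rk U \<in> card ` {S. S \<subseteq> U \<and> fv.independent S}"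
    unfolding rk_def using rk_fin[OF Um] by (intro Max_in) auto
  then obtain S where S: "S \<subseteq> U" "fv.independent S" "rk U = card S" by auto
  obtain w where w: "w \<in> W" "w \<notin> U" using U by blast
  have "w \<notin> fv.span S" using fv.span_minimal[OF S(1) U(1)] w by blast
  hence "fv.independent (insert w S)" using S by (intro fv.independent_insertI)
  hence "card (insert w S) \<le> rk W"
    unfolding rk_def using rk_fin[OF W] S U w by (intro Max_ge) auto
  moreover have "card (insert w S) = Suc (card S)"
    using independent_vs[OF S(2), of m] S Um w by (subst card_insert_disjoint) auto
  ultimately show ?thesis using S by simp
qed

section \<open>Polynomials in an operator and eigenvectors\<close>

definition ap :: "((nat \<Rightarrow> 'k::field) \<Rightarrow> (nat \<Rightarrow> 'k)) \<Rightarrow> 'k poly \<Rightarrow> (nat \<Rightarrow> 'k) \<Rightarrow> nat \<Rightarrow> 'k" where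
  "ap L p w = (\<Sum>i\<le>degree p. coeff p i \<star> (L ^^ i) w)"

lemma ap_eq: "degree p \<le> N \<Longrightarrow> ap L p w = (\<Sum>i\<le>N. coeff p i \<star> (L ^^ i) w)"
  unfolding ap_def by (intro sum.mono_neutral_left) (auto simp: coeff_eq_0)

lemma ap_linear_factor:
  assumes "lin L" shows "ap L ([:- c, 1:] * q) w = L (ap L q w) - c \<star> ap L q w"
proof -
  let ?N = "degree q"
  have "degree ([:- c, 1:] * q) \<le> Suc ?N" using degree_mult_le[of "[:- c, 1:]" q] by simp
  hence "ap L ([:- c, 1:] * q) w = (\<Sum>i\<le>Suc ?N. coeff ([:- c, 1:] * q) i \<star> (L ^^ i) w)" by (rule ap_eq)
  also have "\<dots> = (\<Sum>i\<le>Suc ?N. coeff (pCons 0 q) i \<star> (L ^^ i) w - (c * coeff q i) \<star> (L ^^ i) w)"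
    by (intro sum.cong) (auto simp: scl_left_add scl_left_diff)
  also have "\<dots> = (\<Sum>i\<le>Suc ?N. coeff (pCons 0 q) i \<star> (L ^^ i) w) - (\<Sum>i\<le>Suc ?N. (c * coeff q i) \<star> (L ^^ i) w)"
    by (rule sum_subtractf)
  also have "(\<Sum>i\<le>Suc ?N. coeff (pCons 0 q) i \<star> (L ^^ i) w) = (\<Sum>i\<le>?N. coeff q i \<star> L ((L ^^ i) w))"
    by (subst sum.atMost_Suc_shift) simp
  also have "\<dots> = L (ap L q w)" using assms unfolding ap_def by (subst lin_sum[OF assms]) (simp add: lin_def)
  also have "(\<Sum>i\<le>Suc ?N. (c * coeff q i) \<star> (L ^^ i) w) = c \<star> (\<Sum>i\<le>Suc ?N. coeff q i \<star> (L ^^ i) w)"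
    by (subst fv.scale_sum_right) simp
  also have "(\<Sum>i\<le>Suc ?N. coeff q i \<star> (L ^^ i) w) = ap L q w" by (rule ap_eq[symmetric]) simp
  finally show ?thesis .
qed

lemma ap_in:
  assumes "fv.subspace W" "w \<in> W" "\<And>u. u \<in> W \<Longrightarrow> L u \<in> W" shows "ap L p w \<in> W"
proof -
  have "(L ^^ i) w \<in> W" for i using assms by (induction i) auto
  thus ?thesis unfolding ap_def using assms(1) by (intro fv.subspace_sum fv.subspace_scale)
qed

text \<open>A linear factor is split off \<open>p\<close>. Either the quotient still annihilates
  \<open>w\<close>, or its value at \<open>w\<close> is an eigenvector for the root.\<close>

lemma eigenvector_of_annihilator:
  fixes L :: "(nat \<Rightarrow> 'k::alg_closed_field) \<Rightarrow> (nat \<Rightarrow> 'k)"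
  assumes L: "lin L" and W: "fv.subspace W" "\<And>u. u \<in> W \<Longrightarrow> L u \<in> W" and w: "w \<in> W" "w \<noteq> 0"
  shows "p \<noteq> 0 \<Longrightarrow> ap L p w = 0 \<Longrightarrow> \<exists>u\<in>W. u \<noteq> 0 \<and> (\<exists>c. L u = c \<star> u)"
proof (induction "degree p" arbitrary: p rule: less_induct)
  case less
  show ?case
  proof (cases "degree p = 0")
    case True
    then obtain a where "p = [:a:]" by (rule degree_eq_zeroE)
    thus ?thesis using less.prems w by (simp add: ap_def)
  next
    case False
    then obtain c where "poly p c = 0" using alg_closed_imp_poly_has_root[of p] by auto
    then obtain q where q: "p = [:- c, 1:] * q" by (auto simp: poly_eq_0_iff_dvd dvd_def)
    have q0: "q \<noteq> 0" using less.prems q by auto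
    have dq: "degree q < degree p" unfolding q using q0 by (subst degree_mult_eq) auto
    show ?thesis
    proof (cases "ap L q w = 0")
      case True thus ?thesis using less.hyps dq q0 by blast
    next
      case False
      have "L (ap L q w) = c \<star> ap L q w" using less.prems(2) unfolding q ap_linear_factor[OF L] by simp
      thus ?thesis
        by (intro bexI[of _ "ap L q w"] conjI exI[of _ c] False ap_in[OF W(1) w(1)] W(2))
    qed
  qed
qed

text \<open>Repeated vectors form a separate case because independence of the image set does not see
  repetitions.\<close>

lemma vectors_dependent:
  fixes x :: "nat \<Rightarrow> nat \<Rightarrow> 'k::field"
  assumes "\<And>i. x i \<in> vs m"
  shows "\<exists>a. (\<exists>i\<le>m. a i \<noteq> 0) \<and> (\<Sum>i\<le>m. a i \<star> x i) = 0"
proof (cases "inj_on x {..m}")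
  case False
  then obtain i j where ij: "i \<le> m" "j \<le> m" "i \<noteq> j" "x i = x j" by (auto simp: inj_on_def)
  have e: "(\<Sum>k\<le>m. ((if k = l then c else 0) :: 'k) \<star> x k) = c \<star> x l" if "l \<le> m" for l c
    using that by (subst sum.remove[of _ l]) auto
  have "(\<Sum>k\<le>m. ((if k = i then 1 else 0) - (if k = j then 1 else 0)) \<star> x k) = 0"
    using ij by (simp only: scl_left_diff sum_subtractf e) simp
  thus ?thesis using ij by (intro exI[of _ "\<lambda>k. (if k = i then 1 else 0) - (if k = j then 1 else 0)"]) auto
next
  case True
  have "fv.dependent (x ` {..m})"
  proof (rule ccontr)
    assume "fv.independent (x ` {..m})"
    hence "card (x ` {..m}) \<le> m" using independent_vs[of _ m] assms by blast
    thus False using card_image[OF True] by simp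
  qed
  then obtain u where u: "\<exists>v\<in>x ` {..m}. u v \<noteq> 0" "(\<Sum>v\<in>x ` {..m}. u v \<star> v) = 0"
    by (subst (asm) fv.dependent_finite) auto
  thus ?thesis using True by (intro exI[of _ "u \<circ> x"]) (auto simp: sum.reindex)
qed

lemma exists_eigenvector:
  fixes L :: "(nat \<Rightarrow> 'k::alg_closed_field) \<Rightarrow> (nat \<Rightarrow> 'k)"
  assumes L: "lin L" and W: "fv.subspace W" "W \<subseteq> vs m" "\<And>u. u \<in> W \<Longrightarrow> L u \<in> W" and w: "w \<in> W" "w \<noteq> 0"
  shows "\<exists>u\<in>W. u \<noteq> 0 \<and> (\<exists>c. L u = c \<star> u)"
proof -
  have x: "(L ^^ i) w \<in> W" for i using w W by (induction i) auto
  obtain a where a: "\<exists>i\<le>m. a i \<noteq> 0" "(\<Sum>i\<le>m. a i \<star> (L ^^ i) w) = 0"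
    using vectors_dependent[of "\<lambda>i. (L ^^ i) w" m] x W by blast
  define p where "p = (\<Sum>i\<le>m. monom (a i) i)"
  have cp: "coeff p i = (if i \<le> m then a i else 0)" for i by (simp add: p_def coeff_sum)
  have "degree p \<le> m" by (rule degree_le) (auto simp: cp)
  hence "ap L p w = 0" using a(2) by (simp add: ap_eq cp)
  moreover have "p \<noteq> 0" using a(1) cp by (metis coeff_0)
  ultimately show ?thesis by (intro eigenvector_of_annihilator[OF L W(1) W(3) w])
qed

lemma finite_eigenvalues:
  fixes A :: "'k::field mat"
  assumes A: "A \<in> carrier_mat m m"
  shows "finite {c. \<exists>u\<in>vs m. u \<noteq> 0 \<and> act m A u = c \<star> u}"
proof -
  have "{c. \<exists>u\<in>vs m. u \<noteq> 0 \<and> act m A u = c \<star> u} \<subseteq> {c. poly (char_poly A) c = 0}"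
  proof safe
    fix c u assume u: "u \<in> vs m" "u \<noteq> 0" "act m A u = c \<star> u"
    have "A *\<^sub>v vec m u = c \<cdot>\<^sub>v vec m u"
    proof (rule eq_vecI)
      fix i assume i: "i < dim_vec (c \<cdot>\<^sub>v vec m u)"
      have "(A *\<^sub>v vec m u) $ i = act m A u i"
        using A i by (auto simp: scalar_prod_def act_def atLeast0LessThan intro!: sum.cong)
      thus "(A *\<^sub>v vec m u) $ i = (c \<cdot>\<^sub>v vec m u) $ i" using i u(3) by simp
    qed (use A in auto)
    moreover have "vec m u \<noteq> 0\<^sub>v m"
    proof
      assume *: "vec m u = 0\<^sub>v m"
      have "u i = 0" for i using * u(1) by (cases "i < m") (auto simp: vs_def vec_eq_iff)
      thus False using u(2) by (auto simp: fun_eq_iff)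
    qed
    ultimately have "eigenvalue A c" using A unfolding eigenvalue_def eigenvector_def by (intro exI[of _ "vec m u"]) auto
    thus "poly (char_poly A) c = 0" using eigenvalue_root_char_poly[OF A] by blast
  qed
  moreover have "char_poly A \<noteq> 0" using degree_monic_char_poly[OF A] by auto
  ultimately show ?thesis using poly_roots_finite finite_subset by blast
qed

text \<open>In a nonzero invariant subspace of least rank, an eigenspace of one operator is stable
  under the others by commutation, hence is everything. So all operators act there as
  scalars.\<close>

lemma commuting_eigenvector:
  fixes F :: "((nat \<Rightarrow> 'k::alg_closed_field) \<Rightarrow> (nat \<Rightarrow> 'k)) set"
  assumes F: "\<And>L. L \<in> F \<Longrightarrow> lin L" and W: "fv.subspace W" "W \<subseteq> vs m" "w \<in> W" "w \<noteq> 0"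
    and inv: "\<And>L u. L \<in> F \<Longrightarrow> u \<in> W \<Longrightarrow> L u \<in> W"
    and comm: "\<And>L M u. L \<in> F \<Longrightarrow> M \<in> F \<Longrightarrow> u \<in> W \<Longrightarrow> L (M u) = M (L u)"
  shows "\<exists>u\<in>W. u \<noteq> 0 \<and> (\<forall>L\<in>F. \<exists>c. L u = c \<star> u)"
proof -
  let ?P = "\<lambda>U. fv.subspace U \<and> U \<subseteq> W \<and> (\<exists>u\<in>U. u \<noteq> 0) \<and> (\<forall>L\<in>F. \<forall>u\<in>U. L u \<in> U)"
  have "?P W" using W inv by blast
  then obtain U where U: "?P U" and least: "\<And>V. ?P V \<Longrightarrow> rk U \<le> rk V"
    using ex_has_least_nat[of ?P W rk] by blast
  obtain u where u: "u \<in> U" "u \<noteq> 0" using U by blast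
  have "\<exists>c. \<forall>v\<in>U. L v = c \<star> v" if L: "L \<in> F" for L
  proof -
    obtain v c where v: "v \<in> U" "v \<noteq> 0" "L v = c \<star> v"
      using exists_eigenvector[of L U m u] F L U u W by blast
    let ?E = "{v \<in> U. L v = c \<star> v}"
    have "fv.subspace ?E"
      using U F[OF L] lin_0[of L] unfolding fv.subspace_def by (auto simp: lin_def scl_add mult.commute)
    moreover have "M x \<in> ?E" if "M \<in> F" "x \<in> ?E" for M x
      using that U comm[OF L \<open>M \<in> F\<close>, of x] F[OF \<open>M \<in> F\<close>] by (auto simp: lin_def)
    ultimately have "?P ?E" using U v by blast
    hence "rk U \<le> rk ?E" by (rule least)
    moreover have "rk ?E < rk U" if "?E \<noteq> U"
      using U subset_trans[OF _ W(2), of U] that by (intro rk_less[of U m ?E, OF _ \<open>fv.subspace ?E\<close>]) auto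
    ultimately have "?E = U" by linarith
    thus ?thesis by blast
  qed
  moreover have "u \<in> W" using u U by (elim conjE) (rule subsetD)
  ultimately show ?thesis using u by (intro bexI[of _ u]) auto
qed

section \<open>The Lie--Kolchin theorem\<close>

text \<open>If \<open>f\<close> took a second value, the level set at \<open>f g\<close> and the
  union of the finitely many other level sets would be separated by the two open sets.\<close>

lemma connected_finite_range_const:
  fixes f :: "'k::field mat \<Rightarrow> 'k"
  assumes H: "connectedin (zariski N) H" and f: "pf N f" and fin: "finite (f ` H)" and gh: "g \<in> H" "h \<in> H"
  shows "f g = f h"
proof (rule ccontr)
  assume ne: "f g \<noteq> f h"
  let ?E1 = "{A \<in> carrier_mat N N. f A - f g \<noteq> 0}"
  let ?E2 = "{A \<in> carrier_mat N N. (\<Prod>b\<in>f ` H - {f g}. f A - b) \<noteq> 0}"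
  have "openin (zariski N) ?E1" "openin (zariski N) ?E2"
    by (rule openin_pf, use f in simp)+
  moreover have Hc: "H \<subseteq> carrier_mat N N" using H by (auto simp: connectedin_def)
  moreover have "H \<subseteq> ?E1 \<union> ?E2" using Hc fin by (auto simp: prod_zero_iff)
  moreover have "?E1 \<inter> ?E2 \<inter> H = {}" using fin by (auto simp: prod_zero_iff)
  moreover have "h \<in> ?E1 \<inter> H" "g \<in> ?E2 \<inter> H" using Hc gh ne fin by (auto simp: prod_zero_iff)
  ultimately show False using H unfolding connectedin by (metis (no_types, lifting) empty_iff)
qed

text \<open>For fixed \<open>h\<close> the commutators with \<open>h\<close> form a connected set
  through 1, the image of \<open>H\<close> under a polynomial map. Inverses and products are handled
  by mapping, translating and gluing such sets.\<close>

lemma derived_connected: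
  fixes H :: "'k::field mat set"
  assumes sub: "subgroup H (Sp n)" and con: "connectedin (zariski (2*n)) H"
  shows "connectedin (zariski (2*n)) (derived (Sp n) H)"
proof -
  let ?D = "derived (Sp n) H" and ?Z = "zariski (2*n)"
  interpret group "Sp n :: 'k mat monoid" by (rule Sp_group)
  have HS: "H \<subseteq> carrier (Sp n)" using sub by (rule subgroup.subset)
  have D: "subgroup ?D (Sp n)" using HS by (rule derived_is_subgroup)
  have DS: "?D \<subseteq> carrier (Sp n)" using D by (rule subgroup.subset)
  have one: "1\<^sub>m (2*n) \<in> H" using subgroup.one_closed[OF sub] by simp
  have mem: "x * h * sinv n x * sinv n h \<in> ?D" if "x \<in> H" "h \<in> H" for x h
  proof -
    have "x \<in> carrier (Sp n)" "h \<in> carrier (Sp n)" using that HS by auto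
    hence "x * h * sinv n x * sinv n h \<in> derived_set (Sp n) H" using that by (intro UN_I[of x H] UN_I[of h H]) auto
    thus ?thesis unfolding derived_def by (rule generate.incl)
  qed
  have base: "\<exists>S\<subseteq>?D. connectedin ?Z S \<and> 1\<^sub>m (2*n) \<in> S \<and> a \<in> S" if "a \<in> derived_set (Sp n) H" for a
  proof -
    obtain x h where xh: "x \<in> H" "h \<in> H" "a = x \<otimes>\<^bsub>Sp n\<^esub> h \<otimes>\<^bsub>Sp n\<^esub> inv\<^bsub>Sp n\<^esub> x \<otimes>\<^bsub>Sp n\<^esub> inv\<^bsub>Sp n\<^esub> h"
      using \<open>a \<in> derived_set (Sp n) H\<close> by blast
    have hS: "x \<in> carrier (Sp n)" "h \<in> carrier (Sp n)" using xh HS by auto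
    let ?S = "(\<lambda>x. x * h * sinv n x * sinv n h) ` H"
    have "connectedin ?Z ?S" using hS by (intro connectedin_pm[OF _ con] pm_mult pm_sinv pm_id pm_const) auto
    moreover have "sinv n (1\<^sub>m (2*n)) = (1\<^sub>m (2*n) :: 'k mat)" using inv_Sp[OF one_Sp, of n] inv_one by simp
    hence *: "1\<^sub>m (2*n) = 1\<^sub>m (2*n) * h * sinv n (1\<^sub>m (2*n)) * sinv n h"
      using hS by (simp add: sinv_right left_mult_one_mat[OF Sp_carrier_mat[OF hS(2)]]
        right_mult_one_mat[OF Sp_carrier_mat[OF hS(2)]])
    have "1\<^sub>m (2*n) \<in> ?S" by (rule image_eqI[where x = "1\<^sub>m (2*n)"], rule *, rule one)
    moreover have "a \<in> ?S" using xh hS by auto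
    moreover have "?S \<subseteq> ?D" using mem xh by auto
    ultimately show ?thesis by blast
  qed
  have all: "\<exists>S\<subseteq>?D. connectedin ?Z S \<and> 1\<^sub>m (2*n) \<in> S \<and> a \<in> S" if "a \<in> generate (Sp n) (derived_set (Sp n) H)" for a
    using that
  proof induction
    case one
    have "{1\<^sub>m (2*n)} \<subseteq> ?D" using subgroup.one_closed[OF D] by simp
    thus ?case by (intro exI[of _ "{1\<^sub>m (2*n)}"]) auto
  next
    case (incl a) thus ?case by (rule base)
  next
    case (inv a)
    then obtain S where S: "S \<subseteq> ?D" "connectedin ?Z S" "1\<^sub>m (2*n) \<in> S" "a \<in> S" using base by blast
    have "connectedin ?Z (sinv n ` S)" by (intro connectedin_pm[OF _ S(2)] pm_sinv pm_id)
    moreover have "sinv n (1\<^sub>m (2*n)) = (1\<^sub>m (2*n) :: 'k mat)" using inv_Sp[OF one_Sp, of n] inv_one by simp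
    hence "1\<^sub>m (2*n) \<in> sinv n ` S" by (intro image_eqI[OF _ S(3)]) simp
    moreover have "sinv n ` S \<subseteq> ?D"
    proof
      fix y assume "y \<in> sinv n ` S"
      then obtain x where x: "x \<in> ?D" "y = sinv n x" using S(1) by auto
      thus "y \<in> ?D" using subgroup.m_inv_closed[OF D x(1)] DS by auto
    qed
    moreover have "inv\<^bsub>Sp n\<^esub> a \<in> sinv n ` S" using S DS by (subst inv_Sp) auto
    ultimately show ?case by blast
  next
    case (eng a b)
    then obtain S T where S: "S \<subseteq> ?D" "connectedin ?Z S" "1\<^sub>m (2*n) \<in> S" "a \<in> S"
      and T: "T \<subseteq> ?D" "connectedin ?Z T" "1\<^sub>m (2*n) \<in> T" "b \<in> T" by blast
    have b: "b \<in> ?D" "b \<in> carrier_mat (2*n) (2*n)" using T DS by auto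
    have "connectedin ?Z ((\<lambda>A. A * b) ` S)" by (rule connectedin_pm[OF _ S(2)]) (use b in auto)
    moreover have "b \<in> (\<lambda>A. A * b) ` S" using S(3) b by (auto intro!: image_eqI[of _ _ "1\<^sub>m (2*n)"])
    ultimately have "connectedin ?Z ((\<lambda>A. A * b) ` S \<union> T)"
      using T by (intro connectedin_Un) auto
    moreover have "(\<lambda>A. A * b) ` S \<union> T \<subseteq> ?D"
      using S(1) T(1) b subgroup.m_closed[OF D] by auto
    moreover have "a \<otimes>\<^bsub>Sp n\<^esub> b \<in> (\<lambda>A. A * b) ` S \<union> T" "1\<^sub>m (2*n) \<in> (\<lambda>A. A * b) ` S \<union> T" using S T by auto
    ultimately show ?case by blast
  qed
  let ?F = "{S. S \<subseteq> ?D \<and> connectedin ?Z S \<and> 1\<^sub>m (2*n) \<in> S}"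
  have "connectedin ?Z (\<Union>?F)" by (rule connectedin_Union) auto
  moreover have "\<Union>?F = ?D" using all by (fastforce simp: derived_def)
  ultimately show ?thesis by simp
qed

lemma pm_comp: "pm M K \<rho> \<Longrightarrow> pm N M h \<Longrightarrow> pm N K (\<lambda>A. \<rho> (h A))"
  unfolding pm_def[of M K] pm_def[of N K]
proof (intro conjI ballI allI impI)
  fix i j
  assume r: "(\<forall>A\<in>carrier_mat M M. \<rho> A \<in> carrier_mat K K) \<and> (\<forall>i<K. \<forall>j<K. pf M (\<lambda>A. \<rho> A $$ (i, j)))"
    and h: "pm N M h"
  show "pf N (\<lambda>A. \<rho> (h A) $$ (i, j))" if "i < K" "j < K"
    using r that by (intro pf_comp[OF _ h, of "\<lambda>A. \<rho> A $$ (i, j)"]) auto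
qed (auto simp: pm_def)

text \<open>The map \<open>\<rho>\<close> is multiplicative on \<open>H\<close> only, since it will
  be a diagonal block, which is multiplicative just on matrices preserving the corresponding
  subspaces. The induction is on the derived length: on a weight space of the derived group, the
  whole group turns out to act commutatively.\<close>

theorem Lie_Kolchin:
  fixes \<rho> :: "'k::alg_closed_field mat \<Rightarrow> 'k mat"
  assumes rho: "pm (2*n) m \<rho>" and m: "m > 0" and one: "\<rho> (1\<^sub>m (2*n)) = 1\<^sub>m m"
  shows "(derived (Sp n) ^^ k) H = {1\<^sub>m (2*n)} \<Longrightarrow> subgroup H (Sp n) \<Longrightarrow> connectedin (zariski (2*n)) H \<Longrightarrow>
    (\<And>g h. g \<in> H \<Longrightarrow> h \<in> H \<Longrightarrow> \<rho> (g * h) = \<rho> g * \<rho> h) \<Longrightarrow>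
    \<exists>v\<in>vs m. v \<noteq> 0 \<and> (\<forall>h\<in>H. \<exists>c. act m (\<rho> h) v = c \<star> v)"
proof (induction k arbitrary: H)
  case 0
  have "bv 0 \<noteq> (0 :: nat \<Rightarrow> 'k)" by (auto simp: bv_def fun_eq_iff)
  thus ?case using 0 m one by (intro bexI[of _ "bv 0"]) (auto intro: exI[of _ 1])
next
  case (Suc k)
  interpret group "Sp n :: 'k mat monoid" by (rule Sp_group)
  note H = Suc.prems(2) and con = Suc.prems(3) and hom = Suc.prems(4)
  let ?D = "derived (Sp n) H"
  have HS: "H \<subseteq> carrier (Sp n)" using H by (rule subgroup.subset)
  have D: "subgroup ?D (Sp n)" using HS by (rule derived_is_subgroup)
  have DH: "?D \<subseteq> H" by (rule derived_incl[OF order_refl H])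
  have mult: "g * h \<in> H" if "g \<in> H" "h \<in> H" for g h using subgroup.m_closed[OF H that] by simp
  have sv: "sinv n g \<in> H" if "g \<in> H" for g using subgroup.m_inv_closed[OF H that] HS that by auto
  have oneH: "1\<^sub>m (2*n) \<in> H" using subgroup.one_closed[OF H] by simp
  have rc: "\<rho> g \<in> carrier_mat m m" if "g \<in> H" for g using rho that HS by (auto simp: pm_def)
  have act_rho: "act m (\<rho> (g * h)) w = act m (\<rho> g) (act m (\<rho> h) w)" if "g \<in> H" "h \<in> H" for g h w
    using hom[OF that] rc that by (simp add: act_mult)
  have comD: "g * h * sinv n g * sinv n h \<in> ?D" if "g \<in> H" "h \<in> H" for g h
  proof -
    have "g * h * sinv n g * sinv n h \<in> derived_set (Sp n) H"
      by (rule UN_I[OF that(1)], rule UN_I[OF that(2)])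
        (use that inv_Sp[OF subsetD[OF HS that(1)]] inv_Sp[OF subsetD[OF HS that(2)]] in simp)
    thus ?thesis unfolding derived_def by (rule generate.incl)
  qed
  have e: "A * B * C = A * (B * C)" if "A \<in> H" "B \<in> H" "C \<in> H" for A B C
    using that HS by (intro assoc_mult_mat[of _ "2*n" "2*n" _ "2*n" _ "2*n"]) auto
  have sl: "sinv n g * g = 1\<^sub>m (2*n)" "g * sinv n g = 1\<^sub>m (2*n)" "1\<^sub>m (2*n) * g = g" "g * 1\<^sub>m (2*n) = g" if "g \<in> H" for g
    using sinv_left[OF subsetD[OF HS that]] sinv_right[OF subsetD[OF HS that]]
      left_mult_one_mat[OF Sp_carrier_mat[OF subsetD[OF HS that]]] right_mult_one_mat[OF Sp_carrier_mat[OF subsetD[OF HS that]]]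
    by blast+
  have comm: "g * h = (g * h * sinv n g * sinv n h) * (h * g)" if "g \<in> H" "h \<in> H" for g h
  proof -
    have "(g * h * sinv n g * sinv n h) * (h * g) = g * h * sinv n g * (sinv n h * h) * g"
      using that by (simp add: e mult sv)
    thus ?thesis using that by (simp add: e mult sv sl)
  qed
  have conjD: "sinv n g * d * g \<in> ?D" if "g \<in> H" "d \<in> ?D" for g d
  proof -
    have d: "d \<in> H" using that DH by blast
    have gg: "sinv n (sinv n g) = g" using that(1) HS inv_Sp[of g n] inv_Sp[of "sinv n g" n] inv_inv[of g] by auto
    have "sinv n g * d * sinv n (sinv n g) * sinv n d * d \<in> ?D"
      using comD[OF sv[OF that(1)] d] that(2) subgroup.m_closed[OF D] by auto
    moreover have "sinv n g * d * g * sinv n d * d = sinv n g * d * g * (sinv n d * d)"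
      using that d by (simp add: e mult sv)
    ultimately show ?thesis unfolding gg using that d by (simp add: sl mult sv)
  qed
  have "\<exists>v\<in>vs m. v \<noteq> 0 \<and> (\<forall>h\<in>?D. \<exists>c. act m (\<rho> h) v = c \<star> v)"
  proof (rule Suc.IH)
    show "(derived (Sp n) ^^ k) ?D = {1\<^sub>m (2*n)}" using Suc.prems(1) by (simp add: funpow_swap1)
    show "connectedin (zariski (2*n)) ?D" by (rule derived_connected[OF H con])
    show "\<rho> (g * h) = \<rho> g * \<rho> h" if "g \<in> ?D" "h \<in> ?D" for g h using hom that DH by blast
  qed (rule D)
  then obtain v \<chi> where v: "v \<in> vs m" "v \<noteq> 0" and chi: "\<And>d. d \<in> ?D \<Longrightarrow> act m (\<rho> d) v = \<chi> d \<star> v" by metis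
  obtain i where vi: "v i \<noteq> 0" using v(2) by (auto simp: fun_eq_iff)
  define W where "W = {w \<in> vs m. \<forall>d\<in>?D. act m (\<rho> d) w = \<chi> d \<star> w}"
  have sW: "fv.subspace W" by (auto simp: W_def fv.subspace_def scl_add mult.commute)
  have vW: "v \<in> W" using v chi by (auto simp: W_def)
  have chi_eq: "\<chi> d = act m (\<rho> d) v i / v i" if "d \<in> ?D" for d using chi[OF that] vi by simp
  have inj: "w = 0" if "g \<in> H" "w \<in> vs m" "act m (\<rho> g) w = 0" for g w
  proof -
    have "act m (\<rho> (sinv n g * g)) w = 0" using that act_rho[OF sv[OF that(1)] that(1)] by simp
    thus ?thesis using that one sl by simp
  qed
  have chi0: "\<chi> d \<noteq> 0" if "d \<in> ?D" for d
    using inj[of d v] v chi[OF that] that DH by auto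
  have conj_eq: "act m (\<rho> d) (act m (\<rho> g) w) = act m (\<rho> g) (act m (\<rho> (sinv n g * d * g)) w)" if "g \<in> H" "d \<in> ?D" for g d w
  proof -
    have d: "d \<in> H" using that DH by blast
    have "g * (sinv n g * d * g) = (g * sinv n g) * d * g" using that d by (simp add: e mult sv)
    hence "g * (sinv n g * d * g) = d * g" using that d by (simp add: sl mult)
    thus ?thesis using act_rho[of g "sinv n g * d * g" w] act_rho[of d g w] that d by (simp add: mult sv)
  qed
  \<comment> \<open>The value of \<open>\<chi>\<close> at a conjugate of \<open>d\<close> is an
    eigenvalue of \<open>\<rho> d\<close>, so it takes finitely many values as \<open>g\<close> runs
    through the connected group \<open>H\<close>. Hence it is the value for \<open>g = 1\<close>,
    and the weight space \<open>W\<close> is stable under \<open>H\<close>.\<close>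
  have chi_conj: "\<chi> (sinv n g * d * g) = \<chi> d" if g: "g \<in> H" and d: "d \<in> ?D" for g d
  proof -
    let ?f = "\<lambda>g. act m (\<rho> (sinv n g * d * g)) v i * inverse (v i)"
    have dS: "d \<in> carrier_mat (2*n) (2*n)" using d DH HS by auto
    have p: "pm (2*n) m (\<lambda>g. \<rho> (sinv n g * d * g))"
      by (intro pm_comp[OF rho] pm_mult pm_sinv pm_id pm_const dS)
    have "?f g = ?f (1\<^sub>m (2*n))"
    proof (rule connected_finite_range_const[OF con, where f = ?f])
      show "pf (2*n) ?f" by (rule pf_mult[OF pf_act[OF p] pf_const]) simp
      have "?f ` H \<subseteq> {c. \<exists>u\<in>vs m. u \<noteq> 0 \<and> act m (\<rho> d) u = c \<star> u}"
      proof safe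
        fix g assume g: "g \<in> H"
        have "?f g = \<chi> (sinv n g * d * g)" using chi_eq[OF conjD[OF g d]] by (simp add: divide_inverse)
        thus "\<exists>u\<in>vs m. u \<noteq> 0 \<and> act m (\<rho> d) u = ?f g \<star> u"
          using conj_eq[OF g d, of v] chi[OF conjD[OF g d]] inj[OF g v(1)] v
          by (intro bexI[of _ "act m (\<rho> g) v"]) auto
      qed
      thus "finite (?f ` H)" using finite_eigenvalues[OF rc, of d] d DH finite_subset by blast
    qed (use g oneH in auto)
    moreover have "sinv n (1\<^sub>m (2*n)) * d * 1\<^sub>m (2*n) = d"
      using sl(1)[OF oneH] sl(4)[OF sv[OF oneH]] sl(3,4)[of d] d DH by auto
    ultimately show ?thesis using chi_eq[OF conjD[OF g d]] chi_eq[OF d] by (simp add: divide_inverse)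
  qed
  have invW: "act m (\<rho> g) w \<in> W" if "g \<in> H" "w \<in> W" for g w
    using that conj_eq chi_conj conjD by (auto simp: W_def)
  have W_com: "act m (\<rho> g) (act m (\<rho> h) w) = \<chi> (g * h * sinv n g * sinv n h) \<star> act m (\<rho> h) (act m (\<rho> g) w)"
    if gh: "g \<in> H" "h \<in> H" and w: "w \<in> W" for g h w
  proof -
    let ?c = "g * h * sinv n g * sinv n h"
    have cH: "?c \<in> H" using comD[OF gh] DH by blast
    have "act m (\<rho> g) (act m (\<rho> h) w) = act m (\<rho> (?c * (h * g))) w"
      using act_rho[OF gh] comm[OF gh] by simp
    also have "\<dots> = act m (\<rho> ?c) (act m (\<rho> h) (act m (\<rho> g) w))"
      using act_rho[OF cH mult[OF gh(2,1)]] act_rho[OF gh(2,1)] by simp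
    also have "\<dots> = \<chi> ?c \<star> act m (\<rho> h) (act m (\<rho> g) w)"
      using invW[OF gh(2) invW[OF gh(1) w]] comD[OF gh] by (auto simp: W_def)
    finally show ?thesis .
  qed
  \<comment> \<open>On \<open>W\<close> the commutator acts as a scalar \<open>c\<close>. If
    \<open>e'\<close> is an eigenvalue of \<open>\<rho> h\<close> with eigenvector in
    \<open>W\<close>, then \<open>e' / c\<close> is an eigenvalue too; finiteness and connectedness
    make \<open>c\<close> constant in \<open>g\<close>, and \<open>g = 1\<close> gives the value 1.
    This takes the place of the usual determinant argument.\<close>
  have chi_one: "\<chi> (g * h * sinv n g * sinv n h) = 1" if gh: "g \<in> H" "h \<in> H" for g h
  proof -
    let ?f = "\<lambda>g. act m (\<rho> (g * h * sinv n g * sinv n h)) v i * inverse (v i)"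
    have hS: "h \<in> carrier_mat (2*n) (2*n)" using gh HS by auto
    obtain u e' where u: "u \<in> W" "u \<noteq> 0" "act m (\<rho> h) u = e' \<star> u"
      using exists_eigenvector[of "act m (\<rho> h)" W m v] sW vW v invW[OF gh(2)] by (auto simp: W_def)
    have e0: "e' \<noteq> 0" using inj[OF gh(2), of u] u by (auto simp: W_def)
    have p: "pm (2*n) m (\<lambda>g. \<rho> (g * h * sinv n g * sinv n h))"
      by (intro pm_comp[OF rho] pm_mult pm_sinv pm_id pm_const hS sinv_carrier)
    have "?f g = ?f (1\<^sub>m (2*n))"
    proof (rule connected_finite_range_const[OF con, where f = ?f])
      show "pf (2*n) ?f" by (rule pf_mult[OF pf_act[OF p] pf_const]) simp
      have "?f ` H \<subseteq> (\<lambda>c. e' / c) ` {c. \<exists>u\<in>vs m. u \<noteq> 0 \<and> act m (\<rho> h) u = c \<star> u}"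
      proof
        fix c assume "c \<in> ?f ` H"
        then obtain g where g: "g \<in> H" "c = ?f g" by blast
        have c: "c = \<chi> (g * h * sinv n g * sinv n h)"
          using chi_eq[OF comD[OF g(1) gh(2)]] g(2) by (simp add: divide_inverse)
        have c0: "c \<noteq> 0" using chi0[OF comD[OF g(1) gh(2)]] c by simp
        have "e' \<star> act m (\<rho> g) u = c \<star> act m (\<rho> h) (act m (\<rho> g) u)"
          using W_com[OF g(1) gh(2) u(1)] u(3) c by simp
        hence "inverse c \<star> e' \<star> act m (\<rho> g) u = inverse c \<star> c \<star> act m (\<rho> h) (act m (\<rho> g) u)" by (rule arg_cong)
        hence "act m (\<rho> h) (act m (\<rho> g) u) = (e' / c) \<star> act m (\<rho> g) u"
          using c0 by (simp add: divide_inverse mult.commute)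
        moreover have "act m (\<rho> g) u \<noteq> 0" using inj[OF g(1), of u] u by (auto simp: W_def)
        ultimately have "e' / c \<in> {c. \<exists>u\<in>vs m. u \<noteq> 0 \<and> act m (\<rho> h) u = c \<star> u}"
          by (intro CollectI bexI[of _ "act m (\<rho> g) u"]) auto
        thus "c \<in> (\<lambda>c. e' / c) ` {c. \<exists>u\<in>vs m. u \<noteq> 0 \<and> act m (\<rho> h) u = c \<star> u}"
          using c0 e0 by (intro image_eqI[of _ _ "e' / c"]) auto
      qed
      thus "finite (?f ` H)" using finite_eigenvalues[OF rc[OF gh(2)]] finite_subset by blast
    qed (use gh oneH in auto)
    moreover have "1\<^sub>m (2*n) * h * sinv n (1\<^sub>m (2*n)) * sinv n h = 1\<^sub>m (2*n)"
      using gh sl(1)[OF oneH] sl(4)[OF sv[OF oneH]] sl[OF gh(2)] by simp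
    ultimately show ?thesis using chi_eq[OF comD[OF gh]] v one vi by (simp add: divide_inverse)
  qed
  have "\<exists>u\<in>W. u \<noteq> 0 \<and> (\<forall>L\<in>(\<lambda>h. act m (\<rho> h)) ` H. \<exists>c. L u = c \<star> u)"
  proof (rule commuting_eigenvector[where m = m and w = v])
    show "L (M u) = M (L u)" if "L \<in> (\<lambda>h. act m (\<rho> h)) ` H" "M \<in> (\<lambda>h. act m (\<rho> h)) ` H" "u \<in> W" for L M u
      using that W_com chi_one by auto
  qed (use sW vW v invW in \<open>auto simp: W_def\<close>)
  then obtain u where u: "u \<in> W" "u \<noteq> 0" "\<And>h. h \<in> H \<Longrightarrow> \<exists>c. act m (\<rho> h) u = c \<star> u" by auto
  have "u \<in> vs m" using u(1) by (simp add: W_def)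
  with u(2,3) show ?case by (intro bexI[of _ u] conjI ballI)
qed


section \<open>The standard Borel subgroup is a Borel subgroup\<close>

definition Us :: "nat \<Rightarrow> nat \<Rightarrow> 'k::field mat set" where
  "Us n i = {g \<in> carrier (Sp n). shf n i (g - 1\<^sub>m (2*n))}"

lemma Us_0: "Us n 0 = Bstd n"
proof -
  have "shf n 0 (g - 1\<^sub>m (2*n)) \<longleftrightarrow> shf n 0 g" if "g \<in> carrier_mat (2*n) (2*n)" for g :: "'a mat"
    unfolding shf_def using that
    by (intro all_cong) (auto simp: index_minus_mat)
  thus ?thesis by (auto simp: Us_def Bstd_def)
qed

lemma sinv_one: "sinv n (1\<^sub>m (2*n)) = (1\<^sub>m (2*n) :: 'k::field mat)"
  using inv_Sp[OF one_Sp, of n] monoid.inv_one[OF group.is_monoid[OF Sp_group[of n]]] by simp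

lemma shf_add: "A \<in> carrier_mat (2*n) (2*n) \<Longrightarrow> B \<in> carrier_mat (2*n) (2*n) \<Longrightarrow>
    shf n i A \<Longrightarrow> shf n i B \<Longrightarrow> shf n i (A + B)"
  unfolding shf_def by (auto simp: index_add_mat) (metis add.right_neutral)

lemma shf_mono: "shf n i A \<Longrightarrow> j \<le> i \<Longrightarrow> shf n j A"
  unfolding shf_def by (meson add_left_mono order_trans)

lemma Us_subgroup: "subgroup (Us n i) (Sp n :: 'k::field mat monoid)"
proof (rule subgroup.intro)
  let ?I = "1\<^sub>m (2*n) :: 'k mat"
  show "Us n i \<subseteq> carrier (Sp n)" by (auto simp: Us_def)
  show "\<one>\<^bsub>Sp n\<^esub> \<in> Us n i" by (auto simp: Us_def shf_def)
  show "g \<otimes>\<^bsub>Sp n\<^esub> h \<in> Us n i" if "g \<in> Us n i" "h \<in> Us n i" for g h :: "'k mat"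
  proof -
    have S: "g \<in> carrier (Sp n)" "h \<in> carrier (Sp n)" and s: "shf n i (g - ?I)" "shf n i (h - ?I)"
      using that by (auto simp: Us_def)
    have c: "g - ?I \<in> carrier_mat (2*n) (2*n)" "h - ?I \<in> carrier_mat (2*n) (2*n)" using S by auto
    have "g * h - ?I = (g - ?I) * (h - ?I) + ((g - ?I) + (h - ?I))"
    proof (rule mat_eq_act[of _ "2*n"])
      fix j
      show "act (2*n) (g * h - ?I) (bv j) = act (2*n) ((g - ?I) * (h - ?I) + ((g - ?I) + (h - ?I))) (bv j)" if "j < 2*n"
        using S c that by (simp add: act_mult act_add_mat act_diff_mat)
    qed (use S c in auto)
    moreover have "shf n i ((g - ?I) * (h - ?I))" by (rule shf_mono[OF shf_mult[OF c s]]) simp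
    ultimately have "shf n i (g * h - ?I)" using c s by (auto intro!: shf_add)
    thus ?thesis using S by (simp add: Us_def)
  qed
  show "inv\<^bsub>Sp n\<^esub> g \<in> Us n i" if "g \<in> Us n i" for g :: "'k mat"
  proof -
    have S: "g \<in> carrier (Sp n)" and s: "shf n i (g - ?I)" using that by (auto simp: Us_def)
    have "sinv n (g - ?I) = sinv n g - sinv n ?I"
      using carrier_matD[OF Sp_carrier_mat[OF S]] by (intro eq_matI) (auto simp: sinv_def right_diff_distrib)
    hence "sinv n g - ?I = sinv n (g - ?I)" by (simp add: sinv_one)
    thus ?thesis using S shf_sinv[OF s] by (simp add: Us_def)
  qed
qed

text \<open>For positive \<open>i\<close> the two shifts add up to at least \<open>i + 1\<close>.
  For \<open>i = 0\<close> both products have the same diagonal, which cancels.\<close>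

lemma shf_commutator:
  fixes a b :: "'k::field mat"
  assumes c: "a \<in> carrier_mat (2*n) (2*n)" "b \<in> carrier_mat (2*n) (2*n)" and s: "shf n i a" "shf n i b"
  shows "shf n (Suc i) (a * b - b * a)"
  unfolding shf_def
proof (intro allI impI)
  fix k j assume kj: "k < 2*n" "j < 2*n" and nz: "(a * b - b * a) $$ (k, j) \<noteq> 0"
  hence "(a * b) $$ (k, j) \<noteq> 0 \<or> (b * a) $$ (k, j) \<noteq> 0" using c by auto
  hence p: "pos n k + (i + i) \<le> pos n j"
    using shf_mult[OF c s] shf_mult[OF c(2,1) s(2,1)] kj unfolding shf_def by blast
  show "pos n k + Suc i \<le> pos n j"
  proof (cases "i = 0 \<and> pos n k = pos n j")
    case True
    hence k: "k = j" using pos_inj kj by blast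
    have diag: "(A * B) $$ (k, k) = A $$ (k, k) * B $$ (k, k)"
      if "A \<in> carrier_mat (2*n) (2*n)" "B \<in> carrier_mat (2*n) (2*n)" "shf n 0 A" "shf n 0 B" for A B :: "'k mat"
    proof -
      have "A $$ (k, r) * B $$ (r, k) = 0" if r: "r < 2*n" "r \<noteq> k" for r
      proof (rule ccontr)
        assume "A $$ (k, r) * B $$ (r, k) \<noteq> 0"
        hence "pos n k \<le> pos n r" "pos n r \<le> pos n k"
          using \<open>shf n 0 A\<close> \<open>shf n 0 B\<close> kj r by (auto simp: shf_def)
        thus False using pos_inj[of r n k] r kj by simp
      qed
      hence "(\<Sum>r<2*n. A $$ (k, r) * B $$ (r, k)) = A $$ (k, k) * B $$ (k, k)"
        using kj by (subst sum.remove[of _ k]) (simp_all add: sum.neutral)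
      thus ?thesis using that kj by (auto simp: scalar_prod_def atLeast0LessThan)
    qed
    have "(a * b - b * a) $$ (k, j) = 0"
      using c s True kj k diag[of a b] diag[of b a] by (auto simp: mult.commute)
    thus ?thesis using nz by simp
  qed (use p in linarith)
qed

text \<open>The group commutator minus 1 equals the additive commutator of \<open>g - 1\<close> and
  \<open>h - 1\<close> times \<open>sinv n g * sinv n h\<close>.\<close>

lemma derived_Us: "derived (Sp n) (Us n i) \<subseteq> (Us n (Suc i) :: 'k::field mat set)"
  unfolding derived_def
proof (rule group.generate_subgroup_incl[OF Sp_group _ Us_subgroup], safe)
  let ?I = "1\<^sub>m (2*n) :: 'k mat"
  fix g h :: "'k mat" assume gh: "g \<in> Us n i" "h \<in> Us n i"
  have S: "g \<in> carrier (Sp n)" "h \<in> carrier (Sp n)" and s: "shf n i (g - ?I)" "shf n i (h - ?I)"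
    using gh by (auto simp: Us_def)
  have B: "g \<in> Bstd n" "h \<in> Bstd n" using S s shf_mono[of n i _ 0] unfolding Us_0[symmetric] by (auto simp: Us_def)
  have c: "g - ?I \<in> carrier_mat (2*n) (2*n)" "h - ?I \<in> carrier_mat (2*n) (2*n)" using S by auto
  let ?C = "(g - ?I) * (h - ?I) - (h - ?I) * (g - ?I)" and ?q = "sinv n g * sinv n h"
  have q: "?q \<in> carrier_mat (2*n) (2*n)" "shf n 0 ?q" using B by (auto simp: Bstd_def intro!: shf_mult[of _ _ _ 0 0, simplified] shf_sinv)
  have C: "?C \<in> carrier_mat (2*n) (2*n)" by (rule minus_carrier_mat[OF mult_carrier_mat_sq[OF c(2,1)]])
  have "g * h * sinv n g * sinv n h - ?I = ?C * ?q"
  proof (rule mat_eq_act[of _ "2*n"])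
    fix j assume "j < 2*n"
    thus "act (2*n) (g * h * sinv n g * sinv n h - ?I) (bv j) = act (2*n) (?C * ?q) (bv j)"
      using S c q C by (simp add: act_mult act_diff_mat)
  qed (use S c q C in auto)
  moreover have "shf n (Suc i + 0) (?C * ?q)"
    using c q by (intro shf_mult shf_commutator s) auto
  ultimately have "g * h * sinv n g * sinv n h \<in> Us n (Suc i)" using S by (simp add: Us_def)
  thus "g \<otimes>\<^bsub>Sp n\<^esub> h \<otimes>\<^bsub>Sp n\<^esub> inv\<^bsub>Sp n\<^esub> g \<otimes>\<^bsub>Sp n\<^esub> inv\<^bsub>Sp n\<^esub> h \<in> Us n (Suc i)"
    using S by simp
qed

text \<open>Positions are below \<open>2 * n\<close>, so a shift by \<open>2 * n\<close> leaves only
  zero entries.\<close>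

lemma derived_Bstd: "(derived (Sp n) ^^ (2*n)) (Bstd n) = {1\<^sub>m (2*n) :: 'k::field mat}"
proof -
  interpret group "Sp n :: 'k mat monoid" by (rule Sp_group)
  have "(derived (Sp n) ^^ i) (Bstd n) \<subseteq> (Us n i :: 'k mat set)" for i
  proof (induction i)
    case (Suc i)
    thus ?case using mono_derived[OF Suc] derived_Us[of n i] by auto
  qed (simp add: Us_0)
  moreover have "Us n (2*n) \<subseteq> {1\<^sub>m (2*n) :: 'k mat}"
  proof safe
    fix g :: "'k mat" assume g: "g \<in> Us n (2*n)"
    hence gc: "g \<in> carrier_mat (2*n) (2*n)" by (auto simp: Us_def)
    have "(g - 1\<^sub>m (2*n)) $$ (i, j) = 0" if "i < 2*n" "j < 2*n" for i j
      using g that pos_lt[of j n] by (fastforce simp: Us_def shf_def)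
    thus "g = 1\<^sub>m (2*n)" using gc by (intro eq_matI) (auto simp: index_minus_mat)
  qed
  moreover have "1\<^sub>m (2*n) \<in> (derived (Sp n) ^^ (2*n)) (Bstd n :: 'k mat set)"
    using subgroup.one_closed[OF exp_of_derived_is_subgroup[OF Bstd_subgroup]] by simp
  ultimately show ?thesis by blast
qed

lemma subgroup_id_hom:
  assumes "subgroup H (Sp n)" shows "group_hom (Sp n\<lparr>carrier := H\<rparr>) (Sp n) (\<lambda>x. x)"
  using group.subgroup_imp_group[OF Sp_group assms] subgroup.subset[OF assms]
  by (auto simp: group_hom_def group_hom_axioms_def hom_def Sp_group)

lemma Bstd_solvable: "solvable (Sp n\<lparr>carrier := Bstd n\<rparr>)"
proof -
  interpret h: group_hom "Sp n\<lparr>carrier := Bstd n\<rparr>" "Sp n" "\<lambda>x. x" by (rule subgroup_id_hom[OF Bstd_subgroup])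
  have "solvable_seq (Sp n) (Bstd n)"
    by (rule group.trivial_derived_seq_imp_solvable[OF Sp_group Bstd_subgroup, where n = "2*n"]) (simp add: derived_Bstd)
  thus ?thesis
    unfolding solvable_def using h.solvable_img_imp_solvable[of "Bstd n"] h.G.subgroup_self by simp
qed

lemma solvable_derived:
  assumes H: "subgroup H (Sp n)" and s: "solvable (Sp n\<lparr>carrier := H\<rparr>)"
  shows "\<exists>k. (derived (Sp n) ^^ k) H = {1\<^sub>m (2*n)}"
proof -
  interpret h: group_hom "Sp n\<lparr>carrier := H\<rparr>" "Sp n" "\<lambda>x. x" by (rule subgroup_id_hom[OF H])
  have "solvable_seq (Sp n) H" using h.solvable_imp_solvable_img[of H] s by (simp add: solvable_def)
  thus ?thesis using h.H.solvable_imp_trivial_derived_seq by simp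
qed

lemma Lie_Kolchin_ccs:
  fixes \<rho> :: "'k::alg_closed_field mat \<Rightarrow> 'k mat"
  assumes H: "closed_connected_solvable n H" and "pm (2*n) m \<rho>" "m > 0" "\<rho> (1\<^sub>m (2*n)) = 1\<^sub>m m"
    and "\<And>g h. g \<in> H \<Longrightarrow> h \<in> H \<Longrightarrow> \<rho> (g * h) = \<rho> g * \<rho> h"
  shows "\<exists>v\<in>vs m. v \<noteq> 0 \<and> (\<forall>h\<in>H. \<exists>c. act m (\<rho> h) v = c \<star> v)"
proof -
  obtain k where "(derived (Sp n) ^^ k) H = {1\<^sub>m (2*n)}"
    using solvable_derived H unfolding closed_connected_solvable_def by blast
  thus ?thesis using Lie_Kolchin[OF assms(2-4)] H assms(5) unfolding closed_connected_solvable_def by blast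
qed

section \<open>Maximality of the standard Borel subgroup\<close>

lemma bv_apply: "bv i j = (if j = i then 1 else 0)" by (simp add: bv_def)

text \<open>Each coordinate of \<open>U\<close> beyond \<open>i\<close> is excluded by one element
  \<open>eic\<close> that, on coordinates from \<open>i\<close> on, changes only the coordinate
  \<open>i\<close> of \<open>U\<close>.\<close>

lemma Bstd_fixed_line:
  fixes U :: "nat \<Rightarrow> 'k::alg_closed_field"
  assumes two: "(2::'k) \<noteq> 0" and i: "i < n" and U: "U \<in> vs (2*n)"
    and eig: "\<And>b. b \<in> Bstd n \<Longrightarrow> \<exists>c. \<forall>k\<ge>i. act (2*n) b U k = c * U k"
    and k: "i < k"
  shows "U k = 0"
proof -
  \<comment> \<open>A nonzero coordinate \<open>k\<close> that the element leaves alone forces the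
    eigenvalue 1, and then the coordinate \<open>i\<close> cannot change either.\<close>
  have key: "om n (bv j) U * z i + om n z U * bv j i = 0 \<or> U k = 0"
    if j: "j < n" and z: "z \<in> vs (2*n)" "\<And>l. l \<le> j \<Longrightarrow> om n (bv l) z = 0" and "i < k"
      and zk: "\<And>k. i < k \<Longrightarrow> om n (bv j) U * z k + om n z U * bv j k = 0" for j k z
  proof (rule ccontr)
    assume *: "\<not> (om n (bv j) U * z i + om n z U * bv j i = 0 \<or> U k = 0)"
    have "eic n (bv j) z \<in> Bstd n" using eic_Bcon[OF j z] by blast
    then obtain c where c: "\<And>k. i \<le> k \<Longrightarrow> act (2*n) (eic n (bv j) z) U k = c * U k" using eig by blast
    have "U k + (om n (bv j) U * z k + om n z U * bv j k) = c * U k" if "i \<le> k" for k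
      using c[OF that] j z U by (simp add: act_eic add.assoc)
    from this[of k] this[of i] zk[OF \<open>i < k\<close>] * \<open>i < k\<close> have "c = 1" "U i + (om n (bv j) U * z i + om n z U * bv j i) = c * U i" by auto
    thus False using * by simp
  qed
  have b: "om n (bv l) (bv j) = (0::'k)" if "l < n" "j < n" for l j
    using that by (auto simp: om_bv swp_def)
  have e: "om n (bv j) U = U (n + j)" "om n (bv (n + j)) U = - U j" if "j < n" for j
    using that by (auto simp: om_bv_left swp_def eps_def add.commute)
  \<comment> \<open>With \<open>z = bv i\<close> the element is a transvection that adds
    \<open>2 * U (n + i)\<close> to the coordinate \<open>i\<close>.\<close>
  have ni: "U (n + i) = 0"
    using key[of i "bv i" "n + i"] i two b e by (auto simp: bv_apply)
  consider "k < n" | j where "j < n" "k = n + j" | "k \<ge> 2*n"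
    by (metis add_diff_inverse_nat linorder_not_less mult_2 nat_add_left_cancel_less)
  thus ?thesis
  proof cases
    case 1
    thus ?thesis using key[of i "bv (n + k)" k] i ni k e
      by (auto simp: om_bv swp_def bv_apply split: if_splits)
  next
    case 2
    show ?thesis
    proof (cases "j < i")
      case True
      thus ?thesis using key[of j "bv i" k] i k 2 b e ni by (auto simp: bv_apply)
    next
      case False
      show ?thesis
      proof (cases "j = i")
        case True thus ?thesis using ni 2 by simp
      next
        case F: False
        thus ?thesis using key[of i "bv j" k] i k 2 b e ni by (auto simp: bv_apply)
      qed
    qed
  qed (use U in \<open>auto simp: vs_def\<close>)
qed

text \<open>By the Lie-Kolchin theorem \<open>H\<close> fixes a line in the quotient by the part of
  the flag already known to be stable. The subgroup \<open>Bstd n\<close> fixes that line too, so it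
  must be the next line of the flag.\<close>

lemma Bstd_maximal:
  fixes H :: "'k::alg_closed_field mat set"
  assumes two: "(2::'k) \<noteq> 0" and H: "closed_connected_solvable n H" and BH: "Bstd n \<subseteq> H"
  shows "H = Bstd n"
proof -
  have sub: "subgroup H (Sp n)" using H by (simp add: closed_connected_solvable_def)
  have HS: "h \<in> carrier (Sp n)" if "h \<in> H" for h using subgroup.subset[OF sub] that by blast
  have flag: "i \<le> n \<Longrightarrow> h \<in> H \<Longrightarrow> j < i \<Longrightarrow> k < 2*n \<Longrightarrow> j < k \<Longrightarrow> h $$ (k, j) = 0" for i h j k
  proof (induction i arbitrary: h j k)
    case (Suc i)
    let ?m = "2*n - i"
    \<comment> \<open>The action on the quotient by the first \<open>i\<close> basis vectors; it is
      multiplicative on \<open>H\<close> by the induction hypothesis.\<close>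
    define \<rho> :: "'k mat \<Rightarrow> 'k mat" where "\<rho> h = mat ?m ?m (\<lambda>(k, l). h $$ (k + i, l + i))" for h
    have IH: "h $$ (k, j) = 0" if "h \<in> H" "j < i" "k < 2*n" "j < k" for h k j using Suc that by auto
    have ex: "\<exists>v\<in>vs ?m. v \<noteq> 0 \<and> (\<forall>h\<in>H. \<exists>c. act ?m (\<rho> h) v = c \<star> v)"
    proof (rule Lie_Kolchin_ccs[OF H])
      show "pm (2*n) ?m \<rho>" by (auto simp: pm_def \<rho>_def)
      show "?m > 0" using Suc.prems by simp
      show "\<rho> (1\<^sub>m (2*n)) = 1\<^sub>m ?m" by (rule eq_matI) (auto simp: \<rho>_def)
      show "\<rho> (g * h) = \<rho> g * \<rho> h" if gh: "g \<in> H" "h \<in> H" for g h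
      proof (rule eq_matI)
        fix k l assume "k < dim_row (\<rho> g * \<rho> h)" "l < dim_col (\<rho> g * \<rho> h)"
        hence kl: "k < ?m" "l < ?m" by (auto simp: \<rho>_def)
        have c: "g \<in> carrier_mat (2*n) (2*n)" "h \<in> carrier_mat (2*n) (2*n)" using gh HS by auto
        have "\<rho> (g * h) $$ (k, l) = (\<Sum>r<2*n. g $$ (k + i, r) * h $$ (r, l + i))"
          using kl c by (auto simp: \<rho>_def scalar_prod_def atLeast0LessThan)
        also have "\<dots> = (\<Sum>r\<in>{i..<2*n}. g $$ (k + i, r) * h $$ (r, l + i))"
          using IH[OF gh(1)] kl by (intro sum.mono_neutral_right) auto
        also have "\<dots> = (\<Sum>r<?m. g $$ (k + i, r + i) * h $$ (r + i, l + i))"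
          by (rule sum.reindex_bij_witness[of _ "\<lambda>r. r + i" "\<lambda>r. r - i"]) auto
        finally show "\<rho> (g * h) $$ (k, l) = (\<rho> g * \<rho> h) $$ (k, l)"
          using kl by (simp add: \<rho>_def scalar_prod_def atLeast0LessThan)
      qed (auto simp: \<rho>_def)
    qed
    then obtain u where u: "u \<in> vs ?m" "u \<noteq> 0" and eu: "\<And>h. h \<in> H \<Longrightarrow> \<exists>c. act ?m (\<rho> h) u = c \<star> u" by blast
    define U where "U = (\<lambda>r. if r < i then 0 else u (r - i))"
    have Uvs: "U \<in> vs (2*n)" using u by (auto simp: U_def vs_def)
    have eig: "\<exists>c. \<forall>k\<ge>i. act (2*n) h U k = c * U k" if h: "h \<in> H" for h
    proof -
      obtain c where c: "act ?m (\<rho> h) u = c \<star> u" using eu[OF h] by blast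
      have "act (2*n) h U k = c * U k" if k: "i \<le> k" for k
      proof (cases "k < 2*n")
        case True
        have "act (2*n) h U k = (\<Sum>r\<in>{i..<2*n}. h $$ (k, r) * U r)"
          using True unfolding act_def by (simp, intro sum.mono_neutral_right) (auto simp: U_def)
        also have "\<dots> = (\<Sum>r<?m. h $$ (k, r + i) * u r)"
          by (rule sum.reindex_bij_witness[of _ "\<lambda>r. r + i" "\<lambda>r. r - i"]) (auto simp: U_def)
        also have "\<dots> = act ?m (\<rho> h) u (k - i)" using True k by (auto simp: act_def \<rho>_def intro!: sum.cong)
        finally show ?thesis using k unfolding c by (simp add: U_def)
      qed (use Uvs in \<open>auto simp: act_def vs_def\<close>)
      thus ?thesis by blast
    qed
    have U0: "U k = 0" if "i < k" for k
      by (rule Bstd_fixed_line[OF two _ Uvs _ that]) (use Suc.prems eig BH in auto)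
    have Ui: "U i \<noteq> 0"
    proof
      assume "U i = 0"
      hence "u r = 0" for r using U0[of "r + i"] by (cases "r = 0") (auto simp: U_def)
      thus False using u by (auto simp: fun_eq_iff)
    qed
    show ?case
    proof (cases "j = i")
      case True
      have Ueq: "U = U i \<star> bv i"
      proof
        fix r show "U r = (U i \<star> bv i) r"
          using U0[of r] by (cases r i rule: linorder_cases) (auto simp: bv_def U_def)
      qed
      obtain c where "act (2*n) h U k = c * U k" using eig[OF Suc.prems(2)] Suc.prems True by (meson less_imp_le)
      hence "U i * h $$ (k, i) = 0"
        using U0[of k] Suc.prems True by (subst (asm) Ueq) (simp add: act_bv)
      thus ?thesis using Ui True by simp
    qed (use Suc IH in auto)
  qed simp
  have "shf n 0 h" if h: "h \<in> H" for h
    unfolding shf_def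
  proof (intro allI impI)
    fix a b assume ab: "a < 2*n" "b < 2*n" "h $$ (a, b) \<noteq> 0"
    have hi: "sinv n h \<in> H" using subgroup.m_inv_closed[OF sub h] HS[OF h] by simp
    show "pos n a + 0 \<le> pos n b"
    proof (cases "b < n")
      case True
      hence "a \<le> b" using flag[OF le_refl h, of b a] ab by force
      thus ?thesis using True by (simp add: pos_def)
    next
      case False
      show ?thesis
      proof (cases "a < n")
        case True thus ?thesis using False ab by (simp add: pos_def)
      next
        case F: False
        \<comment> \<open>Columns from \<open>n\<close> on require no further eigenvectors: by
          passing to the adjoint, an entry there with row index from \<open>n\<close> on becomes, up
          to sign, an entry in a column below \<open>n\<close>.\<close>
        have "sinv n h $$ (swp n b, swp n a) \<noteq> 0" using ab by (simp add: sinv_def)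
        hence "swp n b \<le> swp n a" using flag[OF le_refl hi, of "swp n a" "swp n b"] ab F by (force simp: swp_def)
        thus ?thesis using F False by (simp add: pos_def swp_def)
      qed
    qed
  qed
  thus ?thesis using BH HS by (auto simp: Bstd_def)
qed

lemma Bstd_borel:
  assumes "(2::'k::alg_closed_field) \<noteq> 0"
  shows "borel_subgroup n (Bstd n :: 'k mat set)"
  unfolding borel_subgroup_def closed_connected_solvable_def[of n "Bstd n"]
  using Bstd_maximal[OF assms] Bstd_subgroup Bstd_closed Bstd_connected[OF assms] Bstd_solvable by blast


section \<open>Spherical classes and functions on the class\<close>

lemma closure_of_zariski_iff:
  fixes S C :: "'k::field mat set"
  assumes SC: "S \<subseteq> C" and C: "C \<subseteq> carrier_mat N N"
  shows "subtopology (zariski N) C closure_of S = C \<longleftrightarrow>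
    (\<forall>f. pf N f \<longrightarrow> (\<forall>s\<in>S. f s = 0) \<longrightarrow> (\<forall>z\<in>C. f z = 0))"
proof
  assume cl: "subtopology (zariski N) C closure_of S = C"
  show "\<forall>f. pf N f \<longrightarrow> (\<forall>s\<in>S. f s = 0) \<longrightarrow> (\<forall>z\<in>C. f z = 0)"
  proof (intro allI impI ballI, rule ccontr)
    fix f z assume f: "pf N f" "\<forall>s\<in>S. f s = 0" "z \<in> C" "f z \<noteq> 0"
    have "openin (subtopology (zariski N) C) (C \<inter> {A \<in> carrier_mat N N. f A \<noteq> 0})"
      using openin_pf[OF f(1)] by (rule openin_subtopology_Int2)
    moreover have "z \<in> subtopology (zariski N) C closure_of S" using f cl by simp
    moreover have "z \<in> C \<inter> {A \<in> carrier_mat N N. f A \<noteq> 0}" using f C by auto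
    ultimately obtain y where "y \<in> S" "y \<in> C \<inter> {A \<in> carrier_mat N N. f A \<noteq> 0}"
      unfolding in_closure_of by metis
    thus False using f(2) by auto
  qed
next
  assume *: "\<forall>f. pf N f \<longrightarrow> (\<forall>s\<in>S. f s = 0) \<longrightarrow> (\<forall>z\<in>C. f z = 0)"
  have "z \<in> subtopology (zariski N) C closure_of S" if z: "z \<in> C" for z
    unfolding in_closure_of
  proof (intro conjI allI impI)
    show "z \<in> topspace (subtopology (zariski N) C)" using z C by auto
    fix T assume T: "z \<in> T \<and> openin (subtopology (zariski N) C) T"
    then obtain U where U: "openin (zariski N) U" "T = U \<inter> C" by (auto simp: openin_subtopology)
    then obtain f where f: "pf N f" "f z \<noteq> 0" "\<And>B. B \<in> carrier_mat N N \<Longrightarrow> f B \<noteq> 0 \<Longrightarrow> B \<in> U"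
      using openin_zariski_base[of N U z] T by blast
    then obtain s where "s \<in> S" "f s \<noteq> 0" using * z by blast
    thus "\<exists>y. y \<in> S \<and> y \<in> T" using f(3) U(2) SC C by blast
  qed
  moreover have "subtopology (zariski N) C closure_of S \<subseteq> C"
    using closure_of_subset_topspace[of "subtopology (zariski N) C" S] by auto
  ultimately show "subtopology (zariski N) C closure_of S = C" by blast
qed

section \<open>Conjugation in the symplectic group\<close>

lemma conj_action_Sp [simp]: "g \<in> carrier (Sp n) \<Longrightarrow> conj_action (Sp n) g y = g * y * sinv n g"
  by (simp add: conj_action_def)

lemma conj_class_Sp: "conj_class (Sp n) x = {g * x * sinv n g | g. g \<in> carrier (Sp n)}"
  unfolding conj_class_def orbit_def by (rule Collect_cong) (metis conj_action_Sp)

lemma conj_class_sub: "x \<in> carrier (Sp n) \<Longrightarrow> conj_class (Sp n) x \<subseteq> carrier (Sp n)"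
  by (auto simp: conj_class_Sp)

lemma orbit_Sp: "B \<subseteq> carrier (Sp n) \<Longrightarrow>
    orbit (Sp n\<lparr>carrier := B\<rparr>) (conj_action (Sp n)) y = {b * y * sinv n b | b. b \<in> B}"
proof -
  assume "B \<subseteq> carrier (Sp n)"
  hence "conj_action (Sp n) b y = b * y * sinv n b" if "b \<in> B" for b using that by (intro conj_action_Sp) blast
  hence "(\<lambda>b. conj_action (Sp n) b y) ` B = (\<lambda>b. b * y * sinv n b) ` B" by (rule image_cong[OF refl])
  thus ?thesis unfolding orbit_def by (simp add: image_def Bex_def conj_commute)
qed

lemma sinv_sinv: "g \<in> carrier (Sp n) \<Longrightarrow> sinv n (sinv n g) = g"
  by (intro mat_eq_act[of _ "2*n"] om_eqI[of _ n]) (auto simp: om_sinv om_sinv_right)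

lemma sinv_mult: "g \<in> carrier (Sp n) \<Longrightarrow> h \<in> carrier (Sp n) \<Longrightarrow> sinv n (g * h) = sinv n h * sinv n g"
  by (intro mat_eq_act[of _ "2*n"] om_eqI[of _ n]) (auto simp: om_sinv act_mult)

lemma conj_conj:
  assumes "g \<in> carrier (Sp n)" "h \<in> carrier (Sp n)" "x \<in> carrier_mat (2*n) (2*n)"
  shows "g * (h * x * sinv n h) * sinv n g = (g * h) * x * sinv n (g * h)"
  using assms by (intro mat_eq_act[of _ "2*n"]) (auto simp: act_mult sinv_mult)

lemma conj_back:
  assumes "g \<in> carrier (Sp n)" "x \<in> carrier_mat (2*n) (2*n)"
  shows "g * (sinv n g * x * g) * sinv n g = x" "sinv n g * (g * x * sinv n g) * g = x"
  using assms by (auto intro!: mat_eq_act[of _ "2*n"] simp: act_mult)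

lemma conj_class_eq:
  assumes "x \<in> carrier (Sp n)" "y \<in> conj_class (Sp n) x"
  shows "conj_class (Sp n) y = conj_class (Sp n) x"
proof -
  obtain h where h: "h \<in> carrier (Sp n)" "y = h * x * sinv n h" using assms(2) by (auto simp: conj_class_Sp)
  have 1: "g * y * sinv n g = (g * h) * x * sinv n (g * h)" if "g \<in> carrier (Sp n)" for g
    using conj_conj[OF that h(1)] assms(1) h(2) by auto
  have 2: "g * x * sinv n g = (g * sinv n h) * y * sinv n (g * sinv n h)" if g: "g \<in> carrier (Sp n)" for g
  proof -
    have "g * sinv n h * h = g"
      using g h by (intro mat_eq_act[of _ "2*n"]) (auto simp: act_mult)
    thus ?thesis using 1[of "g * sinv n h"] g h(1) by simp
  qed
  show ?thesis
  proof (intro equalityI subsetI)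
    fix z assume "z \<in> conj_class (Sp n) y"
    then obtain g where g: "g \<in> carrier (Sp n)" "z = g * y * sinv n g" by (auto simp: conj_class_Sp)
    show "z \<in> conj_class (Sp n) x"
      unfolding conj_class_Sp g(2) 1[OF g(1)] by (intro CollectI exI[of _ "g * h"] conjI refl mult_Sp g(1) h(1))
  next
    fix z assume "z \<in> conj_class (Sp n) x"
    then obtain g where g: "g \<in> carrier (Sp n)" "z = g * x * sinv n g" by (auto simp: conj_class_Sp)
    show "z \<in> conj_class (Sp n) y"
      unfolding conj_class_Sp g(2) 2[OF g(1)]
      by (intro CollectI exI[of _ "g * sinv n h"] conjI refl mult_Sp sinv_Sp g(1) h(1))
  qed
qed

text \<open>Up to sign, the entries of a conjugate are pairings of frame vectors with images of
  frame vectors. This is what allows normal forms to be found by working with the form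
  alone.\<close>

lemma conj_entry:
  assumes g: "g \<in> carrier (Sp n)" and x: "x \<in> carrier_mat (2*n) (2*n)" and kj: "k < 2*n" "j < 2*n"
  shows "(sinv n g * x * g) $$ (k, j) = - eps n k * om n (fcol n g (swp n k)) (act (2*n) x (fcol n g j))"
proof -
  let ?v = "fcol n (sinv n g * x * g) j"
  have "om n (bv (swp n k)) ?v = om n (fcol n g (swp n k)) (act (2*n) x (fcol n g j))"
    using g x by (simp add: act_mult om_sinv_right)
  moreover have "om n (bv (swp n k)) ?v = - eps n k * ?v k" using kj by (simp add: om_bv_left)
  ultimately have "om n (fcol n g (swp n k)) (act (2*n) x (fcol n g j)) = - eps n k * ?v k" by simp
  thus ?thesis using kj by (simp add: act_bv)
qed

lemma finite_mats_with_entries: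
  assumes "finite \<Phi>" shows "finite {A \<in> carrier_mat N N. \<forall>i<N. \<forall>j<N. A $$ (i, j) \<in> \<Phi>}"
proof (rule finite_subset)
  let ?F = "({..<N} \<times> {..<N}) \<rightarrow>\<^sub>E \<Phi>"
  show "{A \<in> carrier_mat N N. \<forall>i<N. \<forall>j<N. A $$ (i, j) \<in> \<Phi>} \<subseteq> mat N N ` ?F"
  proof
    fix A assume A: "A \<in> {A \<in> carrier_mat N N. \<forall>i<N. \<forall>j<N. A $$ (i, j) \<in> \<Phi>}"
    let ?f = "\<lambda>p\<in>{..<N} \<times> {..<N}. A $$ p"
    have "A = mat N N ?f" using A by (intro eq_matI) auto
    moreover have "?f \<in> ?F" using A by auto
    ultimately show "A \<in> mat N N ` ?F" by blast
  qed
  show "finite (mat N N ` ?F)" using assms by (intro finite_imageI finite_PiE) auto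
qed

lemma Sp_irreducible_prod:
  fixes F :: "'i \<Rightarrow> 'k::alg_closed_field mat \<Rightarrow> 'k"
  assumes "finite I" "\<And>i. i \<in> I \<Longrightarrow> pf (2*n) (F i)" "\<And>i. i \<in> I \<Longrightarrow> \<exists>g\<in>carrier (Sp n). F i g \<noteq> 0"
  shows "\<exists>g\<in>carrier (Sp n). \<forall>i\<in>I. F i g \<noteq> 0"
  using assms
proof (induction I rule: finite_induct)
  case empty thus ?case using one_Sp by blast
next
  case (insert i I)
  have "\<exists>g\<in>carrier (Sp n). \<forall>j\<in>I. F j g \<noteq> 0" by (rule insert.IH) (use insert.prems in auto)
  then obtain g where "g \<in> carrier (Sp n)" "(\<Prod>i\<in>I. F i g) \<noteq> 0" using insert.hyps by (auto simp: prod_zero_iff)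
  moreover obtain h where "h \<in> carrier (Sp n)" "F i h \<noteq> 0" using insert.prems(2)[of i] by auto
  ultimately show ?case using Sp_irreducible[of n "F i" "\<lambda>g. \<Prod>i\<in>I. F i g" h g] insert by (auto simp: prod_zero_iff)
qed

text \<open>The frames \<open>g\<close> in whose flag the element \<open>x\<close> can be brought, by the standard Borel subgroup, to
  a matrix with entries in the finite set \<open>\<Phi>\<close>.\<close>

definition good :: "nat \<Rightarrow> 'k::field mat \<Rightarrow> 'k set \<Rightarrow> 'k mat set" where
  "good n x \<Phi> = {g \<in> carrier (Sp n). \<exists>b\<in>Bstd n. \<forall>k<2*n. \<forall>j<2*n.
     om n (fcol n (g * b) k) (act (2*n) x (fcol n (g * b) j)) \<in> \<Phi>}"

text \<open>Only finitely many Borel orbits meet the matrices with entries in \<open>\<Phi>\<close>, so by irreducibility one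
  of them is dense as soon as their union is.\<close>

lemma spherical_criterion:
  fixes x :: "'k::alg_closed_field mat"
  assumes two: "(2::'k) \<noteq> 0" and x: "x \<in> carrier (Sp n)" and fin: "finite \<Phi>"
    and dense: "\<And>g. g \<in> carrier (Sp n) \<Longrightarrow> zc n (good n x \<Phi>) g"
  shows "spherical_class n (conj_class (Sp n) x)"
proof -
  \<comment> \<open>The negatives are included because \<open>conj_entry\<close> expresses the
    entries by the pairings only up to a sign.\<close>
  let ?C = "conj_class (Sp n) x" and ?Psi = "\<Phi> \<union> uminus ` \<Phi>"
  let ?O = "\<lambda>y. {b * y * sinv n b | b. b \<in> Bstd n}"
  define Y where "Y = {y \<in> ?C. \<forall>i<2*n. \<forall>j<2*n. y $$ (i, j) \<in> ?Psi}"
  have CS: "?C \<subseteq> carrier (Sp n)" by (rule conj_class_sub[OF x])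
  have Cc: "?C \<subseteq> carrier_mat (2*n) (2*n)" using CS by auto
  have xc: "x \<in> carrier_mat (2*n) (2*n)" using x by auto
  have BS: "Bstd n \<subseteq> carrier (Sp n :: 'k mat monoid)" by (auto simp: Bstd_def)
  have OC: "?O y \<subseteq> ?C" if "y \<in> ?C" for y
    using BS unfolding conj_class_eq[OF x that, symmetric] by (auto simp: conj_class_Sp)
  have finY: "finite Y"
    by (rule finite_subset[OF _ finite_mats_with_entries[of ?Psi "2*n"]]) (use fin Cc in \<open>auto simp: Y_def\<close>)
  have "\<exists>y\<in>Y. \<forall>f. pf (2*n) f \<longrightarrow> (\<forall>s\<in>?O y. f s = 0) \<longrightarrow> (\<forall>z\<in>?C. f z = 0)"
  proof (rule ccontr)
    assume *: "\<not> ?thesis"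
    have "\<exists>f. pf (2*n) f \<and> (\<forall>s\<in>?O y. f s = 0) \<and> (\<exists>z\<in>?C. f z \<noteq> 0)" if "y \<in> Y" for y
    proof (rule ccontr)
      assume ne: "\<not> ?thesis"
      have "f z = 0" if "pf (2*n) f" "\<forall>s\<in>?O y. f s = 0" "z \<in> ?C" for f z
      proof (rule ccontr)
        assume "f z \<noteq> 0"
        with that have "pf (2*n) f \<and> (\<forall>s\<in>?O y. f s = 0) \<and> (\<exists>z\<in>?C. f z \<noteq> 0)"
          by (intro conjI) (assumption, assumption, rule bexI)
        with ne show False by (elim notE) (rule exI)
      qed
      hence "\<forall>f. pf (2*n) f \<longrightarrow> (\<forall>s\<in>?O y. f s = 0) \<longrightarrow> (\<forall>z\<in>?C. f z = 0)" by (intro allI impI ballI)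
      with * \<open>y \<in> Y\<close> show False by (elim notE) (rule bexI)
    qed
    hence "\<forall>y\<in>Y. \<exists>f. pf (2*n) f \<and> (\<forall>s\<in>?O y. f s = 0) \<and> (\<exists>z\<in>?C. f z \<noteq> 0)" by (rule ballI)
    from bchoice[OF this] obtain f where f: "\<And>y. y \<in> Y \<Longrightarrow> pf (2*n) (f y)" "\<And>y s. y \<in> Y \<Longrightarrow> s \<in> ?O y \<Longrightarrow> f y s = 0"
      "\<And>y. y \<in> Y \<Longrightarrow> \<exists>z\<in>?C. f y z \<noteq> 0" by auto
    \<comment> \<open>Functions on the class are pulled back to the group, where irreducibility is
      available.\<close>
    let ?F = "\<lambda>y g. f y (sinv n g * x * g)"
    have F: "pf (2*n) (?F y)" if "y \<in> Y" for y
      by (rule pf_comp[OF f(1)[OF that], of "2*n" "\<lambda>g. sinv n g * x * g"]) (use xc in auto)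
    have ne: "\<exists>g\<in>carrier (Sp n). ?F y g \<noteq> 0" if y: "y \<in> Y" for y
    proof -
      obtain h where h: "h \<in> carrier (Sp n)" "f y (h * x * sinv n h) \<noteq> 0" using f(3)[OF y] by (auto simp: conj_class_Sp)
      thus ?thesis by (intro bexI[of _ "sinv n h"]) (auto simp: sinv_sinv)
    qed
    obtain g where g: "g \<in> carrier (Sp n)" "\<forall>y\<in>Y. ?F y g \<noteq> 0"
      using Sp_irreducible_prod[where F = ?F, OF finY F ne] by blast
    have "(\<Prod>y\<in>Y. ?F y g) = 0"
    proof -
      have "(\<Prod>y\<in>Y. ?F y s) = 0" if s: "s \<in> good n x \<Phi>" for s
      proof -
        obtain b where sS: "s \<in> carrier (Sp n)" and b: "b \<in> Bstd n" "\<And>k j. k < 2*n \<Longrightarrow> j < 2*n \<Longrightarrow>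
            om n (fcol n (s * b) k) (act (2*n) x (fcol n (s * b) j)) \<in> \<Phi>"
          using s by (auto simp: good_def)
        have bS: "b \<in> carrier (Sp n)" using b BS by blast
        let ?h = "s * b" let ?y = "sinv n ?h * x * ?h"
        have hS: "?h \<in> carrier (Sp n)" using sS bS by auto
        have "?y \<in> ?C" using hS by (auto simp: conj_class_Sp sinv_sinv intro!: exI[of _ "sinv n ?h"])
        moreover have "?y $$ (k, j) \<in> ?Psi" if "k < 2*n" "j < 2*n" for k j
          using b(2)[of "swp n k" j] that unfolding conj_entry[OF hS xc that] by (auto simp: eps_def)
        ultimately have y: "?y \<in> Y" by (auto simp: Y_def)
        have "sinv n s * x * s = b * ?y * sinv n b"
          using sS bS xc by (intro mat_eq_act[of _ "2*n"]) (auto simp: act_mult sinv_mult)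
        hence "?F ?y s = 0" using f(2)[OF y] b(1) by blast
        thus ?thesis using y finY by (auto simp: prod_zero_iff)
      qed
      moreover have "pf (2*n) (\<lambda>g. \<Prod>y\<in>Y. ?F y g)" by (rule pf_prod[OF F])
      ultimately show ?thesis using dense[OF g(1)] unfolding zc_def by blast
    qed
    thus False using g(2) finY by (auto simp: prod_zero_iff)
  qed
  then obtain y where y: "y \<in> ?C" "\<forall>f. pf (2*n) f \<longrightarrow> (\<forall>s\<in>?O y. f s = 0) \<longrightarrow> (\<forall>z\<in>?C. f z = 0)"
    unfolding Y_def by (elim bexE CollectE conjE)
  have "subtopology (zariski (2*n)) ?C closure_of ?O y = ?C"
    using closure_of_zariski_iff[OF OC[OF y(1)] Cc] y(2) by blast
  thus ?thesis
    unfolding spherical_class_def using Bstd_borel[OF two, of n] y(1)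
    by (intro exI[of _ "Bstd n"] conjI bexI[of _ y]) (simp_all only: orbit_Sp[OF BS])
qed

text \<open>Right multiplication by \<open>sinv n b\<close> preserves the set of good frames, hence
  its closure. A frame may therefore be improved inside the Borel subgroup before it is shown to lie
  in the closure.\<close>

lemma zc_Bstd:
  assumes g: "g \<in> carrier (Sp n)" and b: "b \<in> Bstd n" and z: "zc n (good n x \<Phi>) (g * b)"
  shows "zc n (good n x \<Phi>) g"
  unfolding zc_def
proof (intro conjI allI impI)
  fix f assume f: "pf (2*n) f" "\<forall>s\<in>good n x \<Phi>. f s = 0"
  have bS: "b \<in> carrier (Sp n)" using b by blast
  have canc: "h * c * sinv n c = h" if "h \<in> carrier (Sp n)" "c \<in> carrier (Sp n)" for h c
    using that by (intro mat_eq_act[of _ "2*n"]) (auto simp: act_mult)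
  have good: "s * sinv n b \<in> good n x \<Phi>" if s: "s \<in> good n x \<Phi>" for s
  proof -
    obtain a where a: "s \<in> carrier (Sp n)" "a \<in> Bstd n" "\<forall>k<2*n. \<forall>j<2*n.
       om n (fcol n (s * a) k) (act (2*n) x (fcol n (s * a) j)) \<in> \<Phi>" using s by (auto simp: good_def)
    have "s * sinv n b * (b * a) = s * a"
      using a bS Bstd_Sp[OF a(2)] by (intro mat_eq_act[of _ "2*n"]) (auto simp: act_mult)
    thus ?thesis using a bS b by (auto simp: good_def intro!: bexI[of _ "b * a"])
  qed
  have "pf (2*n) (\<lambda>A. f (A * sinv n b))"
    by (rule pf_comp[OF f(1), of "2*n" "\<lambda>A. A * sinv n b"]) auto
  moreover have "\<forall>s\<in>good n x \<Phi>. f (s * sinv n b) = 0" using good f(2) by blast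
  ultimately have "f (g * b * sinv n b) = 0" using z unfolding zc_def by blast
  thus "f g = 0" using canc[OF g bS] by simp
qed (rule g)

section \<open>Relations satisfied by spherical elements\<close>

text \<open>A combination that vanishes at \<open>y\<close> vanishes on the whole orbit, because
  both functions scale by the same factor, and then on the class by density.\<close>

lemma semi_invariants_dependent:
  fixes f1 f2 :: "'k::field mat \<Rightarrow> 'k"
  assumes x: "x \<in> carrier (Sp n)" and H: "H \<subseteq> carrier (Sp n)" and y: "y \<in> conj_class (Sp n) x"
    and dense: "subtopology (zariski (2*n)) (conj_class (Sp n) x) closure_of
                orbit (Sp n \<lparr>carrier := H\<rparr>) (conj_action (Sp n)) y = conj_class (Sp n) x"
    and f: "pf (2*n) f1" "pf (2*n) f2"
    and semi: "\<And>h. h \<in> H \<Longrightarrow> \<exists>c. \<forall>z\<in>carrier (Sp n). f1 (h * z * sinv n h) = c * f1 z \<and> f2 (h * z * sinv n h) = c * f2 z"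
  shows "\<exists>\<alpha> \<beta>. (\<alpha> \<noteq> 0 \<or> \<beta> \<noteq> 0) \<and> (\<forall>g\<in>carrier (Sp n). \<alpha> * f1 (g * x * sinv n g) + \<beta> * f2 (g * x * sinv n g) = 0)"
proof -
  let ?C = "conj_class (Sp n) x" and ?O = "{b * y * sinv n b | b. b \<in> H}"
  have CS: "?C \<subseteq> carrier (Sp n)" by (rule conj_class_sub[OF x])
  have Cc: "?C \<subseteq> carrier_mat (2*n) (2*n)" using CS by auto
  have OC: "?O \<subseteq> ?C" using H unfolding conj_class_eq[OF x y, symmetric] by (auto simp: conj_class_Sp)
  have van: "f z = 0" if "pf (2*n) f" "\<And>s. s \<in> ?O \<Longrightarrow> f s = 0" "z \<in> ?C" for f z
    using closure_of_zariski_iff[OF OC Cc] dense that unfolding orbit_Sp[OF H] by blast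
  obtain \<alpha> \<beta> where ab: "\<alpha> \<noteq> 0 \<or> \<beta> \<noteq> 0" "\<alpha> * f1 y + \<beta> * f2 y = 0"
  proof (cases "f2 y = 0")
    case True thus ?thesis using that[of 0 1] by simp
  next
    case False thus ?thesis using that[of "f2 y" "- f1 y"] by simp
  qed
  have "\<alpha> * f1 s + \<beta> * f2 s = 0" if s: "s \<in> ?O" for s
  proof -
    obtain h where h: "h \<in> H" "s = h * y * sinv n h" using s by blast
    obtain c where "f1 s = c * f1 y" "f2 s = c * f2 y" using semi[OF h(1)] h(2) y CS by blast
    hence "\<alpha> * f1 s + \<beta> * f2 s = c * (\<alpha> * f1 y + \<beta> * f2 y)" by (simp add: algebra_simps)
    thus ?thesis using ab by simp
  qed
  hence "\<alpha> * f1 z + \<beta> * f2 z = 0" if "z \<in> ?C" for z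
    using van[of "\<lambda>z. \<alpha> * f1 z + \<beta> * f2 z" z] f that by simp
  thus ?thesis using ab(1) by (auto simp: conj_class_Sp)
qed

section \<open>Extension of isotropic vectors to frames, and invariant flags\<close>

lemma om_complement:
  fixes v :: "nat \<Rightarrow> 'k::field"
  assumes "v \<in> vs (2*n)" "v \<noteq> 0" shows "\<exists>u\<in>vs (2*n). om n v u = 1"
proof -
  obtain w where w: "w \<in> vs (2*n)" "om n v w \<noteq> 0" using om_nondeg[OF assms(1)] assms(2) by blast
  thus ?thesis by (intro bexI[of _ "(1 / om n v w) \<star> w"]) auto
qed

text \<open>If every vector perpendicular to \<open>v\<close> were perpendicular to
  \<open>w\<close>, then \<open>w\<close> would equal \<open>om n w u \<star> v\<close> for any
  \<open>u\<close> with \<open>om n v u = 1\<close>.\<close>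

lemma om_independent:
  fixes v :: "nat \<Rightarrow> 'k::field"
  assumes v: "v \<in> vs (2*n)" "v \<noteq> 0" and w: "w \<in> vs (2*n)" "\<And>c. w \<noteq> c \<star> v"
  shows "\<exists>d\<in>vs (2*n). om n v d = 0 \<and> om n w d \<noteq> 0"
proof (rule ccontr)
  assume *: "\<not> ?thesis"
  obtain u where u: "u \<in> vs (2*n)" "om n v u = 1" using om_complement[OF v] by blast
  have "w = om n w u \<star> v"
  proof (rule om_eqI[of _ n])
    fix z :: "nat \<Rightarrow> 'k" assume z: "z \<in> vs (2*n)"
    have "z - om n v z \<star> u \<in> vs (2*n)" "om n v (z - om n v z \<star> u) = 0" using z u by auto
    hence "om n w (z - om n v z \<star> u) = 0" using * by blast
    thus "om n w z = om n (om n w u \<star> v) z" by (simp add: mult.commute)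
  qed (use v w in auto)
  thus False using w(2) by blast
qed

text \<open>Witt's theorem for an isotropic plane: \<open>v\<close> is put in place first, then the
  second column by a curve that fixes \<open>v\<close>.\<close>

lemma isotropic_pair_frame:
  fixes v :: "nat \<Rightarrow> 'k::field"
  assumes n: "n \<ge> 2" and v: "v \<in> vs (2*n)" "v \<noteq> 0" and w: "w \<in> vs (2*n)" "\<And>c. w \<noteq> c \<star> v" and vw: "om n v w = 0"
  shows "\<exists>g\<in>carrier (Sp n). fcol n g 0 = v \<and> fcol n g 1 = w"
proof -
  obtain u where u: "u \<in> vs (2*n)" "om n v u = 1" using om_complement[OF v] by blast
  obtain \<gamma> where ga: "tcurve n (pairs n (1\<^sub>m (2*n)) 0) \<gamma>" "act (2*n) (\<gamma> 1) (fcol n (1\<^sub>m (2*n)) 0) = v"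
    using frame_step[OF one_Sp, of 0 n v u] n u v by (auto simp: pairs_def)
  have gS: "\<gamma> 1 \<in> carrier (Sp n)" using tcurve_Sp[OF ga(1)] .
  have g0: "fcol n (\<gamma> 1) 0 = v" using ga(2) n by simp
  obtain d where d: "d \<in> vs (2*n)" "om n v d = 0" "om n w d \<noteq> 0" using om_independent[OF v w] by blast
  have o: "om n v (fcol n (\<gamma> 1) 1) = 0" "om n v (fcol n (\<gamma> 1) (n + 1)) = 0"
    "om n (fcol n (\<gamma> 1) 1) (fcol n (\<gamma> 1) (n + 1)) = 1"
    using n gS om_col_simps[OF gS, of 0 1] om_col_simps[OF gS, of 1 1] unfolding g0[symmetric] by auto
  obtain \<delta> where d: "tcurve n {v} \<delta>" "act (2*n) (\<delta> 1) (fcol n (\<gamma> 1) 1) = w"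
    using transK[of "fcol n (\<gamma> 1) 1" n w "{v}" "fcol n (\<gamma> 1) (n + 1)" d] o d v w vw by auto
  have dS: "\<delta> 1 \<in> carrier (Sp n)" using tcurve_Sp[OF d(1)] .
  have "fcol n (\<delta> 1 * \<gamma> 1) 0 = v \<and> fcol n (\<delta> 1 * \<gamma> 1) 1 = w"
    using d gS dS g0 by (auto simp: act_mult tcurve_def)
  thus ?thesis using gS dS by (intro bexI[of _ "\<delta> 1 * \<gamma> 1"]) auto
qed

text \<open>The line comes from the Lie-Kolchin theorem for the group itself, the plane from the
  same theorem for the action on the vectors perpendicular to the line, modulo the line.\<close>

lemma ccs_fixed_flag:
  fixes H :: "'k::alg_closed_field mat set"
  assumes n: "n \<ge> 2" and H: "closed_connected_solvable n H"
  shows "\<exists>g\<in>carrier (Sp n). \<forall>h\<in>H. (\<exists>c. act (2*n) h (fcol n g 0) = c \<star> fcol n g 0) \<and>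
    (\<exists>c d. act (2*n) h (fcol n g 1) = c \<star> fcol n g 1 + d \<star> fcol n g 0)"
proof -
  have sub: "subgroup H (Sp n)" using H by (simp add: closed_connected_solvable_def)
  have HS: "h \<in> carrier (Sp n)" if "h \<in> H" for h using subgroup.subset[OF sub] that by blast
  have "\<exists>v\<in>vs (2*n). v \<noteq> 0 \<and> (\<forall>h\<in>H. \<exists>c. act (2*n) h v = c \<star> v)"
    by (rule Lie_Kolchin_ccs[OF H, of "2*n" "\<lambda>h. h"]) (use n in auto)
  then obtain v where v: "v \<in> vs (2*n)" "v \<noteq> 0" "\<And>h. h \<in> H \<Longrightarrow> \<exists>c. act (2*n) h v = c \<star> v" by blast
  obtain u where u: "u \<in> vs (2*n)" "om n v u = 1" using om_complement[OF v(1,2)] by blast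
  obtain \<gamma> where ga: "tcurve n (pairs n (1\<^sub>m (2*n)) 0) \<gamma>" "act (2*n) (\<gamma> 1) (fcol n (1\<^sub>m (2*n)) 0) = v"
    using frame_step[OF one_Sp, of 0 n v u] n u v by (auto simp: pairs_def)
  define \<tau> where "\<tau> = \<gamma> 1"
  have tS: "\<tau> \<in> carrier (Sp n)" using tcurve_Sp[OF ga(1)] by (simp add: \<tau>_def)
  have t0: "fcol n \<tau> 0 = v" using ga(2) n by (simp add: \<tau>_def)
  \<comment> \<open>Conjugation by \<open>\<tau>\<close> turns the invariant line into the span of
    \<open>bv 0\<close>.\<close>
  define C where "C h = sinv n \<tau> * h * \<tau>" for h
  have CS: "C h \<in> carrier (Sp n)" if "h \<in> H" for h using HS[OF that] tS by (simp add: C_def)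
  have Cmult: "C (g * h) = C g * C h" if "g \<in> H" "h \<in> H" for g h
    using HS[OF that(1)] HS[OF that(2)] tS unfolding C_def by (intro mat_eq_act[of _ "2*n"]) (auto simp: act_mult)
  have C0: "\<exists>c. fcol n (C h) 0 = c \<star> bv 0" if h: "h \<in> H" for h
  proof -
    obtain c where "act (2*n) h v = c \<star> v" using v(3)[OF h] by blast
    hence "fcol n (C h) 0 = c \<star> act (2*n) (sinv n \<tau>) (fcol n \<tau> 0)"
      using HS[OF h] tS t0 by (simp add: C_def act_mult)
    thus ?thesis using tS n by auto
  qed
  have col0: "C h $$ (k, 0) = 0" if h: "h \<in> H" and k: "0 < k" "k < 2*n" for h k
  proof -
    obtain c where "fcol n (C h) 0 = c \<star> bv 0" using C0[OF h] by blast
    hence "fcol n (C h) 0 k = 0" using k by (simp add: bv_def)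
    thus ?thesis using k by (simp add: act_bv)
  qed
  \<comment> \<open>Row \<open>n\<close> expresses that the space perpendicular to the line is
    stable; up to signs it is column 0 of the inverse.\<close>
  have rown: "C h $$ (n, j) = 0" if h: "h \<in> H" and j: "j < 2*n" "j \<noteq> n" for h j
  proof -
    have hi: "sinv n h \<in> H" using subgroup.m_inv_closed[OF sub h] HS[OF h] by simp
    have Ci: "C (sinv n h) = sinv n (C h)"
      using HS[OF h] tS assoc_mult_mat[of "sinv n \<tau>" "2*n" "2*n" "sinv n h" "2*n" \<tau> "2*n"]
      by (simp add: C_def sinv_mult sinv_sinv)
    have "C (sinv n h) $$ (swp n j, 0) = 0"
      using j n by (intro col0[OF hi]) (auto simp: swp_def)
    hence "sinv n (C h) $$ (swp n j, swp n n) = 0" using n unfolding Ci by (simp add: swp_def)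
    thus ?thesis using j n by (simp add: sinv_def)
  qed
  let ?m = "2*n - 2"
  \<comment> \<open>An enumeration of the indices other than 0 and \<open>n\<close>; these basis
    vectors represent the perpendicular space modulo the line.\<close>
  define \<iota> where "\<iota> k = (if k < n - 1 then k + 1 else k + 2)" for k
  have iot: "\<iota> k < 2*n" "\<iota> k \<noteq> 0" "\<iota> k \<noteq> n" if "k < ?m" for k using that n by (auto simp: \<iota>_def)
  have bij: "bij_betw \<iota> {..<?m} ({..<2*n} - {0, n})"
    by (rule bij_betw_byWitness[where f' = "\<lambda>r. if r < n then r - 1 else r - 2"]) (use n in \<open>auto simp: \<iota>_def\<close>)
  have sum_iot: "(\<Sum>r<2*n. F r) = F 0 + F n + (\<Sum>r<?m. F (\<iota> r))" for F :: "nat \<Rightarrow> 'k"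
  proof -
    have "(\<Sum>r<2*n. F r) = F 0 + (\<Sum>r\<in>{..<2*n} - {0}. F r)" using n by (subst sum.remove[of _ 0]) auto
    also have "(\<Sum>r\<in>{..<2*n} - {0}. F r) = F n + (\<Sum>r\<in>{..<2*n} - {0} - {n}. F r)" using n by (subst sum.remove[of _ n]) auto
    also have "{..<2*n} - {0} - {n} = {..<2*n} - {0, n}" by auto
    also have "(\<Sum>r\<in>{..<2*n} - {0, n}. F r) = (\<Sum>r<?m. F (\<iota> r))"
      by (rule sum.reindex_bij_betw[OF bij, symmetric])
    finally show ?thesis by (simp add: add.assoc)
  qed
  define \<rho> :: "'k mat \<Rightarrow> 'k mat" where "\<rho> h = mat ?m ?m (\<lambda>(k, l). C h $$ (\<iota> k, \<iota> l))" for h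
  have "\<exists>u\<in>vs ?m. u \<noteq> 0 \<and> (\<forall>h\<in>H. \<exists>c. act ?m (\<rho> h) u = c \<star> u)"
  proof (rule Lie_Kolchin_ccs[OF H])
    have "pm (2*n) (2*n) C" unfolding C_def using tS by (intro pm_mult pm_id pm_const) auto
    thus "pm (2*n) ?m \<rho>" using iot by (auto simp: pm_def \<rho>_def)
    show "?m > 0" using n by simp
    have "C (1\<^sub>m (2*n)) = 1\<^sub>m (2*n)" using tS by (simp add: C_def sinv_left right_mult_one_mat[OF sinv_carrier])
    moreover have "\<iota> k = \<iota> l \<longleftrightarrow> k = l" if "k < ?m" "l < ?m" for k l
      using bij that unfolding bij_betw_def inj_on_def by blast
    ultimately show "\<rho> (1\<^sub>m (2*n)) = 1\<^sub>m ?m" using iot by (intro eq_matI) (auto simp: \<rho>_def)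
    show "\<rho> (g * h) = \<rho> g * \<rho> h" if gh: "g \<in> H" "h \<in> H" for g h
    proof (rule eq_matI)
      fix k l assume "k < dim_row (\<rho> g * \<rho> h)" "l < dim_col (\<rho> g * \<rho> h)"
      hence kl: "k < ?m" "l < ?m" by (auto simp: \<rho>_def)
      have c: "C g \<in> carrier_mat (2*n) (2*n)" "C h \<in> carrier_mat (2*n) (2*n)" using gh CS by auto
      have "\<rho> (g * h) $$ (k, l) = (\<Sum>r<2*n. C g $$ (\<iota> k, r) * C h $$ (r, \<iota> l))"
        using kl c iot by (auto simp: \<rho>_def Cmult[OF gh] scalar_prod_def atLeast0LessThan)
      also have "\<dots> = (\<Sum>r<?m. C g $$ (\<iota> k, \<iota> r) * C h $$ (\<iota> r, \<iota> l))"
        using kl iot col0[OF gh(1)] rown[OF gh(2)] by (subst sum_iot) auto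
      finally show "\<rho> (g * h) $$ (k, l) = (\<rho> g * \<rho> h) $$ (k, l)"
        using kl by (simp add: \<rho>_def scalar_prod_def atLeast0LessThan)
    qed (auto simp: \<rho>_def)
  qed
  then obtain u where u: "u \<in> vs ?m" "u \<noteq> 0" "\<And>h. h \<in> H \<Longrightarrow> \<exists>c. act ?m (\<rho> h) u = c \<star> u" by blast
  define W where "W r = (if r = 0 \<or> r = n \<or> \<not> r < 2*n then 0 else u (the_inv_into {..<?m} \<iota> r))" for r
  have Wi: "W (\<iota> k) = u k" if "k < ?m" for k
    using iot[OF that] bij that by (auto simp: W_def bij_betw_def the_inv_into_f_f)
  have Wvs: "W \<in> vs (2*n)" by (auto simp: vs_def W_def)
  have W0: "W 0 = 0" "W n = 0" by (auto simp: W_def)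
  have Wne: "W \<noteq> 0"
  proof
    assume "W = 0"
    hence "u k = 0" for k using Wi[of k] u(1) by (cases "k < ?m") (auto simp: vs_def)
    thus False using u(2) by (auto simp: fun_eq_iff)
  qed
  have CW: "\<exists>c d. act (2*n) (C h) W = c \<star> W + d \<star> bv 0" if h: "h \<in> H" for h
  proof -
    obtain c where c: "act ?m (\<rho> h) u = c \<star> u" using u(3)[OF h] by blast
    have s: "act (2*n) (C h) W k = (\<Sum>r<?m. C h $$ (k, \<iota> r) * u r)" if "k < 2*n" for k
      using that Wi by (simp add: act_def sum_iot W0)
    have "act (2*n) (C h) W k = (c \<star> W + act (2*n) (C h) W 0 \<star> bv 0) k" for k
    proof -
      have "k \<in> \<iota> ` {..<?m}" if "k < 2*n" "k \<noteq> 0" "k \<noteq> n"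
        using bij that unfolding bij_betw_def by simp
      then consider "k = 0" | "k = n" "n \<noteq> 0" | "\<not> k < 2*n" | l where "l < ?m" "k = \<iota> l"
        using n by fastforce
      thus ?thesis
      proof cases
        case 1 thus ?thesis using W0 by (simp add: bv_def)
      next
        case 2
        thus ?thesis using n s[of n] rown[OF h] iot W0 by (simp add: bv_def)
      next
        case 3 thus ?thesis using n by (auto simp: act_def W_def bv_def)
      next
        case 4
        have "act (2*n) (C h) W k = act ?m (\<rho> h) u l"
          using s[of k] iot[OF 4(1)] 4 by (simp add: act_def \<rho>_def)
        thus ?thesis using c Wi[OF 4(1)] 4 iot[OF 4(1)] by (simp add: bv_def)
      qed
    qed
    thus ?thesis by blast
  qed
  define w where "w = act (2*n) \<tau> W"
  have hw: "\<exists>c d. act (2*n) h w = c \<star> w + d \<star> v" if h: "h \<in> H" for h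
  proof -
    obtain c d where cd: "act (2*n) (C h) W = c \<star> W + d \<star> bv 0" using CW[OF h] by blast
    have "act (2*n) h w = act (2*n) \<tau> (act (2*n) (C h) W)"
      using HS[OF h] tS by (simp add: C_def w_def act_mult)
    thus ?thesis unfolding cd using t0 by (auto simp: w_def)
  qed
  have "om n v w = 0" using tS n W0 unfolding t0[symmetric] w_def by (simp add: om_bv_left swp_def)
  moreover have "w \<noteq> c \<star> v" for c
  proof
    assume "w = c \<star> v"
    hence "act (2*n) \<tau> W = act (2*n) \<tau> (c \<star> bv 0)" by (simp add: w_def t0)
    hence "act (2*n) (sinv n \<tau>) (act (2*n) \<tau> W) = act (2*n) (sinv n \<tau>) (act (2*n) \<tau> (c \<star> bv 0))" by (rule arg_cong)
    hence W: "W = c \<star> bv 0" using tS Wvs n by (subst (asm) (1 2) act_sinv) auto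
    hence "c = 0" using W0(1) by (simp add: bv_def)
    thus False using W Wne by simp
  qed
  ultimately obtain g where "g \<in> carrier (Sp n)" "fcol n g 0 = v" "fcol n g 1 = w"
    using isotropic_pair_frame[OF n v(1,2), of w] by (auto simp: w_def)
  thus ?thesis using v(3) hw by (intro bexI[of _ g]) auto
qed


lemma vector_frame:
  fixes v :: "nat \<Rightarrow> 'k::field"
  assumes n: "n > 0" and v: "v \<in> vs (2*n)" "v \<noteq> 0"
  shows "\<exists>g\<in>carrier (Sp n). fcol n g 0 = v"
proof -
  obtain u where u: "u \<in> vs (2*n)" "om n v u = 1" using om_complement[OF v] by blast
  obtain \<gamma> where ga: "tcurve n (pairs n (1\<^sub>m (2*n)) 0) \<gamma>" "act (2*n) (\<gamma> 1) (fcol n (1\<^sub>m (2*n)) 0) = v"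
    using frame_step[OF one_Sp, of 0 n v u] n u v by (auto simp: pairs_def)
  show ?thesis using ga(2) n tcurve_Sp[OF ga(1), of 1] by (intro bexI[of _ "\<gamma> 1"]) auto
qed

section \<open>The operators X and Y of a symplectic element\<close>

locale sp_elem =
  fixes n :: nat and x :: "'k::alg_closed_field mat"
  assumes two: "(2::'k) \<noteq> 0" and x: "x \<in> carrier (Sp n)"
begin

lemma pow2_nz: "(4::'k) \<noteq> 0" "(8::'k) \<noteq> 0" "(16::'k) \<noteq> 0"
proof -
  have "(2::'k) * 2 = 4" "(2::'k) * 4 = 8" "(2::'k) * 8 = 16" by simp_all
  thus "(4::'k) \<noteq> 0" "(8::'k) \<noteq> 0" "(16::'k) \<noteq> 0" using two by (metis mult_eq_0_iff)+
qed

abbreviation "V \<equiv> vs (2*n) :: (nat \<Rightarrow> 'k) set"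
abbreviation "T \<equiv> act (2*n) x"
abbreviation "T' \<equiv> act (2*n) (sinv n x)"
text \<open>\<open>X\<close> is skew-adjoint and \<open>Y\<close> self-adjoint, so
  \<open>om n v (X w)\<close> is a symmetric form and \<open>om n v (Y w)\<close> an alternating
  one. They are linked by \<open>Y\<^sup>2 = X\<^sup>2 + 4\<close>.\<close>

definition "X v = T v - T' v"
definition "Y v = T v + T' v"

lemma TT [simp]: "v \<in> V \<Longrightarrow> T (T' v) = v" "v \<in> V \<Longrightarrow> T' (T v) = v" "om n (T v) (T w) = om n v w"
  using x by auto

lemma om_T': "om n (T' v) w = om n v (T w)" "w \<in> V \<Longrightarrow> om n v (T' w) = om n (T v) w"
  using x by (auto simp: om_sinv om_sinv_right)

lemma XY_V [simp]: "X v \<in> V" "Y v \<in> V" by (auto simp: X_def Y_def)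

lemma X_lin [simp]: "X (v + w) = X v + X w" "X (v - w) = X v - X w" "X (c \<star> v) = c \<star> X v" "X (- v) = - X v" "X 0 = 0"
  by (auto simp: X_def scl_diff)

lemma Y_lin [simp]: "Y (v + w) = Y v + Y w" "Y (v - w) = Y v - Y w" "Y (c \<star> v) = c \<star> Y v" "Y (- v) = - Y v" "Y 0 = 0"
  by (auto simp: Y_def scl_add)

lemma om_X: "v \<in> V \<Longrightarrow> w \<in> V \<Longrightarrow> om n (X v) w = - om n v (X w)"
  by (simp add: X_def om_T')

lemma om_Y: "v \<in> V \<Longrightarrow> w \<in> V \<Longrightarrow> om n (Y v) w = om n v (Y w)"
  by (simp add: Y_def om_T')

lemma om_X_sym: "v \<in> V \<Longrightarrow> w \<in> V \<Longrightarrow> om n v (X w) = om n w (X v)"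
  using om_X[of v w] om_skew[of n "X v" w] by simp

lemma XY_comm: "v \<in> V \<Longrightarrow> X (Y v) = Y (X v)"
  by (simp add: X_def Y_def)

lemma XT_comm: "v \<in> V \<Longrightarrow> X (T v) = T (X v)" "v \<in> V \<Longrightarrow> Y (T v) = T (Y v)"
  by (simp_all add: X_def Y_def)

lemma YY: "v \<in> V \<Longrightarrow> Y (Y v) = X (X v) + 4 \<star> v"
  by (simp add: X_def Y_def fun_eq_iff)

lemma T_XY: "2 \<star> T v = Y v + X v"
  by (simp add: X_def Y_def fun_eq_iff)

text \<open>Polarisation in characteristic other than 2: a symmetric bilinear form vanishes with its
  quadratic form.\<close>

lemma skew_form_zero:
  assumes "lin Z" "\<And>v. v \<in> V \<Longrightarrow> Z v \<in> V" "\<And>v w. v \<in> V \<Longrightarrow> w \<in> V \<Longrightarrow> om n v (Z w) = om n w (Z v)"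
    and "\<And>v. v \<in> V \<Longrightarrow> om n v (Z v) = 0" and v: "v \<in> V"
  shows "Z v = 0"
proof (rule om_nondeg[of _ n])
  fix w assume w: "w \<in> V"
  have "om n (v + w) (Z (v + w)) = 0" using assms(4)[of "v + w"] v w by simp
  hence "2 * om n w (Z v) = 0"
    using assms(1,3,4) v w by (simp add: lin_def)
  thus "om n (Z v) w = 0" using two om_skew[of n "Z v" w] by simp
qed (use assms in auto)

text \<open>The coefficients multiply Gram determinants on an isotropic plane, of the symmetric form
  of \<open>X\<close> and of the alternating form of \<open>Y\<close>. Under a change of basis of
  the plane both are multiplied by the squared determinant, so a group stabilising a plane acts on
  them by one character.\<close>

definition "R2 \<longleftrightarrow> (\<exists>\<gamma> \<delta>. (\<gamma> \<noteq> 0 \<or> \<delta> \<noteq> 0) \<and> (\<forall>v\<in>V. \<forall>w\<in>V. om n v w = 0 \<longrightarrow>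
    \<gamma> * (om n v (X v) * om n w (X w) - (om n v (X w))\<^sup>2) + \<delta> * (om n v (Y w))\<^sup>2 = 0))"

lemma om_X_self: "v \<in> V \<Longrightarrow> om n v (X v) = 2 * om n v (T v)"
  using om_skew[of n "T v" v] by (simp add: X_def om_T')

lemma om_X_T: "v \<in> V \<Longrightarrow> w \<in> V \<Longrightarrow> om n v (X w) = om n v (T w) + om n w (T v)"
  using om_skew[of n "T v" w] by (simp add: X_def om_T')

lemma om_Y_T: "v \<in> V \<Longrightarrow> w \<in> V \<Longrightarrow> om n v (Y w) = om n v (T w) - om n w (T v)"
  using om_skew[of n "T v" w] by (simp add: Y_def om_T')

lemma spherical_relations:
  assumes n: "n \<ge> 2" and sph: "spherical_class n (conj_class (Sp n) x)"
  shows "\<exists>\<alpha> \<beta>. (\<alpha> \<noteq> 0 \<or> \<beta> \<noteq> 0) \<and> (\<forall>v\<in>V. \<alpha> \<star> X v + \<beta> \<star> X (Y v) = 0)" and R2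
proof -
  obtain H y where H: "closed_connected_solvable n H" and y: "y \<in> conj_class (Sp n) x"
    and dense: "subtopology (zariski (2*n)) (conj_class (Sp n) x) closure_of
                orbit (Sp n \<lparr>carrier := H\<rparr>) (conj_action (Sp n)) y = conj_class (Sp n) x"
    using sph unfolding spherical_class_def borel_subgroup_def by blast
  have sub: "subgroup H (Sp n)" using H by (simp add: closed_connected_solvable_def)
  have HS: "H \<subseteq> carrier (Sp n)" using sub by (rule subgroup.subset)
  have Hi: "sinv n h \<in> H" if "h \<in> H" for h using subgroup.m_inv_closed[OF sub that] HS that by auto
  obtain g0 where g0: "g0 \<in> carrier (Sp n)"
    and fl: "\<And>h. h \<in> H \<Longrightarrow> \<exists>c. act (2*n) h (fcol n g0 0) = c \<star> fcol n g0 0"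
      "\<And>h. h \<in> H \<Longrightarrow> \<exists>c d. act (2*n) h (fcol n g0 1) = c \<star> fcol n g0 1 + d \<star> fcol n g0 0"
    using ccs_fixed_flag[OF n H] by blast
  define v w where "v = fcol n g0 0" and "w = fcol n g0 1"
  have vw: "v \<in> V" "w \<in> V" by (auto simp: v_def w_def)
  define M where "M z a b = om n a (act (2*n) z b)" for z :: "'k mat" and a b
  have M: "M (h * z * sinv n h) a b = om n (act (2*n) (sinv n h) a) (act (2*n) z (act (2*n) (sinv n h) b))"
    if "h \<in> carrier (Sp n)" "z \<in> carrier (Sp n)" for h z a b
    using that by (simp add: M_def act_mult om_sinv)
  have pfM: "pf (2*n) (\<lambda>z. M z a b)" for a b
    unfolding M_def by (intro pf_om pf_act) auto
  \<comment> \<open>The fixed vectors \<open>v\<close> and \<open>w\<close> can be moved to the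
    first two columns of any frame; a relation on the class thus becomes one for all nonzero vectors
    or all isotropic pairs.\<close>
  have gg: "\<exists>g\<in>carrier (Sp n). act (2*n) (sinv n g) v = fcol n g' 0 \<and> act (2*n) (sinv n g) w = fcol n g' 1"
    if "g' \<in> carrier (Sp n)" for g'
    using that g0 n by (intro bexI[of _ "g0 * sinv n g'"])
      (auto simp: v_def w_def sinv_mult sinv_sinv act_mult)
  show "\<exists>\<alpha> \<beta>. (\<alpha> \<noteq> 0 \<or> \<beta> \<noteq> 0) \<and> (\<forall>v\<in>V. \<alpha> \<star> X v + \<beta> \<star> X (Y v) = 0)"
  proof -
    let ?f1 = "\<lambda>z. M z v v" and ?f2 = "\<lambda>z. M (z * z) v v"
    have pf2: "pf (2*n) ?f2" by (rule pf_comp[OF pfM, of "2*n" "\<lambda>z. z * z"]) simp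
    have semi: "\<exists>c. \<forall>z\<in>carrier (Sp n). ?f1 (h * z * sinv n h) = c * ?f1 z \<and> ?f2 (h * z * sinv n h) = c * ?f2 z" if h: "h \<in> H" for h
    proof -
      have hS: "h \<in> carrier (Sp n)" using h HS by blast
      obtain c where c: "act (2*n) (sinv n h) v = c \<star> v" using fl(1)[OF Hi[OF h]] by (auto simp: v_def)
      have "?f1 (h * z * sinv n h) = c\<^sup>2 * ?f1 z \<and> ?f2 (h * z * sinv n h) = c\<^sup>2 * ?f2 z" if z: "z \<in> carrier (Sp n)" for z
      proof -
        have "(h * z * sinv n h) * (h * z * sinv n h) = h * (z * z) * sinv n h"
          using hS z by (intro mat_eq_act[of _ "2*n"]) (auto simp: act_mult)
        thus ?thesis using M[OF hS, of z v v] M[OF hS, of "z * z" v v] z c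
          by (simp add: power2_eq_square M_def)
      qed
      thus ?thesis by blast
    qed
    obtain \<alpha> \<beta> where ab: "\<alpha> \<noteq> 0 \<or> \<beta> \<noteq> 0"
      "\<And>g. g \<in> carrier (Sp n) \<Longrightarrow> \<alpha> * ?f1 (g * x * sinv n g) + \<beta> * ?f2 (g * x * sinv n g) = 0"
      using semi_invariants_dependent[OF x HS y dense pfM pf2 semi] by blast
    have rel: "\<alpha> * om n a (T a) + \<beta> * om n a (T (T a)) = 0" if a: "a \<in> V" for a
    proof (cases "a = 0")
      case False
      then obtain g' where g': "g' \<in> carrier (Sp n)" "fcol n g' 0 = a" using vector_frame[of n a] a n by auto
      obtain g where g: "g \<in> carrier (Sp n)" "act (2*n) (sinv n g) v = a" using gg[OF g'(1)] g'(2) by blast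
      have "(g * x * sinv n g) * (g * x * sinv n g) = g * (x * x) * sinv n g"
        using g x by (intro mat_eq_act[of _ "2*n"]) (auto simp: act_mult)
      thus ?thesis using ab(2)[OF g(1)] M[OF g(1) x, of v v] M[OF g(1), of "x * x" v v] x g(2) by (simp add: act_mult)
    qed simp
    \<comment> \<open>Up to the factor 2, the semi-invariants are the quadratic forms of
      \<open>X\<close> and of \<open>X (Y v)\<close>, which equals
      \<open>T (T v) - T' (T' v)\<close>. Polarisation then yields an identity of operators.\<close>
    let ?Z = "\<lambda>v. \<alpha> \<star> X v + \<beta> \<star> X (Y v)"
    have sym: "om n a (X (Y b)) = om n b (X (Y a))" if "a \<in> V" "b \<in> V" for a b
    proof -
      have "om n a (X (Y b)) = om n (Y b) (X a)" using that by (intro om_X_sym) auto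
      also have "\<dots> = om n b (Y (X a))" using that by (intro om_Y) auto
      finally show ?thesis using that by (simp add: XY_comm)
    qed
    have "?Z a = 0" if "a \<in> V" for a
    proof (rule skew_form_zero[where Z = ?Z, OF _ _ _ _ that])
      show "lin ?Z" by (auto simp: lin_def fun_eq_iff algebra_simps)
      show "om n a (?Z b) = om n b (?Z a)" if "a \<in> V" "b \<in> V" for a b
        using om_X_sym[OF that] sym[OF that] by simp
      show "om n a (?Z a) = 0" if a: "a \<in> V" for a
      proof -
        have "X (Y a) = T (T a) - T' (T' a)" using a by (simp add: X_def Y_def)
        hence "om n a (X (Y a)) = 2 * om n a (T (T a))"
          using a om_skew[of n "T (T a)" a] by (simp add: om_T')
        hence "om n a (?Z a) = 2 * (\<alpha> * om n a (T a) + \<beta> * om n a (T (T a)))"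
          using a by (simp add: om_X_self algebra_simps)
        thus ?thesis using rel[OF a] by simp
      qed
    qed auto
    thus ?thesis using ab(1) by blast
  qed
  show R2
  proof -
    \<comment> \<open>These are the Gram determinants of \<open>R2\<close>, expressed by
      \<open>T\<close> through \<open>om_X_self\<close>, \<open>om_X_T\<close> and
      \<open>om_Y_T\<close>.\<close>
    let ?f1 = "\<lambda>z. 4 * M z v v * M z w w - (M z v w + M z w v)\<^sup>2" and ?f2 = "\<lambda>z. (M z v w - M z w v)\<^sup>2"
    have p: "pf (2*n) ?f1" "pf (2*n) ?f2"
      using pfM by (auto simp: power2_eq_square)
    have semi: "\<exists>c. \<forall>z\<in>carrier (Sp n). ?f1 (h * z * sinv n h) = c * ?f1 z \<and> ?f2 (h * z * sinv n h) = c * ?f2 z" if h: "h \<in> H" for h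
    proof -
      have hS: "h \<in> carrier (Sp n)" using h HS by blast
      obtain c where c: "act (2*n) (sinv n h) v = c \<star> v" using fl(1)[OF Hi[OF h]] by (auto simp: v_def)
      obtain d e where de: "act (2*n) (sinv n h) w = d \<star> w + e \<star> v" using fl(2)[OF Hi[OF h]] by (auto simp: v_def w_def)
      have "?f1 (h * z * sinv n h) = (c * d)\<^sup>2 * ?f1 z \<and> ?f2 (h * z * sinv n h) = (c * d)\<^sup>2 * ?f2 z" if z: "z \<in> carrier (Sp n)" for z
        unfolding M[OF hS z] c de by (simp add: M_def) (simp add: power2_eq_square algebra_simps)
      thus ?thesis by blast
    qed
    obtain \<gamma> \<delta> where ab: "\<gamma> \<noteq> 0 \<or> \<delta> \<noteq> 0"
      "\<And>g. g \<in> carrier (Sp n) \<Longrightarrow> \<gamma> * ?f1 (g * x * sinv n g) + \<delta> * ?f2 (g * x * sinv n g) = 0"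
      using semi_invariants_dependent[OF x HS y dense p semi] by blast
    have "\<gamma> * (om n a (X a) * om n b (X b) - (om n a (X b))\<^sup>2) + \<delta> * (om n a (Y b))\<^sup>2 = 0"
      if a: "a \<in> V" and b: "b \<in> V" and o: "om n a b = 0" for a b
    proof -
      have eq: "om n a (X a) * om n b (X b) - (om n a (X b))\<^sup>2 = 4 * om n a (T a) * om n b (T b) - (om n a (T b) + om n b (T a))\<^sup>2"
        "om n a (Y b) = om n a (T b) - om n b (T a)"
        using a b by (simp_all add: om_X_self om_X_T om_Y_T algebra_simps)
      consider "a = 0" | c where "b = c \<star> a" | "a \<noteq> 0" "\<forall>c. b \<noteq> c \<star> a" by blast
      thus ?thesis
      proof cases
        case 2 thus ?thesis unfolding eq by (simp add: power2_eq_square)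
      next
        case 3
        then obtain g' where g': "g' \<in> carrier (Sp n)" "fcol n g' 0 = a" "fcol n g' 1 = b"
          using isotropic_pair_frame[OF n a _ b _ o] by auto
        obtain g where g: "g \<in> carrier (Sp n)" "act (2*n) (sinv n g) v = a" "act (2*n) (sinv n g) w = b"
          using gg[OF g'(1)] g'(2,3) by blast
        show ?thesis using ab(2)[OF g(1)] unfolding eq M[OF g(1) x] g(2,3) by simp
      qed (simp add: eq)
    qed
    thus ?thesis using ab(1) unfolding R2_def by blast
  qed
qed

section \<open>Classification of the elements satisfying the relations\<close>

lemma ev_perp:
  assumes "T a = \<kappa> \<star> a" "T b = \<mu> \<star> b" "\<kappa> * \<mu> \<noteq> 1" shows "om n a b = 0"
proof -
  have "\<kappa> * (\<mu> * om n a b) = om n a b" using TT(3)[of a b] unfolding assms by (simp add: mult.left_commute)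
  hence "(\<kappa> * \<mu> - 1) * om n a b = 0" by (simp add: algebra_simps)
  thus ?thesis using assms(3) by simp
qed

lemma ev_T':
  assumes "T a = \<kappa> \<star> a" "\<kappa> \<noteq> 0" "a \<in> V" shows "T' a = inverse \<kappa> \<star> a"
proof -
  have "inverse \<kappa> \<star> T' (T a) = T' a" using assms by simp
  thus ?thesis using assms(3) by simp
qed

lemma ev_XY:
  assumes "T a = \<kappa> \<star> a" "\<kappa> \<noteq> 0" "a \<in> V"
  shows "X a = (\<kappa> - inverse \<kappa>) \<star> a" "Y a = (\<kappa> + inverse \<kappa>) \<star> a"
  using ev_T'[OF assms] assms(1) by (auto simp: X_def Y_def scl_left_add scl_left_diff)

lemma ev_om: "T r = \<mu> \<star> r \<Longrightarrow> \<mu> \<noteq> 0 \<Longrightarrow> r \<in> V \<Longrightarrow> om n r (T z) = inverse \<mu> * om n r z"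
  using ev_T'[of r \<mu>] om_T'(1)[of r z] by simp

lemma normalize_partner:
  assumes "d \<in> V" "T d = \<mu> \<star> d" "om n c d \<noteq> 0"
  shows "\<exists>c'\<in>V. T c' = \<mu> \<star> c' \<and> om n c c' = 1"
proof (intro bexI conjI)
  let ?k = "inverse (om n c d)"
  have "T (?k \<star> d) = ?k \<star> \<mu> \<star> d" using assms(2) by simp
  thus "T (?k \<star> d) = \<mu> \<star> ?k \<star> d" by (simp only: scl_scl mult.commute)
qed (use assms in auto)

lemma R2_neq:
  assumes R2
  obtains \<gamma> \<delta> where "\<gamma> \<noteq> 0 \<or> \<delta> \<noteq> 0" "\<And>v w. v \<in> V \<Longrightarrow> w \<in> V \<Longrightarrow> om n v w = 0 \<Longrightarrow>
    \<gamma> * (om n v (X v) * om n w (X w) - (om n v (X w))\<^sup>2) + \<delta> * (om n v (Y w))\<^sup>2 = 0"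
  using assms unfolding R2_def by blast

text \<open>Under the linear relation \<open>V\<close> is the sum of the eigenspaces for
  \<open>\<kappa>\<close>, \<open>inverse \<kappa>\<close>, 1 and -1. If both kinds of eigenvalue
  occur, the quadratic relation is tested on isotropic sums of dual eigenvectors: both coefficients
  come out nonzero, only one of 1 and -1 survives, and \<open>\<kappa>\<close> keeps multiplicity
  one.\<close>

lemma classify_semisimple:
  assumes r2: R2 and lam: "\<kappa> \<noteq> 0" "\<kappa>\<^sup>2 \<noteq> 1" and XY: "\<And>v. v \<in> V \<Longrightarrow> X (Y v - (\<kappa> + inverse \<kappa>) \<star> v) = 0"
  shows "(\<forall>v\<in>V. X v = 0) \<or> (\<forall>v\<in>V. Y v = (\<kappa> + inverse \<kappa>) \<star> v) \<or>
    (\<exists>\<mu> p q \<epsilon>. \<mu> \<noteq> 0 \<and> \<mu>\<^sup>2 \<noteq> 1 \<and> \<epsilon>\<^sup>2 = 1 \<and> p \<in> V \<and> q \<in> V \<and> om n p q = 1 \<and> T p = \<mu> \<star> p \<and> T q = inverse \<mu> \<star> q \<and>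
       (\<forall>v\<in>V. om n p v = 0 \<longrightarrow> om n q v = 0 \<longrightarrow> T v = \<epsilon> \<star> v))"
proof (rule disjCI)
  let ?t = "\<kappa> + inverse \<kappa>"
  assume A: "\<not> ((\<forall>v\<in>V. Y v = ?t \<star> v) \<or> (\<exists>\<mu> p q \<epsilon>. \<mu> \<noteq> 0 \<and> \<mu>\<^sup>2 \<noteq> 1 \<and> \<epsilon>\<^sup>2 = 1 \<and> p \<in> V \<and> q \<in> V \<and> om n p q = 1 \<and> T p = \<mu> \<star> p \<and> T q = inverse \<mu> \<star> q \<and>
       (\<forall>v\<in>V. om n p v = 0 \<longrightarrow> om n q v = 0 \<longrightarrow> T v = \<epsilon> \<star> v)))"
  show "\<forall>v\<in>V. X v = 0"
  proof (rule ccontr)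
    assume "\<not> (\<forall>v\<in>V. X v = 0)"
    then obtain u0 where u0: "u0 \<in> V" "X u0 \<noteq> 0" by blast
    have lam1: "inverse \<kappa> \<noteq> 0" "(inverse \<kappa>)\<^sup>2 \<noteq> 1" "inverse (inverse \<kappa>) = \<kappa>"
      using lam by (auto simp: field_simps)
    define U where "U = {u \<in> V. Y u = ?t \<star> u}"
    have Ueq: "T (T u) = ?t \<star> T u - u" if "u \<in> U" for u
    proof -
      have "T (Y u) = T (?t \<star> u)" using that by (simp add: U_def)
      thus ?thesis using that by (simp add: U_def Y_def) (simp add: fun_eq_iff algebra_simps)
    qed
    have eig: "\<exists>c\<in>V. c \<noteq> 0 \<and> (T c = \<kappa> \<star> c \<or> T c = inverse \<kappa> \<star> c) \<and> (\<exists>k l. c = k \<star> T u + l \<star> u)"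
      if u: "u \<in> U" "u \<noteq> 0" for u
    proof (cases "T u = inverse \<kappa> \<star> u")
      case True thus ?thesis using u by (intro bexI[of _ u] conjI exI[of _ 0] exI[of _ 1]) (auto simp: U_def)
    next
      case False
      let ?c = "T u - inverse \<kappa> \<star> u"
      have "T ?c = \<kappa> \<star> ?c" using Ueq[OF u(1)] lam by (simp add: fun_eq_iff algebra_simps)
      moreover have "?c = 1 \<star> T u + (- inverse \<kappa>) \<star> u" by (simp add: fun_eq_iff)
      moreover have "?c \<in> V" "?c \<noteq> 0" using False u by (auto simp: U_def)
      ultimately show ?thesis by blast
    qed
    have cub: "X (T (T v)) = X (?t \<star> T v - v)" if "v \<in> V" for v
      using XY[of "T v"] that by (simp add: Y_def) (simp add: fun_eq_iff algebra_simps)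
    have XX: "T (T z) = z" if "z \<in> V" "X z = 0" for z
    proof -
      have "T z = T' z" using that by (simp add: X_def)
      thus ?thesis using that(1) by (metis TT(1))
    qed
    have XT: "T (T z) = z + T (X z)" if "z \<in> V" for z
      using that by (simp add: X_def)
    \<comment> \<open>the spectral projection \<open>(T\<^sup>2 - 1) (T - \<mu>\<inverse>)\<close> onto the \<open>\<mu>\<close>-eigenspace\<close>
    have part: "\<exists>c'\<in>V. T c' = inverse \<mu> \<star> c' \<and> om n c c' = 1"
      if c: "c \<in> V" "c \<noteq> 0" "T c = \<mu> \<star> c" and mu: "\<mu> = \<kappa> \<or> \<mu> = inverse \<kappa>" for c \<mu>
    proof -
      have mu0: "\<mu> \<noteq> 0" "\<mu>\<^sup>2 \<noteq> 1" "\<mu> + inverse \<mu> = ?t" using mu lam lam1 by auto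
      obtain z where z: "z \<in> V" "om n c z = 1" using om_complement[OF c(1,2)] by blast
      let ?d = "T (X z) - \<mu> \<star> X z"
      have Xz: "X z \<in> U" using XY[OF z(1)] z(1) by (simp add: U_def XY_comm)
      have Td: "T ?d = inverse \<mu> \<star> ?d"
        using Ueq[OF Xz] mu0 unfolding mu0(3)[symmetric] by (simp add: fun_eq_iff algebra_simps)
      have ct: "om n c (T y) = inverse \<mu> * om n c y" for y using ev_om[OF c(3) mu0(1) c(1)] .
      have cX: "om n c (X z) = inverse \<mu> - \<mu>"
        using om_X[OF c(1) z(1)] ev_XY(1)[OF c(3) mu0(1) c(1)] z(2) by (simp add: algebra_simps)
      have "om n c ?d = (inverse \<mu> - \<mu>) * (inverse \<mu> - \<mu>)"
        unfolding om_simps ct cX by (simp add: algebra_simps)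
      moreover have "inverse \<mu> - \<mu> \<noteq> 0" using mu0 by (auto simp: field_simps power2_eq_square)
      ultimately have "om n c ?d \<noteq> 0" by simp
      thus ?thesis by (intro normalize_partner[OF _ Td]) auto
    qed
    have "X u0 \<in> U" using XY[OF u0(1)] u0(1) by (simp add: U_def XY_comm)
    then obtain a \<mu> where a: "a \<in> V" "a \<noteq> 0" "T a = \<mu> \<star> a" and mu: "\<mu> = \<kappa> \<or> \<mu> = inverse \<kappa>"
      using eig[of "X u0"] u0 by blast
    have mu0: "\<mu> \<noteq> 0" "\<mu>\<^sup>2 \<noteq> 1" "\<mu> + inverse \<mu> = ?t" using mu lam lam1 by auto
    obtain b where b: "b \<in> V" "T b = inverse \<mu> \<star> b" "om n a b = 1" using part[OF a mu] by blast
    define s where "s = \<mu> - inverse \<mu>"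
    have s0: "s \<noteq> 0" using mu0 by (auto simp: s_def field_simps power2_eq_square)
    have ba: "om n b a = -1" using b(3) om_skew[of n b a] by simp
    have Xab: "X a = s \<star> a" "X b = - (s \<star> b)" "Y a = ?t \<star> a" "Y b = ?t \<star> b"
      using ev_XY[OF a(3) mu0(1) a(1)] ev_XY[OF b(2) _ b(1)] mu0 by (simp_all add: s_def fun_eq_iff algebra_simps)
    obtain v0 where v0: "v0 \<in> V" "Y v0 \<noteq> ?t \<star> v0" using A by blast
    obtain r \<epsilon> where r: "r \<in> V" "r \<noteq> 0" "T r = \<epsilon> \<star> r" and ep: "\<epsilon> = 1 \<or> \<epsilon> = -1"
    proof -
      let ?z = "Y v0 - ?t \<star> v0"
      have z: "?z \<in> V" "T (T ?z) = ?z" using XX[of ?z] XY[OF v0(1)] v0(1) by auto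
      show ?thesis
      proof (cases "T ?z = - ?z")
        case True thus ?thesis using that[of ?z "-1"] z v0 by simp
      next
        case False
        have "T (T ?z + ?z) = 1 \<star> (T ?z + ?z)" unfolding act_add z(2) by simp
        moreover have "T ?z + ?z \<noteq> 0" using False by (metis eq_neg_iff_add_eq_0)
        ultimately show ?thesis using that[of "T ?z + ?z" 1] z(1) by blast
      qed
    qed
    have tne: "?t - 2 * e \<noteq> 0" if "e = 1 \<or> e = -1" for e
    proof
      assume "?t - 2 * e = 0"
      hence "(\<kappa> + inverse \<kappa> - 2 * e) * \<kappa> = 0" by simp
      hence "\<kappa> * \<kappa> + 1 - 2 * e * \<kappa> = 0" using lam(1) by (simp add: algebra_simps)
      hence "(\<kappa> - e) * (\<kappa> - e) = 0" using that by (auto simp: algebra_simps)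
      thus False using lam(2) that by (auto simp: power2_eq_square)
    qed
    \<comment> \<open>\<open>?d\<close> is a multiple of the component of \<open>z\<close> in the
      \<open>e\<close>-eigenspace; the factor is nonzero because \<open>?t\<close> differs from
      \<open>2 * e\<close>.\<close>
    have rpart: "\<exists>r'\<in>V. T r' = e \<star> r' \<and> om n r r' = 1"
      if r: "r \<in> V" "r \<noteq> 0" "T r = e \<star> r" and e: "e = 1 \<or> e = -1" for r e
    proof -
      obtain z where z: "z \<in> V" "om n r z = 1" using om_complement[OF r(1,2)] by blast
      let ?y = "Y z - ?t \<star> z" let ?d = "T ?y + e \<star> ?y"
      have ee: "e * e = 1" "inverse e = e" "e \<noteq> 0" using e by auto
      have Ty: "T (T ?y) = ?y" using XX[of ?y] XY[OF z(1)] z(1) by auto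
      have "e \<star> ?d = e \<star> T ?y + ?y" by (simp only: scl_add scl_scl ee scl_one)
      hence Td: "T ?d = e \<star> ?d" unfolding act_add Ty act_scl by (simp only: add.commute)
      have ct: "om n r (T y) = e * om n r y" for y using ev_om[OF r(3) ee(3) r(1)] ee by simp
      have Yr: "Y r = (2 * e) \<star> r" using ev_XY(2)[OF r(3) ee(3) r(1)] unfolding ee(2) by (simp only: mult_2)
      have ry: "om n r ?y = 2 * e - ?t" using om_Y[OF r(1) z(1)] Yr z(2) by simp
      have "om n r ?d = 2 * e * (2 * e - ?t)"
        using ry ct[of ?y] by (simp only: om_simps) (simp add: algebra_simps)
      moreover have "2 * e * (2 * e - ?t) \<noteq> 0" using tne[OF e] ee two by auto
      ultimately have "om n r ?d \<noteq> 0" by simp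
      thus ?thesis using z(1) by (intro normalize_partner[OF _ Td]) auto
    qed
    obtain r' where r': "r' \<in> V" "T r' = \<epsilon> \<star> r'" "om n r r' = 1" using rpart[OF r ep] by blast
    have ee: "\<epsilon> * \<epsilon> = 1" "inverse \<epsilon> = \<epsilon>" "\<epsilon> \<noteq> 0" using ep by auto
    have me: "\<mu> * e \<noteq> 1" "inverse \<mu> * e \<noteq> 1" "e * \<mu> \<noteq> 1" "e * inverse \<mu> \<noteq> 1" if "e = 1 \<or> e = -1" for e
      using mu0 that by (auto simp: power2_eq_square field_simps minus_equation_iff)
    have Xr: "X z = 0" "Y z = (2 * e) \<star> z" if "z \<in> V" "T z = e \<star> z" "e = 1 \<or> e = -1" for z e
      using ev_XY[OF that(2) _ that(1)] that(3) by auto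
    obtain \<gamma> \<delta> where gd: "\<gamma> \<noteq> 0 \<or> \<delta> \<noteq> 0" and rel: "\<And>v w. v \<in> V \<Longrightarrow> w \<in> V \<Longrightarrow> om n v w = 0 \<Longrightarrow>
      \<gamma> * (om n v (X v) * om n w (X w) - (om n v (X w))\<^sup>2) + \<delta> * (om n v (Y w))\<^sup>2 = 0"
      using R2_neq[OF r2] by blast
    have perp: "om n a r = 0" "om n a r' = 0" "om n r b = 0" "om n b r' = 0" "om n r a = 0"
      using ev_perp[OF a(3) r(3)] ev_perp[OF a(3) r'(2)] ev_perp[OF r(3) b(2)] ev_perp[OF b(2) r'(2)] ev_perp[OF r(3) a(3)] me[OF ep] by auto
    \<comment> \<open>The sign in \<open>b - r'\<close> makes the pair isotropic. The symmetric form
      has zero diagonal and mixed value \<open>- s\<close> on it, the alternating form has the value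
      \<open>?t - 2 * \<epsilon>\<close>.\<close>
    have "\<gamma> * (- (s * s)) + \<delta> * (?t - 2 * \<epsilon>)\<^sup>2 = 0"
      using rel[of "a + r" "b - r'"] a b r r' perp Xab Xr[OF r(1,3) ep] Xr[OF r'(1,2) ep]
      by (simp add: power2_eq_square)
    hence nz: "\<gamma> \<noteq> 0" "\<delta> \<noteq> 0" using gd s0 tne[OF ep] by auto
    \<comment> \<open>On eigenvectors for 1 and -1 the operator \<open>X\<close> vanishes, so the
      test pair isolates \<open>\<delta>\<close>.\<close>
    have E_neg: "z = 0" if z: "z \<in> V" "T z = (- \<epsilon>) \<star> z" for z
    proof (rule ccontr)
      assume "z \<noteq> 0"
      have ep': "- \<epsilon> = 1 \<or> - \<epsilon> = -1" using ep by auto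
      obtain z' where z': "z' \<in> V" "T z' = (- \<epsilon>) \<star> z'" "om n z z' = 1" using rpart[OF z(1) \<open>z \<noteq> 0\<close> z(2) ep'] by blast
      have n1: "\<epsilon> * (- \<epsilon>) \<noteq> 1" "- \<epsilon> * \<epsilon> \<noteq> 1"
        using ee(1) two by (auto simp: minus_equation_iff one_neq_neg_one)
      have p: "om n r z' = 0" "om n z r' = 0" "om n r z = 0"
        using ev_perp[OF r(3) z'(2)] ev_perp[OF z(2) r'(2)] ev_perp[OF r(3) z(2)] n1 by auto
      have "\<delta> * (4 * \<epsilon>)\<^sup>2 = 0"
        using rel[of "r + z" "r' - z'"] r r' z z' p Xr[OF r(1,3) ep] Xr[OF r'(1,2) ep] Xr[OF z ep'] Xr[OF z'(1,2) ep']
        by (simp add: power2_eq_square)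
      thus False using nz ee pow2_nz by simp
    qed
    have all: "T v = \<epsilon> \<star> v" if v: "v \<in> V" "om n a v = 0" "om n b v = 0" for v
    proof (rule ccontr)
      assume ne: "T v \<noteq> \<epsilon> \<star> v"
      \<comment> \<open>Applying \<open>T - \<epsilon>\<close> removes the component of
        \<open>v\<close> for \<open>\<epsilon>\<close>. The one for \<open>- \<epsilon>\<close> is
        zero by \<open>E_neg\<close>, so \<open>u\<close> lies in \<open>U\<close> and yields one
        more eigenvector \<open>c\<close> for \<open>\<kappa>\<close> or its inverse.\<close>
      define u where "u = T v - \<epsilon> \<star> v"
      have aT: "om n a (T y) = inverse \<mu> * om n a y" "om n b (T y) = \<mu> * om n b y" for y
        using ev_om[OF a(3) mu0(1) a(1), of y] ev_om[OF b(2) _ b(1), of y] mu0 by auto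
      have u: "u \<in> V" "u \<noteq> 0" "om n a u = 0" "om n b u = 0" using ne v aT by (auto simp: u_def)
      let ?y = "Y u - ?t \<star> u"
      have TTz: "T (T (Y v - ?t \<star> v)) = Y v - ?t \<star> v" using XX[of "Y v - ?t \<star> v"] XY[OF v(1)] v(1) by auto
      have yT: "?y = T (Y v - ?t \<star> v) - \<epsilon> \<star> (Y v - ?t \<star> v)"
        using v by (simp add: u_def XT_comm) (simp add: fun_eq_iff algebra_simps)
      have "T ?y = (- \<epsilon>) \<star> ?y" unfolding yT act_diff[of _ _ "T _"] TTz using ee
        by (simp add: scl_diff)
      hence "?y = 0" using u by (intro E_neg) auto
      hence "u \<in> U" using u by (simp add: U_def)
      then obtain c k l where c: "c \<in> V" "c \<noteq> 0" "T c = \<kappa> \<star> c \<or> T c = inverse \<kappa> \<star> c" "c = k \<star> T u + l \<star> u"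
        using eig[OF _ u(2)] by blast
      have cab: "om n a c = 0" "om n b c = 0" using u aT by (auto simp: c(4))
      obtain \<nu> where nu: "T c = \<nu> \<star> c" "\<nu> = \<mu> \<or> \<nu> = inverse \<mu>" "\<nu> = \<kappa> \<or> \<nu> = inverse \<kappa>"
        using c(3)
      proof
        assume "T c = \<kappa> \<star> c" thus thesis using that[of \<kappa>] mu lam1(3) by auto
      next
        assume "T c = inverse \<kappa> \<star> c" thus thesis using that[of "inverse \<kappa>"] mu lam1(3) by auto
      qed
      obtain c0 where c0: "c0 \<in> V" "T c0 = inverse \<nu> \<star> c0" "om n c c0 = 1" using part[OF c(1,2) nu(1,3)] by blast
      have caba: "om n c a = 0" "om n c b = 0" using cab om_skew[of n c] by auto
      have sq: "\<mu> * \<mu> \<noteq> 1" "inverse \<mu> * inverse \<mu> \<noteq> 1" using mu0 by (auto simp: power2_eq_square field_simps)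
      obtain c' where c': "c' \<in> V" "T c' = inverse \<nu> \<star> c'" "om n c c' = 1" "om n a c' = 0" "om n b c' = 0"
      proof (cases "\<nu> = \<mu>")
        case True
        have "om n b c0 = 0" using ev_perp[OF b(2) c0(2)] True sq by simp
        thus ?thesis using that[of "c0 - om n a c0 \<star> b"] c0 b caba True by (auto simp: scl_diff mult.commute)
      next
        case False
        hence nm: "\<nu> = inverse \<mu>" using nu by blast
        have "om n a c0 = 0" using ev_perp[OF a(3) c0(2)] nm sq by simp
        thus ?thesis using that[of "c0 + om n b c0 \<star> a"] c0 a ba caba nm by (auto simp: scl_add mult.commute)
      qed
      have nu0: "\<nu> \<noteq> 0" "inverse \<nu> \<noteq> 0" "\<nu> + inverse \<nu> = ?t" "inverse \<nu> + \<nu> = ?t"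
        using nu(2) mu0 by (auto simp: add.commute)
      define s' where "s' = \<nu> - inverse \<nu>"
      have s': "s' = s \<or> s' = - s" using nu(2) by (auto simp: s'_def s_def)
      have Xc: "X c = s' \<star> c" "X c' = - (s' \<star> c')" "Y c = ?t \<star> c" "Y c' = ?t \<star> c'"
        using ev_XY[OF nu(1) nu0(1) c(1)] ev_XY[OF c'(2) nu0(2) c'(1)] nu0
        by (simp_all add: s'_def fun_eq_iff algebra_simps)
      have cc: "om n c' c = -1" using c'(3) om_skew[of n c' c] by simp
      \<comment> \<open>On these sums the alternating form of \<open>Y\<close> vanishes and the
        symmetric form is diagonal with entries \<open>- 2 * s\<close> and \<open>- 2 * s'\<close>,
        so the pair isolates \<open>\<gamma>\<close>.\<close>
      have "\<gamma> * (4 * (s * s')) = 0"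
        using rel[of "a + b" "c + c'"] a b c(1) c' cab ba cc Xab Xc by (simp add: power2_eq_square)
      thus False using nz s0 s' pow2_nz by auto
    qed
    have "\<exists>\<mu> p q \<epsilon>. \<mu> \<noteq> 0 \<and> \<mu>\<^sup>2 \<noteq> 1 \<and> \<epsilon>\<^sup>2 = 1 \<and> p \<in> V \<and> q \<in> V \<and> om n p q = 1 \<and> T p = \<mu> \<star> p \<and> T q = inverse \<mu> \<star> q \<and>
       (\<forall>v\<in>V. om n p v = 0 \<longrightarrow> om n q v = 0 \<longrightarrow> T v = \<epsilon> \<star> v)"
      using mu0 a b all ee by (intro exI[of _ \<mu>] exI[of _ a] exI[of _ b] exI[of _ \<epsilon>]) (auto simp: power2_eq_square)
    thus False using A by blast
  qed
qed

text \<open>Without the eigenvalue -1 the cube of \<open>X\<close> is zero, and Jordan blocks of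
  size 3 have to be excluded. With the eigenvalue -1 and \<open>X\<close> nonzero, the relation
  loses \<open>\<delta>\<close>; then the Gram determinant of the symmetric form vanishes on all
  pairs, isotropic or not, and the form has rank one.\<close>

lemma classify_unipotent:
  assumes r2: R2 and XY: "\<And>v. v \<in> V \<Longrightarrow> X (Y v - 2 \<star> v) = 0"
  shows "(\<forall>v\<in>V. X v = 0) \<or> (\<forall>v\<in>V. Y v = 2 \<star> v) \<or>
    (\<exists>w\<in>V. \<exists>c. w \<noteq> 0 \<and> c \<noteq> 0 \<and> Y w = 2 \<star> w \<and> (\<forall>v\<in>V. X v = (c * om n w v) \<star> w))"
proof -
  obtain \<gamma> \<delta> where gd: "\<gamma> \<noteq> 0 \<or> \<delta> \<noteq> 0" and rel: "\<And>v w. v \<in> V \<Longrightarrow> w \<in> V \<Longrightarrow> om n v w = 0 \<Longrightarrow>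
      \<gamma> * (om n v (X v) * om n w (X w) - (om n v (X w))\<^sup>2) + \<delta> * (om n v (Y w))\<^sup>2 = 0"
    using R2_neq[OF r2] by blast
  have XX: "T (T z) = z" "T' z = T z" if "z \<in> V" "X z = 0" for z
  proof -
    show "T' z = T z" using that by (simp add: X_def)
    thus "T (T z) = z" using that(1) TT(1) by metis
  qed
  \<comment> \<open>If \<open>T\<close> fixes \<open>Y v - 2 \<star> v\<close>, then
    \<open>Y\<close> multiplies this vector by 2; substituting into
    \<open>Y\<^sup>2 = X\<^sup>2 + 4\<close> gives the formula.\<close>
  have B: "X (X v) = 4 \<star> Y v - 8 \<star> v" if v: "v \<in> V" and Ty: "T (Y v - 2 \<star> v) = Y v - 2 \<star> v" for v
  proof -
    let ?y = "Y v - 2 \<star> v"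
    have "T' ?y = T ?y" using XX[of ?y] XY[OF v] v by auto
    hence "Y ?y = 2 \<star> ?y" unfolding Y_def[of ?y] Ty by (auto simp: fun_eq_iff)
    thus ?thesis using YY[OF v] by (simp add: fun_eq_iff algebra_simps)
  qed
  have X3: "X (4 \<star> Y v - 8 \<star> v) = 0" if "v \<in> V" for v
  proof -
    have "4 \<star> Y v - 8 \<star> v = 4 \<star> (Y v - 2 \<star> v)" by (simp add: scl_diff)
    thus ?thesis using XY[OF that] by (simp only: X_lin) simp
  qed
  show ?thesis
  proof (cases "\<exists>z\<in>V. z \<noteq> 0 \<and> T z = (-1) \<star> z")
    case False
    have Ty: "T (Y v - 2 \<star> v) = Y v - 2 \<star> v" if v: "v \<in> V" for v
    proof -
      let ?y = "Y v - 2 \<star> v"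
      have TTy: "T (T ?y) = ?y" using XX(1)[of ?y] XY[OF v] v by auto
      have "T (T ?y - ?y) = (-1) \<star> (T ?y - ?y)" unfolding act_diff[of _ _ "T ?y"] TTy by simp
      moreover have "T ?y - ?y \<in> V" using v by auto
      ultimately have "T ?y - ?y = 0" using False by metis
      thus ?thesis by (simp only: right_minus_eq)
    qed
    note B = B[OF _ Ty]
    have XXX: "X (X (X v)) = 0" if "v \<in> V" for v using X3[OF that] B[OF that that] by simp
    have "X (X v) = 0" if v: "v \<in> V" for v
    proof (rule ccontr)
      assume ne: "X (X v) \<noteq> 0"
      note om_left = om_X
      have sk: "om n a (X (X b)) = - om n b (X (X a))" if "a \<in> V" "b \<in> V" for a b
        using that om_skew[of n a "X (X b)"] by (simp add: om_X)
      obtain u where "u \<in> V" "om n (X (X v)) u = 1" using om_complement[OF XY_V(1) ne] by blast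
      hence u: "- u \<in> V" "om n (- u) (X (X v)) = 1" using om_skew[of n "X (X v)" u] by auto
      \<comment> \<open>Blocks of size 3 occur in dual pairs. The corrections up to \<open>f\<close>
        produce generators \<open>e\<close> and \<open>f\<close> of such a pair:
        \<open>om n e (X (X f)) = 1\<close>, while \<open>om n e f\<close>,
        \<open>om n e (X f)\<close>, \<open>om n e (X e)\<close> and \<open>om n f (X f)\<close>
        vanish.\<close>
      define p where "p = om n (- u) (X (- u))"
      define e where "e = - u - (p / 2) \<star> X v"
      have e: "e \<in> V" using u v by (simp add: e_def)
      have evv: "om n e (X (X v)) = 1"
        using u v sk[of v v] XXX[OF v] two unfolding e_def by (simp add: om_X)
      have u2: "om n v (X (X (- u))) = -1" using sk[OF v u(1)] unfolding u(2) .
      have ee: "om n e (X e) = 0"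
      proof -
        have "om n e (X e) = p - p / 2 * om n (- u) (X (X v)) + p / 2 * om n v (X (X (- u)))"
          using u(1) v XXX[OF v] unfolding e_def
          by (simp only: om_simps X_lin om_X XY_V p_def) (simp add: algebra_simps)
        also have "\<dots> = 0" unfolding u(2) u2 using two by (simp add: field_simps)
        finally show ?thesis .
      qed
      have ve: "om n v (X (X e)) = -1" using sk[OF v e] evv by simp
      define q where "q = om n v (X v)"
      define f1 where "f1 = v + (q / 2) \<star> X e"
      have f1: "f1 \<in> V" "om n e (X (X f1)) = 1" "X (X f1) = X (X v)"
        using v e evv XXX[OF e] by (auto simp: f1_def)
      have f1f: "om n f1 (X f1) = 0"
      proof -
        have "om n f1 (X f1) = q + q / 2 * om n v (X (X e)) - q / 2 * om n e (X (X v))"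
          using v e XXX[OF e] unfolding f1_def
          by (simp only: om_simps X_lin om_X XY_V q_def) (simp add: algebra_simps)
        thus ?thesis using ve evv two by simp
      qed
      define f2 where "f2 = f1 - om n e (X f1) \<star> X f1"
      have f2: "f2 \<in> V" "om n e (X (X f2)) = 1" "om n e (X f2) = 0" "om n f2 (X f2) = 0"
        using f1 e f1f XXX[OF f1(1)] sk[OF f1(1) f1(1)] two unfolding f2_def by (simp_all add: om_X)
      define f where "f = f2 - om n e f2 \<star> X (X f2)"
      have f: "f \<in> V" "om n e (X (X f)) = 1" "om n e (X f) = 0" "om n f (X f) = 0" "om n e f = 0"
        using f2 e XXX[OF f2(1)] unfolding f_def by (simp_all add: om_X)
      have ff: "om n f (X (X f)) = 0" using sk[OF f(1) f(1)] two by (simp add: eq_neg_iff_add_eq_0 flip: mult_2)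
      have ee2: "om n e (X (X e)) = 0" using sk[OF e e] two by (simp add: eq_neg_iff_add_eq_0 flip: mult_2)
      have fe: "om n f (X (X e)) = -1" using sk[OF f(1) e] f by simp
      have fe1: "om n f (X e) = 0" using om_X_sym[OF f(1) e] f by simp
      have fe0: "om n f e = 0" using om_skew[of n f e] f by simp
      \<comment> \<open>The pair \<open>e\<close>, \<open>f\<close> is isotropic and the symmetric
        form is zero on it, but \<open>om n e (Y f)\<close> is not zero; this kills
        \<open>\<delta>\<close>.\<close>
      have "om n e (X (X f)) = 4 * om n e (Y f) - 8 * om n e f" unfolding B[OF f(1) f(1)] by simp
      hence "om n e (Y f) \<noteq> 0" using f by auto
      hence d0: "\<delta> = 0" using rel[OF e f(1) f(5)] ee f by simp
      \<comment> \<open>The summand \<open>- X (X f)\<close> makes the pair isotropic. The symmetric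
        form is diagonal on it, with entries 2 and -2, which kills \<open>\<gamma>\<close>.\<close>
      let ?v = "e + X f" and ?w = "f + X e - X (X f)"
      have vw: "om n ?v ?w = 0" "om n ?v (X ?v) = 2" "om n ?w (X ?w) = -2" "om n ?v (X ?w) = 0"
        using e f ee ff ee2 fe fe1 fe0 XXX by (simp_all add: om_X)
      have "?v \<in> V" "?w \<in> V" using e f by auto
      hence "\<gamma> * (2 * (-2)) = 0" using rel[OF _ _ vw(1)] unfolding vw d0 by simp
      thus False using gd d0 pow2_nz by auto
    qed
    hence "4 \<star> (Y v - 2 \<star> v) = 0" if "v \<in> V" for v
      using B[OF that that] that by (simp only: scl_diff scl_scl) simp
    hence "Y v = 2 \<star> v" if "v \<in> V" for v
      using that pow2_nz(1) unfolding scl_eq_0 right_minus_eq by blast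
    thus ?thesis by blast
  next
    case True
    then obtain z where z: "z \<in> V" "z \<noteq> 0" "T z = (-1) \<star> z" by blast
    show ?thesis
    proof (cases "\<forall>v\<in>V. X v = 0")
      case False
      \<comment> \<open>On eigenvectors for -1 the operator \<open>Y\<close> is -2, so
        \<open>Q\<close> is multiplication by (-2)(-4) = 8 there. Hence \<open>P\<close> is the
        projection to that eigenspace, and \<open>V1\<close> is the complement perpendicular to
        it.\<close>
      define Q where "Q v = T (Y v - 2 \<star> v) - (Y v - 2 \<star> v)" for v
      define P where "P v = (1 / 8) \<star> Q v" for v
      have Qlin: "Q (v - w) = Q v - Q w" for v w unfolding Q_def by (simp add: scl_diff)
      have QV: "Q v \<in> V" "P v \<in> V" if "v \<in> V" for v using that by (auto simp: Q_def P_def)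
      have TQ: "T (Q v) = (-1) \<star> Q v" if v: "v \<in> V" for v
      proof -
        have "T (T (Y v - 2 \<star> v)) = Y v - 2 \<star> v" using XX(1)[of "Y v - 2 \<star> v"] XY[OF v] v by auto
        thus ?thesis unfolding Q_def act_diff[of _ _ "T (Y v - 2 \<star> v)"] by simp
      qed
      have TP: "T (P v) = (-1) \<star> P v" if "v \<in> V" for v using TQ[OF that] by (simp add: P_def)
      have neg: "X y = 0" "Y y = - (2 \<star> y)" if "y \<in> V" "T y = (-1) \<star> y" for y
        using ev_XY[OF that(2) _ that(1)] by (simp_all add: fun_eq_iff)
      have omQ: "om n y (Q v) = 8 * om n y v" if y: "y \<in> V" "T y = (-1) \<star> y" and v: "v \<in> V" for y v
      proof -
        have t: "om n y (T a) = - om n y a" for a using ev_om[OF y(2) _ y(1)] by simp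
        have "om n y (Y v) = - 2 * om n y v" using om_Y[OF y(1) v] neg[OF y] by simp
        thus ?thesis unfolding Q_def om_simps t by (simp add: algebra_simps)
      qed
      have omP: "om n y (P v) = om n y v" if "y \<in> V" "T y = (-1) \<star> y" "v \<in> V" for y v
        using omQ[OF that] pow2_nz by (simp add: P_def)
      define V1 where "V1 = {v \<in> V. Q v = 0}"
      have perp: "om n y v = 0" "om n v y = 0" if "y \<in> V" "T y = (-1) \<star> y" "v \<in> V1" for y v
        using omQ[OF that(1,2), of v] that(3) pow2_nz om_skew[of n v y] by (auto simp: V1_def)
      have PV1: "v - P v \<in> V1" if v: "v \<in> V" for v
      proof -
        define r where "r = v - P v"
        have r: "r \<in> V" using v QV by (auto simp: r_def)
        have z0: "om n y r = 0" if "y \<in> V" "T y = (-1) \<star> y" for y using omP[OF that v] by (simp add: r_def)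
        have "P r = 0"
        proof (rule om_nondeg[of _ n])
          fix a assume a: "a \<in> V"
          have "om n (P r) a = om n (P r) (P a)" using omP[OF QV(2)[OF r] TP[OF r] a] by simp
          also have "\<dots> = - om n (P a) (P r)" by (rule om_skew)
          also have "om n (P a) (P r) = om n (P a) r" by (rule omP[OF QV(2)[OF a] TP[OF a] r])
          also have "\<dots> = 0" by (rule z0[OF QV(2)[OF a] TP[OF a]])
          finally show "om n (P r) a = 0" by simp
        qed (rule QV(2)[OF r])
        hence "Q r = 0" using pow2_nz by (simp add: P_def)
        thus ?thesis using r by (simp add: V1_def r_def)
      qed
      have QX: "Q (X v) = X (Q v)" if "v \<in> V" for v
        using that by (simp add: Q_def XT_comm XY_comm)
      have XV1: "X v \<in> V1" if "v \<in> V1" for v using that QX[of v] by (auto simp: V1_def)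
      have B1: "X (X v) = 4 \<star> Y v - 8 \<star> v" if v: "v \<in> V1" for v
        using v by (intro B) (auto simp: V1_def Q_def)
      obtain v0 where v0: "v0 \<in> V1" "X v0 \<noteq> 0"
      proof -
        obtain v where v: "v \<in> V" "X v \<noteq> 0" using False by blast
        have "X (v - P v) = X v" using neg(1)[OF QV(2)[OF v(1)] TP[OF v(1)]] by simp
        thus ?thesis using that[of "v - P v"] PV1[OF v(1)] v(2) by simp
      qed
      obtain w1 where w1: "w1 \<in> V1" "w1 \<noteq> 0" "X w1 = 0"
      proof (cases "X (X v0) = 0")
        case True thus ?thesis using that[of "X v0"] v0 XV1 by blast
      next
        case False
        have "X (X (X v0)) = 0" using X3[of v0] v0(1) unfolding B1[OF v0(1)] by (simp add: V1_def)
        thus ?thesis using that[of "X (X v0)"] False XV1[OF XV1[OF v0(1)]] by blast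
      qed
      have w1V: "w1 \<in> V" using w1 by (simp add: V1_def)
      have Yw1: "Y w1 = 2 \<star> w1"
      proof -
        have Tw: "T (T w1) = w1" "Y w1 = 2 \<star> T w1" using XX[OF w1V w1(3)] by (auto simp: Y_def fun_eq_iff)
        have "4 \<star> (w1 - T w1) = Q w1" unfolding Q_def Tw(2) act_diff act_scl Tw(1) by (simp add: fun_eq_iff algebra_simps)
        hence "w1 - T w1 = 0" using w1(1) pow2_nz by (simp add: V1_def)
        thus ?thesis using Tw(2) by simp
      qed
      obtain u1 where u1: "u1 \<in> V1" "om n u1 w1 = 1"
      proof -
        obtain u where u: "u \<in> V" "om n w1 u = 1" using om_complement[OF w1V w1(2)] by blast
        let ?u = "u - P u"
        have "om n w1 ?u = 1" using perp(2)[OF QV(2)[OF u(1)] TP[OF u(1)] w1(1)] u by simp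
        hence "om n (- ?u) w1 = 1" unfolding om_simps(5) by (simp only: om_skew[of n "?u" w1] minus_minus)
        moreover have "Q (- ?u) = 0" using PV1[OF u(1)] Qlin[of 0 ?u] Qlin[of 0 0] by (simp add: V1_def)
        hence "- ?u \<in> V1" using u(1) QV(2)[OF u(1)] unfolding V1_def by (intro CollectI conjI vs_closed)
        ultimately show ?thesis using that by blast
      qed
      have u1V: "u1 \<in> V" using u1 by (simp add: V1_def)
      obtain z' where z': "z' \<in> V" "T z' = (-1) \<star> z'" "om n z z' = 1"
      proof -
        obtain u where u: "u \<in> V" "om n z u = 1" using om_complement[OF z(1,2)] by blast
        thus ?thesis using normalize_partner[OF QV(1)[OF u(1)] TQ[OF u(1)], of z] omQ[OF z(1,3) u(1)] pow2_nz that by auto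
      qed
      \<comment> \<open>\<open>X\<close> vanishes on \<open>w1 - z'\<close>, while \<open>Y\<close>
        has the eigenvalues 2 and -2 on the two summands; together with the minus sign the pairing
        becomes 4.\<close>
      have "\<delta> * 16 = 0"
        using rel[of "u1 + z" "w1 - z'"] u1V w1V z z' u1 w1 Yw1 neg[OF z(1,3)] neg[OF z'(1,2)]
          perp[OF z(1,3) w1(1)] perp[OF z'(1,2) u1(1)] by (simp add: power2_eq_square)
      hence d0: "\<delta> = 0" and g0: "\<gamma> \<noteq> 0" using gd pow2_nz by auto
      \<comment> \<open>The eigenvectors \<open>z\<close> and \<open>z'\<close> supply a correction
        that makes an arbitrary pair in \<open>V1\<close> isotropic without affecting the symmetric
        form.\<close>
      have D1: "om n v (X v) * om n w (X w) = (om n v (X w))\<^sup>2" if vw: "v \<in> V1" "w \<in> V1" for v w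
      proof -
        have V: "v \<in> V" "w \<in> V" using vw by (auto simp: V1_def)
        have "\<gamma> * (om n v (X v) * om n w (X w) - (om n v (X w))\<^sup>2) = 0"
          using rel[of "v + z" "w - om n v w \<star> z'"] V z z' neg[OF z(1,3)] neg[OF z'(1,2)] d0
            perp[OF z(1,3) vw(2)] perp[OF z'(1,2) vw(1)] perp[OF z(1,3) XV1[OF vw(1)]] perp[OF z(1,3) XV1[OF vw(2)]]
            perp[OF z'(1,2) XV1[OF vw(2)]] by simp
        thus ?thesis using g0 by simp
      qed
      have red: "X v = X (v - P v)" "om n v (X w) = om n (v - P v) (X (w - P w))" if "v \<in> V" "w \<in> V" for v w
      proof -
        have 0: "X (P a) = 0" if "a \<in> V" for a using neg(1)[OF QV(2)[OF that] TP[OF that]] .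
        show "X v = X (v - P v)" using 0[OF that(1)] by simp
        have "om n (P v) (X (w - P w)) = 0" by (rule perp(1)[OF QV(2) TP XV1[OF PV1]]) (use that in auto)
        thus "om n v (X w) = om n (v - P v) (X (w - P w))" using 0[OF that(2)] by simp
      qed
      have D: "om n v (X v) * om n w (X w) = (om n v (X w))\<^sup>2" if "v \<in> V" "w \<in> V" for v w
        unfolding red(2)[OF that] red(2)[OF that(1,1)] red(2)[OF that(2,2)] by (rule D1[OF PV1 PV1]) (use that in auto)
      obtain a where a: "a \<in> V" "om n a (X a) \<noteq> 0"
      proof (rule ccontr)
        assume "\<not> thesis"
        hence "\<And>v. v \<in> V \<Longrightarrow> om n v (X v) = 0" using that by blast
        hence "X v = 0" if "v \<in> V" for v
          by (intro skew_form_zero[where Z = X]) (use that om_X_sym in \<open>auto simp: lin_def\<close>)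
        thus False using False by blast
      qed
      define \<sigma> where "\<sigma> = om n a (X a)"
      define w where "w = X a"
      have wV: "w \<in> V" by (simp add: w_def)
      have w0: "w \<noteq> 0" using a by (auto simp: w_def)
      have aw: "om n a (X v) = om n v w" if "v \<in> V" for v using om_X_sym[OF a(1) that] by (simp add: w_def)
      \<comment> \<open>Polarising the vanishing determinant of \<open>a\<close> and
        \<open>y\<close> in \<open>y\<close> exhibits the symmetric form as a multiple of the square
        of a linear functional.\<close>
      have pol: "\<sigma> * om n v (X u) = om n v w * om n u w" if "v \<in> V" "u \<in> V" for v u
      proof -
        have "\<sigma> * om n y (X y) = (om n y w)\<^sup>2" if "y \<in> V" for y using D[OF a(1) that] aw[OF that] by (simp add: \<sigma>_def)
        from this[of v] this[of u] this[of "v + u"] that om_X_sym[OF that]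
        have "\<sigma> * om n v (X v) = (om n v w)\<^sup>2" "\<sigma> * om n u (X u) = (om n u w)\<^sup>2"
          "\<sigma> * (om n v (X v) + om n v (X u) + (om n v (X u) + om n u (X u))) = (om n v w + om n u w)\<^sup>2"
          by (simp_all add: add.assoc)
        hence "2 * (\<sigma> * om n v (X u)) = 2 * (om n v w * om n u w)"
          by (simp add: power2_eq_square algebra_simps)
        thus ?thesis using two by simp
      qed
      have Xu: "X u = ((- 1 / \<sigma>) * om n w u) \<star> w" if u: "u \<in> V" for u
      proof (rule om_eqI[of _ n])
        fix v assume v: "v \<in> V"
        have "om n v (X u) = om n v w * om n u w / \<sigma>" using pol[OF v u] a(2) by (simp add: \<sigma>_def field_simps)
        thus "om n (X u) v = om n (((- 1 / \<sigma>) * om n w u) \<star> w) v"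
          using om_skew[of n "X u" v] om_skew[of n v w] om_skew[of n u w] by (simp add: field_simps)
      qed (use wV in auto)
      have "Y w = 2 \<star> w" using XY[OF a(1)] XY_comm[OF a(1)] by (simp add: w_def)
      moreover have "- 1 / \<sigma> \<noteq> 0" using a(2) by (simp add: \<sigma>_def)
      ultimately show ?thesis using Xu w0 wV by blast
    qed simp
  qed
qed

end


section \<open>Dense Borel orbits\<close>

definition perp :: "nat \<Rightarrow> 'k::field mat \<Rightarrow> nat \<Rightarrow> (nat \<Rightarrow> 'k) set" where
  "perp n g i = {v \<in> vs (2*n). \<forall>k\<in>pairs n g i. om n k v = 0}"

definition same_pairs :: "nat \<Rightarrow> nat \<Rightarrow> 'k::field mat \<Rightarrow> 'k mat \<Rightarrow> bool" where
  "same_pairs n i g h \<longleftrightarrow> (\<forall>j<i. fcol n h j = fcol n g j \<and> fcol n h (n + j) = fcol n g (n + j))"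

lemma same_pairsD: "same_pairs n i g h \<Longrightarrow> pairs n h i = pairs n g i" "same_pairs n i g h \<Longrightarrow> perp n h i = perp n g i"
proof -
  assume "same_pairs n i g h"
  thus "pairs n h i = pairs n g i" by (auto simp: same_pairs_def pairs_def)
  thus "perp n h i = perp n g i" by (simp add: perp_def)
qed

lemma pairs_Suc: "pairs n g (Suc i) = insert (fcol n g i) (insert (fcol n g (n + i)) (pairs n g i))"
  by (auto simp: pairs_def less_Suc_eq)

lemma perp_Suc: "perp n g (Suc i) = {v \<in> perp n g i. om n (fcol n g i) v = 0 \<and> om n (fcol n g (n + i)) v = 0}"
  by (auto simp: perp_def pairs_Suc)

lemma perp_vs [dest]: "v \<in> perp n g i \<Longrightarrow> v \<in> vs (2*n)" by (simp add: perp_def)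

lemma perp_closed: "v \<in> perp n g i \<Longrightarrow> w \<in> perp n g i \<Longrightarrow> v + w \<in> perp n g i"
  "v \<in> perp n g i \<Longrightarrow> w \<in> perp n g i \<Longrightarrow> v - w \<in> perp n g i" "v \<in> perp n g i \<Longrightarrow> c \<star> v \<in> perp n g i"
  "v \<in> perp n g i \<Longrightarrow> - v \<in> perp n g i"
  by (simp_all add: perp_def)

lemma perp_om: "v \<in> perp n g i \<Longrightarrow> k \<in> pairs n g i \<Longrightarrow> om n k v = 0 \<and> om n v k = 0"
proof -
  assume "v \<in> perp n g i" "k \<in> pairs n g i"
  hence "om n k v = 0" by (simp add: perp_def)
  thus ?thesis by (simp add: om_skew[of n v k])
qed

lemma perp_om_col: "v \<in> perp n g i \<Longrightarrow> j < i \<Longrightarrow>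
    om n (fcol n g j) v = 0 \<and> om n (fcol n g (n + j)) v = 0 \<and> om n v (fcol n g j) = 0 \<and> om n v (fcol n g (n + j)) = 0"
  using perp_om[of v n g i] by (auto simp: pairs_def)

lemma col_in_perp:
  assumes "g \<in> carrier (Sp n)" "i \<le> j" "j < n" shows "fcol n g j \<in> perp n g i" "fcol n g (n + j) \<in> perp n g i"
  using pairs_perp[OF assms] by (auto simp: perp_def)

lemma pairs_or_perp:
  assumes "g \<in> carrier (Sp n)" "j < 2*n" shows "fcol n g j \<in> pairs n g i \<or> fcol n g j \<in> perp n g i"
proof (cases "j < n")
  case True thus ?thesis using col_in_perp[OF assms(1), of i j] by (cases "j < i") (auto simp: pairs_def)
next
  case False
  define l where "l = j - n"
  have "l < n" "j = n + l" using False assms(2) by (auto simp: l_def)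
  thus ?thesis using col_in_perp[OF assms(1), of i l] by (cases "l < i") (auto simp: pairs_def)
qed

lemma perp_eq_0:
  assumes g: "g \<in> carrier (Sp n)" and v: "v \<in> perp n g i" and 0: "\<And>u. u \<in> perp n g i \<Longrightarrow> om n u v = 0"
  shows "v = 0"
proof (rule om_col_eqI[OF g])
  fix j assume "j < 2*n"
  thus "om n (fcol n g j) v = om n (fcol n g j) 0"
    using pairs_or_perp[OF g, of j i] 0 perp_om[OF v] by auto
qed (use v in auto)

lemma perp_n: "g \<in> carrier (Sp n) \<Longrightarrow> v \<in> perp n g n \<Longrightarrow> v = 0"
proof (rule om_col_eqI)
  fix j assume "g \<in> carrier (Sp n)" "v \<in> perp n g n" "j < 2*n"
  moreover have "fcol n g j \<in> pairs n g n"
  proof (cases "j < n")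
    case False
    hence "n + (j - n) = j" "j - n < n" using \<open>j < 2*n\<close> by auto
    thus ?thesis unfolding pairs_def by (intro UN_I[of "j - n"]) auto
  qed (auto simp: pairs_def)
  ultimately show "om n (fcol n g j) v = om n (fcol n g j) 0"
    using perp_om[of v n g n "fcol n g j"] by simp
qed auto

lemma perp_partner:
  assumes "g \<in> carrier (Sp n)" "v \<in> perp n g i" "v \<noteq> 0"
  shows "\<exists>u\<in>perp n g i. om n v u = 1"
proof -
  obtain u where u: "u \<in> perp n g i" "om n u v \<noteq> 0" using perp_eq_0[OF assms(1,2)] assms(3) by blast
  hence "om n v u \<noteq> 0" using om_skew[of n v u] by simp
  thus ?thesis using u by (intro bexI[of _ "inverse (om n v u) \<star> u"]) (auto intro: perp_closed)
qed

text \<open>Gram-Schmidt against the first \<open>i\<close> pairs; inside the complement,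
  \<open>w\<close> can be replaced by its component there.\<close>

lemma perp_component:
  assumes g: "g \<in> carrier (Sp n)" and w: "w \<in> vs (2*n)"
  shows "i \<le> n \<Longrightarrow> \<exists>u\<in>perp n g i. \<forall>v\<in>perp n g i. om n w v = om n u v"
proof (induction i)
  case 0 thus ?case using w by (intro bexI[of _ w]) (auto simp: perp_def pairs_def)
next
  case (Suc i)
  then obtain u where u: "u \<in> perp n g i" "\<And>v. v \<in> perp n g i \<Longrightarrow> om n w v = om n u v" by auto
  let ?e = "fcol n g i" and ?f = "fcol n g (n + i)"
  let ?u = "u - om n u ?f \<star> ?e + om n u ?e \<star> ?f"
  have p: "?e \<in> perp n g i" "?f \<in> perp n g i" using col_in_perp[OF g, of i i] Suc.prems by auto
  have "?u \<in> perp n g i" using u p by (intro perp_closed)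
  moreover have "om n ?e ?u = 0" "om n ?f ?u = 0"
    using g Suc.prems om_skew[of n ?e u] om_skew[of n ?f u] by (simp_all del: Sp_om)
  ultimately have "?u \<in> perp n g (Suc i)" by (simp add: perp_Suc)
  moreover have "om n w v = om n ?u v" if "v \<in> perp n g (Suc i)" for v
    using u(2)[of v] that by (simp add: perp_Suc)
  ultimately show ?case by blast
qed

text \<open>The frames \<open>\<delta> t * g\<close> share the first \<open>i\<close> pairs with
  \<open>g\<close>, and it is enough to treat generic ones. The condition \<open>F\<close> is
  generic because it holds at parameter 1, the condition \<open>G\<close> because it holds at
  \<open>g\<close> itself.\<close>

lemma density_step:
  fixes g :: "'k::alg_closed_field mat"
  assumes g: "g \<in> carrier (Sp n)" and d: "tcurve n (pairs n g i) \<delta>"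
    and F: "pf (2*n) F" "F (\<delta> 1 * g) \<noteq> 0" and G: "pf (2*n) G" "G g \<noteq> 0"
    and step: "\<And>h. h \<in> carrier (Sp n) \<Longrightarrow> F h \<noteq> 0 \<Longrightarrow> G h \<noteq> 0 \<Longrightarrow> same_pairs n i g h \<Longrightarrow> zc n S h"
  shows "zc n S g"
proof -
  have c: "pcurve (2*n) (\<lambda>t. \<delta> t * g)" using d g by (auto simp: tcurve_def)
  obtain p q where p: "\<And>t. F (\<delta> t * g) = poly p t" and q: "\<And>t. G (\<delta> t * g) = poly q t"
    using pf_pcurve[OF F(1) c] pf_pcurve[OF G(1) c] by auto
  have d0: "\<delta> 0 * g = g" using d g left_mult_one_mat[OF Sp_carrier_mat[OF g]] by (simp add: tcurve_def)
  have "p \<noteq> 0" "q \<noteq> 0" using p[of 1] q[of 0] F(2) G(2) d0 by auto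
  hence pq: "p * q \<noteq> 0" by simp
  have "zc n S (\<delta> t * g)" if "poly (p * q) t \<noteq> 0" for t
  proof (rule step)
    have dS: "\<delta> t \<in> carrier (Sp n)" by (rule tcurve_Sp[OF d])
    show "\<delta> t * g \<in> carrier (Sp n)" using dS g by simp
    show "same_pairs n i g (\<delta> t * g)"
      unfolding same_pairs_def
    proof (intro allI impI)
      fix j assume "j < i"
      hence "fcol n g j \<in> pairs n g i" "fcol n g (n + j) \<in> pairs n g i" by (auto simp: pairs_def)
      thus "fcol n (\<delta> t * g) j = fcol n g j \<and> fcol n (\<delta> t * g) (n + j) = fcol n g (n + j)"
        using d dS g by (simp add: act_mult tcurve_def)
    qed
  qed (use that p q in auto)
  from zc_curve[OF c _ pq this] show ?thesis using g d0 by simp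
qed

lemma sqrt_exists: "\<exists>c. c * c = (a :: 'k::alg_closed_field)"
proof -
  have "\<exists>c. poly [:- a, 0, 1:] c = 0" by (rule alg_closed_imp_poly_has_root) simp
  thus ?thesis by auto
qed

lemma pf_fcol [simp]: "j < 2*n \<Longrightarrow> pf (2*n) (\<lambda>h. fcol n h j k)"
  by (intro pf_act) auto

text \<open>The orthogonality conditions below \<open>j\<close> come from \<open>u\<close> lying in
  the complement, which also guarantees that the first \<open>j\<close> pairs stay
  unchanged.\<close>

lemma move_perp:
  fixes g :: "'k::alg_closed_field mat"
  assumes two: "(2::'k) \<noteq> 0" and g: "g \<in> carrier (Sp n)" and i: "i < n" and ji: "j \<le> i"
    and u: "u \<in> perp n g j" and u1: "om n (fcol n g i) u = 1" and u0: "\<And>l. j \<le> l \<Longrightarrow> l < i \<Longrightarrow> om n (fcol n g l) u = 0"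
  shows "\<exists>b\<in>Bstd n. fcol n (g * b) i = fcol n g i \<and> fcol n (g * b) (n + i) = u \<and>
    (\<forall>l<2*n. l \<noteq> i \<longrightarrow> l \<noteq> n + i \<longrightarrow> fcol n (g * b) l = fcol n g l + om n u (fcol n g l) \<star> fcol n g i) \<and>
    same_pairs n j g (g * b)"
proof -
  obtain b where b: "b \<in> Bcon n" "fcol n (g * b) i = fcol n g i" "fcol n (g * b) (n + i) = u"
    "\<And>l. l < 2*n \<Longrightarrow> l \<noteq> i \<Longrightarrow> l \<noteq> n + i \<Longrightarrow> fcol n (g * b) l = fcol n g l + om n u (fcol n g l) \<star> fcol n g i"
    using move[OF two g i _ u1] u u0 perp_om_col[OF u] by (metis not_le perp_vs)
  have "same_pairs n j g (g * b)"
    unfolding same_pairs_def using b(4) perp_om_col[OF u] ji i by auto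
  thus ?thesis using b by blast
qed

lemma scale_perp:
  fixes g :: "'k::alg_closed_field mat"
  assumes "g \<in> carrier (Sp n)" "i < n" "c \<noteq> 0"
  shows "\<exists>b\<in>Bstd n. fcol n (g * b) i = c \<star> fcol n g i \<and>
    (\<forall>l<2*n. l \<noteq> i \<longrightarrow> l \<noteq> n + i \<longrightarrow> fcol n (g * b) l = fcol n g l) \<and> same_pairs n i g (g * b)"
proof -
  obtain b where b: "b \<in> Bcon n" "fcol n (g * b) i = c \<star> fcol n g i"
    "\<And>j. j < 2*n \<Longrightarrow> j \<noteq> i \<Longrightarrow> j \<noteq> n + i \<Longrightarrow> fcol n (g * b) j = fcol n g j"
    using scale_step[OF assms] by blast
  have "same_pairs n i g (g * b)" using b(3) assms(2) by (auto simp: same_pairs_def)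
  thus ?thesis using b by blast
qed

context sp_elem
begin

text \<open>If \<open>X\<^sup>2\<close> is a scalar, a generic flag has an adapted basis with \<open>S(e\<^sub>i, e\<^sub>j) = \<delta>\<^sub>i\<^sub>j\<close> for the
  quadratic form \<open>S(v, w) = om v (X w)\<close>, and then \<open>f\<^sub>i = X e\<^sub>i\<close> completes it to a symplectic basis.\<close>

lemma spherical_if_Y_scalar:
  assumes Yt: "\<And>v. v \<in> V \<Longrightarrow> Y v = t \<star> v"
  shows "spherical_class n (conj_class (Sp n) x)"
proof -
  define k where "k = t * t - 4"
  have XX: "X (X v) = k \<star> v" if "v \<in> V" for v
  proof -
    have "Y (Y v) = (t * t) \<star> v" using Yt[of "Y v"] Yt[OF that] by simp
    thus ?thesis using YY[OF that] by (simp add: k_def fun_eq_iff algebra_simps)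
  qed
  have omT: "om n a (T b) = (t * om n a b + om n a (X b)) / 2" if "b \<in> V" for a b
  proof -
    have "2 * om n a (T b) = om n a (2 \<star> T b)" by simp
    also have "\<dots> = t * om n a b + om n a (X b)" unfolding T_XY using Yt[OF that] by simp
    finally show ?thesis using two by (simp add: field_simps)
  qed
  \<comment> \<open>By \<open>omT\<close> the pairings with \<open>T\<close> are determined by those
    of the frame, which are 0, 1 or -1, and by the values of the symmetric form, which will be 0, 1,
    \<open>k\<close> or \<open>- k\<close>.\<close>
  define \<Phi> where "\<Phi> = (\<lambda>(a, b). (t * a + b) / 2) ` ({0, 1, -1} \<times> {0, 1, k, - k})"
  define N where "N i g \<longleftrightarrow> g \<in> carrier (Sp n) \<and> (\<forall>j<i. fcol n g (n + j) = X (fcol n g j))" for i g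
  have NX: "X v \<in> perp n g i" if "N i g" "i \<le> n" "v \<in> perp n g i" for i g v
  proof -
    have "om n a (X v) = 0" if "a \<in> pairs n g i" for a
    proof -
      have aV: "a \<in> V" using that pairs_vs by blast
      obtain j where j: "j < i" "a = fcol n g j \<or> a = fcol n g (n + j)" using \<open>a \<in> pairs n g i\<close> by (auto simp: pairs_def)
      have "fcol n g (n + j) = X (fcol n g j)" using \<open>N i g\<close> j(1) by (simp add: N_def)
      hence "om n (X a) v = 0" using j perp_om_col[OF \<open>v \<in> perp n g i\<close> j(1)] XX by auto
      thus ?thesis using om_X[OF aV, of v] \<open>v \<in> perp n g i\<close> by auto
    qed
    thus ?thesis by (simp add: perp_def)
  qed
  \<comment> \<open>Once \<open>X\<close> vanishes on the complement, the remaining columns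
    contribute only zeros to the symmetric form, however they are chosen.\<close>
  have terminal: "g \<in> good n x \<Phi>" if N: "N i g" and i: "i \<le> n" and X0: "\<And>v. v \<in> perp n g i \<Longrightarrow> X v = 0" for i g
  proof -
    have g: "g \<in> carrier (Sp n)" using N by (simp add: N_def)
    have val: "om n (fcol n g a) (X (fcol n g b)) \<in> {0, 1, k, - k}" if ab: "a < 2*n" "b < 2*n" for a b
    proof (cases "fcol n g b \<in> perp n g i")
      case True thus ?thesis using X0 by simp
    next
      case False
      hence "fcol n g b \<in> pairs n g i" using pairs_or_perp[OF g ab(2)] by blast
      then obtain j where j: "j < i" "fcol n g b = fcol n g j \<or> fcol n g b = fcol n g (n + j)" by (auto simp: pairs_def)
      have jn: "j < 2*n" "n + j < 2*n" using j i by auto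
      have f: "fcol n g (n + j) = X (fcol n g j)" using N j(1) by (simp add: N_def)
      have 1: "om n (fcol n g a) (fcol n g (n + j)) \<in> {0, 1}"
        using om_col[OF g ab(1) jn(2)] j i ab(1) by (auto simp: swp_def eps_def)
      have 2: "om n (fcol n g a) (k \<star> fcol n g j) \<in> {0, k, - k}"
        using om_col[OF g ab(1) jn(1)] by (auto simp: eps_def)
      show ?thesis using j(2)
      proof
        assume "fcol n g b = fcol n g j"
        thus ?thesis using 1 f by auto
      next
        assume "fcol n g b = fcol n g (n + j)"
        thus ?thesis using 2 f XX[of "fcol n g j"] by auto
      qed
    qed
    have "om n (fcol n (g * 1\<^sub>m (2*n)) a) (T (fcol n (g * 1\<^sub>m (2*n)) b)) \<in> \<Phi>" if ab: "a < 2*n" "b < 2*n" for a b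
    proof -
      have g1: "g * 1\<^sub>m (2*n) = g" using right_mult_one_mat[OF Sp_carrier_mat[OF g]] .
      have "om n (fcol n g a) (fcol n g b) \<in> {0, 1, -1}" using om_col[OF g ab] by (auto simp: eps_def)
      thus ?thesis unfolding g1 \<Phi>_def using val[OF ab] omT[of "fcol n g b" "fcol n g a"]
        by (intro image_eqI[of _ _ "(om n (fcol n g a) (fcol n g b), om n (fcol n g a) (X (fcol n g b)))"]) auto
    qed
    thus ?thesis unfolding good_def using g by (intro CollectI conjI bexI[of _ "1\<^sub>m (2*n)"]) auto
  qed
  have main: "i \<le> n \<Longrightarrow> N i g \<Longrightarrow> zc n (good n x \<Phi>) g" for i g
  proof (induction "n - i" arbitrary: i g rule: less_induct)
    case less
    have g: "g \<in> carrier (Sp n)" using less.prems by (simp add: N_def)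
    show ?case
    proof (cases "\<forall>v\<in>perp n g i. X v = 0")
      case True
      thus ?thesis using terminal[OF less.prems(2,1)] g by (auto simp: zc_def)
    next
      case False
      obtain v' where v': "v' \<in> perp n g i" "X v' \<noteq> 0" using False by blast
      have "i \<noteq> n"
      proof
        assume "i = n"
        hence "v' = 0" using v'(1) perp_n[OF g] by simp
        thus False using v'(2) by simp
      qed
      hence i: "i < n" using less.prems(1) by simp
      \<comment> \<open>If the quadratic form vanished on the complement, polarisation would make
        \<open>X\<close> vanish there.\<close>
      have "\<exists>v\<in>perp n g i. om n v (X v) \<noteq> 0"
      proof (rule ccontr)
        assume "\<not> ?thesis"
        hence 0: "om n v (X v) = 0" if "v \<in> perp n g i" for v using that by blast
        have "X w = 0" if w: "w \<in> perp n g i" for w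
        proof (rule perp_eq_0[OF g NX[OF less.prems(2,1) w]])
          fix u assume u: "u \<in> perp n g i"
          have "om n (u + w) (X (u + w)) = 0" using 0 perp_closed(1)[OF u w] by blast
          hence "2 * om n u (X w) = 0" using 0[OF u] 0[OF w] om_X_sym[OF perp_vs[OF u] perp_vs[OF w]] by simp
          thus "om n u (X w) = 0" using two by simp
        qed
        thus False using False by blast
      qed
      then obtain v where v: "v \<in> perp n g i" "om n v (X v) \<noteq> 0" by blast
      obtain \<delta> where d: "tcurve n (pairs n g i) \<delta>" "act (2*n) (\<delta> 1) (fcol n g i) = v"
      proof -
        note e = col_in_perp[OF g le_refl i]
        have "\<exists>\<gamma>. tcurve n (pairs n g i) \<gamma> \<and> act (2*n) (\<gamma> 1) (fcol n g i) = v"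
        proof (rule transK[where d = "fcol n g (n + i)" and e = "X v"])
          show "om n (fcol n g i) (fcol n g (n + i)) \<noteq> 0" using g i by (simp del: Sp_om)
          show "om n k (fcol n g (n + i)) = 0" "om n k (X v) = 0" "om n k (v - fcol n g i) = 0" if "k \<in> pairs n g i" for k
            using perp_om[OF e(2) that] perp_om[OF NX[OF less.prems(2,1) v(1)] that] perp_om[OF perp_closed(2)[OF v(1) e(1)] that] by auto
        qed (use v in auto)
        thus ?thesis using that by blast
      qed
      let ?F = "\<lambda>h. om n (fcol n h i) (T (fcol n h i))"
      show ?thesis
      proof (rule density_step[OF g d(1), of ?F "\<lambda>_. 1"])
        show "pf (2*n) ?F" using i x by (intro pf_om pf_act pf_fcol pm_const) auto
        show "?F (\<delta> 1 * g) \<noteq> 0"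
          using d(2) g tcurve_Sp[OF d(1), of 1] v om_X_self[OF perp_vs[OF v(1)]] by (simp add: act_mult)
      next
        fix h assume h: "h \<in> carrier (Sp n)" "?F h \<noteq> 0" "same_pairs n i g h"
        have Nh: "N i h" using less.prems(2) h by (simp add: N_def same_pairs_def)
        define a where "a = om n (fcol n h i) (X (fcol n h i))"
        have a0: "a \<noteq> 0" using h(2) two by (simp add: a_def om_X_self)
        \<comment> \<open>Scaling column \<open>i\<close> by \<open>c\<close> multiplies its value
          under the quadratic form by \<open>c * c\<close>, which makes it 1.\<close>
        obtain c where c: "c * c = inverse a" using sqrt_exists by blast
        have c0: "c \<noteq> 0" using c a0 by auto
        obtain b where b: "b \<in> Bstd n" "fcol n (h * b) i = c \<star> fcol n h i" "same_pairs n i h (h * b)"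
          using scale_perp[OF h(1) i c0] by blast
        let ?h = "h * b"
        have hS: "?h \<in> carrier (Sp n)" using h(1) b(1) by auto
        have N': "N i ?h" using Nh b(3) hS by (simp add: N_def same_pairs_def)
        define u where "u = X (fcol n ?h i)"
        have up: "u \<in> perp n ?h i" unfolding u_def by (rule NX[OF N' less.prems(1)]) (rule col_in_perp[OF hS le_refl i])
        have "om n (fcol n ?h i) u = c * c * a" unfolding u_def b(2) a_def by simp
        hence u1: "om n (fcol n ?h i) u = 1" using c a0 by simp
        obtain b2 where b2: "b2 \<in> Bstd n" "fcol n (?h * b2) i = fcol n ?h i" "fcol n (?h * b2) (n + i) = u"
            "same_pairs n i ?h (?h * b2)"
          using move_perp[OF two hS i le_refl up u1] by auto
        have "N (Suc i) (?h * b2)"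
          using N' b2 hS Bstd_Sp[OF b2(1)] by (auto simp: N_def same_pairs_def less_Suc_eq u_def)
        hence "zc n (good n x \<Phi>) (?h * b2)" using less.hyps[of "Suc i"] i by simp
        thus "zc n (good n x \<Phi>) h" using zc_Bstd[OF hS b2(1)] zc_Bstd[OF h(1) b(1)] by blast
      qed auto
    qed
  qed
  show ?thesis
  proof (rule spherical_criterion[OF two x])
    show "finite \<Phi>" by (simp add: \<Phi>_def)
    show "zc n (good n x \<Phi>) g" if "g \<in> carrier (Sp n)" for g
      using main[of 0 g] that by (simp add: N_def)
  qed
qed

text \<open>The element depends only on the functionals \<open>om n p\<close> and
  \<open>om n q\<close>, and it does not change when \<open>p\<close> and \<open>q\<close> are
  scaled by reciprocal factors. So it suffices to normalise the values of these functionals on a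
  frame, and the first two pairs can absorb them.\<close>

lemma spherical_if_rank_two:
  assumes n: "n \<ge> 2" and p: "p \<in> V" "T p = \<mu> \<star> p" and q: "q \<in> V" "T q = inverse \<mu> \<star> q" and pq: "om n p q = 1"
    and rest: "\<And>v. v \<in> V \<Longrightarrow> om n p v = 0 \<Longrightarrow> om n q v = 0 \<Longrightarrow> T v = v"
  shows "spherical_class n (conj_class (Sp n) x)"
proof -
  have qp: "om n q p = -1" using pq om_skew[of n q p] by simp
  have Tv: "T v = v - ((\<mu> - 1) * om n q v) \<star> p + ((inverse \<mu> - 1) * om n p v) \<star> q" if v: "v \<in> V" for v
  proof -
    let ?z = "v + om n q v \<star> p - om n p v \<star> q"
    have "T ?z = ?z" using rest[of ?z] v p q pq qp by simp
    hence "T v + (\<mu> * om n q v) \<star> p - (inverse \<mu> * om n p v) \<star> q = ?z" using p q by (simp add: mult.commute)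
    thus ?thesis by (simp add: fun_eq_iff algebra_simps)
  qed
  have omT: "om n u (T v) = om n u v - (\<mu> - 1) * (om n q v * om n u p) + (inverse \<mu> - 1) * (om n p v * om n u q)" if "v \<in> V" for u v
    by (subst Tv[OF that]) (simp add: mult.assoc)
  define \<Psi> where "\<Psi> = {0, 1, -1, 1 / 2, - 1 / 2 :: 'k}"
  define \<Phi> where "\<Phi> = (\<lambda>(a, b, c, d, e). a - (\<mu> - 1) * (b * c) + (inverse \<mu> - 1) * (d * e)) ` (\<Psi> \<times> \<Psi> \<times> \<Psi> \<times> \<Psi> \<times> \<Psi>)"
  have psi: "- a \<in> \<Psi>" if "a \<in> \<Psi>" for a using that by (auto simp: \<Psi>_def)
  let ?FA = "\<lambda>h. om n p (fcol n h 0)" and ?FB = "\<lambda>h. om n q (fcol n h 0)"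
  \<comment> \<open>The determinant of the two functionals on the first two columns; it decides
    whether the second column can be normalised.\<close>
  let ?FC = "\<lambda>h. om n p (fcol n h 0) * om n q (fcol n h 1) - om n q (fcol n h 0) * om n p (fcol n h 1)"
  have pfs: "pf (2*n) ?FA" "pf (2*n) ?FB" "pf (2*n) ?FC"
    using n by (auto intro!: pf_mult pf_diff pf_om)
  have good: "h \<in> good n x \<Phi>" if h: "h \<in> carrier (Sp n)" and F: "?FA h \<noteq> 0" "?FB h \<noteq> 0" "?FC h \<noteq> 0" for h
  proof -
    define A B where "A = ?FA h" and "B = ?FB h"
    \<comment> \<open>With these scalings \<open>p'\<close> and \<open>q'\<close> take the values 1
      and -1 on the new first column: \<open>\<alpha> * c * A = 1\<close> and
      \<open>inverse \<alpha> * c * B = c * c * A * B = -1\<close>.\<close>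
    obtain c where c: "c * c = - inverse (A * B)" using sqrt_exists by blast
    have AB: "A \<noteq> 0" "B \<noteq> 0" using F by (auto simp: A_def B_def)
    have c0: "c \<noteq> 0" using c AB by auto
    define \<alpha> where "\<alpha> = inverse (c * A)"
    have al0: "\<alpha> \<noteq> 0" using c0 AB by (simp add: \<alpha>_def)
    define p' q' where "p' = \<alpha> \<star> p" and "q' = inverse \<alpha> \<star> q"
    have pq': "om n p' q' = 1" "om n q' p' = -1" "p' \<in> V" "q' \<in> V" using pq qp al0 p q by (auto simp: p'_def q'_def)
    obtain b1 where b1: "b1 \<in> Bstd n" "fcol n (h * b1) 0 = c \<star> fcol n h 0"
        "\<And>l. l < 2*n \<Longrightarrow> l \<noteq> 0 \<Longrightarrow> l \<noteq> n + 0 \<Longrightarrow> fcol n (h * b1) l = fcol n h l"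
      using scale_perp[OF h _ c0, of 0] n by auto
    define h1 where "h1 = h * b1"
    have h1S: "h1 \<in> carrier (Sp n)" using h b1(1) by (auto simp: h1_def)
    have e0: "om n p' (fcol n h1 0) = 1" "om n q' (fcol n h1 0) = -1"
    proof -
      have "om n p' (fcol n h1 0) = \<alpha> * (c * A)" by (simp add: h1_def b1(2) p'_def A_def)
      moreover have "inverse (c * A) * (c * A) = 1" using AB c0 by (intro left_inverse) simp
      ultimately show "om n p' (fcol n h1 0) = 1" by (simp only: \<alpha>_def)
      have "om n q' (fcol n h1 0) = c * c * (A * B)" by (simp add: h1_def b1(2) q'_def \<alpha>_def B_def[symmetric])
      also have "\<dots> = - (inverse (A * B) * (A * B))" unfolding c by simp
      also have "inverse (A * B) * (A * B) = 1" using AB by (intro left_inverse) simp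
      finally show "om n q' (fcol n h1 0) = -1" .
    qed
    have e1: "fcol n h1 1 = fcol n h 1" using b1(3)[of 1] n by (simp add: h1_def)
    \<comment> \<open>Thus \<open>p' - q'\<close> becomes a multiple of the new column
      \<open>n\<close>. The second column is perpendicular to it, so both functionals take the same
      value there.\<close>
    define u where "u = (- 1 / 2) \<star> (p' - q')"
    have sk: "om n v p' = - om n p' v" "om n v q' = - om n q' v" for v by (rule om_skew)+
    have u1: "om n (fcol n h1 0) u = 1" using two by (simp add: u_def sk e0)
    obtain b2 where b2: "b2 \<in> Bstd n" "fcol n (h1 * b2) 0 = fcol n h1 0" "fcol n (h1 * b2) (n + 0) = u"
        "\<And>l. l < 2*n \<Longrightarrow> l \<noteq> 0 \<Longrightarrow> l \<noteq> n + 0 \<Longrightarrow> fcol n (h1 * b2) l = fcol n h1 l + om n u (fcol n h1 l) \<star> fcol n h1 0"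
      using move_perp[OF two h1S _ le_refl _ u1] n pq' by (auto simp: perp_def pairs_def u_def)
    define h2 where "h2 = h1 * b2"
    have h2S: "h2 \<in> carrier (Sp n)" using h1S b2(1) by (auto simp: h2_def)
    have h20: "fcol n h2 0 = fcol n h1 0" "fcol n h2 n = u" using b2 by (auto simp: h2_def)
    define \<kappa> where "\<kappa> = om n p' (fcol n h2 1)"
    have k2: "om n u (fcol n h2 1) = 0"
      using om_col_simps(4)[OF h2S, of 0 1] n h20 by simp
    have kq: "om n q' (fcol n h2 1) = \<kappa>" using k2 two by (simp add: u_def \<kappa>_def)
    have "2 * \<kappa> = om n p' (fcol n h 1) + om n q' (fcol n h 1)"
    proof -
      have "fcol n h2 1 = fcol n h 1 + om n u (fcol n h 1) \<star> fcol n h1 0" using b2(4)[of 1] n e1 by (simp add: h2_def)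
      hence "\<kappa> = om n p' (fcol n h 1) + om n u (fcol n h 1)" using e0 by (simp add: \<kappa>_def)
      thus ?thesis using two by (simp add: u_def field_simps)
    qed
    moreover have "\<alpha> * (om n p' (fcol n h 1) + om n q' (fcol n h 1)) * A = \<alpha> * \<alpha> * A * om n p (fcol n h 1) + A * om n q (fcol n h 1)"
      using al0 by (simp add: p'_def q'_def algebra_simps)
    moreover have "\<alpha> * \<alpha> * A = - B"
    proof -
      have "\<alpha> * \<alpha> = inverse (c * c) * inverse (A * A)" by (simp add: \<alpha>_def field_simps)
      thus ?thesis using c AB by (simp add: field_simps)
    qed
    ultimately have "\<alpha> * (2 * \<kappa>) * A = ?FC h" by (simp add: A_def B_def)
    hence k0: "\<kappa> \<noteq> 0" using F(3) by auto
    hence kk: "- inverse \<kappa> \<noteq> 0" by simp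
    obtain b3 where b3: "b3 \<in> Bstd n" "fcol n (h2 * b3) 1 = (- inverse \<kappa>) \<star> fcol n h2 1"
        "same_pairs n 1 h2 (h2 * b3)"
      using scale_perp[OF h2S _ kk, of 1] n by auto
    define h3 where "h3 = h2 * b3"
    have h3S: "h3 \<in> carrier (Sp n)" using h2S b3(1) by (auto simp: h3_def)
    have h30: "fcol n h3 0 = fcol n h1 0" "fcol n h3 n = u" using b3(3) h20 by (auto simp: h3_def same_pairs_def)
    have h31: "om n p' (fcol n h3 1) = -1" "om n q' (fcol n h3 1) = -1"
      unfolding h3_def b3(2) om_simps kq \<kappa>_def[symmetric] using k0 by simp_all
    \<comment> \<open>With column \<open>n + 1\<close> equal to \<open>(- 1 / 2) \<star> z\<close>,
      both \<open>p'\<close> and \<open>q'\<close> lie in the span of the columns 0,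
      \<open>n\<close> and \<open>n + 1\<close>. Every column outside the first two pairs is then
      killed by both functionals.\<close>
    define z where "z = fcol n h3 0 - p' - q'"
    have zV: "z \<in> V" using pq' by (simp add: z_def)
    have e01: "om n (fcol n h3 0) (fcol n h3 1) = 0" "om n (fcol n h3 1) (fcol n h3 0) = 0"
      using om_col_simps(1)[OF h3S, of 0 1] om_col_simps(1)[OF h3S, of 1 0] n by auto
    have e0'': "om n p' (fcol n h3 0) = 1" "om n q' (fcol n h3 0) = -1" "om n (fcol n h3 0) p' = -1" "om n (fcol n h3 0) q' = 1"
      "om n (fcol n h3 1) p' = 1" "om n (fcol n h3 1) q' = 1"
      unfolding h30(1) using e0 sk[of "fcol n h1 0"] sk[of "fcol n h3 1"] h31 by auto
    have z1: "om n (fcol n h3 1) ((- 1 / 2) \<star> z) = 1" "om n (fcol n h3 0) ((- 1 / 2) \<star> z) = 0"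
      "om n u ((- 1 / 2) \<star> z) = 0"
      using e01 two e0'' by (simp_all add: z_def u_def pq' del: One_nat_def)
    have zp: "(- 1 / 2) \<star> z \<in> perp n h3 1"
      using z1 h30 zV by (auto simp: perp_def pairs_def)
    obtain b4 where b4: "b4 \<in> Bstd n" "fcol n (h3 * b4) 1 = fcol n h3 1" "fcol n (h3 * b4) (n + 1) = (- 1 / 2) \<star> z"
        "same_pairs n 1 h3 (h3 * b4)"
      using move_perp[OF two h3S _ le_refl zp z1(1)] n by auto
    define k where "k = h3 * b4"
    have kS: "k \<in> carrier (Sp n)" using h3S b4(1) by (auto simp: k_def)
    have k4: "fcol n k 0 = fcol n h3 0" "fcol n k n = u" "fcol n k 1 = fcol n h3 1" "fcol n k (n + 1) = (- 1 / 2) \<star> z"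
      using b4 h30 by (auto simp: k_def same_pairs_def)
    have vals: "om n p' (fcol n k j) \<in> \<Psi> \<and> om n q' (fcol n k j) \<in> \<Psi>" if j: "j < 2*n" for j
    proof -
      have "j \<in> {0, 1, n, n + 1} \<or> (j \<noteq> 0 \<and> j \<noteq> 1 \<and> j \<noteq> n \<and> j \<noteq> n + 1)" by auto
      thus ?thesis
      proof
        assume "j \<in> {0, 1, n, n + 1}"
        thus ?thesis using e0 h31 h30 two pq' by (auto simp: k4 k4(3)[unfolded One_nat_def] k4(4)[unfolded add_Suc_right One_nat_def add_0_right] u_def z_def \<Psi>_def)
      next
        assume jj: "j \<noteq> 0 \<and> j \<noteq> 1 \<and> j \<noteq> n \<and> j \<noteq> n + 1"
        have "swp n j \<noteq> 0" "swp n j \<noteq> 1" "swp n j \<noteq> n" "swp n j \<noteq> n + 1" using jj j by (auto simp: swp_def split: if_splits)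
        hence o: "om n (fcol n k i) (fcol n k j) = 0" if "i \<in> {0, 1, n, n + 1}" for i
          using om_col[OF kS _ j, of i] that n j by (auto simp: swp_swp)
        have "om n u (fcol n k j) = 0" "om n z (fcol n k j) = 0" "om n (fcol n h3 0) (fcol n k j) = 0"
          using o[of n] o[of "n + 1"] o[of 0] two unfolding k4 by auto
        hence "om n p' (fcol n k j) - om n q' (fcol n k j) = 0" "om n p' (fcol n k j) + om n q' (fcol n k j) = 0"
          using two by (auto simp: u_def z_def algebra_simps)
        hence "2 * om n p' (fcol n k j) = 0" "om n q' (fcol n k j) = om n p' (fcol n k j)" by (auto simp: algebra_simps)
        thus ?thesis using two by (simp add: \<Psi>_def)
      qed
    qed
    define b where "b = b1 * b2 * b3 * b4"
    have bB: "b \<in> Bstd n" using b1 b2 b3 b4 by (simp add: b_def)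
    have hb: "h * b = k"
      using h Bstd_Sp[OF b1(1)] Bstd_Sp[OF b2(1)] Bstd_Sp[OF b3(1)] Bstd_Sp[OF b4(1)]
      unfolding b_def k_def h3_def h2_def h1_def by (intro mat_eq_act[of _ "2*n"]) (auto simp: act_mult)
    have "om n (fcol n k i) (T (fcol n k j)) \<in> \<Phi>" if ij: "i < 2*n" "j < 2*n" for i j
    proof -
      have inv: "om n q v * om n w p = om n q' v * om n w p'" "om n p v * om n w q = om n p' v * om n w q'" for v w
        using al0 by (simp_all add: p'_def q'_def)
      let ?t = "(om n (fcol n k i) (fcol n k j), om n q' (fcol n k j), om n (fcol n k i) p',
            om n p' (fcol n k j), om n (fcol n k i) q')"
      have "om n (fcol n k i) (fcol n k j) \<in> \<Psi>" using om_col[OF kS ij] by (auto simp: \<Psi>_def eps_def)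
      moreover have "om n (fcol n k i) p' \<in> \<Psi>" "om n (fcol n k i) q' \<in> \<Psi>"
        using vals[OF ij(1)] unfolding sk[of "fcol n k i"] by (simp_all add: psi)
      ultimately have "?t \<in> \<Psi> \<times> \<Psi> \<times> \<Psi> \<times> \<Psi> \<times> \<Psi>" using vals[OF ij(2)] by simp
      hence "(\<lambda>(a, b, c, d, e). a - (\<mu> - 1) * (b * c) + (inverse \<mu> - 1) * (d * e)) ?t \<in> \<Phi>"
        unfolding \<Phi>_def by (rule imageI)
      thus ?thesis
        by (simp only: omT[OF vs_closed(6), of "fcol n k i" k "bv j"] inv[of "fcol n k j" "fcol n k i"] prod.case)
    qed
    thus ?thesis unfolding good_def using h bB hb by (intro CollectI conjI bexI[of _ b]) auto
  qed
  have "p \<noteq> 0" "q \<noteq> 0" using pq by auto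
  have ne: "\<exists>g\<in>carrier (Sp n). ?FA g \<noteq> 0" "\<exists>g\<in>carrier (Sp n). ?FB g \<noteq> 0"
  proof -
    have "n > 0" using n by simp
    obtain g where g: "g \<in> carrier (Sp n)" "fcol n g 0 = q" using vector_frame[OF \<open>n > 0\<close> q(1) \<open>q \<noteq> 0\<close>] by blast
    show "\<exists>g\<in>carrier (Sp n). ?FA g \<noteq> 0" by (rule bexI[OF _ g(1)]) (simp add: g(2) pq)
    obtain g where g: "g \<in> carrier (Sp n)" "fcol n g 0 = p" using vector_frame[OF \<open>n > 0\<close> p(1) \<open>p \<noteq> 0\<close>] by blast
    show "\<exists>g\<in>carrier (Sp n). ?FB g \<noteq> 0" by (rule bexI[OF _ g(1)]) (simp add: g(2) qp)
  qed
  have "\<exists>g\<in>carrier (Sp n). ?FC g \<noteq> 0"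
  proof -
    obtain \<gamma> where ga: "tcurve n (pairs n (1\<^sub>m (2*n)) 0) \<gamma>" "act (2*n) (\<gamma> 1) (fcol n (1\<^sub>m (2*n)) 0) = p"
      "act (2*n) (\<gamma> 1) (fcol n (1\<^sub>m (2*n)) (n + 0)) = q"
      using frame_step[OF one_Sp, of 0 n p q] n p q pq by (auto simp: pairs_def)
    define g where "g = \<gamma> 1"
    have gS: "g \<in> carrier (Sp n)" using tcurve_Sp[OF ga(1)] by (simp add: g_def)
    have g0: "fcol n g 0 = p" "fcol n g n = q" using ga n by (auto simp: g_def)
    let ?a = "fcol n g 1" and ?b = "fcol n g (n + 1)"
    have o: "om n p ?a = 0" "om n p ?b = 0" "om n q ?a = 0" "om n q ?b = 0" "om n ?a ?b = 1" "om n ?a q = 0"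
      using om_col_simps[OF gS, of 0 1] om_col_simps[OF gS, of 1 1] om_col_simps[OF gS, of 1 0] n g0 by auto
    \<comment> \<open>An isotropic pair on which the determinant is 1: the functional of
      \<open>p\<close> takes the values 0 and 1 on it, that of \<open>q\<close> the values -1 and
      0.\<close>
    let ?v = "p + ?a" and ?w = "q - ?b"
    have "?v \<noteq> 0"
    proof
      assume "?v = 0"
      hence "om n ?v q = om n 0 q" by (rule arg_cong)
      thus False using pq o by simp
    qed
    moreover have "?w \<noteq> c \<star> ?v" for c
    proof
      assume "?w = c \<star> ?v"
      hence "om n p ?w = om n p (c \<star> ?v)" by (rule arg_cong)
      thus False using pq o by simp
    qed
    moreover have "om n ?v ?w = 0" using pq o by simp
    moreover have "?v \<in> V" "?w \<in> V" using p q by auto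
    ultimately obtain h where "h \<in> carrier (Sp n)" "fcol n h 0 = ?v" "fcol n h 1 = ?w"
      using isotropic_pair_frame[OF n, of ?v ?w] by blast
    thus ?thesis using pq qp o by (intro bexI[of _ h]) auto
  qed
  from this[unfolded Bex_def] obtain gC where gC: "gC \<in> carrier (Sp n)" "?FC gC \<noteq> 0" by (elim exE conjE)
  from ne(1)[unfolded Bex_def] obtain gA where gA: "gA \<in> carrier (Sp n)" "?FA gA \<noteq> 0" by (elim exE conjE)
  from ne(2)[unfolded Bex_def] obtain gB where gB: "gB \<in> carrier (Sp n)" "?FB gB \<noteq> 0" by (elim exE conjE)
  obtain gD where gD: "gD \<in> carrier (Sp n)" "?FA gD * ?FB gD \<noteq> 0"
    using Sp_irreducible[OF pfs(1,2) gA(1) gB(1) gA(2) gB(2)] by auto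
  obtain g0 where g0: "g0 \<in> carrier (Sp n)" "?FA g0 * ?FB g0 * ?FC g0 \<noteq> 0"
    using Sp_irreducible[OF pf_mult[OF pfs(1,2)] pfs(3) gD(1) gC(1) gD(2) gC(2)] by auto
  show ?thesis
  proof (rule spherical_criterion[OF two x])
    have "finite \<Psi>" by (simp add: \<Psi>_def)
    thus "finite \<Phi>" unfolding \<Phi>_def by (intro finite_imageI finite_cartesian_product)
    show "zc n (good n x \<Phi>) g" if g: "g \<in> carrier (Sp n)" for g
      unfolding zc_def
    proof (intro conjI allI impI g, rule ccontr)
      fix f assume f: "pf (2*n) f" "\<forall>s\<in>good n x \<Phi>. f s = 0" "f g \<noteq> 0"
      have P: "pf (2*n) (\<lambda>h. ?FA h * ?FB h * ?FC h)" by (intro pf_mult pfs)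
      then obtain y where "y \<in> carrier (Sp n)" "f y \<noteq> 0" "?FA y * ?FB y * ?FC y \<noteq> 0"
        using Sp_irreducible[OF f(1) P g g0(1) f(3) g0(2)] by (elim bexE conjE)
      thus False using good[of y] f(2) by auto
    qed
  qed
qed

end


lemma pairs_D [dest]: "a \<in> pairs n g i \<Longrightarrow> a \<in> vs (2*n)"
  using pairs_vs by blast

text \<open>For an involution \<open>s\<close>, a generic flag has an adapted basis in which consecutive pairs
  \<open>a = e\<^sub>i, b = e\<^sub>i\<^sub>+\<^sub>1\<close> satisfy \<open>om (P a) (P b) = 1\<close>, where \<open>P\<close> and \<open>Q\<close> project onto the
  \<open>-1\<close>- and \<open>1\<close>-eigenspaces of \<open>s\<close>; then \<open>f\<^sub>i = P b\<close> and \<open>f\<^sub>i\<^sub>+\<^sub>1 = Q a\<close> complete them. The linear form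
  \<open>om w\<close> is normalised along the way.\<close>

lemma (in sp_elem) spherical_if_involution_transvection:
  fixes s :: "(nat \<Rightarrow> 'k) \<Rightarrow> (nat \<Rightarrow> 'k)"
  assumes s_lin: "lin s" and sV: "\<And>v. v \<in> V \<Longrightarrow> s v \<in> V" and ss: "\<And>v. v \<in> V \<Longrightarrow> s (s v) = v"
    and s_om: "\<And>v u. v \<in> V \<Longrightarrow> u \<in> V \<Longrightarrow> om n (s v) (s u) = om n v u"
    and s_mat: "\<exists>A\<in>carrier_mat (2*n) (2*n). \<forall>v\<in>V. s v = act (2*n) A v"
    and w: "w \<in> V" "s w = w" and Ts: "\<And>v. v \<in> V \<Longrightarrow> T v = s v + om n w v \<star> w"
  shows "spherical_class n (conj_class (Sp n) x)"
proof -
  have s_simps [simp]: "s (a + b) = s a + s b" "s (a - b) = s a - s b" "s (c \<star> a) = c \<star> s a" "s (- a) = - s a" for a b c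
    using s_lin lin_diff[OF s_lin] lin_minus[OF s_lin] by (auto simp: lin_def)
  have adj: "om n (s v) u = om n v (s u)" if "v \<in> V" "u \<in> V" for v u
    using s_om[OF that(1) sV[OF that(2)]] ss[OF that(2)] by simp
  have skew_s: "om n v (s u) = - om n u (s v)" if "v \<in> V" "u \<in> V" for v u
    using adj[OF that(2,1)] om_skew[of n v "s u"] by simp
  \<comment> \<open>The values 2 and -2 arise from \<open>om n e (s b)\<close> for the pairs
    normalised below; the other pairings are 0, 1 or -1.\<close>
  define \<Psi> where "\<Psi> = {0, 1, -1, 2, -2 :: 'k}"
  have psi: "- a \<in> \<Psi>" if "a \<in> \<Psi>" for a using that by (auto simp: \<Psi>_def)
  have psi0: "0 \<in> \<Psi>" by (simp add: \<Psi>_def)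
  define \<Phi> where "\<Phi> = (\<lambda>(a, b, c). a + b * c) ` (\<Psi> \<times> \<Psi> \<times> \<Psi>)"
  define N where "N i g \<longleftrightarrow> g \<in> carrier (Sp n) \<and> (\<forall>v\<in>perp n g i. s v \<in> perp n g i) \<and>
      (\<forall>a\<in>pairs n g i. \<forall>b\<in>pairs n g i. om n a (s b) \<in> \<Psi>) \<and> (\<forall>a\<in>pairs n g i. om n w a \<in> \<Psi>)" for i g
  have N_same: "N i h" if "N i g" "same_pairs n i g h" "h \<in> carrier (Sp n)" for i g h
    using that same_pairsD[OF that(2)] by (simp add: N_def)
  have terminal: "g \<in> good n x \<Phi>"
    if N: "N i g" and e: "\<exists>e\<in>{1, -1}. \<forall>v\<in>perp n g i. s v = e \<star> v" and w0: "\<And>v. v \<in> perp n g i \<Longrightarrow> om n w v = 0" for i g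
  proof -
    have g: "g \<in> carrier (Sp n)" using N by (simp add: N_def)
    have S: "om n (fcol n g a) (s (fcol n g b)) \<in> \<Psi>" if ab: "a < 2*n" "b < 2*n" for a b
    proof (cases "fcol n g b \<in> perp n g i")
      case True
      then obtain e' where e': "e' \<in> {1, -1}" "s (fcol n g b) = e' \<star> fcol n g b" using e by blast
      have "om n (fcol n g a) (fcol n g b) \<in> {0, 1, -1}" using om_col[OF g ab] by (auto simp: eps_def)
      thus ?thesis using e' by (auto simp: \<Psi>_def)
    next
      case False
      hence b: "fcol n g b \<in> pairs n g i" using pairs_or_perp[OF g ab(2)] by blast
      show ?thesis
      proof (cases "fcol n g a \<in> perp n g i")
        case True
        hence "om n (s (fcol n g a)) (fcol n g b) = 0" using N perp_om[OF _ b] by (simp add: N_def)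
        thus ?thesis using adj[of "fcol n g a" "fcol n g b"] psi0 by simp
      next
        case False
        hence "fcol n g a \<in> pairs n g i" using pairs_or_perp[OF g ab(1)] by blast
        thus ?thesis using N b by (simp add: N_def)
      qed
    qed
    have W: "om n w (fcol n g a) \<in> \<Psi>" if "a < 2*n" for a
      using pairs_or_perp[OF g that, of i] N w0 psi0 by (auto simp: N_def)
    have "om n (fcol n (g * 1\<^sub>m (2*n)) a) (T (fcol n (g * 1\<^sub>m (2*n)) b)) \<in> \<Phi>" if ab: "a < 2*n" "b < 2*n" for a b
    proof -
      have g1: "g * 1\<^sub>m (2*n) = g" using right_mult_one_mat[OF Sp_carrier_mat[OF g]] .
      let ?t = "(om n (fcol n g a) (s (fcol n g b)), om n w (fcol n g b), om n (fcol n g a) w)"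
      have "om n (fcol n g a) w \<in> \<Psi>" using psi[OF W[OF ab(1)]] om_skew[of n "fcol n g a" w] by simp
      hence "(\<lambda>(a, b, c). a + b * c) ?t \<in> \<Phi>" unfolding \<Phi>_def using S[OF ab] W[OF ab(2)] by (intro imageI) simp
      thus ?thesis unfolding g1 by (subst Ts) simp_all
    qed
    thus ?thesis unfolding good_def using g by (intro CollectI conjI bexI[of _ "1\<^sub>m (2*n)"]) auto
  qed
  have zgood: "zc n (good n x \<Phi>) g" if "g \<in> good n x \<Phi>" for g
    using that by (auto simp: zc_def good_def)
  obtain A where A: "A \<in> carrier_mat (2*n) (2*n)" "\<And>v. v \<in> V \<Longrightarrow> s v = act (2*n) A v" using s_mat by blast

  \<comment> \<open>If \<open>s\<close> is the identity on the complement, one pair is enough: its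
    second vector represents the functional of \<open>w\<close> up to sign, so this functional
    vanishes on what remains and \<open>terminal\<close> applies.\<close>
  have single: "zc n (good n x \<Phi>) g"
    if i: "i < n" and N: "N i g" and s1: "\<And>v. v \<in> perp n g i \<Longrightarrow> s v = v" and th: "om n w (fcol n g i) \<noteq> 0" for i g
  proof -
    have g: "g \<in> carrier (Sp n)" using N by (simp add: N_def)
    define c where "c = inverse (om n w (fcol n g i))"
    have c0: "c \<noteq> 0" using th by (simp add: c_def)
    obtain b where b: "b \<in> Bstd n" "fcol n (g * b) i = c \<star> fcol n g i" "same_pairs n i g (g * b)"
      using scale_perp[OF g i c0] by blast
    define h where "h = g * b"
    have h: "h \<in> carrier (Sp n)" using g b(1) by (auto simp: h_def)
    have Nh: "N i h" using N_same[OF N b(3)] h by (simp add: h_def)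
    have ph: "perp n h i = perp n g i" using same_pairsD(2)[OF b(3)] by (simp add: h_def)
    have th1: "om n w (fcol n h i) = 1" using th by (simp add: h_def b(2) c_def)
    obtain u where u: "u \<in> perp n h i" "\<And>v. v \<in> perp n h i \<Longrightarrow> om n w v = om n u v"
      using perp_component[OF h w(1), of i] i by auto
    have mu: "- u \<in> perp n h i" using u(1) by (rule perp_closed)
    have ei: "fcol n h i \<in> perp n h i" using col_in_perp[OF h le_refl i] by simp
    have u1: "om n (fcol n h i) (- u) = 1" using th1 u(2)[OF ei] om_skew[of n "fcol n h i" u] by simp
    obtain b2 where b2: "b2 \<in> Bstd n" "fcol n (h * b2) i = fcol n h i" "fcol n (h * b2) (n + i) = - u" "same_pairs n i h (h * b2)"
      using move_perp[OF two h i le_refl mu u1] by auto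
    define k where "k = h * b2"
    have k: "k \<in> carrier (Sp n)" using h b2(1) by (auto simp: k_def)
    have Nk: "N i k" using N_same[OF Nh b2(4)] k by (simp add: k_def)
    have pk: "perp n k i = perp n g i" using same_pairsD(2)[OF b2(4)] ph by (simp add: k_def)
    have cols: "fcol n k i = fcol n h i" "fcol n k (n + i) = - u" using b2 by (auto simp: k_def)
    have pk': "fcol n k i \<in> perp n g i" "fcol n k (n + i) \<in> perp n g i" using col_in_perp[OF k le_refl i] pk by auto
    have "perp n k (Suc i) \<subseteq> perp n g i" unfolding perp_Suc pk by blast
    hence s1': "s v = v" if "v \<in> perp n k (Suc i)" for v using s1 that by blast
    have w0: "om n w v = 0" if "v \<in> perp n k (Suc i)" for v
      using that u(2)[of v] cols(2) by (simp add: perp_Suc pk ph)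
    have "om n w u = 0" using u(2)[OF u(1)] by simp
    have old: "om n a (s e) = 0 \<and> om n e (s a) = 0 \<and> om n e a = 0 \<and> om n a e = 0" if "a \<in> pairs n k i" "e \<in> perp n g i" for a e
    proof -
      have "a \<in> V" "e \<in> V" using that by auto
      have "om n a (s e) = 0" using s1[OF that(2)] perp_om[of e n k i a] that pk by simp
      thus ?thesis using skew_s[OF \<open>e \<in> V\<close> \<open>a \<in> V\<close>] perp_om[of e n k i a] that pk by simp
    qed
    have new: "om n e (s e') \<in> \<Psi>" if "e \<in> {fcol n k i, fcol n k (n + i)}" "e' \<in> {fcol n k i, fcol n k (n + i)}" for e e'
      using that s1[OF pk'(1)] s1[OF pk'(2)] om_col_simps[OF k i i] by (auto simp: \<Psi>_def simp del: Sp_om)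
    have "N (Suc i) k"
      unfolding N_def pairs_Suc
    proof (intro conjI ballI k)
      show "s v \<in> perp n k (Suc i)" if "v \<in> perp n k (Suc i)" for v using s1'[OF that] that by simp
      show "om n w a \<in> \<Psi>" if "a \<in> insert (fcol n k i) (insert (fcol n k (n + i)) (pairs n k i))" for a
        using that th1 \<open>om n w u = 0\<close> Nk by (auto simp: cols \<Psi>_def N_def)
      fix a e assume ae: "a \<in> insert (fcol n k i) (insert (fcol n k (n + i)) (pairs n k i))"
        "e \<in> insert (fcol n k i) (insert (fcol n k (n + i)) (pairs n k i))"
      have "a \<in> {fcol n k i, fcol n k (n + i)} \<or> a \<in> pairs n k i" "e \<in> {fcol n k i, fcol n k (n + i)} \<or> e \<in> pairs n k i" using ae by auto
      thus "om n a (s e) \<in> \<Psi>"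
        using new[of a e] old[of a e] old[of e a] pk' Nk psi0 by (elim disjE) (auto simp: N_def)
    qed
    hence "k \<in> good n x \<Phi>" by (rule terminal) (use s1' w0 in auto)
    hence "zc n (good n x \<Phi>) k" by (rule zgood)
    thus ?thesis using zc_Bstd[OF h b2(1)] zc_Bstd[OF g b(1)] by (simp add: h_def k_def)
  qed

  have pair: "\<exists>b\<in>Bstd n. N (Suc (Suc i)) (g * b)"
    if i: "Suc i < n" and N: "N i g" and A: "om n (fcol n g i) (s (fcol n g (Suc i))) \<noteq> 0"
      and th: "om n w (fcol n g i) \<noteq> 0 \<or> (\<forall>v\<in>perp n g i. om n w v = 0)" for i g
  proof -
    define P where "P v = (1 / 2) \<star> (v - s v)" for v
    define Q where "Q v = (1 / 2) \<star> (v + s v)" for v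
    have PQ: "P v \<in> V" "Q v \<in> V" "s (P v) = - P v" "s (Q v) = Q v" "v = P v + Q v" if "v \<in> V" for v
      using that sV[OF that] ss[OF that] two by (auto simp: P_def Q_def fun_eq_iff field_simps)
    have i': "i < n" using i by simp
    have g: "g \<in> carrier (Sp n)" using N by (simp add: N_def)
    \<comment> \<open>If the functional of \<open>w\<close> is zero at column \<open>i\<close>,
      hypothesis \<open>th\<close> says that it vanishes on the whole complement, and the scaling is
      trivial.\<close>
    define c where "c = (if om n w (fcol n g i) = 0 then 1 else inverse (om n w (fcol n g i)))"
    have c0: "c \<noteq> 0" by (simp add: c_def)
    obtain b1 where b1: "b1 \<in> Bstd n" "fcol n (g * b1) i = c \<star> fcol n g i" "same_pairs n i g (g * b1)"
      "\<And>l. l < 2*n \<Longrightarrow> l \<noteq> i \<Longrightarrow> l \<noteq> n + i \<Longrightarrow> fcol n (g * b1) l = fcol n g l"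
      using scale_perp[OF g i' c0] by blast
    define h1 where "h1 = g * b1"
    have h1: "h1 \<in> carrier (Sp n)" using g b1(1) by (auto simp: h1_def)
    \<comment> \<open>Chosen so that \<open>om n e (s e') = -2\<close>, which for the isotropic pair
      means \<open>om n (P e) (P e') = 1\<close>.\<close>
    define d where "d = - 2 * inverse (c * om n (fcol n g i) (s (fcol n g (Suc i))))"
    have d0: "d \<noteq> 0" using c0 A two by (simp add: d_def)
    obtain b2 where b2: "b2 \<in> Bstd n" "fcol n (h1 * b2) (Suc i) = d \<star> fcol n h1 (Suc i)" "same_pairs n (Suc i) h1 (h1 * b2)"
      using scale_perp[OF h1 i d0] by blast
    define h where "h = h1 * b2"
    have h: "h \<in> carrier (Sp n)" using h1 b2(1) by (auto simp: h_def)
    define e e' where "e = fcol n h i" and "e' = fcol n h (Suc i)"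
    have ecol: "e = c \<star> fcol n g i" using b2(3) b1(2) by (simp add: e_def h_def same_pairs_def h1_def)
    have e'col: "e' = d \<star> fcol n g (Suc i)" using b2(2) b1(4)[of "Suc i"] i by (simp add: e'_def h_def h1_def)
    have eV: "e \<in> V" "e' \<in> V" by (auto simp: e_def e'_def)
    have ee: "om n e e' = 0" "om n e' e = 0" using om_col_simps(1)[OF h i' i] om_col_simps(1)[OF h i i'] by (auto simp: e_def e'_def)
    have Aee: "om n e (s e') = -2"
    proof -
      let ?A = "om n (fcol n g i) (s (fcol n g (Suc i)))"
      have "om n e (s e') = - 2 * (inverse (c * ?A) * (c * ?A))" by (simp add: ecol e'col d_def)
      also have "inverse (c * ?A) * (c * ?A) = 1" using c0 A by (intro left_inverse) simp
      finally show ?thesis by simp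
    qed
    have Aee': "om n e' (s e) = 2" using skew_s[OF eV(2,1)] Aee by simp
    have same: "same_pairs n i g h" using b1(3) b2(3) by (auto simp: same_pairs_def h_def h1_def)
    have Nh: "N i h" using N_same[OF N same h] .
    have ph: "perp n h i = perp n g i" using same_pairsD(2)[OF same] .
    have sp: "s v \<in> perp n h i" if "v \<in> perp n h i" for v using Nh that by (simp add: N_def)
    have PQp: "P v \<in> perp n h i" "Q v \<in> perp n h i" if "v \<in> perp n h i" for v
      unfolding P_def Q_def by (intro perp_closed that sp[OF that])+
    have ep: "e \<in> perp n h i" "e' \<in> perp n h i"
      using col_in_perp(1)[OF h, of i i] col_in_perp(1)[OF h, of i "Suc i"] i by (auto simp: e_def e'_def)
    have the: "om n w e \<in> {0, 1}" and th0: "om n w e = 0 \<Longrightarrow> om n w e' = 0"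
    proof -
      show "om n w e \<in> {0, 1}" by (simp add: ecol c_def)
      assume "om n w e = 0"
      hence "om n w (fcol n g i) = 0" using c0 by (simp add: ecol)
      thus "om n w e' = 0" using th ep(2) ph by auto
    qed
    define \<theta> where "\<theta> = om n w e'"
    \<comment> \<open>The functional of \<open>w\<close> is 1 at \<open>e\<close> or vanishes at
      both vectors, so it vanishes at \<open>b\<close>. The exchange of column \<open>n + i\<close>
      for \<open>P b\<close> itself turns \<open>e'\<close> into this \<open>b\<close>, because
      \<open>om n (P b) e' = - \<theta>\<close>.\<close>
    define b where "b = e' - \<theta> \<star> e"
    have bp: "b \<in> perp n h i" unfolding b_def by (intro perp_closed ep)
    have bV: "b \<in> V" using bp by auto
    have thb: "om n w b = 0" using the th0 by (auto simp: b_def \<theta>_def)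
    have omP: "om n (P v) u = (om n v u - om n v (s u)) / 2" "om n v (P u) = (om n v u - om n v (s u)) / 2"
      "om n (Q v) u = (om n v u + om n v (s u)) / 2" "om n v (Q u) = (om n v u + om n v (s u)) / 2"
      if "v \<in> V" "u \<in> V" for v u
      using adj[OF that] by (simp_all add: P_def Q_def)
    have se0: "om n e (s e) = 0" "om n e' (s e') = 0"
      using skew_s[OF eV(1,1)] skew_s[OF eV(2,2)] two by (auto simp: eq_neg_iff_add_eq_0 simp flip: mult_2)
    have eb: "om n e (s b) = -2" "om n e b = 0" "om n b e = 0" "om n b (s e) = 2" "om n b (s b) = 0"
      using Aee Aee' ee se0 by (simp_all add: b_def)
    define u where "u = P b"
    have up: "u \<in> perp n h i" unfolding u_def by (rule PQp[OF bp])
    have u1: "om n (fcol n h i) u = 1" using omP(2)[OF eV(1) bV] eb two by (simp add: u_def e_def[symmetric])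
    have ue': "om n u e' = - \<theta>"
      using omP(1)[OF bV eV(2)] Aee ee se0 two by (simp add: u_def b_def field_simps)
    obtain b3 where b3: "b3 \<in> Bstd n" "fcol n (h * b3) i = fcol n h i" "fcol n (h * b3) (n + i) = u" "same_pairs n i h (h * b3)"
      "\<And>l. l < 2*n \<Longrightarrow> l \<noteq> i \<Longrightarrow> l \<noteq> n + i \<Longrightarrow> fcol n (h * b3) l = fcol n h l + om n u (fcol n h l) \<star> fcol n h i"
      using move_perp[OF two h i' le_refl up u1] by auto
    define k1 where "k1 = h * b3"
    have k1: "k1 \<in> carrier (Sp n)" using h b3(1) by (auto simp: k1_def)
    have k1c: "fcol n k1 i = e" "fcol n k1 (n + i) = u" "fcol n k1 (Suc i) = b"
      using b3(2,3) b3(5)[of "Suc i"] i ue' by (auto simp: k1_def e_def[symmetric] e'_def[symmetric] b_def)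
    define u2 where "u2 = Q e"
    have pk1: "perp n k1 i = perp n h i" using same_pairsD(2)[OF b3(4)] by (simp add: k1_def)
    have u2p: "u2 \<in> perp n k1 i" unfolding u2_def pk1 by (rule PQp[OF ep(1)])
    have u21: "om n (fcol n k1 (Suc i)) u2 = 1" using omP(4)[OF bV eV(1)] eb two by (simp add: u2_def k1c)
    have u2e: "om n e u2 = 0" "om n u2 e = 0" using omP(3,4)[OF eV(1,1)] se0 by (auto simp: u2_def)
    have uV: "u \<in> V" "u2 \<in> V" using PQ[OF bV] PQ[OF eV(1)] by (auto simp: u_def u2_def)
    have suu: "s u = - u" "s u2 = u2" using PQ[OF bV] PQ[OF eV(1)] by (auto simp: u_def u2_def)
    have uu: "om n u u2 = 0" "om n u2 u = 0"
    proof -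
      have "om n u u2 = - om n u u2" using s_om[OF uV] suu by simp
      thus "om n u u2 = 0" using two by (simp add: eq_neg_iff_add_eq_0 flip: mult_2)
      thus "om n u2 u = 0" using om_skew[of n u2 u] by simp
    qed
    obtain b4 where b4: "b4 \<in> Bstd n" "fcol n (k1 * b4) (Suc i) = fcol n k1 (Suc i)" "fcol n (k1 * b4) (n + Suc i) = u2"
      "same_pairs n i k1 (k1 * b4)"
      "\<And>l. l < 2*n \<Longrightarrow> l \<noteq> Suc i \<Longrightarrow> l \<noteq> n + Suc i \<Longrightarrow> fcol n (k1 * b4) l = fcol n k1 l + om n u2 (fcol n k1 l) \<star> fcol n k1 (Suc i)"
    proof -
      have "om n (fcol n k1 l) u2 = 0" if "i \<le> l" "l < Suc i" for l using that u2e k1c(1) by (cases "l = i") auto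
      thus ?thesis using move_perp[OF two k1 i le_SucI[OF le_refl] u2p u21] that by blast
    qed
    define k where "k = k1 * b4"
    have k: "k \<in> carrier (Sp n)" using k1 b4(1) by (auto simp: k_def)
    have kc: "fcol n k i = e" "fcol n k (n + i) = u" "fcol n k (Suc i) = b" "fcol n k (n + Suc i) = u2"
      using b4(2,3) b4(5)[of i] b4(5)[of "n + i"] i k1c u2e uu by (auto simp: k_def)
    have same_k: "same_pairs n i g k" using same b3(4) b4(4) by (auto simp: same_pairs_def k_def k1_def)
    have pk: "perp n k i = perp n g i" "pairs n k i = pairs n g i" using same_pairsD[OF same_k] by auto
    have Nk: "N i k" using N_same[OF N same_k k] .
    let ?new = "{e, u, b, u2}"
    have P2: "pairs n k (Suc (Suc i)) = ?new \<union> pairs n k i" unfolding pairs_Suc kc by auto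
    have newp: "?new \<subseteq> perp n k i" using ep bp up u2p by (simp add: pk pk1 ph)
    have s_e: "s e = 2 \<star> u2 - e" using two by (simp add: u2_def Q_def fun_eq_iff)
    have s_b: "s b = b - 2 \<star> u" using two by (simp add: u_def P_def fun_eq_iff)
    have oms: "om n e u = 1" "om n u e = -1" "om n b u2 = 1" "om n u2 b = -1" "om n b u = 0" "om n u b = 0"
    proof -
      show "om n e u = 1" using u1 by (simp add: e_def)
      thus "om n u e = -1" using om_skew[of n u e] by simp
      show "om n b u2 = 1" using u21 k1c by simp
      thus "om n u2 b = -1" using om_skew[of n u2 b] by simp
      show "om n b u = 0" "om n u b = 0" using omP(1,2)[OF bV bV] eb by (simp_all add: u_def)
    qed
    have new: "om n a (s a') \<in> \<Psi>" if "a \<in> ?new" "a' \<in> ?new" for a a'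
      using that by (auto simp: s_e s_b suu oms eb uu u2e \<Psi>_def)
    have old: "om n a (s a') = 0 \<and> om n a' (s a) = 0" if "a \<in> pairs n k i" "a' \<in> ?new" for a a'
    proof -
      have "a' \<in> perp n k i" using newp that by blast
      hence "s a' \<in> perp n k i" using Nk by (simp add: N_def)
      hence 0: "om n a (s a') = 0" using perp_om that by blast
      have "a \<in> V" "a' \<in> V" using that \<open>a' \<in> perp n k i\<close> by auto
      thus ?thesis using 0 skew_s[of a' a] by simp
    qed
    have inv: "s v \<in> perp n k (Suc (Suc i))" if v: "v \<in> perp n k (Suc (Suc i))" for v
    proof -
      have vp: "v \<in> perp n k i" "om n e v = 0" "om n u v = 0" "om n b v = 0" "om n u2 v = 0"
        using v by (auto simp: perp_Suc kc kc(4)[unfolded add_Suc_right])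
      have "om n a (s v) = 0" if "a \<in> ?new" for a
      proof -
        have "a \<in> V" "v \<in> V" using that newp vp(1) by auto
        hence "om n a (s v) = om n (s a) v" using adj by simp
        also have "\<dots> = 0" using that vp by (auto simp: s_e s_b suu)
        finally show ?thesis .
      qed
      thus ?thesis using vp(1) Nk by (simp add: perp_Suc kc kc(4)[unfolded add_Suc_right] N_def)
    qed
    have wu: "om n w u = 0" "om n w u2 = om n w e"
    proof -
      have "om n w (s b) = om n w b" "om n w (s e) = om n w e" using adj[OF w(1)] w(2) bV eV by auto
      thus "om n w u = 0" "om n w u2 = om n w e" using two thb by (simp_all add: u_def u2_def P_def Q_def)
    qed
    have "N (Suc (Suc i)) k"
      unfolding N_def P2
    proof (intro conjI ballI k inv)
      show "om n w a \<in> \<Psi>" if "a \<in> ?new \<union> pairs n k i" for a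
        using that the thb wu Nk by (auto simp: N_def \<Psi>_def)
      show "om n a (s a') \<in> \<Psi>" if "a \<in> ?new \<union> pairs n k i" "a' \<in> ?new \<union> pairs n k i" for a a'
        using that new[of a a'] old[of a a'] old[of a' a] Nk psi0 unfolding Un_iff by (elim disjE) (simp_all add: N_def)
    qed
    moreover have "k = g * (b1 * b2 * b3 * b4)"
      using g Bstd_Sp[OF b1(1)] Bstd_Sp[OF b2(1)] Bstd_Sp[OF b3(1)] Bstd_Sp[OF b4(1)]
      unfolding k_def k1_def h_def h1_def by (intro mat_eq_act[of _ "2*n"]) (auto simp: act_mult)
    ultimately show ?thesis using b1(1) b2(1) b3(1) b4(1) by (intro bexI[of _ "b1 * b2 * b3 * b4"]) auto
  qed

  have move_to: "\<exists>\<delta>. tcurve n (pairs n g i) \<delta> \<and> act (2*n) (\<delta> 1) (fcol n g i) = v"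
    if g: "g \<in> carrier (Sp n)" and i: "i < n" and v: "v \<in> perp n g i" "v \<noteq> 0" for i g v
  proof -
    obtain u where u: "u \<in> perp n g i" "om n v u = 1" using perp_partner[OF g v] by blast
    note e = col_in_perp[OF g le_refl i]
    show ?thesis
    proof (rule transK[where d = "fcol n g (n + i)" and e = u])
      show "om n (fcol n g i) (fcol n g (n + i)) \<noteq> 0" using g i by (simp del: Sp_om)
      show "om n k (fcol n g (n + i)) = 0" "om n k u = 0" "om n k (v - fcol n g i) = 0" if "k \<in> pairs n g i" for k
        using perp_om[OF e(2) that] perp_om[OF u(1) that] perp_om[OF perp_closed(2)[OF v(1) e(1)] that] by auto
    qed (use u v in auto)
  qed

  have main: "i \<le> n \<Longrightarrow> N i g \<Longrightarrow> zc n (good n x \<Phi>) g" for i g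
  proof (induction "n - i" arbitrary: i g rule: less_induct)
    case less
    note N = less.prems(2) and IH = less.hyps
    have g: "g \<in> carrier (Sp n)" using N by (simp add: N_def)
    have sp: "s v \<in> perp n g i" if "v \<in> perp n g i" for v using N that by (simp add: N_def)
    have iff: "i < n" if "v \<in> perp n g i" "v \<noteq> 0" for v
      using less.prems(1) perp_n[OF g, of v] that by (cases "i = n") auto
    let ?\<theta> = "\<lambda>h. om n w (fcol n h i)"
    have pf_th: "pf (2*n) ?\<theta>" if "i < n" using that w by (intro pf_om) auto
    \<comment> \<open>a generic frame has \<open>\<theta>(e\<^sub>i) \<noteq> 0\<close> unless \<open>\<theta>\<close> vanishes on the complement\<close>
    have gen_th: "zc n (good n x \<Phi>) g"
      if "\<And>h. h \<in> carrier (Sp n) \<Longrightarrow> same_pairs n i g h \<Longrightarrow> ?\<theta> h \<noteq> 0 \<or> (\<forall>v\<in>perp n g i. om n w v = 0) \<Longrightarrow> zc n (good n x \<Phi>) h"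
    proof (cases "\<forall>v\<in>perp n g i. om n w v = 0")
      case True thus ?thesis using that[OF g] by (simp add: same_pairs_def)
    next
      case False
      then obtain v where v: "v \<in> perp n g i" "om n w v \<noteq> 0" by blast
      have v0: "v \<noteq> 0" using v(2) by auto
      have i: "i < n" using iff v(1) v0 by blast
      obtain \<delta> where d: "tcurve n (pairs n g i) \<delta>" "act (2*n) (\<delta> 1) (fcol n g i) = v"
        using move_to[OF g i v(1) v0] by blast
      show ?thesis
      proof (rule density_step[OF g d(1) pf_th[OF i], of "\<lambda>_. 1"])
        show "?\<theta> (\<delta> 1 * g) \<noteq> 0" using d(2) g tcurve_Sp[OF d(1), of 1] v by (simp add: act_mult)
      qed (use that in auto)
    qed
    show ?case
    proof (cases "\<exists>e\<in>{1, -1}. \<forall>v\<in>perp n g i. s v = e \<star> v")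
      case True
      show ?thesis
      proof (cases "\<forall>v\<in>perp n g i. om n w v = 0")
        case True
        show ?thesis by (intro zgood terminal[OF N \<open>\<exists>e\<in>{1, -1}. \<forall>v\<in>perp n g i. s v = e \<star> v\<close>]) (use True in blast)
      next
        case False
        then obtain v where v: "v \<in> perp n g i" "om n w v \<noteq> 0" by blast
        have "v \<noteq> 0" using v(2) by auto
        with v(1) have i: "i < n" by (rule iff)
        have "s v \<noteq> - v"
        proof
          assume "s v = - v"
          hence "om n w v = - om n w v" using adj[OF w(1), of v] w(2) v(1) by auto
          thus False using v(2) two by (simp add: eq_neg_iff_add_eq_0 flip: mult_2)
        qed
        hence s1: "s y = y" if "y \<in> perp n g i" for y using True v(1) that by auto
        show ?thesis
        proof (rule gen_th)
          fix h assume h: "h \<in> carrier (Sp n)" "same_pairs n i g h" "?\<theta> h \<noteq> 0 \<or> (\<forall>v\<in>perp n g i. om n w v = 0)"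
          show "zc n (good n x \<Phi>) h"
            by (rule single[OF i N_same[OF N h(2,1)]]) (use s1 same_pairsD(2)[OF h(2)] h(3) v in auto)
        qed
      qed
    next
      case False
      obtain v1 v2 where v12: "v1 \<in> perp n g i" "s v1 \<noteq> v1" "v2 \<in> perp n g i" "s v2 \<noteq> - v2"
        using False by auto
      \<comment> \<open>Symmetrising a vector and a partner of the result with respect to
        \<open>s\<close> gives dual vectors in the same eigenspace.\<close>
      have eig: "\<exists>p\<in>perp n g i. \<exists>p'\<in>perp n g i. s p = e \<star> p \<and> s p' = e \<star> p' \<and> om n p p' = 1"
        if v: "v \<in> perp n g i" "s v \<noteq> (- e) \<star> v" and e: "e * e = 1" for v e
      proof -
        have vV: "v \<in> V" using v(1) by auto
        let ?p = "v + e \<star> s v"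
        have p: "?p \<in> perp n g i" by (intro perp_closed v sp)
        have "e \<star> ?p = s v + e \<star> v" using e by (simp add: scl_add)
        moreover have "s v + e \<star> v \<noteq> 0"
          using v(2) by (auto simp: fun_eq_iff eq_neg_iff_add_eq_0)
        ultimately have p0: "?p \<noteq> 0" by (metis scl_zero_right)
        have sp': "s ?p = e \<star> ?p" using ss[OF vV] e by (simp add: scl_add add.commute)
        obtain u where u: "u \<in> perp n g i" "om n ?p u = 1" using perp_partner[OF g p p0] by blast
        have uV: "u \<in> V" using u(1) by auto
        let ?q = "(1 / 2) \<star> (u + e \<star> s u)"
        have q: "?q \<in> perp n g i" by (intro perp_closed u sp)
        have sq: "s ?q = e \<star> ?q" using ss[OF uV] e by (simp add: scl_add add.commute mult.commute)
        have "om n ?p (s u) = om n (s ?p) u" using adj[OF perp_vs[OF p] uV] by simp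
        also have "\<dots> = e" unfolding sp' using u(2) by simp
        finally have "om n ?p ?q = 1" using u(2) e two by (simp only: om_simps(2,8)) simp
        thus ?thesis using p q sp' sq by blast
      qed
      obtain p p' where p: "p \<in> perp n g i" "p' \<in> perp n g i" "s p = - p" "s p' = - p'" "om n p p' = 1"
        using eig[OF v12(1), of "-1"] v12(2) by auto
      obtain q q' where q: "q \<in> perp n g i" "q' \<in> perp n g i" "s q = q" "s q' = q'" "om n q q' = 1"
        using eig[OF v12(3), of 1] v12(4) by auto
      have PV: "p \<in> V" "p' \<in> V" "q \<in> V" "q' \<in> V" using p q by auto
      have cross: "om n y z = 0" "om n z y = 0" if "y \<in> V" "z \<in> V" "s y = - y" "s z = z" for y z
      proof -
        have "om n y z = - om n y z" using s_om[OF that(1,2)] that by simp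
        thus "om n y z = 0" using two by (simp add: eq_neg_iff_add_eq_0 flip: mult_2)
        thus "om n z y = 0" using om_skew[of n z y] by simp
      qed
      \<comment> \<open>The sign makes the pair isotropic; applying \<open>s\<close> to
        \<open>b\<close> reverses one of the two contributions, so they add up to -2.\<close>
      define a b where "a = p + q" and "b = p' - q'"
      have ab: "a \<in> perp n g i" "b \<in> perp n g i" unfolding a_def b_def by (intro perp_closed p q)+
      have o: "om n a b = 0" "om n a (s b) = -2"
        using p q cross[OF PV(1,4)] cross[OF PV(2,3)] unfolding a_def b_def by simp_all
      have a0: "a \<noteq> 0" using o(2) two by auto
      have i: "i < n" using iff[OF ab(1) a0] .
      have b_not: "b \<noteq> c \<star> a" for c
      proof
        assume "b = c \<star> a"
        hence "c * om n a (s a) = -2" using o(2) by simp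
        moreover have "om n a (s a) = 0"
          using skew_s[of a a] ab(1) two by (auto simp: eq_neg_iff_add_eq_0 simp flip: mult_2)
        ultimately show False using two by simp
      qed
      \<comment> \<open>If only one pair were left, \<open>om n a (s b)\<close> would be a multiple
        of the determinant of \<open>a\<close> and \<open>b\<close> in that plane, which is
        \<open>om n a b = 0\<close>.\<close>
      have Si: "Suc i < n"
      proof (rule ccontr)
        assume "\<not> Suc i < n"
        hence n: "n = Suc i" using i by simp
        let ?e = "fcol n g i" and ?f = "fcol n g (n + i)"
        have ex: "v = om n v ?f \<star> ?e + om n ?e v \<star> ?f" if v: "v \<in> perp n g i" for v
        proof -
          let ?r = "v - (om n v ?f \<star> ?e + om n ?e v \<star> ?f)"
          have "?r \<in> perp n g i" using v col_in_perp[OF g le_refl i] by (intro perp_closed)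
          moreover have "om n ?e ?r = 0" "om n ?f ?r = 0"
            using om_col_simps[OF g i i] om_skew[of n ?f v] by (simp_all del: Sp_om om_col_simps)
          ultimately have "?r \<in> perp n g (Suc i)" by (simp add: perp_Suc)
          moreover have "perp n g (Suc i) = perp n g n" by (rule arg_cong[OF n[symmetric]])
          ultimately have "?r = 0" by (intro perp_n[OF g]) (simp only:)
          thus ?thesis by (simp only: right_minus_eq)
        qed
        have "om n a b = om n a ?f * om n ?e b - om n ?e a * om n b ?f"
          by (subst ex[OF ab(1)], subst (1) ex[OF ab(2)])
            (use om_col_simps[OF g i i] in \<open>simp add: om_skew[of n ?f] del: Sp_om om_col_simps\<close>)
        hence D: "om n a ?f * om n ?e b = om n ?e a * om n b ?f" using o(1) by simp
        have V: "?e \<in> V" "?f \<in> V" by auto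
        have z: "om n ?e (s ?e) = 0" "om n ?f (s ?f) = 0" "om n ?f (s ?e) = - om n ?e (s ?f)"
          using skew_s[OF V(1,1)] skew_s[OF V(2,2)] skew_s[OF V(2,1)] two by (auto simp: eq_neg_iff_add_eq_0 simp flip: mult_2)
        define \<alpha>1 \<beta>1 \<alpha>2 \<beta>2 where "\<alpha>1 = om n a ?f" and "\<beta>1 = om n ?e a" and "\<alpha>2 = om n b ?f" and "\<beta>2 = om n ?e b"
        have "a = \<alpha>1 \<star> ?e + \<beta>1 \<star> ?f" "b = \<alpha>2 \<star> ?e + \<beta>2 \<star> ?f"
          using ex[OF ab(1)] ex[OF ab(2)] by (simp_all add: \<alpha>1_def \<beta>1_def \<alpha>2_def \<beta>2_def)
        hence "om n a (s b) = (\<alpha>1 * \<beta>2 - \<beta>1 * \<alpha>2) * om n ?e (s ?f)"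
          by (simp only: s_simps om_simps z) (simp add: algebra_simps)
        also have "\<dots> = 0" using D by (simp add: \<alpha>1_def \<beta>1_def \<alpha>2_def \<beta>2_def)
        finally show False using o(2) two by simp
      qed
      have final: "zc n (good n x \<Phi>) h"
        if h: "h \<in> carrier (Sp n)" "same_pairs n i g h" "om n (fcol n h i) (s (fcol n h (Suc i))) \<noteq> 0"
          "?\<theta> h \<noteq> 0 \<or> (\<forall>v\<in>perp n g i. om n w v = 0)" for h
      proof -
        obtain b where b: "b \<in> Bstd n" "N (Suc (Suc i)) (h * b)"
          using pair[OF Si N_same[OF N h(2,1)] h(3)] h(4) same_pairsD(2)[OF h(2)] by auto
        have "zc n (good n x \<Phi>) (h * b)" using IH[of "Suc (Suc i)"] Si b(2) by simp
        thus ?thesis by (rule zc_Bstd[OF h(1) b(1)])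
      qed
      show ?thesis
      proof (rule gen_th)
        fix h assume h: "h \<in> carrier (Sp n)" "same_pairs n i g h" "?\<theta> h \<noteq> 0 \<or> (\<forall>v\<in>perp n g i. om n w v = 0)"
        have ph: "perp n h i = perp n g i" "pairs n h i = pairs n g i" using same_pairsD[OF h(2)] by auto
        obtain \<delta>1 where d1: "tcurve n (pairs n h i) \<delta>1" "act (2*n) (\<delta>1 1) (fcol n h i) = a"
          using move_to[OF h(1) i, of a] ab(1) a0 ph by auto
        define h1 where "h1 = \<delta>1 1 * h"
        have dS1: "\<delta>1 1 \<in> carrier (Sp n)" by (rule tcurve_Sp[OF d1(1)])
        have h1: "h1 \<in> carrier (Sp n)" using dS1 h(1) by (simp add: h1_def)
        have h1i: "fcol n h1 i = a" using d1(2) dS1 h(1) by (simp add: h1_def act_mult)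
        have sh1: "same_pairs n i h h1"
          unfolding same_pairs_def
        proof (intro allI impI)
          fix j assume "j < i"
          hence "fcol n h j \<in> pairs n h i" "fcol n h (n + j) \<in> pairs n h i" by (auto simp: pairs_def)
          thus "fcol n h1 j = fcol n h j \<and> fcol n h1 (n + j) = fcol n h (n + j)"
            using d1(1) dS1 h(1) by (simp add: act_mult tcurve_def h1_def)
        qed
        have ph1: "perp n h1 i = perp n g i" "pairs n h1 i = pairs n g i" using same_pairsD[OF sh1] ph by auto
        \<comment> \<open>The second curve also fixes \<open>a\<close>, so the product curve brings
          both columns to \<open>a\<close> and \<open>b\<close> at parameter 1.\<close>
        let ?K = "insert a (pairs n g i)"
        note cs = col_in_perp[OF h1 le_SucI[OF le_refl] Si] col_in_perp(1)[OF h1 le_refl i]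
        have o1: "om n a (fcol n h1 (Suc i)) = 0" "om n a (fcol n h1 (n + Suc i)) = 0" "om n (fcol n h1 (Suc i)) (fcol n h1 (n + Suc i)) = 1"
          using om_col_simps[OF h1 i Si] om_col_simps[OF h1 Si Si] h1i by auto
        have "\<exists>\<gamma>. tcurve n ?K \<gamma> \<and> act (2*n) (\<gamma> 1) (fcol n h1 (Suc i)) = b"
        proof (rule transK[where d = "fcol n h1 (n + Suc i)" and e = q])
          show "om n b q \<noteq> 0"
            using q(5) cross[OF PV(2,3) p(4) q(3)] om_skew[of n q' q] by (simp add: b_def)
          have aq: "om n a q = 0" using cross[OF PV(1,3) p(3) q(3)] by (simp add: a_def)
          show "om n k (fcol n h1 (n + Suc i)) = 0" "om n k q = 0" "om n k (b - fcol n h1 (Suc i)) = 0" if "k \<in> ?K" for k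
            using that o1 o(1) aq perp_om[OF cs(2)[unfolded ph1]] perp_om[OF q(1)] perp_om[OF cs(1)[unfolded ph1]] perp_om[OF ab(2)]
              perp_om[of "fcol n h1 (n + Suc i)" n h1 i] perp_om[of "fcol n h1 (Suc i)" n h1 i] cs ph1 by auto
        qed (use o1 ab q pairs_vs in auto)
        then obtain \<delta>2 where d2: "tcurve n ?K \<delta>2" "act (2*n) (\<delta>2 1) (fcol n h1 (Suc i)) = b" by blast
        have dS2: "\<delta>2 1 \<in> carrier (Sp n)" by (rule tcurve_Sp[OF d2(1)])
        let ?\<delta> = "\<lambda>t. \<delta>2 t * \<delta>1 t"
        have d: "tcurve n (pairs n h i) ?\<delta>"
          using tcurve_mult[OF tcurve_mono[OF d2(1)] d1(1) pairs_vs] ph by auto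
        have val: "fcol n (?\<delta> 1 * h) i = a" "fcol n (?\<delta> 1 * h) (Suc i) = b"
        proof -
          have "?\<delta> 1 * h = \<delta>2 1 * h1"
            using dS1 dS2 h(1) unfolding h1_def by (intro assoc_mult_mat[of _ "2*n" "2*n" _ "2*n" _ "2*n"]) auto
          moreover have "act (2*n) (\<delta>2 1) a = a" using d2(1) by (simp add: tcurve_def)
          ultimately show "fcol n (?\<delta> 1 * h) i = a" "fcol n (?\<delta> 1 * h) (Suc i) = b"
            using dS2 h1 h1i d2(2) by (simp_all add: act_mult)
        qed
        let ?F = "\<lambda>h. om n (fcol n h i) (act (2*n) A (fcol n h (Suc i)))"
        have pF: "pf (2*n) ?F" using Si A(1) by (intro pf_om pf_act pf_fcol pm_const pm_id pf_const) auto
        have F: "?F y = om n (fcol n y i) (s (fcol n y (Suc i)))" for y using A(2)[of "fcol n y (Suc i)"] by simp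
        \<comment> \<open>Where the functional vanishes on the complement, the constant 1 stands in
          for the generic condition on it.\<close>
        let ?G = "\<lambda>h. if \<forall>v\<in>perp n g i. om n w v = 0 then 1 else ?\<theta> h"
        have pG: "pf (2*n) ?G"
        proof (cases "\<forall>v\<in>perp n g i. om n w v = 0")
          case True
          show ?thesis by (rule pf_cong[OF pf_const[of _ 1]]) (rule if_P[OF True, symmetric])
        next
          case False
          show ?thesis by (rule pf_cong[OF pf_th[OF i]]) (rule if_not_P[OF False, symmetric])
        qed
        show "zc n (good n x \<Phi>) h"
        proof (rule density_step[OF h(1) d pF _ pG])
          show "?F (?\<delta> 1 * h) \<noteq> 0" unfolding val using o(2) two A(2)[OF perp_vs[OF ab(2)]] by simp
          show "?G h \<noteq> 0" using h(3) by auto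
          fix y assume y: "y \<in> carrier (Sp n)" "?F y \<noteq> 0" "?G y \<noteq> 0" "same_pairs n i h y"
          have "same_pairs n i g y" using h(2) y(4) by (simp add: same_pairs_def)
          thus "zc n (good n x \<Phi>) y" using final[OF y(1)] y(2,3) unfolding F by (auto split: if_splits)
        qed
      qed
    qed
  qed
  show ?thesis
  proof (rule spherical_criterion[OF two x])
    have "finite \<Psi>" by (simp add: \<Psi>_def)
    thus "finite \<Phi>" unfolding \<Phi>_def by (intro finite_imageI finite_cartesian_product)
    show "zc n (good n x \<Phi>) g" if "g \<in> carrier (Sp n)" for g
      using main[of 0 g] that sV by (auto simp: N_def pairs_def perp_def)
  qed
qed


section \<open>Adapted frames and the representatives\<close>

lemma uminus_conj: "g \<in> carrier (Sp n) \<Longrightarrow> y \<in> carrier_mat (2*n) (2*n) \<Longrightarrow> g * (- y) * sinv n g = - (g * y * sinv n g)"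
  by (intro mat_eq_act[of _ "2*n"]) (auto simp: act_mult)

lemma conj_class_uminus:
  assumes "x \<in> carrier (Sp n)" shows "conj_class (Sp n) (- x) = uminus ` conj_class (Sp n) x"
  unfolding conj_class_Sp using uminus_conj[of _ n x] assms by (auto simp: image_iff) (metis Sp_carrier_mat)+

lemma uminus_uminus_Sp: "x \<in> carrier (Sp n) \<Longrightarrow> - (- x) = x"
  using Sp_carrier_mat[of x n] by (intro eq_matI) auto

lemma pf_uminus_arg:
  fixes f :: "'a::field mat \<Rightarrow> 'a"
  shows "pf N f \<Longrightarrow> pf N (\<lambda>A. f (- A))"
proof (rule pf_comp[of N _ N uminus])
  have "pf N (\<lambda>A::'a mat. (- A) $$ (i, j))" if "i < N" "j < N" for i j
    using that by (intro pf_cong[OF pf_uminus[OF pf_coord[OF that]]]) simp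
  thus "pm N N (uminus :: 'a mat \<Rightarrow> 'a mat)" by (simp add: pm_def)
qed

text \<open>Negation commutes with conjugation and preserves polynomial functions, so the same Borel
  subgroup has a dense orbit on both classes.\<close>

lemma spherical_uminus:
  assumes x: "x \<in> carrier (Sp n)" and sph: "spherical_class n (conj_class (Sp n) (- x))"
  shows "spherical_class n (conj_class (Sp n) x)"
proof -
  let ?C = "conj_class (Sp n) x" and ?C' = "conj_class (Sp n) (- x)"
  obtain B y where B: "borel_subgroup n B" and y: "y \<in> ?C'"
    and cl: "subtopology (zariski (2*n)) ?C' closure_of orbit (Sp n\<lparr>carrier := B\<rparr>) (conj_action (Sp n)) y = ?C'"
    using sph unfolding spherical_class_def by blast
  have BS: "B \<subseteq> carrier (Sp n)"
    using B subgroup.subset unfolding borel_subgroup_def closed_connected_solvable_def by blast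
  have CS: "?C \<subseteq> carrier (Sp n)" "?C' \<subseteq> carrier (Sp n)" using conj_class_sub[OF x] conj_class_sub[OF uminus_Sp[OF x]] by auto
  hence Cc: "?C \<subseteq> carrier_mat (2*n) (2*n)" "?C' \<subseteq> carrier_mat (2*n) (2*n)" by auto
  let ?O = "\<lambda>y. {b * y * sinv n b | b. b \<in> B}"
  have yC: "- y \<in> ?C" using y CS(2) conj_class_uminus[OF uminus_Sp[OF x]] uminus_uminus_Sp[OF x] by auto
  have O': "?O y \<subseteq> ?C'" using BS unfolding conj_class_eq[OF uminus_Sp[OF x] y, symmetric] by (auto simp: conj_class_Sp)
  have O: "?O (- y) \<subseteq> ?C" using BS unfolding conj_class_eq[OF x yC, symmetric] by (auto simp: conj_class_Sp)
  have van': "f z = 0" if "pf (2*n) f" "\<And>s. s \<in> ?O y \<Longrightarrow> f s = 0" "z \<in> ?C'" for f z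
    using closure_of_zariski_iff[OF O' Cc(2)] cl that unfolding orbit_Sp[OF BS] by blast
  have "f z = 0" if f: "pf (2*n) f" "\<forall>s\<in>?O (- y). f s = 0" "z \<in> ?C" for f z
  proof -
    have "f (- s) = 0" if s: "s \<in> ?O y" for s
    proof -
      obtain b where b: "b \<in> B" "s = b * y * sinv n b" using s by blast
      have "- s = b * (- y) * sinv n b" unfolding b(2) by (rule uminus_conj[symmetric]) (use b BS y Cc(2) in auto)
      thus ?thesis using f(2) b(1) by blast
    qed
    moreover have "- z \<in> ?C'" using f(3) by (auto simp: conj_class_uminus[OF x])
    ultimately have "f (- (- z)) = 0" by (rule van'[OF pf_uminus_arg[OF f(1)]])
    thus ?thesis using uminus_uminus_Sp[of z n] f(3) CS by auto
  qed
  hence "\<forall>f. pf (2*n) f \<longrightarrow> (\<forall>s\<in>?O (- y). f s = 0) \<longrightarrow> (\<forall>z\<in>?C. f z = 0)" by blast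
  hence "subtopology (zariski (2*n)) ?C closure_of ?O (- y) = ?C"
    unfolding closure_of_zariski_iff[OF O Cc(1)] .
  thus ?thesis
    unfolding spherical_class_def using B yC
    by (intro exI[of _ B] conjI bexI[of _ "- y"]) (simp_all only: orbit_Sp[OF BS])
qed

lemma conj_class_frame:
  assumes x: "x \<in> carrier (Sp n)" and g: "g \<in> carrier (Sp n)" and y: "y \<in> carrier_mat (2*n) (2*n)"
    and eq: "\<And>j. j < 2*n \<Longrightarrow> act (2*n) x (fcol n g j) = act (2*n) g (fcol n y j)"
  shows "y \<in> conj_class (Sp n) x" "sinv n g * x * g = y"
proof -
  show *: "sinv n g * x * g = y"
    using x g y eq by (intro mat_eq_act[of _ "2*n"]) (auto simp: act_mult)
  show "y \<in> conj_class (Sp n) x"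
    unfolding conj_class_Sp *[symmetric] using g by (intro CollectI exI[of _ "sinv n g"]) (simp add: sinv_sinv)
qed

section \<open>Diagonal matrices and greedy construction of frames\<close>

definition dmat :: "nat \<Rightarrow> (nat \<Rightarrow> 'k::field) \<Rightarrow> 'k mat" where
  "dmat m d = mat m m (\<lambda>(i, j). if i = j then d i else 0)"

lemma dmat_carrier [simp]: "dmat m d \<in> carrier_mat m m" by (simp add: dmat_def)

lemma act_dmat: "v \<in> vs m \<Longrightarrow> act m (dmat m d) v = (\<lambda>i. d i * v i)"
  by (auto simp: act_def dmat_def fun_eq_iff vs_def if_distrib if_distribR cong: if_cong)

lemma act_dmat_bv: "j < m \<Longrightarrow> act m (dmat m d) (bv j) = d j \<star> bv j"
  by (simp add: act_dmat fun_eq_iff) (simp add: bv_def)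

lemma four_block_dmat:
  "four_block_mat (dmat p d) (0\<^sub>m p q) (0\<^sub>m q p) (dmat q e) = dmat (p + q) (\<lambda>i. if i < p then d i else e (i - p))"
  by (rule eq_matI) (auto simp: dmat_def)

lemma scalar_dmat: "1\<^sub>m p = dmat p (\<lambda>_. 1)" "- 1\<^sub>m p = dmat p (\<lambda>_. - 1)" "c \<cdot>\<^sub>m 1\<^sub>m p = dmat p (\<lambda>_. c)"
  "0\<^sub>m 0 0 = dmat 0 (\<lambda>_. 0)"
  by (rule eq_matI; simp add: dmat_def)+

lemma dmat_dim [simp]: "dim_row (dmat p d) = p" "dim_col (dmat p d) = p" by (simp_all add: dmat_def)

lemma diag_block_dmat:
  "diag_block_mat [dmat p d] = dmat p d"
  "diag_block_mat (dmat p d # dmat q e # As) =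
    diag_block_mat (dmat (p + q) (\<lambda>i. if i < p then d i else e (i - p)) # As)"
proof -
  show "diag_block_mat [dmat p d] = dmat p d" by (rule diag_block_mat_singleton)
  have *: "diag_block_mat (dmat p d # dmat q e # As) = diag_block_mat (diag_block_mat [dmat p d, dmat q e] # As)"
    using diag_block_mat_append[of "[dmat p d, dmat q e]" As] diag_block_mat_append[of "[diag_block_mat [dmat p d, dmat q e]]" As]
    by (simp only: append_Cons append_Nil diag_block_mat_singleton)
  show "diag_block_mat (dmat p d # dmat q e # As) =
    diag_block_mat (dmat (p + q) (\<lambda>i. if i < p then d i else e (i - p)) # As)"
    unfolding * unfolding diag_block_mat.simps(2)[of "dmat p d" "[dmat q e]"] Let_def diag_block_mat_singleton
    by (simp add: four_block_dmat)
qed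

lemma dmat_cong: "p = q \<Longrightarrow> (\<And>i. i < q \<Longrightarrow> d i = e i) \<Longrightarrow> dmat p d = dmat q e"
  unfolding dmat_def by (rule eq_matI) auto

lemma sigma_dmat: "l \<le> n \<Longrightarrow> sigma_mat n l = dmat (2*n) (\<lambda>i. if i < l \<or> (n \<le> i \<and> i < n + l) then - 1 else 1)"
  unfolding sigma_mat_def scalar_dmat(2) unfolding scalar_dmat(1) diag_block_dmat by (rule dmat_cong) (simp_all, presburger?)

lemma a_dmat: "a_mat n c = dmat (2*n) (\<lambda>i. if i < n then c else inverse c)"
  unfolding a_mat_def scalar_dmat(3) diag_block_dmat by (rule dmat_cong) auto

lemma c_dmat: "n > 0 \<Longrightarrow> c_mat n c = dmat (2*n) (\<lambda>i. if i = 0 then c else if i = n then inverse c else 1)"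
  unfolding c_mat_def scalar_dmat(3) unfolding scalar_dmat(1) diag_block_dmat by (rule dmat_cong) auto

text \<open>The common pattern of the normal forms: pairs with property \<open>R\<close> are split
  off until the complement satisfies \<open>E\<close>. The step may use \<open>R\<close> for the
  earlier pairs, typically to show that the complement is stable.\<close>

lemma frame_greedy:
  fixes R :: "(nat \<Rightarrow> 'k::alg_closed_field) \<Rightarrow> (nat \<Rightarrow> 'k) \<Rightarrow> bool"
  assumes step: "\<And>i g. g \<in> carrier (Sp n) \<Longrightarrow> i < n \<Longrightarrow> (\<And>j. j < i \<Longrightarrow> R (fcol n g j) (fcol n g (n + j))) \<Longrightarrow>
      \<not> (\<forall>v\<in>perp n g i. E v) \<Longrightarrow> \<exists>v\<in>perp n g i. \<exists>u\<in>perp n g i. om n v u = 1 \<and> R v u"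
    and E0: "E 0"
  shows "\<exists>g\<in>carrier (Sp n). \<exists>m\<le>n. (\<forall>j<m. R (fcol n g j) (fcol n g (n + j))) \<and> (\<forall>v\<in>perp n g m. E v)"
proof -
  have "g \<in> carrier (Sp n) \<Longrightarrow> i \<le> n \<Longrightarrow> (\<And>j. j < i \<Longrightarrow> R (fcol n g j) (fcol n g (n + j))) \<Longrightarrow>
    \<exists>g\<in>carrier (Sp n). \<exists>m\<le>n. (\<forall>j<m. R (fcol n g j) (fcol n g (n + j))) \<and> (\<forall>v\<in>perp n g m. E v)" for i g
  proof (induction "n - i" arbitrary: i g rule: less_induct)
    case less
    show ?case
    proof (cases "\<forall>v\<in>perp n g i. E v")
      case True thus ?thesis using less.prems by blast
    next
      case False
      then obtain v0 where "v0 \<in> perp n g i" "\<not> E v0" by blast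
      hence i: "i < n" using perp_n[OF less.prems(1), of v0] E0 less.prems(2) by (cases "i = n") auto
      obtain v u where vu: "v \<in> perp n g i" "u \<in> perp n g i" "om n v u = 1" "R v u"
        using step[OF less.prems(1) i less.prems(3) False] by blast
      have "\<exists>\<gamma>. tcurve n (pairs n g i) \<gamma> \<and> act (2*n) (\<gamma> 1) (fcol n g i) = v \<and> act (2*n) (\<gamma> 1) (fcol n g (n + i)) = u"
        by (rule frame_step[OF less.prems(1) i _ _ vu(3)]) (use perp_om(1)[OF vu(1)] perp_om(1)[OF vu(2)] vu in auto)
      then obtain \<gamma> where ga: "tcurve n (pairs n g i) \<gamma>" "act (2*n) (\<gamma> 1) (fcol n g i) = v" "act (2*n) (\<gamma> 1) (fcol n g (n + i)) = u" by blast
      let ?h = "\<gamma> 1 * g"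
      have gS: "\<gamma> 1 \<in> carrier (Sp n)" using tcurve_Sp[OF ga(1)] .
      have "R (fcol n ?h j) (fcol n ?h (n + j))" if "j < Suc i" for j
      proof (cases "j = i")
        case True thus ?thesis using ga vu(4) gS less.prems(1) by (simp add: act_mult)
      next
        case False
        hence "fcol n g j \<in> pairs n g i" "fcol n g (n + j) \<in> pairs n g i" using that by (auto simp: pairs_def)
        thus ?thesis using ga(1) gS less.prems(1) less.prems(3)[of j] that False by (simp add: act_mult tcurve_def)
      qed
      thus ?thesis using less.hyps[of "Suc i" ?h] i gS less.prems(1) by auto
    qed
  qed
  from this[of "1\<^sub>m (2*n)" 0] show ?thesis by simp
qed

lemma perp_invariant:
  assumes x: "x \<in> carrier (Sp n)" and v: "v \<in> perp n g i"
    and inv: "\<And>k. k \<in> pairs n g i \<Longrightarrow> om n (act (2*n) (sinv n x) k) v = 0"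
  shows "act (2*n) x v \<in> perp n g i"
  using inv by (auto simp: perp_def om_sinv)

text \<open>Reverses the order within each half of the basis. Conjugation by the corresponding
  matrix brings the last \<open>n - l\<close> pairs to the front and so turns
  \<open>- sigma_mat n l\<close> into \<open>sigma_mat n (n - l)\<close>.\<close>

definition rv :: "nat \<Rightarrow> nat \<Rightarrow> nat" where
  "rv n k = (if k < n then n - 1 - k else 3 * n - 1 - k)"

definition rvm :: "nat \<Rightarrow> 'k::field mat" where
  "rvm n = mof (2*n) (\<lambda>v i. if i < 2*n then v (rv n i) else 0)"

lemma rv_lt: "k < 2*n \<Longrightarrow> rv n k < 2*n" "k < 2*n \<Longrightarrow> rv n (rv n k) = k"
  by (auto simp: rv_def)

lemma act_rvm: "j < 2*n \<Longrightarrow> act (2*n) (rvm n) (bv j) = bv (rv n j)"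
proof -
  assume j: "j < 2*n"
  have "(\<lambda>i. if i < 2*n then bv j (rv n i) else 0) = (bv (rv n j) :: nat \<Rightarrow> 'a)"
    using j by (auto simp: fun_eq_iff bv_def rv_def split: if_splits)
  moreover have "act (2*n) (rvm n) (bv j) = (\<lambda>i. if i < 2*n then bv j (rv n i) else (0 :: 'a))"
    unfolding rvm_def by (subst act_mof) (use j in \<open>auto simp: lin_def fun_eq_iff vs_def bv_def\<close>)
  ultimately show ?thesis by simp
qed

lemma rvm_Sp: "rvm n \<in> carrier (Sp n)"
  unfolding Sp_iff_basis
proof (intro conjI allI impI)
  fix i j assume ij: "i < 2*n" "j < 2*n"
  have "rv n j = swp n (rv n i) \<longleftrightarrow> j = swp n i" "eps n (rv n i) = (eps n i :: 'a)"
    using ij by (auto simp: rv_def swp_def eps_def split: if_splits)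
  thus "om n (act (2*n) (rvm n) (bv i)) (act (2*n) (rvm n) (bv j)) = om n (bv i) (bv j :: nat \<Rightarrow> 'a)"
    using ij by (simp add: act_rvm om_bv rv_lt)
qed (simp add: rvm_def)

lemma split_index:
  assumes "j < 2 * (n::nat)" obtains "j < n" | l where "l < n" "j = n + l"
  using assms by (metis add_diff_inverse_nat mult_2 nat_add_left_cancel_less)

context sp_elem
begin

text \<open>Pairs are taken from the eigenspace for -1, which is nondegenerate: antisymmetrising and
  halving a partner keeps its pairing with an eigenvector.\<close>

lemma involution_frame:
  assumes inv: "\<And>v. v \<in> V \<Longrightarrow> T (T v) = v"
  shows "\<exists>g\<in>carrier (Sp n). \<exists>l\<le>n. sinv n g * x * g = sigma_mat n l"
proof -
  have T'T: "T' v = T v" if "v \<in> V" for v using inv[OF that] TT(2)[of "T v"] by simp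
  let ?R = "\<lambda>v u. T v = - v \<and> T u = - u"
  have "\<exists>g\<in>carrier (Sp n). \<exists>m\<le>n. (\<forall>j<m. ?R (fcol n g j) (fcol n g (n + j))) \<and> (\<forall>v\<in>perp n g m. T v = v)"
  proof (rule frame_greedy)
    fix i g assume g: "g \<in> carrier (Sp n)" and i: "i < n" and R: "\<And>j. j < i \<Longrightarrow> ?R (fcol n g j) (fcol n g (n + j))"
      and ne: "\<not> (\<forall>v\<in>perp n g i. T v = v)"
    have Tp: "T v \<in> perp n g i" if "v \<in> perp n g i" for v
    proof (rule perp_invariant[OF x that])
      fix k assume k: "k \<in> pairs n g i"
      have "T' k = - k" using T'T[OF pairs_D[OF k]] k R by (auto simp: pairs_def)
      thus "om n (T' k) v = 0" using perp_om[OF that k] by simp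
    qed
    obtain v0 where v0: "v0 \<in> perp n g i" "T v0 \<noteq> v0" using ne by blast
    let ?v = "v0 - T v0"
    have v: "?v \<in> perp n g i" "?v \<noteq> 0" "T ?v = - ?v"
      using v0 Tp[OF v0(1)] inv[of v0] by (auto intro: perp_closed)
    obtain u0 where u0: "u0 \<in> perp n g i" "om n ?v u0 = 1" using perp_partner[OF g v(1,2)] by blast
    let ?u = "(1 / 2) \<star> (u0 - T u0)"
    have u: "?u \<in> perp n g i" using u0 Tp by (intro perp_closed)
    have Tu: "T ?u = - ?u" using inv[of u0] u0(1) by (auto simp: fun_eq_iff algebra_simps)
    have "om n ?v (T u0) = om n (T' ?v) u0" by (rule om_T'(1)[symmetric])
    also have "T' ?v = - ?v" using T'T[OF perp_vs[OF v(1)]] v(3) by simp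
    finally have "om n ?v (T u0) = -1" using u0(2) by (simp only: om_simps(5))
    hence "om n ?v ?u = 1" using u0(2) two by (simp only: om_simps(4,8)) simp
    thus "\<exists>v\<in>perp n g i. \<exists>u\<in>perp n g i. om n v u = 1 \<and> ?R v u" using v u Tu by blast
  qed (simp add: fun_eq_iff act_def)
  then obtain g m where g: "g \<in> carrier (Sp n)" "m \<le> n" "\<And>j. j < m \<Longrightarrow> ?R (fcol n g j) (fcol n g (n + j))"
    "\<And>v. v \<in> perp n g m \<Longrightarrow> T v = v" by blast
  have "sinv n g * x * g = sigma_mat n m"
  proof (rule conj_class_frame(2)[OF x g(1)])
    fix j assume "j < 2*n"
    thus "T (fcol n g j) = act (2*n) g (fcol n (sigma_mat n m) j)"
    proof (cases rule: split_index)
      case 1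
      thus ?thesis using g(3)[of j] g(4) col_in_perp(1)[OF g(1), of m j] by (cases "j < m") (auto simp: sigma_dmat[OF g(2)] act_dmat_bv)
    next
      case (2 l)
      thus ?thesis using g(3)[of l] g(4) col_in_perp(2)[OF g(1), of m l] by (cases "l < m") (auto simp: sigma_dmat[OF g(2)] act_dmat_bv)
    qed
  qed (simp add: sigma_dmat[OF g(2)])
  thus ?thesis using g by blast
qed

text \<open>\<open>T - inverse c\<close> and \<open>T - c\<close> map into the eigenspaces for
  \<open>c\<close> and \<open>inverse c\<close>. These are totally isotropic and dual to each other,
  which supplies the pairs.\<close>

lemma eigen_frame:
  assumes Yt: "\<And>v. v \<in> V \<Longrightarrow> Y v = (c + inverse c) \<star> v" and c: "c\<^sup>2 \<noteq> 0" "c\<^sup>2 \<noteq> 1"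
  shows "a_mat n c \<in> conj_class (Sp n) x"
proof -
  have c0: "c \<noteq> 0" "c * c \<noteq> 1" using c by (auto simp: power2_eq_square)
  let ?R = "\<lambda>v u. T v = c \<star> v \<and> T u = inverse c \<star> u"
  have TT2: "T (T v) = (c + inverse c) \<star> T v - v" if "v \<in> V" for v
  proof -
    have "T (Y v) = T ((c + inverse c) \<star> v)" using Yt[OF that] by simp
    thus ?thesis using that by (simp add: Y_def) (simp add: fun_eq_iff algebra_simps)
  qed
  have "\<exists>g\<in>carrier (Sp n). \<exists>m\<le>n. (\<forall>j<m. ?R (fcol n g j) (fcol n g (n + j))) \<and> (\<forall>v\<in>perp n g m. v = 0)"
  proof (rule frame_greedy)
    fix i g assume g: "g \<in> carrier (Sp n)" and i: "i < n" and R: "\<And>j. j < i \<Longrightarrow> ?R (fcol n g j) (fcol n g (n + j))"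
      and ne: "\<not> (\<forall>v\<in>perp n g i. v = 0)"
    have Tp: "T v \<in> perp n g i" if "v \<in> perp n g i" for v
    proof (rule perp_invariant[OF x that])
      fix k assume k: "k \<in> pairs n g i"
      obtain j where j: "j < i" "k = fcol n g j \<or> k = fcol n g (n + j)" using k by (auto simp: pairs_def)
      from j(2) have "\<exists>d. T k = d \<star> k \<and> d \<noteq> 0"
      proof
        assume "k = fcol n g j" thus ?thesis using R[OF j(1)] c0 by (intro exI[of _ c]) simp
      next
        assume "k = fcol n g (n + j)" thus ?thesis using R[OF j(1)] c0 by (intro exI[of _ "inverse c"]) simp
      qed
      then obtain d where "T k = d \<star> k" "d \<noteq> 0" by blast
      hence "T' k = inverse d \<star> k" using ev_T' pairs_D[OF k] by blast
      thus "om n (T' k) v = 0" using perp_om[OF that k] by simp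
    qed
    have "\<exists>v0\<in>perp n g i. T v0 \<noteq> inverse c \<star> v0"
    proof (rule ccontr)
      assume "\<not> ?thesis"
      hence *: "T y = inverse c \<star> y" if "y \<in> perp n g i" for y using that by blast
      obtain y where y: "y \<in> perp n g i" "y \<noteq> 0" using ne by blast
      obtain z where z: "z \<in> perp n g i" "om n y z = 1" using perp_partner[OF g y] by blast
      have "inverse c * inverse c \<noteq> 1" using c0 by (auto simp: field_simps)
      hence "om n y z = 0" using ev_perp[OF *[OF y(1)] *[OF z(1)]] by blast
      thus False using z by simp
    qed
    then obtain v0 where v0: "v0 \<in> perp n g i" "T v0 \<noteq> inverse c \<star> v0" by blast
    let ?v = "T v0 - inverse c \<star> v0"
    have v: "?v \<in> perp n g i" using Tp v0(1) by (intro perp_closed)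
    have v1: "?v \<noteq> 0" "T ?v = c \<star> ?v"
      using v0 TT2[OF perp_vs[OF v0(1)]] c0 by (auto simp: fun_eq_iff algebra_simps)
    obtain u0 where u0: "u0 \<in> perp n g i" "om n ?v u0 = 1" using perp_partner[OF g v v1(1)] by blast
    let ?d = "T u0 - c \<star> u0"
    have d: "?d \<in> perp n g i" using Tp u0(1) by (intro perp_closed)
    have Td: "T ?d = inverse c \<star> ?d"
      using TT2[OF perp_vs[OF u0(1)]] c0 by (auto simp: fun_eq_iff algebra_simps)
    have "om n ?v (T u0) = inverse c * om n ?v u0" by (rule ev_om[OF v1(2) c0(1) perp_vs[OF v]])
    hence "om n ?v ?d = inverse c - c" using u0(2) by (simp only: om_simps(4,8)) simp
    moreover have "inverse c - c \<noteq> 0" using c0 by (auto simp: field_simps)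
    ultimately have nz: "om n ?v ?d \<noteq> 0" by simp
    let ?u = "inverse (om n ?v ?d) \<star> ?d"
    have "om n ?v ?u = 1" using nz by (simp only: om_simps(8)) simp
    moreover have "?u \<in> perp n g i" using d by (rule perp_closed)
    moreover have "T ?u = inverse c \<star> ?u" unfolding act_scl Td by (simp only: scl_scl mult.commute)
    ultimately show "\<exists>v\<in>perp n g i. \<exists>u\<in>perp n g i. om n v u = 1 \<and> ?R v u" using v v1(2) by blast
  qed simp
  then obtain g m where g: "g \<in> carrier (Sp n)" "m \<le> n" "\<And>j. j < m \<Longrightarrow> ?R (fcol n g j) (fcol n g (n + j))"
    "\<And>v. v \<in> perp n g m \<Longrightarrow> v = 0" by blast
  have mn: "m = n"
  proof (rule ccontr)
    assume "m \<noteq> n"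
    hence m: "m < n" using g(2) by simp
    have "fcol n g m = 0" using g(4) col_in_perp(1)[OF g(1) le_refl m] by blast
    hence "om n (fcol n g m) (fcol n g (n + m)) = 0" by simp
    thus False using om_col_simps(3)[OF g(1) m m] by simp
  qed
  show ?thesis
  proof (rule conj_class_frame(1)[OF x g(1)])
    fix j assume "j < 2*n"
    thus "T (fcol n g j) = act (2*n) g (fcol n (a_mat n c) j)"
      by (cases rule: split_index) (use g(3) mn in \<open>auto simp: a_dmat act_dmat_bv\<close>)
  qed (simp add: a_dmat)
qed

lemma rank_two_frame:
  assumes n: "n > 0" and p: "p \<in> V" "T p = c \<star> p" and q: "q \<in> V" "T q = inverse c \<star> q" and pq: "om n p q = 1"
    and rest: "\<And>v. v \<in> V \<Longrightarrow> om n p v = 0 \<Longrightarrow> om n q v = 0 \<Longrightarrow> T v = v"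
  shows "c_mat n c \<in> conj_class (Sp n) x"
proof -
  obtain \<gamma> where ga: "tcurve n (pairs n (1\<^sub>m (2*n)) 0) \<gamma>" "act (2*n) (\<gamma> 1) (fcol n (1\<^sub>m (2*n)) 0) = p"
    "act (2*n) (\<gamma> 1) (fcol n (1\<^sub>m (2*n)) (n + 0)) = q"
    using frame_step[OF one_Sp, of 0 n p q] n p q pq by (auto simp: pairs_def)
  define g where "g = \<gamma> 1"
  have gS: "g \<in> carrier (Sp n)" using tcurve_Sp[OF ga(1)] by (simp add: g_def)
  have g0: "fcol n g 0 = p" "fcol n g n = q" using ga n by (auto simp: g_def)
  show ?thesis
  proof (rule conj_class_frame(1)[OF x gS])
    fix j assume j: "j < 2*n"
    have "T (fcol n g j) = fcol n g j" if "j \<noteq> 0" "j \<noteq> n"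
    proof (rule rest)
      show "om n p (fcol n g j) = 0" "om n q (fcol n g j) = 0"
        using om_col[OF gS _ j, of 0] om_col[OF gS _ j, of n] that n unfolding g0 by (auto simp: swp_def)
    qed auto
    thus "T (fcol n g j) = act (2*n) g (fcol n (c_mat n c) j)"
      using j n p q g0 by (cases "j = 0 \<or> j = n") (auto simp: c_dmat act_dmat_bv)
  qed (use n in \<open>simp add: c_dmat\<close>)
qed

text \<open>\<open>X\<close> squares to zero, so a vector with \<open>om n v (X v) = 1\<close> spans
  together with \<open>X v\<close> a hyperbolic plane stable under \<open>X\<close>.\<close>

lemma unipotent_frame:
  assumes Y2: "\<And>v. v \<in> V \<Longrightarrow> Y v = 2 \<star> v"
  shows "\<exists>g\<in>carrier (Sp n). \<exists>m\<le>n. (\<forall>j<m. fcol n g (n + j) = X (fcol n g j) \<and> X (fcol n g (n + j)) = 0) \<and>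
    (\<forall>v\<in>perp n g m. X v = 0)"
proof -
  have XX: "X (X v) = 0" if "v \<in> V" for v
  proof -
    have "Y (Y v) = 4 \<star> v" using Y2[of "Y v"] Y2[OF that] by simp
    thus ?thesis using YY[OF that] by simp
  qed
  let ?R = "\<lambda>v u. v \<in> V \<and> u = X v \<and> X u = 0"
  have "\<exists>g\<in>carrier (Sp n). \<exists>m\<le>n. (\<forall>j<m. ?R (fcol n g j) (fcol n g (n + j))) \<and> (\<forall>v\<in>perp n g m. X v = 0)"
  proof (rule frame_greedy)
    fix i g assume g: "g \<in> carrier (Sp n)" and i: "i < n" and R: "\<And>j. j < i \<Longrightarrow> ?R (fcol n g j) (fcol n g (n + j))"
      and ne: "\<not> (\<forall>v\<in>perp n g i. X v = 0)"
    have Xp: "X v \<in> perp n g i" if v: "v \<in> perp n g i" for v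
    proof -
      have "om n k (X v) = 0" if k: "k \<in> pairs n g i" for k
      proof -
        have "X k \<in> pairs n g i \<or> X k = 0"
        proof -
          obtain j where j: "j < i" "k = fcol n g j \<or> k = fcol n g (n + j)" using k by (auto simp: pairs_def)
          have "X k = fcol n g (n + j) \<or> X k = 0" using j(2) R[OF j(1)] by metis
          moreover have "fcol n g (n + j) \<in> pairs n g i" using j(1) by (auto simp: pairs_def)
          ultimately show ?thesis by metis
        qed
        hence "om n (X k) v = 0" using perp_om[OF v] by auto
        thus ?thesis using om_X[OF pairs_D[OF k] perp_vs[OF v]] by simp
      qed
      thus ?thesis by (simp add: perp_def)
    qed
    have "\<exists>v\<in>perp n g i. om n v (X v) \<noteq> 0"
    proof (rule ccontr)
      assume "\<not> ?thesis"
      hence 0: "om n v (X v) = 0" if "v \<in> perp n g i" for v using that by blast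
      have "X y = 0" if y: "y \<in> perp n g i" for y
      proof (rule perp_eq_0[OF g Xp[OF y]])
        fix u assume u: "u \<in> perp n g i"
        have "om n (u + y) (X (u + y)) = 0" using 0 perp_closed(1)[OF u y] by blast
        hence "2 * om n u (X y) = 0" using 0[OF u] 0[OF y] om_X_sym[OF perp_vs[OF u] perp_vs[OF y]] by simp
        thus "om n u (X y) = 0" using two by simp
      qed
      thus False using ne by blast
    qed
    then obtain v where v: "v \<in> perp n g i" "om n v (X v) \<noteq> 0" by blast
    obtain d where d: "d * d = inverse (om n v (X v))" using sqrt_exists by blast
    let ?v = "d \<star> v"
    have vp: "?v \<in> perp n g i" using v(1) by (rule perp_closed)
    have "om n ?v (X ?v) = d * d * om n v (X v)" by simp
    hence "om n ?v (X ?v) = 1" using d v(2) by simp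
    thus "\<exists>v\<in>perp n g i. \<exists>u\<in>perp n g i. om n v u = 1 \<and> ?R v u"
      using vp Xp[OF vp] XX[OF perp_vs[OF vp]] by blast
  qed (simp add: X_def fun_eq_iff act_def)
  then obtain g m where "g \<in> carrier (Sp n)" "m \<le> n" "\<And>j. j < m \<Longrightarrow> ?R (fcol n g j) (fcol n g (n + j))"
    "\<And>v. v \<in> perp n g m \<Longrightarrow> X v = 0" by blast
  hence "(\<forall>j<m. fcol n g (n + j) = X (fcol n g j) \<and> X (fcol n g (n + j)) = 0) \<and> (\<forall>v\<in>perp n g m. X v = 0)" by blast
  thus ?thesis using \<open>g \<in> carrier (Sp n)\<close> \<open>m \<le> n\<close> by blast
qed

end


section \<open>Jordan types\<close>

text \<open>A permutation of the basis with scaling; it reorders a symplectic frame into a Jordan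
  basis.\<close>

definition monmat :: "nat \<Rightarrow> (nat \<Rightarrow> 'k::field) \<Rightarrow> (nat \<Rightarrow> nat) \<Rightarrow> 'k mat" where
  "monmat N s p = mat N N (\<lambda>(i, k). if i = p k then s k else 0)"

lemma monmat_carrier [simp]: "monmat N s p \<in> carrier_mat N N" by (simp add: monmat_def)

lemma act_monmat: "k < N \<Longrightarrow> p k < N \<Longrightarrow> act N (monmat N s p) (bv k) = s k \<star> bv (p k)"
proof (rule ext)
  fix i assume "k < N" "p k < N"
  thus "act N (monmat N s p) (bv k) i = (s k \<star> bv (p k)) i"
    by (cases "i < N") (simp add: act_bv, simp add: monmat_def bv_def, auto simp: act_def bv_def)
qed

lemma jordan_matrix_ones: "jordan_matrix (replicate r (1, 1)) = (1\<^sub>m r :: 'k::field mat)"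
proof (induction r)
  case 0 show ?case by (rule eq_matI) auto
next
  case (Suc r)
  have "jordan_block 1 1 = (1\<^sub>m 1 :: 'k mat)" by (rule eq_matI) auto
  thus ?case using Suc four_block_one_mat[of 1 r] by (simp add: jordan_matrix_Cons sum_list_replicate)
qed

lemma jordan_matrix_twos_ones:
  assumes "i < 2 * m + r" "k < 2 * m + r"
  shows "jordan_matrix (replicate m (2, 1) @ replicate r (1, 1)) $$ (i, k) =
    (if i = k \<or> Suc i = k \<and> even i \<and> k < 2 * m then 1 else (0 :: 'k::field))"
  using assms
proof (induction m arbitrary: i k)
  case 0 thus ?case by (auto simp: jordan_matrix_ones simp flip: One_nat_def)
next
  case (Suc m)
  have d: "sum_list (map fst (replicate m (2 :: nat, 1 :: 'k) @ replicate r (1, 1))) = 2 * m + r"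
    by (simp add: sum_list_replicate)
  have e: "jordan_matrix (replicate (Suc m) (2, 1) @ replicate r (1, 1)) =
      four_block_mat (jordan_block 2 1) (0\<^sub>m 2 (2 * m + r)) (0\<^sub>m (2 * m + r) 2)
        (jordan_matrix (replicate m (2, 1 :: 'k) @ replicate r (1, 1)))"
    unfolding replicate_Suc append_Cons jordan_matrix_Cons d ..
  have i: "jordan_matrix (replicate (Suc m) (2, 1) @ replicate r (1, 1)) $$ (i, k) =
      (if i < 2 then if k < 2 then jordan_block 2 (1 :: 'k) $$ (i, k) else 0 else if k < 2 then 0
       else jordan_matrix (replicate m (2, 1) @ replicate r (1, 1)) $$ (i - 2, k - 2))"
    unfolding e using Suc.prems d by (subst index_mat_four_block(1)) auto
  show ?case
  proof (cases "i < 2 \<or> k < 2")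
    case True thus ?thesis unfolding i by (auto simp: less_2_cases_iff)
  next
    case False
    then obtain i' k' where ik: "i = i' + 2" "k = k' + 2" by (metis add.commute le_Suc_ex not_less)
    show ?thesis unfolding i using Suc.IH[of i' k'] Suc.prems unfolding ik by simp
  qed
qed

lemma jordan_matrix_one_two:
  assumes "i < p + 2 + q" "k < p + 2 + q"
  shows "jordan_matrix (replicate p (1, 1) @ (2, 1) # replicate q (1, 1)) $$ (i, k) =
    (if i = k \<or> i = p \<and> k = Suc p then 1 else (0 :: 'k::field))"
  using assms
proof (induction p arbitrary: i k)
  case 0
  have "jordan_matrix (replicate 0 (1, 1) @ (2, 1) # replicate q (1, 1)) =
      jordan_matrix (replicate 1 (2, 1 :: 'k) @ replicate q (1, 1))" by simp
  thus ?case using jordan_matrix_twos_ones[of i 1 q k] 0 by auto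
next
  case (Suc p)
  let ?J = "jordan_matrix (replicate p (1, 1) @ (2, 1 :: 'k) # replicate q (1, 1))"
  have d: "sum_list (map fst (replicate p (1 :: nat, 1 :: 'k) @ (2, 1) # replicate q (1, 1))) = p + 2 + q"
    by (simp add: sum_list_replicate)
  have e: "jordan_matrix (replicate (Suc p) (1, 1) @ (2, 1) # replicate q (1, 1)) =
      four_block_mat (jordan_block 1 1) (0\<^sub>m 1 (p + 2 + q)) (0\<^sub>m (p + 2 + q) 1) ?J"
    unfolding replicate_Suc append_Cons jordan_matrix_Cons d ..
  have i: "jordan_matrix (replicate (Suc p) (1, 1) @ (2, 1) # replicate q (1, 1)) $$ (i, k) =
      (if i < 1 then if k < 1 then 1 else 0 else if k < 1 then 0 else ?J $$ (i - 1, k - 1))"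
    unfolding e using Suc.prems d by (subst index_mat_four_block(1)) auto
  show ?case
  proof (cases "i < 1 \<or> k < 1")
    case True thus ?thesis unfolding i by auto
  next
    case False
    then obtain i' k' where ik: "i = Suc i'" "k = Suc k'" by (metis less_one not0_implies_Suc)
    show ?thesis unfolding i using Suc.IH[of i' k'] Suc.prems unfolding ik by simp
  qed
qed

context sp_elem
begin

lemma T_square_zero: "(\<And>v. v \<in> V \<Longrightarrow> Y v = 2 \<star> v) \<Longrightarrow> v \<in> V \<Longrightarrow> T v = v + (1 / 2) \<star> X v"
proof -
  assume "\<And>v. v \<in> V \<Longrightarrow> Y v = 2 \<star> v" and v: "v \<in> V"
  hence "2 \<star> T v = 2 \<star> v + X v" using T_XY[of v] by simp
  hence "(1 / 2) \<star> 2 \<star> T v = (1 / 2) \<star> (2 \<star> v + X v)" by simp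
  thus ?thesis using two by (simp add: scl_add)
qed

lemma unipotent_if_Y2:
  assumes Y2: "\<And>v. v \<in> V \<Longrightarrow> Y v = 2 \<star> v"
  shows "unipotent_mat x"
proof -
  have c: "x - 1\<^sub>m (2*n) \<in> carrier_mat (2*n) (2*n)" by (rule minus_carrier_mat) simp
  have "(x - 1\<^sub>m (2*n)) * (x - 1\<^sub>m (2*n)) = 0\<^sub>m (2*n) (2*n)"
  proof (rule mat_eq_act[of _ "2*n"])
    fix j assume "j < 2*n"
    hence v: "(bv j :: nat \<Rightarrow> 'k) \<in> V" by simp
    have "T (Y (bv j)) = T (2 \<star> bv j)" using Y2[OF v] by simp
    hence "T (T (bv j)) = 2 \<star> T (bv j) - bv j" using v by (simp add: Y_def eq_diff_eq)
    thus "act (2*n) ((x - 1\<^sub>m (2*n)) * (x - 1\<^sub>m (2*n))) (bv j) = act (2*n) (0\<^sub>m (2*n) (2*n)) (bv j)"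
      using v x c by (simp add: act_mult act_diff_mat) (simp add: fun_eq_iff)
  qed (use c in auto)
  hence "(x - 1\<^sub>m (2*n)) ^\<^sub>m 2 = 0\<^sub>m (2*n) (2*n)" using c by (simp add: numeral_2_eq_2)
  moreover have "dim_row x = 2*n" "dim_col x = 2*n" using Sp_carrier_mat[OF x] by auto
  ultimately show ?thesis unfolding unipotent_mat_def by (auto intro: exI[of _ 2])
qed

text \<open>By \<open>T_square_zero\<close>, \<open>T\<close> adds half of \<open>X v\<close> to
  \<open>v\<close>. Hence column \<open>j < m\<close>, preceded by half of column
  \<open>n + j\<close>, is the basis of a Jordan block of size 2.\<close>

lemma jordan_type_of_frame:
  assumes Y2: "\<And>v. v \<in> V \<Longrightarrow> Y v = 2 \<star> v" and g: "g \<in> carrier (Sp n)" and m: "m \<le> n"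
    and fr: "\<And>j. j < m \<Longrightarrow> fcol n g (n + j) = X (fcol n g j)" "\<And>j. j < m \<Longrightarrow> X (fcol n g (n + j)) = 0"
    and rest: "\<And>v. v \<in> perp n g m \<Longrightarrow> X v = 0"
  shows "has_jordan_type x (replicate_mset m 2 + replicate_mset (2*n - 2*m) 1)"
proof -
  let ?L = "replicate m (2, 1 :: 'k) @ replicate (2*n - 2*m) (1, 1)"
  \<comment> \<open>Position \<open>k\<close> of the Jordan basis holds frame column
    \<open>p k\<close>: the columns \<open>n + j\<close> and \<open>j\<close> alternate in the first
    \<open>2 * m\<close> positions, then the columns \<open>m, ..., n - 1\<close> and those from
    \<open>n + m\<close> on follow. \<open>q\<close> is the inverse of \<open>p\<close>, and
    \<open>s\<close> carries the factor 1/2.\<close>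
  define p where "p k = (if k < 2*m then if even k then n + k div 2 else k div 2 else if k < n + m then k - m else k)" for k
  define q where "q i = (if i < m then 2*i + 1 else if i < n then i + m else if i < n + m then 2 * (i - n) else i)" for i
  define s where "s k = (if k < 2*m \<and> even k then 1 / 2 else 1 :: 'k)" for k
  define P where "P = g * monmat (2*n) s p"
  define Q where "Q = monmat (2*n) (\<lambda>i. inverse (s (q i))) q * sinv n g"
  have pq: "p k < 2*n" "q k < 2*n" "q (p k) = k" if "k < 2*n" for k
    using that m by (auto simp: p_def q_def elim!: oddE)
  have s0: "s k \<noteq> 0" for k using two by (simp add: s_def)
  have Pc: "P \<in> carrier_mat (2*n) (2*n)" and Qc: "Q \<in> carrier_mat (2*n) (2*n)" using g by (auto simp: P_def Q_def)
  have Jc: "jordan_matrix ?L \<in> carrier_mat (2*n) (2*n)"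
    using jordan_matrix_carrier[of ?L] m by (simp add: sum_list_replicate)
  have Pk: "act (2*n) P (bv k) = s k \<star> fcol n g (p k)" if "k < 2*n" for k
    using that pq g by (simp add: P_def act_mult act_monmat)
  have QP: "Q * P = 1\<^sub>m (2*n)"
    by (rule mat_eq_act[of _ "2*n"]) (use Pc Qc pq s0 g in \<open>auto simp: act_mult Pk Q_def act_monmat\<close>)
  have PQ: "P * Q = 1\<^sub>m (2*n)" by (rule mat_mult_left_right_inverse[OF Qc Pc QP])
  have Jk: "act (2*n) (jordan_matrix ?L) (bv k) = (if odd k \<and> k < 2*m then bv (k - 1) + bv k else bv k)" if k: "k < 2*n" for k
  proof (rule ext)
    fix i
    show "act (2*n) (jordan_matrix ?L) (bv k) i = (if odd k \<and> k < 2*m then bv (k - 1) + bv k else bv k) i"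
    proof (cases "i < 2*n")
      case True
      have "jordan_matrix ?L $$ (i, k) = (if i = k \<or> Suc i = k \<and> even i \<and> k < 2 * m then 1 else (0 :: 'k))"
        by (rule jordan_matrix_twos_ones) (use True k m in auto)
      thus ?thesis unfolding act_bv[OF True k] using True k by (auto simp: bv_def elim!: oddE)
    qed (use k in \<open>auto simp: act_def bv_def\<close>)
  qed
  define J where "J = jordan_matrix ?L"
  note Jk' = Jk[folded J_def] and Jc' = Jc[folded J_def]
  have XP: "x * P = P * J"
  proof (rule mat_eq_act[of _ "2*n"])
    fix k assume k: "k < 2*n"
    have "T (act (2*n) P (bv k)) = act (2*n) P (act (2*n) (J) (bv k))"
    proof (cases "k < 2*m")
      case True
      hence k2: "k div 2 < m" by simp
      show ?thesis
      proof (cases "even k")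
        case True
        thus ?thesis using fr(2)[OF k2] \<open>k < 2*m\<close> k T_square_zero[OF Y2, of "fcol n g (p k)"]
          by (simp add: Pk Jk' p_def)
      next
        case False
        hence "even (k - 1)" "(k - 1) div 2 = k div 2" "k - 1 < 2*n" "k - 1 < 2*m" using k True by (auto elim!: oddE)
        thus ?thesis using fr(1)[OF k2] False True k T_square_zero[OF Y2, of "fcol n g (p k)"]
          by (simp add: Pk Jk' p_def s_def add.commute)
      qed
    next
      case False
      have "fcol n g (p k) \<in> perp n g m"
      proof (cases "k < n + m")
        case True thus ?thesis using col_in_perp(1)[OF g, of m "k - m"] False by (simp add: p_def)
      next
        case b: False thus ?thesis using col_in_perp(2)[OF g, of m "k - n"] k False by (simp add: p_def)
      qed
      thus ?thesis using False k rest T_square_zero[OF Y2, of "fcol n g (p k)"] by (simp add: Pk Jk')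
    qed
    thus "act (2*n) (x * P) (bv k) = act (2*n) (P * J) (bv k)" using x Pc Jc' by (simp add: act_mult)
  qed (use x Pc Jc' in auto)
  have "x = x * (P * Q)" using PQ right_mult_one_mat[OF Sp_carrier_mat[OF x]] by simp
  also have "\<dots> = P * J * Q"
    using assoc_mult_mat[OF Sp_carrier_mat[OF x] Pc Qc] XP by simp
  finally have "similar_mat_wit x (J) P Q"
    by (rule similar_mat_witI[OF PQ QP _ Sp_carrier_mat[OF x] Jc' Pc Qc])
  hence "jordan_nf x ?L" unfolding jordan_nf_def similar_mat_def J_def by (auto simp: image_iff)
  thus ?thesis unfolding has_jordan_type_def by (intro exI[of _ ?L]) simp
qed

end

section \<open>Consequences of a prescribed Jordan type\<close>

lemma unipotent_jordan_eigenvalue: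
  assumes y: "y \<in> carrier_mat N N" "unipotent_mat y" and L: "jordan_nf (y :: 'k::field mat) L" "(a, c) \<in> set L"
  shows "c = 1"
proof -
  have "a \<noteq> 0" using L by (force simp: jordan_nf_def)
  hence "order c (char_poly y) \<noteq> 0" using jordan_nf_block_size_order_bound[OF L] by simp
  hence "poly (char_poly y) c = 0" by (simp add: order_root)
  hence "eigenvalue y c" using eigenvalue_root_char_poly[OF y(1)] by blast
  then obtain v where v: "v \<in> carrier_vec N" "v \<noteq> 0\<^sub>v N" "y *\<^sub>v v = c \<cdot>\<^sub>v v"
    using y(1) by (auto simp: eigenvalue_def eigenvector_def)
  obtain k where k: "(y - 1\<^sub>m N) ^\<^sub>m k = 0\<^sub>m N N" using y by (auto simp: unipotent_mat_def)
  have yc: "y - 1\<^sub>m N \<in> carrier_mat N N" by (rule minus_carrier_mat) simp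
  have "(y - 1\<^sub>m N) *\<^sub>v v = (c - 1) \<cdot>\<^sub>v v"
    using v minus_mult_distrib_mat_vec[OF y(1) one_carrier_mat v(1)] by (auto simp: algebra_simps)
  hence "eigenvector (y - 1\<^sub>m N) v (c - 1)" using v by (simp add: eigenvector_def)
  from eigenvector_pow[OF yc this, of k] have "(c - 1) ^ k \<cdot>\<^sub>v v = 0\<^sub>m N N *\<^sub>v v" unfolding k ..
  also have "\<dots> = 0\<^sub>v N" using v(1) by (intro eq_vecI) (auto simp: scalar_prod_def)
  finally have 0: "(c - 1) ^ k \<cdot>\<^sub>v v = 0\<^sub>v N" .
  obtain i where i: "i < N" "v $ i \<noteq> 0" using v(1,2) by (metis carrier_vecD eq_vecI index_zero_vec)
  have "((c - 1) ^ k \<cdot>\<^sub>v v) $ i = 0" using 0 i by simp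
  thus ?thesis using i v(1) by simp
qed

lemma jordan_square_zero:
  assumes "\<And>a c. (a, c) \<in> set L \<Longrightarrow> a \<le> 2 \<and> c = 1"
  defines "N \<equiv> sum_list (map fst L)"
  shows "(jordan_matrix L - 1\<^sub>m N) * (jordan_matrix L - 1\<^sub>m N) = (0\<^sub>m N N :: 'k::field mat)"
  using assms(1) unfolding N_def
proof (induction L)
  case Nil show ?case by (rule eq_matI) auto
next
  case (Cons ac L)
  obtain a where a: "ac = (a, 1)" "a \<le> 2" using Cons.prems by (cases ac) auto
  let ?M = "sum_list (map fst L)"
  let ?A = "jordan_block a 1 - 1\<^sub>m a :: 'k mat" and ?B = "jordan_matrix L - 1\<^sub>m ?M"
  have e: "jordan_matrix (ac # L) - 1\<^sub>m (sum_list (map fst (ac # L))) = four_block_mat ?A (0\<^sub>m a ?M) (0\<^sub>m ?M a) ?B"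
    unfolding a(1) jordan_matrix_Cons by (rule eq_matI) auto
  have AA: "?A * ?A = 0\<^sub>m a a"
  proof (rule eq_matI)
    fix i j assume "i < dim_row (0\<^sub>m a a :: 'k mat)" "j < dim_col (0\<^sub>m a a :: 'k mat)"
    hence "i < a" "j < a" by auto
    thus "(?A * ?A) $$ (i, j) = 0\<^sub>m a a $$ (i, j)" using a(2)
      by (auto simp: scalar_prod_def intro!: sum.neutral)
  qed auto
  have c: "?A \<in> carrier_mat a a" "?B \<in> carrier_mat ?M ?M" by (auto intro: minus_carrier_mat)
  have BB: "?B * ?B = 0\<^sub>m ?M ?M" by (rule Cons.IH) (use Cons.prems in auto)
  show ?case unfolding e
    by (subst mult_four_block_mat[OF c(1) _ _ c(2) c(1) _ _ c(2)]) (use AA BB c a in auto)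
qed

text \<open>Blocks of size at most 2 make \<open>y - 1\<close> square to zero; for a symplectic
  matrix this is the equation \<open>Y v = 2 \<star> v\<close>.\<close>

lemma jordan_type_square_zero:
  assumes y: "y \<in> carrier_mat N N" "unipotent_mat y" and t: "has_jordan_type (y :: 'k::field mat) P"
    and P: "\<And>a. a \<in># P \<Longrightarrow> a \<le> 2" and v: "v \<in> vs N"
  shows "act N y (act N y v) = 2 \<star> act N y v - v"
proof -
  obtain L where L: "jordan_nf y L" "mset (map fst L) = P" using t unfolding has_jordan_type_def by blast
  obtain R Q where "similar_mat_wit y (jordan_matrix L) R Q" using L(1) unfolding jordan_nf_def similar_mat_def by blast
  note w = similar_mat_witD2[OF y(1) this]
  have N: "sum_list (map fst L) = N" using w(5) by auto
  have "a \<le> 2 \<and> c = 1" if "(a, c) \<in> set L" for a c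
  proof
    have "a \<in># P" unfolding L(2)[symmetric] using that by force
    thus "a \<le> 2" by (rule P)
  qed (rule unipotent_jordan_eigenvalue[OF y L(1) that])
  hence J: "(jordan_matrix L - 1\<^sub>m N) * (jordan_matrix L - 1\<^sub>m N) = 0\<^sub>m N N"
    using jordan_square_zero[of L] unfolding N by blast
  define J where "J = act N (jordan_matrix L)"
  let ?q = "act N Q v"
  have "act N ((jordan_matrix L - 1\<^sub>m N) * (jordan_matrix L - 1\<^sub>m N)) ?q = 0" unfolding J by simp
  hence JJ: "J (J ?q) = J ?q + J ?q - ?q"
    using w(5) by (simp add: act_mult act_diff_mat minus_carrier_mat J_def eq_diff_eq) (simp add: algebra_simps)?
  have QP: "act N Q (act N R u) = u" if "u \<in> vs N" for u using w(2) act_mult[OF w(7,6), of u] that by simp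
  have PQ: "act N R (act N Q u) = u" if "u \<in> vs N" for u using w(1) act_mult[OF w(6,7), of u] that by simp
  have yv: "act N y u = act N R (J (act N Q u))" for u
    unfolding w(3) using w by (simp add: act_mult J_def)
  have "act N y (act N y v) = act N R (J (J ?q))" unfolding yv by (simp add: QP J_def)
  also have "\<dots> = act N y v + act N y v - v" unfolding JJ yv act_add act_diff by (simp only: PQ[OF v])
  finally show ?thesis by (simp add: fun_eq_iff)
qed

lemma jordan_type_rank_one:
  assumes y: "y \<in> carrier_mat N N" "unipotent_mat y"
    and t: "has_jordan_type (y :: 'k::field mat) (replicate_mset 1 2 + replicate_mset r 1)"
  obtains \<alpha> \<phi> where "\<alpha> \<in> (vs N :: (nat \<Rightarrow> 'k) set)" "\<And>v. v \<in> vs N \<Longrightarrow> act N y v = v + \<phi> v \<star> \<alpha>"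
proof -
  obtain L where L: "jordan_nf y L" "mset (map fst L) = replicate_mset 1 2 + replicate_mset r 1"
    using t unfolding has_jordan_type_def by blast
  note ev = unipotent_jordan_eigenvalue[OF y L(1)]
  have "2 \<in># mset (map fst L)" unfolding L(2) by simp
  then obtain c where "(2, c) \<in> set L" by auto
  hence "(2, 1) \<in> set L" using ev by blast
  then obtain L1 L2 where L12: "L = L1 @ (2, 1) # L2" by (meson split_list)
  have m1: "mset (map fst L1) + mset (map fst L2) = replicate_mset r 1" using L(2) unfolding L12 by simp
  have "z = (1, 1)" if z: "z \<in> set L1 \<union> set L2" for z
  proof -
    have "fst z \<in># mset (map fst L1) + mset (map fst L2)" using z by auto
    hence "fst z = 1" unfolding m1 by (simp split: if_splits)
    moreover have "snd z = 1" using z ev[of "fst z" "snd z"] L12 by auto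
    ultimately show ?thesis by (simp add: prod_eq_iff)
  qed
  hence "L1 = replicate (length L1) (1, 1)" "L2 = replicate (length L2) (1, 1)"
    by (auto intro!: replicate_eqI)
  then obtain p q where L': "L = replicate p (1, 1) @ (2, 1) # replicate q (1, 1)" unfolding L12 by metis
  obtain R Q where "similar_mat_wit y (jordan_matrix L) R Q" using L(1) unfolding jordan_nf_def similar_mat_def by blast
  note w = similar_mat_witD2[OF y(1) this]
  have N: "N = p + 2 + q" using w(5) by (auto simp: L' sum_list_replicate)
  have Ju: "act N (jordan_matrix L) u = u + u (Suc p) \<star> bv p" if u: "u \<in> vs N" for u
  proof (rule lin_eq_on_basis[OF lin_act _ _ u])
    show "lin (\<lambda>u. u + u (Suc p) \<star> bv p)" by (auto simp: lin_def fun_eq_iff algebra_simps)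
    fix k assume k: "k < N"
    show "act N (jordan_matrix L) (bv k) = bv k + bv k (Suc p) \<star> bv p"
    proof (rule ext)
      fix i show "act N (jordan_matrix L) (bv k) i = (bv k + bv k (Suc p) \<star> bv p) i"
      proof (cases "i < N")
        case True
        have "jordan_matrix L $$ (i, k) = (if i = k \<or> i = p \<and> k = Suc p then 1 else (0 :: 'k))"
          unfolding L' by (rule jordan_matrix_one_two) (use True k N in auto)
        thus ?thesis unfolding act_bv[OF True k] by (auto simp: bv_def)
      qed (use k N in \<open>auto simp: act_def bv_def\<close>)
    qed
  qed
  have PQ: "act N R (act N Q u) = u" if "u \<in> vs N" for u using w(1) act_mult[OF w(6,7), of u] that by simp
  show ?thesis
  proof (rule that[of "act N R (bv p)" "\<lambda>v. act N Q v (Suc p)"])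
    fix v :: "nat \<Rightarrow> 'k" assume v: "v \<in> vs N"
    have "act N y v = act N R (act N (jordan_matrix L) (act N Q v))" unfolding w(3) using w by (simp add: act_mult)
    thus "act N y v = v + act N Q v (Suc p) \<star> act N R (bv p)" using v by (simp add: Ju PQ)
  qed simp
qed

text \<open>Preservation of the pairing of \<open>v\<close> with one fixed vector not perpendicular
  to \<open>\<alpha>\<close> forces \<open>\<phi>\<close> to be a multiple of the pairing with
  \<open>\<alpha>\<close>.\<close>

lemma symplectic_rank_one:
  fixes u :: "'k::field mat"
  assumes u: "u \<in> carrier (Sp n)" and a: "\<alpha> \<in> vs (2*n)" and uv: "\<And>v. v \<in> vs (2*n) \<Longrightarrow> act (2*n) u v = v + \<phi> v \<star> \<alpha>"
  obtains d where "\<And>v. v \<in> vs (2*n) \<Longrightarrow> act (2*n) u v = v + (d * om n v \<alpha>) \<star> \<alpha>"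
proof (cases "\<alpha> = 0")
  case True thus ?thesis using uv that by simp
next
  case False
  then obtain w0 where w0: "w0 \<in> vs (2*n)" "om n \<alpha> w0 \<noteq> 0" using om_nondeg[OF a] by blast
  have "\<phi> v = (\<phi> w0 / om n w0 \<alpha>) * om n v \<alpha>" if v: "v \<in> vs (2*n)" for v
  proof -
    have "om n (v + \<phi> v \<star> \<alpha>) (w0 + \<phi> w0 \<star> \<alpha>) = om n v w0" using Sp_om[OF u, of v w0] uv[OF v] uv[OF w0(1)] by simp
    hence "\<phi> w0 * om n v \<alpha> = \<phi> v * om n w0 \<alpha>" using om_skew[of n \<alpha> w0] by simp
    moreover have "om n w0 \<alpha> \<noteq> 0" using w0(2) om_skew[of n \<alpha> w0] by simp
    ultimately show ?thesis by (simp add: field_simps)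
  qed
  thus ?thesis using that uv by metis
qed


section \<open>The classification\<close>

lemma two_neq_0:
  assumes "odd CHAR('k::{field})" shows "(2 :: 'k) \<noteq> 0"
proof
  assume "(2 :: 'k) = 0"
  hence "of_nat 2 = (0 :: 'k)" by simp
  hence "CHAR('k) dvd 2" by (simp only: of_nat_eq_0_iff_char_dvd)
  hence "CHAR('k) = 1 \<or> CHAR('k) = 2" using prime_nat_iff[of 2] two_is_prime_nat by blast
  moreover have "CHAR('k) \<noteq> 1" using of_nat_eq_0_iff_char_dvd[of 1, where 'a = 'k] by auto
  ultimately show False using assms by auto
qed

lemma dmat_Sp:
  assumes "\<And>i. i < 2*n \<Longrightarrow> d i * d (swp n i) = 1" shows "dmat (2*n) d \<in> carrier (Sp n)"
  unfolding Sp_iff_basis using assms by (auto simp: act_dmat_bv om_bv mult.commute)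

lemma sigma_Sp: "l \<le> n \<Longrightarrow> sigma_mat n l \<in> carrier (Sp n)"
  unfolding sigma_dmat by (rule dmat_Sp) (auto simp: swp_def)

lemma sigma_involution: "l \<le> n \<Longrightarrow> v \<in> vs (2*n) \<Longrightarrow> act (2*n) (sigma_mat n l) (act (2*n) (sigma_mat n l) v) = v"
  unfolding sigma_dmat by (simp add: act_dmat[OF vs_closed(6)]) (auto simp: act_dmat fun_eq_iff)

lemma conj_sinv_mem: "h \<in> carrier (Sp n) \<Longrightarrow> sinv n h * z * h \<in> conj_class (Sp n) z"
  unfolding conj_class_Sp by (intro CollectI exI[of _ "sinv n h"]) (simp add: sinv_sinv)

lemma conj_class_self: "x \<in> carrier (Sp n) \<Longrightarrow> x \<in> conj_class (Sp n) x"
  unfolding conj_class_Sp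
  using left_mult_one_mat[OF Sp_carrier_mat[of x n]] right_mult_one_mat[OF Sp_carrier_mat[of x n]]
  by (intro CollectI exI[of _ "1\<^sub>m (2*n)"]) (simp add: sinv_one)

lemma conj_sinv_mult:
  assumes "h \<in> carrier (Sp n)" "A \<in> carrier_mat (2*n) (2*n)" "B \<in> carrier_mat (2*n) (2*n)"
  shows "sinv n h * (A * B) * h = (sinv n h * A * h) * (sinv n h * B * h)"
  using assms by (intro mat_eq_act[of _ "2*n"]) (auto simp: act_mult)

text \<open>The disjunction of the theorem in the same syntactic form, so that it can be folded
  there.\<close>

definition spherical_rep :: "nat \<Rightarrow> 'k::field mat \<Rightarrow> bool" where
  "spherical_rep n y \<longleftrightarrow>
      (\<exists>l\<in>{1..n div 2}. y = sigma_mat n l)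
     \<or> (\<exists>c. c\<^sup>2 \<noteq> 0 \<and> c\<^sup>2 \<noteq> 1 \<and> y = a_mat n c)
     \<or> (\<exists>c. c\<^sup>2 \<noteq> 0 \<and> c\<^sup>2 \<noteq> 1 \<and> y = c_mat n c)
     \<or> (\<exists>m\<in>{1..n}. y \<in> carrier (Sp n) \<and> unipotent_mat y \<and>
          has_jordan_type y (replicate_mset m 2 + replicate_mset (2 * n - 2 * m) 1))
     \<or> (\<exists>l\<in>{1..n div 2}. \<exists>u\<in>centralizer (Sp n) (sigma_mat n l).
          unipotent_mat u \<and>
          has_jordan_type u (replicate_mset 1 2 + replicate_mset (2 * n - 2) 1) \<and>
          y = sigma_mat n l * u)"

subsection \<open>The representatives are spherical\<close>

lemma (in sp_elem) spherical_if_involution: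
  assumes "\<And>v. v \<in> V \<Longrightarrow> T (T v) = v" shows "spherical_class n (conj_class (Sp n) x)"
  by (rule spherical_if_involution_transvection[of T 0])
    (use assms x in \<open>auto intro!: bexI[of _ x]\<close>)

text \<open>Since \<open>u\<close> commutes with the involution, \<open>\<alpha>\<close> is an
  eigenvector of it unless \<open>u\<close> is trivial. For the eigenvalue -1 the negative of the
  product is treated instead, whose involution fixes \<open>\<alpha>\<close>.\<close>

lemma spherical_sigma_mult:
  fixes u :: "'k::alg_closed_field mat"
  assumes two: "(2 :: 'k) \<noteq> 0" and l: "l \<le> n" and u: "u \<in> carrier (Sp n)"
    and comm: "u * sigma_mat n l = sigma_mat n l * u"
    and a: "\<alpha> \<in> vs (2*n)" and uv: "\<And>v. v \<in> vs (2*n) \<Longrightarrow> act (2*n) u v = v + (d * om n v \<alpha>) \<star> \<alpha>"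
  shows "spherical_class n (conj_class (Sp n) (sigma_mat n l * u))"
proof -
  let ?s = "act (2*n) (sigma_mat n l :: 'k mat)"
  have S: "(sigma_mat n l :: 'k mat) \<in> carrier (Sp n)" by (rule sigma_Sp[OF l])
  interpret sp_elem n "sigma_mat n l * u" using two S u by unfold_locales auto
  have ss: "?s (?s v) = v" if "v \<in> V" for v using sigma_involution[OF l that] .
  have Tv: "T v = ?s v + (d * om n v \<alpha>) \<star> ?s \<alpha>" if "v \<in> V" for v
    using S u uv[OF that] by (simp add: act_mult)
  show ?thesis
  proof (cases "d = 0 \<or> \<alpha> = 0")
    case True
    hence "T v = ?s v" if "v \<in> V" for v using Tv[OF that] by auto
    thus ?thesis using ss by (intro spherical_if_involution) simp
  next
    case False
    then obtain w0 where w0: "w0 \<in> V" "om n \<alpha> w0 \<noteq> 0" using om_nondeg[OF a] by blast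
    have w0': "om n w0 \<alpha> \<noteq> 0" using w0(2) om_skew[of n \<alpha> w0] by simp
    have "act (2*n) (u * sigma_mat n l) w0 = act (2*n) (sigma_mat n l * u) w0" using comm by simp
    hence "?s w0 + (d * om n (?s w0) \<alpha>) \<star> \<alpha> = ?s w0 + (d * om n w0 \<alpha>) \<star> ?s \<alpha>"
      using u S uv[of "?s w0"] uv[OF w0(1)] by (simp add: act_mult)
    hence "(d * om n w0 \<alpha>) \<star> ?s \<alpha> = (d * om n (?s w0) \<alpha>) \<star> \<alpha>" by simp
    hence "inverse (d * om n w0 \<alpha>) \<star> (d * om n w0 \<alpha>) \<star> ?s \<alpha> = inverse (d * om n w0 \<alpha>) \<star> (d * om n (?s w0) \<alpha>) \<star> \<alpha>" by simp
    hence "?s \<alpha> = (om n (?s w0) \<alpha> / om n w0 \<alpha>) \<star> \<alpha>" using w0' False by (simp add: field_simps)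
    then obtain e where e: "?s \<alpha> = e \<star> \<alpha>" by (rule that)
    have "(e * e) \<star> \<alpha> = 1 \<star> \<alpha>" using ss[OF a] unfolding e by (simp add: e)
    hence "(e * e - 1) \<star> \<alpha> = 0" by (simp only: scl_left_diff) simp
    hence "e * e = 1" using False by simp
    hence "(e - 1) * (e + 1) = 0" by (simp add: algebra_simps)
    hence "e = 1 \<or> e = - 1" by (simp add: eq_neg_iff_add_eq_0)
    thus ?thesis
    proof
      assume e1: "e = 1"
      \<comment> \<open>The square root moves the coefficient into the vector; the sign compensates
        for \<open>om n \<alpha> v = - om n v \<alpha>\<close>.\<close>
      obtain c where c: "c * c = - d" using sqrt_exists by blast
      show ?thesis
      proof (rule spherical_if_involution_transvection[of ?s "c \<star> \<alpha>"])
        fix v assume v: "v \<in> V"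
        have "om n (c \<star> \<alpha>) v \<star> c \<star> \<alpha> = (d * om n v \<alpha>) \<star> \<alpha>"
        proof -
          have "om n (c \<star> \<alpha>) v * c = - (c * c) * om n v \<alpha>" using om_skew[of n \<alpha> v] by simp
          thus ?thesis unfolding scl_scl c by simp
        qed
        thus "T v = ?s v + om n (c \<star> \<alpha>) v \<star> c \<star> \<alpha>" unfolding Tv[OF v] e e1 by (simp only: scl_one)
      qed (use ss S a e e1 in \<open>auto intro!: bexI[of _ "sigma_mat n l"]\<close>)
    next
      assume e1: "e = - 1"
      obtain c where c: "c * c = - d" using sqrt_exists by blast
      interpret m: sp_elem n "- (sigma_mat n l * u)" using two S u by unfold_locales auto
      have lm: "lin (\<lambda>v. - ?s v)" by (auto simp: lin_def fun_eq_iff)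
      have "spherical_class n (conj_class (Sp n) (- (sigma_mat n l * u)))"
      proof (rule m.spherical_if_involution_transvection[of "\<lambda>v. - ?s v" "c \<star> \<alpha>", OF lm])
        fix v assume v: "v \<in> V"
        have "om n (c \<star> \<alpha>) v \<star> c \<star> \<alpha> = (d * om n v \<alpha>) \<star> \<alpha>"
        proof -
          have "om n (c \<star> \<alpha>) v * c = - (c * c) * om n v \<alpha>" using om_skew[of n \<alpha> v] by simp
          thus ?thesis unfolding scl_scl c by simp
        qed
        moreover have "act (2*n) (- (sigma_mat n l * u)) v = - ?s v + (d * om n v \<alpha>) \<star> \<alpha>"
          using Tv[OF v] e e1 S u by simp
        ultimately show "act (2*n) (- (sigma_mat n l * u)) v = - ?s v + om n (c \<star> \<alpha>) v \<star> c \<star> \<alpha>" by (simp only:)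
      next
        show "\<exists>A\<in>carrier_mat (2*n) (2*n). \<forall>v\<in>V. - ?s v = act (2*n) A v"
          using S by (intro bexI[of _ "- sigma_mat n l"]) auto
      qed (use ss S a e e1 in auto)
      thus ?thesis by (rule spherical_uminus[OF x])
    qed
  qed
qed

lemma spherical_rep_spherical:
  fixes y :: "'k::alg_closed_field mat"
  assumes two: "(2 :: 'k) \<noteq> 0" and n: "n \<ge> 2" and y: "y \<in> carrier (Sp n)" and rep: "spherical_rep n y"
  shows "spherical_class n (conj_class (Sp n) y)"
proof -
  interpret sp_elem n y using two y by unfold_locales
  from rep consider (s) l where "l \<in> {1..n div 2}" "y = sigma_mat n l"
    | (a) c where "c\<^sup>2 \<noteq> 0" "y = a_mat n c" | (c) c where "c\<^sup>2 \<noteq> 0" "y = c_mat n c"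
    | (u) m where "unipotent_mat y" "has_jordan_type y (replicate_mset m 2 + replicate_mset (2 * n - 2 * m) 1)"
    | (su) l u where "l \<in> {1..n div 2}" "u \<in> centralizer (Sp n) (sigma_mat n l)" "unipotent_mat u"
        "has_jordan_type u (replicate_mset 1 2 + replicate_mset (2 * n - 2) 1)" "y = sigma_mat n l * u"
    unfolding spherical_rep_def by blast
  thus ?thesis
  proof cases
    case s
    have "l \<le> n" using s(1) by (meson atLeastAtMost_iff div_le_dividend order_trans)
    thus ?thesis using sigma_involution[of l n] s(2) by (intro spherical_if_involution) simp
  next
    case a
    let ?d = "\<lambda>i. if i < n then c else inverse c"
    have yd: "y = dmat (2*n) ?d" unfolding a(2) by (rule a_dmat)
    show ?thesis
    proof (rule spherical_if_Y_scalar)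
      fix v assume v: "v \<in> V"
      let ?u = "\<lambda>i. inverse (?d i) * v i"
      have u: "?u \<in> V" using v by (simp add: vs_def)
      have "T ?u = v" unfolding yd act_dmat[OF u] using a(1) by (auto simp: fun_eq_iff)
      hence "T' v = ?u" using TT(2)[OF u] by simp
      thus "Y v = (c + inverse c) \<star> v" unfolding Y_def using act_dmat[OF v, of ?d] unfolding yd
        by (auto simp: fun_eq_iff algebra_simps)
    qed
  next
    case c
    let ?d = "\<lambda>i. if i = 0 then c else if i = n then inverse c else 1"
    have yd: "y = dmat (2*n) ?d" unfolding c(2) by (rule c_dmat) (use n in simp)
    show ?thesis
    proof (rule spherical_if_rank_two[OF n, of "bv 0" c "bv n"])
      show "T (bv 0) = c \<star> bv 0" "T (bv n) = inverse c \<star> bv n"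
        unfolding yd using n act_dmat_bv[of 0 "2*n" ?d] act_dmat_bv[of n "2*n" ?d] by auto
      show "om n (bv 0) (bv n) = (1 :: 'k)" using n by (simp add: om_bv swp_def eps_def)
      fix v assume v: "v \<in> V" "om n (bv 0) v = 0" "om n (bv n) v = 0"
      hence "v n = 0" "v 0 = 0" using n by (auto simp: om_bv_left swp_def eps_def)
      thus "T v = v" unfolding yd act_dmat[OF v(1)] by (auto simp: fun_eq_iff)
    qed (use n in auto)
  next
    case u
    show ?thesis
    proof (rule spherical_if_Y_scalar)
      fix v assume v: "v \<in> V"
      have "T (T v) = 2 \<star> T v - v"
        by (rule jordan_type_square_zero[OF Sp_carrier_mat[OF y] u _ v]) (auto split: if_splits)
      hence "T' (T (T v)) = T' (2 \<star> T v - v)" by simp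
      thus "Y v = 2 \<star> v" using v by (simp add: Y_def)
    qed
  next
    case su
    have l: "l \<le> n" using su(1) by (meson atLeastAtMost_iff div_le_dividend order_trans)
    have uS: "u \<in> carrier (Sp n)" and comm: "u * sigma_mat n l = sigma_mat n l * u"
      using su(2) by (auto simp: centralizer_def)
    obtain \<alpha> \<phi> where al: "\<alpha> \<in> V" "\<And>v. v \<in> V \<Longrightarrow> act (2*n) u v = v + \<phi> v \<star> \<alpha>"
      using jordan_type_rank_one[OF Sp_carrier_mat[OF uS] su(3,4)] by metis
    obtain d where "\<And>v. v \<in> V \<Longrightarrow> act (2*n) u v = v + (d * om n v \<alpha>) \<star> \<alpha>"
      using symplectic_rank_one[OF uS al] by metis
    thus ?thesis unfolding su(5) by (rule spherical_sigma_mult[OF two l uS comm al(1)])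
  qed
qed

subsection \<open>Spherical classes contain a representative\<close>

lemma sigma_reverse:
  assumes "l \<le> n" shows "sinv n (rvm n) * (- sigma_mat n l) * rvm n = (sigma_mat n (n - l) :: 'k::field mat)"
proof (rule conj_class_frame(2)[OF uminus_Sp[OF sigma_Sp[OF assms]] rvm_Sp])
  fix j assume "j < 2*n"
  thus "act (2*n) (- sigma_mat n l) (fcol n (rvm n) j) = act (2*n) (rvm n) (fcol n (sigma_mat n (n - l) :: 'k mat) j)"
    using assms sigma_dmat[OF assms, where 'a = 'k] sigma_dmat[of "n - l" n, where 'a = 'k]
    by (auto simp: act_rvm act_dmat_bv rv_lt rv_def scl_minus_one)
qed (use sigma_Sp[of "n - l" n] in auto)

context sp_elem
begin

text \<open>If more than half of the pairs carry the eigenvalue -1, the negative of \<open>x\<close>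
  is used, with the order of the pairs reversed.\<close>

lemma involution_sigma:
  assumes inv: "\<And>v. v \<in> V \<Longrightarrow> T (T v) = v" and x1: "x \<noteq> 1\<^sub>m (2*n)" "x \<noteq> - 1\<^sub>m (2*n)"
  shows "\<exists>h\<in>carrier (Sp n). \<exists>l\<in>{1..n div 2}. sinv n h * x * h = sigma_mat n l \<or> sinv n h * (- x) * h = sigma_mat n l"
proof -
  obtain g l where g: "g \<in> carrier (Sp n)" and l: "l \<le> n" and s: "sinv n g * x * g = sigma_mat n l"
    using involution_frame[OF inv] by blast
  have xg: "x = g * sigma_mat n l * sinv n g" unfolding s[symmetric] using conj_back(1)[OF g Sp_carrier_mat[OF x]] by simp
  have "l \<noteq> 0"
  proof
    assume "l = 0"
    hence "sigma_mat n l = (1\<^sub>m (2*n) :: 'k mat)"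
      unfolding sigma_dmat[OF l] scalar_dmat(1) by (intro dmat_cong) auto
    thus False using x1(1) xg g right_mult_one_mat[OF Sp_carrier_mat[OF g]] by (simp add: sinv_right)
  qed
  moreover have "l \<noteq> n"
  proof
    assume "l = n"
    hence "sigma_mat n l = (- 1\<^sub>m (2*n) :: 'k mat)"
      unfolding sigma_dmat[OF l] scalar_dmat(2) by (intro dmat_cong) auto
    hence "x = - (g * 1\<^sub>m (2*n) * sinv n g)" using xg uminus_conj[OF g, of "1\<^sub>m (2*n)"] by simp
    thus False using x1(2) g right_mult_one_mat[OF Sp_carrier_mat[OF g]] by (simp add: sinv_right)
  qed
  ultimately have l': "1 \<le> l" "l < n" using l by auto
  show ?thesis
  proof (cases "l \<le> n div 2")
    case True thus ?thesis using g s l' by (intro bexI[of _ g] bexI[of _ l]) auto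
  next
    case False
    let ?h = "g * rvm n"
    have "sinv n ?h * (- x) * ?h = sinv n (rvm n) * (- (sinv n g * x * g)) * rvm n"
      using g x rvm_Sp[of n, where 'a = 'k]
      by (intro mat_eq_act[of _ "2*n"]) (auto simp: act_mult sinv_mult)
    hence "sinv n ?h * (- x) * ?h = sigma_mat n (n - l)" unfolding s sigma_reverse[OF l] .
    thus ?thesis using g rvm_Sp[of n, where 'a = 'k] l' False by (intro bexI[of _ ?h] bexI[of _ "n - l"]) auto
  qed
qed

lemma rep_involution:
  assumes "\<And>v. v \<in> V \<Longrightarrow> X v = 0" "x \<noteq> 1\<^sub>m (2*n)" "x \<noteq> - 1\<^sub>m (2*n)"
  shows "\<exists>y\<in>conj_class (Sp n) x \<union> conj_class (Sp n) (- x). spherical_rep n y"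
proof -
  have "T (T v) = v" if "v \<in> V" for v
    using assms(1)[of "T v"] that by (simp add: X_def)
  then obtain h l where h: "h \<in> carrier (Sp n)" "l \<in> {1..n div 2}"
    "sinv n h * x * h = sigma_mat n l \<or> sinv n h * (- x) * h = sigma_mat n l"
    using involution_sigma[OF _ assms(2,3)] by blast
  hence "sigma_mat n l \<in> conj_class (Sp n) x \<union> conj_class (Sp n) (- x)"
    using conj_sinv_mem[OF h(1), of x] conj_sinv_mem[OF h(1), of "- x"] by auto
  moreover have "spherical_rep n (sigma_mat n l :: 'k mat)" unfolding spherical_rep_def using h(2) by blast
  ultimately show ?thesis by blast
qed

lemma rep_unipotent:
  assumes Y2: "\<And>v. v \<in> V \<Longrightarrow> Y v = 2 \<star> v" and x1: "x \<noteq> 1\<^sub>m (2*n)"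
  shows "spherical_rep n x"
proof -
  obtain g m where g: "g \<in> carrier (Sp n)" "m \<le> n" "\<And>j. j < m \<Longrightarrow> fcol n g (n + j) = X (fcol n g j)"
      "\<And>j. j < m \<Longrightarrow> X (fcol n g (n + j)) = 0" "\<And>v. v \<in> perp n g m \<Longrightarrow> X v = 0"
    using unipotent_frame[OF Y2] by blast
  have "m \<noteq> 0"
  proof
    assume "m = 0"
    hence "X v = 0" if "v \<in> V" for v using g(5) that by (simp add: perp_def pairs_def)
    hence "T v = v" if "v \<in> V" for v using T_square_zero[OF Y2 that] that by simp
    hence "x = 1\<^sub>m (2*n)" using x by (intro mat_eq_act[of _ "2*n"]) auto
    thus False using x1 by simp
  qed
  hence "m \<in> {1..n}" using g(2) by simp
  thus ?thesis unfolding spherical_rep_def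
    using x unipotent_if_Y2[OF Y2] jordan_type_of_frame[OF Y2 g] by blast
qed

text \<open>\<open>X\<close> has rank one, while \<open>m\<close> pairs of the adapted frame provide
  \<open>m\<close> independent vectors in its image; hence \<open>m = 1\<close>.\<close>

lemma transvection_type:
  assumes n: "n > 0" and w: "w \<in> V" "w \<noteq> 0" "c \<noteq> 0" and Tv: "\<And>v. v \<in> V \<Longrightarrow> T v = v + (c * om n w v) \<star> w"
  shows "unipotent_mat x" "has_jordan_type x (replicate_mset 1 2 + replicate_mset (2*n - 2) 1)"
proof -
  have T'v: "T' v = v - (c * om n w v) \<star> w" if v: "v \<in> V" for v
  proof -
    have "T (v - (c * om n w v) \<star> w) = v" using Tv[OF v] Tv[OF w(1)] by simp
    thus ?thesis using TT(2)[of "v - (c * om n w v) \<star> w"] v w(1) by simp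
  qed
  have Y2: "Y v = 2 \<star> v" if "v \<in> V" for v using Tv[OF that] T'v[OF that] by (simp add: Y_def fun_eq_iff)
  have Xv: "X v = (2 * c * om n w v) \<star> w" if "v \<in> V" for v
    using Tv[OF that] T'v[OF that] by (simp add: X_def fun_eq_iff)
  obtain g m where g: "g \<in> carrier (Sp n)" "m \<le> n" "\<And>j. j < m \<Longrightarrow> fcol n g (n + j) = X (fcol n g j)"
      "\<And>j. j < m \<Longrightarrow> X (fcol n g (n + j)) = 0" "\<And>v. v \<in> perp n g m \<Longrightarrow> X v = 0"
    using unipotent_frame[OF Y2] by blast
  have "m \<noteq> 0"
  proof
    assume "m = 0"
    obtain v where v: "v \<in> V" "om n w v \<noteq> 0" using om_nondeg[OF w(1)] w(2) by blast
    have "X v = 0" using g(5) v(1) \<open>m = 0\<close> by (simp add: perp_def pairs_def)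
    thus False using Xv[OF v(1)] v(2) w two by simp
  qed
  moreover have "\<not> m \<ge> 2"
  proof
    assume m: "m \<ge> 2"
    define k where "k j = 2 * c * om n w (fcol n g j)" for j
    have f: "fcol n g (n + j) = k j \<star> w" if "j < 2" for j
      using g(3)[of j] Xv[of "fcol n g j"] that m by (simp add: k_def)
    have "om n (fcol n g 0) (fcol n g (n + 1)) = 0" "om n (fcol n g 0) (fcol n g (n + 0)) = 1"
      "om n (fcol n g 1) (fcol n g (n + 1)) = 1"
      using om_col_simps(3)[OF g(1), of 0 1] om_col_simps(3)[OF g(1), of 0 0] om_col_simps(3)[OF g(1), of 1 1] m g(2) by simp_all
    moreover have kw: "om n (fcol n g i) (fcol n g (n + j)) = k j * om n (fcol n g i) w" if "j < 2" for i j
      unfolding f[OF that] by (rule om_simps(8))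
    ultimately have "k 1 * om n (fcol n g 0) w = 0" "k 0 * om n (fcol n g 0) w = 1" "k 1 * om n (fcol n g 1) w = 1"
      using kw[of 1 0] kw[of 0 0] kw[of 1 1] by simp_all
    thus False by auto
  qed
  ultimately have m: "m = 1" by simp
  show "unipotent_mat x" by (rule unipotent_if_Y2[OF Y2])
  show "has_jordan_type x (replicate_mset 1 2 + replicate_mset (2*n - 2) 1)"
    using jordan_type_of_frame[OF Y2 g] unfolding m by simp
qed

text \<open>Half of \<open>Y\<close> is an involution because \<open>X\<close> squares to zero, and
  it fixes \<open>w\<close>. So \<open>x\<close> is the product of this involution with a
  transvection along \<open>w\<close>, and the two factors commute.\<close>

lemma rep_rank_one:
  assumes n: "n > 0" and w: "w \<in> V" "w \<noteq> 0" "c \<noteq> 0" "Y w = 2 \<star> w" and Xv: "\<And>v. v \<in> V \<Longrightarrow> X v = (c * om n w v) \<star> w"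
    and x1: "x \<noteq> 1\<^sub>m (2*n)"
  shows "\<exists>y\<in>conj_class (Sp n) x \<union> conj_class (Sp n) (- x). spherical_rep n y"
proof -
  define s where "s v = (1 / 2) \<star> Y v" for v
  define S where "S = mof (2*n) s"
  have s_add: "s (a + b) = s a + s b" "s (k \<star> a) = k \<star> s a" for a b k
    by (auto simp: s_def scl_add mult.commute)
  have sV: "s v \<in> V" for v by (auto simp: s_def)
  have Sv: "act (2*n) S v = s v" if "v \<in> V" for v
    unfolding S_def by (rule act_mof[OF _ sV that]) (simp add: lin_def s_add)
  have ss: "s (s v) = v" if v: "v \<in> V" for v
  proof -
    have "X (X v) = 0" using Xv[OF v] Xv[OF w(1)] by simp
    hence "Y (Y v) = 4 \<star> v" using YY[OF v] by simp
    hence "s (s v) = (1 / 2 * (1 / 2) * 4) \<star> v" by (simp add: s_def)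
    thus ?thesis using pow2_nz(1) by simp
  qed
  have adj: "om n (s v) u = om n v (s u)" if "v \<in> V" "u \<in> V" for v u
    using om_Y[OF that] by (simp add: s_def)
  have sw: "s w = w" using w(4) two by (simp add: s_def)
  have Sc: "S \<in> carrier_mat (2*n) (2*n)" by (simp add: S_def)
  have SS: "S \<in> carrier (Sp n)"
    by (rule SpI[OF Sc]) (simp add: Sv adj sV ss)
  have Tv: "T v = s v + (c / 2 * om n w v) \<star> w" if v: "v \<in> V" for v
  proof -
    have "(1 / 2) \<star> 2 \<star> T v = (1 / 2) \<star> (Y v + X v)" using T_XY[of v] by simp
    thus ?thesis using two Xv[OF v] by (simp add: s_def scl_add)
  qed
  define u where "u = S * x"
  have uS: "u \<in> carrier (Sp n)" using SS x by (simp add: u_def)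
  have uv: "act (2*n) u v = v + (c / 2 * om n w v) \<star> w" if v: "v \<in> V" for v
  proof -
    have "act (2*n) u v = s (T v)" unfolding u_def using SS x by (simp add: act_mult Sv)
    thus ?thesis unfolding Tv[OF v] s_add ss[OF v] sw .
  qed
  have xSu: "x = S * u" using SS uS x
    by (intro mat_eq_act[of _ "2*n"]) (auto simp: act_mult Sv uv Tv s_add sw w(1) sV)
  have du: "dim_row u = 2*n" "dim_col u = 2*n" "dim_row S = 2*n" "dim_col S = 2*n"
    using Sp_carrier_mat[OF uS] Sc by auto
  have uSu: "u * S = S * u" using SS uS
    by (intro mat_eq_act[of _ "2*n"]) (auto simp: act_mult Sv uv sV s_add sw w(1) adj[OF w(1), symmetric])
  interpret S: sp_elem n S using two SS by unfold_locales
  show ?thesis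
  proof (cases "S = 1\<^sub>m (2*n)")
    case True
    have "Y v = 2 \<star> v" if "v \<in> V" for v
    proof -
      have "s v = v" using Sv[OF that] that True by simp
      hence "2 \<star> (1 / 2) \<star> Y v = 2 \<star> v" by (simp add: s_def)
      thus ?thesis using two by simp
    qed
    hence "spherical_rep n x" by (rule rep_unipotent[OF _ x1])
    thus ?thesis using conj_class_self[OF x] by blast
  next
    case S1: False
    have S2: "S \<noteq> - 1\<^sub>m (2*n)"
    proof
      assume "S = - 1\<^sub>m (2*n)"
      hence "- w = w" using Sv[OF w(1)] sw w(1) by simp
      hence "w + w = 0" by (metis add.right_inverse)
      hence "2 \<star> w = 0" by (simp add: fun_eq_iff)
      thus False using w(2) two by simp
    qed
    obtain h l where h: "h \<in> carrier (Sp n)" and l: "l \<in> {1..n div 2}"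
      and hl: "sinv n h * S * h = sigma_mat n l \<or> sinv n h * (- S) * h = sigma_mat n l"
      using S.involution_sigma[OF _ S1 S2] Sv sV ss by auto
    let ?u = "sinv n h * u * h" and ?w = "act (2*n) (sinv n h) w"
    have u'S: "?u \<in> carrier (Sp n)" using h uS by simp
    interpret u: sp_elem n ?u using two u'S by unfold_locales
    have u'v: "act (2*n) ?u v = v + (c / 2 * om n ?w v) \<star> ?w" if v: "v \<in> V" for v
      using h uS uv[of "act (2*n) h v"] v by (simp add: act_mult om_sinv)
    have w': "?w \<noteq> 0"
    proof
      assume "?w = 0"
      hence "act (2*n) h ?w = 0" by simp
      thus False using h w by simp
    qed
    have c2: "c / 2 \<noteq> 0" using w(3) two by simp
    note type = u.transvection_type[OF n vs_closed(6) w' c2 u'v]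
    have cen: "?u \<in> centralizer (Sp n) (sigma_mat n l)"
    proof -
      have "?u * (sinv n h * S * h) = (sinv n h * S * h) * ?u"
        using uSu conj_sinv_mult[OF h, of u S] conj_sinv_mult[OF h, of S u] uS SS by simp
      moreover have "?u * (sinv n h * (- S) * h) = (sinv n h * (- S) * h) * ?u"
      proof -
        have "u * (- S) = (- S) * u"
          using uSu uminus_mult_left_mat[of S u] uminus_mult_right_mat[of u S] du by simp
        thus ?thesis using conj_sinv_mult[OF h, of u "- S"] conj_sinv_mult[OF h, of "- S" u] uS SS by simp
      qed
      ultimately show ?thesis using hl u'S by (auto simp: centralizer_def)
    qed
    have rep: "spherical_rep n (sigma_mat n l * ?u)"
      unfolding spherical_rep_def using l cen type by blast
    from hl have "sigma_mat n l * ?u = sinv n h * x * h \<or> sigma_mat n l * ?u = sinv n h * (- x) * h"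
    proof
      assume "sinv n h * S * h = sigma_mat n l"
      thus ?thesis using conj_sinv_mult[OF h, of S u] uS SS xSu by simp
    next
      assume s: "sinv n h * (- S) * h = sigma_mat n l"
      have "(- S) * u = - x" using xSu uminus_mult_left_mat[of S u] du by simp
      thus ?thesis using conj_sinv_mult[OF h, of "- S" u] uS SS s by simp
    qed
    hence "sigma_mat n l * ?u \<in> conj_class (Sp n) x \<union> conj_class (Sp n) (- x)"
      using conj_sinv_mem[OF h, of x] conj_sinv_mem[OF h, of "- x"] by auto
    thus ?thesis using rep by blast
  qed
qed

lemma rep_quasi_unipotent:
  assumes n: "n > 0" and R2 and XY: "\<And>v. v \<in> V \<Longrightarrow> X (Y v - 2 \<star> v) = 0" and x1: "x \<noteq> 1\<^sub>m (2*n)" "x \<noteq> - 1\<^sub>m (2*n)"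
  shows "\<exists>y\<in>conj_class (Sp n) x \<union> conj_class (Sp n) (- x). spherical_rep n y"
proof -
  have "(\<forall>v\<in>V. X v = 0) \<or> (\<forall>v\<in>V. Y v = 2 \<star> v) \<or>
    (\<exists>w\<in>V. \<exists>c. w \<noteq> 0 \<and> c \<noteq> 0 \<and> Y w = 2 \<star> w \<and> (\<forall>v\<in>V. X v = (c * om n w v) \<star> w))"
    by (rule classify_unipotent[OF \<open>R2\<close> XY])
  thus ?thesis
  proof (elim disjE)
    assume "\<forall>v\<in>V. X v = 0" thus ?thesis using rep_involution x1 by blast
  next
    assume "\<forall>v\<in>V. Y v = 2 \<star> v"
    hence "spherical_rep n x" using rep_unipotent x1(1) by blast
    thus ?thesis using conj_class_self[OF x] by blast
  next
    assume "\<exists>w\<in>V. \<exists>c. w \<noteq> 0 \<and> c \<noteq> 0 \<and> Y w = 2 \<star> w \<and> (\<forall>v\<in>V. X v = (c * om n w v) \<star> w)"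
    then obtain w c where "w \<in> V" "w \<noteq> 0" "c \<noteq> 0" "Y w = 2 \<star> w" "\<And>v. v \<in> V \<Longrightarrow> X v = (c * om n w v) \<star> w" by blast
    thus ?thesis using rep_rank_one[OF n] x1(1) by blast
  qed
qed

text \<open>For nonzero \<open>\<beta>\<close> the linear relation reads
  \<open>X (Y v - r \<star> v) = 0\<close>. Writing \<open>r = \<kappa> + inverse \<kappa>\<close>
  separates the semisimple case from \<open>r = 2\<close> and \<open>r = - 2\<close>, and the last
  is the case \<open>r = 2\<close> for the negative of \<open>x\<close>.\<close>

lemma rep_if_spherical:
  assumes n: "n \<ge> 2" and sph: "spherical_class n (conj_class (Sp n) x)" and x1: "x \<noteq> 1\<^sub>m (2*n)" "x \<noteq> - 1\<^sub>m (2*n)"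
  shows "\<exists>y\<in>conj_class (Sp n) x \<union> conj_class (Sp n) (- x). spherical_rep n y"
proof -
  interpret m: sp_elem n "- x" using two x by unfold_locales auto
  have mT: "act (2*n) (- x) v = - T v" for v using x by simp
  have mT': "act (2*n) (sinv n (- x)) v = - T' v" if "v \<in> V" for v
  proof -
    have "act (2*n) (- x) (- T' v) = v" using x that by simp
    thus ?thesis using m.TT(2)[of "- T' v"] by simp
  qed
  have mX: "m.X v = - X v" and mY: "m.Y v = - Y v" if "v \<in> V" for v
    using mT mT'[OF that] by (simp_all add: X_def Y_def m.X_def m.Y_def)
  obtain \<alpha> \<beta> where ab: "\<alpha> \<noteq> 0 \<or> \<beta> \<noteq> 0" "\<And>v. v \<in> V \<Longrightarrow> \<alpha> \<star> X v + \<beta> \<star> X (Y v) = 0"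
    using spherical_relations(1)[OF n sph] by blast
  have r2: R2 by (rule spherical_relations(2)[OF n sph])
  show ?thesis
  proof (cases "\<beta> = 0")
    case True
    hence "X v = 0" if "v \<in> V" for v using ab(1) ab(2)[OF that] by simp
    thus ?thesis by (rule rep_involution[OF _ x1])
  next
    case False
    define r where "r = - (\<alpha> / \<beta>)"
    have Xr: "X (Y v - r \<star> v) = 0" if v: "v \<in> V" for v
    proof -
      have "inverse \<beta> \<star> (\<alpha> \<star> X v + \<beta> \<star> X (Y v)) = 0" using ab(2)[OF v] by simp
      hence "(\<alpha> / \<beta>) \<star> X v + X (Y v) = 0" using False by (simp add: scl_add divide_inverse mult.commute)
      thus ?thesis by (simp add: r_def add.commute)
    qed
    have "\<exists>\<kappa>. poly [:1, - r, 1:] \<kappa> = 0" by (rule alg_closed_imp_poly_has_root) simp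
    then obtain \<kappa> where k: "1 + \<kappa> * (\<kappa> - r) = 0" by auto
    have k0: "\<kappa> \<noteq> 0" using k by auto
    have "r * \<kappa> = (\<kappa> + inverse \<kappa>) * \<kappa>" using k k0 by (simp add: algebra_simps)
    hence rk: "r = \<kappa> + inverse \<kappa>" using k0 by simp
    show ?thesis
    proof (cases "\<kappa>\<^sup>2 = 1")
      case True
      hence "(\<kappa> - 1) * (\<kappa> + 1) = 0" by (simp add: algebra_simps power2_eq_square)
      hence "\<kappa> = 1 \<or> \<kappa> = - 1" by (simp add: eq_neg_iff_add_eq_0)
      thus ?thesis
      proof
        assume "\<kappa> = 1"
        hence "r = 2" using rk by simp
        thus ?thesis using rep_quasi_unipotent[OF _ r2 _ x1] Xr n by simp
      next
        assume "\<kappa> = - 1"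
        hence r2': "r = - 2" using rk by simp
        have "m.X (m.Y v - 2 \<star> v) = 0" if v: "v \<in> V" for v
        proof -
          have "m.X (m.Y v - 2 \<star> v) = X (Y v - r \<star> v)"
            using mX[of "m.Y v - 2 \<star> v"] v mY[OF v] by (simp add: r2')
          thus ?thesis using Xr[OF v] by simp
        qed
        moreover have "m.R2" using r2 unfolding R2_def m.R2_def by (simp add: mX mY)
        moreover have "- x \<noteq> 1\<^sub>m (2*n)" "- x \<noteq> - 1\<^sub>m (2*n)"
          using x1 uminus_uminus_Sp[OF x] uminus_uminus_Sp[OF one_Sp, where 'a = 'k] by metis+
        ultimately have "\<exists>y\<in>conj_class (Sp n) (- x) \<union> conj_class (Sp n) (- (- x)). spherical_rep n y"
          using m.rep_quasi_unipotent n by simp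
        thus ?thesis unfolding uminus_uminus_Sp[OF x] by (simp add: Un_commute)
      qed
    next
      case False
      have "(\<forall>v\<in>V. X v = 0) \<or> (\<forall>v\<in>V. Y v = (\<kappa> + inverse \<kappa>) \<star> v) \<or>
        (\<exists>\<mu> p q \<epsilon>. \<mu> \<noteq> 0 \<and> \<mu>\<^sup>2 \<noteq> 1 \<and> \<epsilon>\<^sup>2 = 1 \<and> p \<in> V \<and> q \<in> V \<and> om n p q = 1 \<and> T p = \<mu> \<star> p \<and> T q = inverse \<mu> \<star> q \<and>
          (\<forall>v\<in>V. om n p v = 0 \<longrightarrow> om n q v = 0 \<longrightarrow> T v = \<epsilon> \<star> v))"
        by (rule classify_semisimple[OF r2 k0 False Xr[unfolded rk]])
      thus ?thesis
      proof (elim disjE)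
        assume "\<forall>v\<in>V. X v = 0" thus ?thesis using rep_involution[OF _ x1] by blast
      next
        assume "\<forall>v\<in>V. Y v = (\<kappa> + inverse \<kappa>) \<star> v"
        hence "a_mat n \<kappa> \<in> conj_class (Sp n) x" using k0 False by (intro eigen_frame) auto
        moreover have "spherical_rep n (a_mat n \<kappa>)" unfolding spherical_rep_def using k0 False by auto
        ultimately show ?thesis by blast
      next
        assume "\<exists>\<mu> p q \<epsilon>. \<mu> \<noteq> 0 \<and> \<mu>\<^sup>2 \<noteq> 1 \<and> \<epsilon>\<^sup>2 = 1 \<and> p \<in> V \<and> q \<in> V \<and> om n p q = 1 \<and> T p = \<mu> \<star> p \<and> T q = inverse \<mu> \<star> q \<and>
          (\<forall>v\<in>V. om n p v = 0 \<longrightarrow> om n q v = 0 \<longrightarrow> T v = \<epsilon> \<star> v)"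
        then obtain \<mu> p q \<epsilon> where mu: "\<mu> \<noteq> 0" "\<mu>\<^sup>2 \<noteq> 1" and e: "\<epsilon>\<^sup>2 = 1" and p: "p \<in> V" "T p = \<mu> \<star> p"
          and q: "q \<in> V" "T q = inverse \<mu> \<star> q" and pq: "om n p q = 1"
          and rest: "\<And>v. v \<in> V \<Longrightarrow> om n p v = 0 \<Longrightarrow> om n q v = 0 \<Longrightarrow> T v = \<epsilon> \<star> v" by blast
        have n0: "n > 0" using n by simp
        have "(\<epsilon> - 1) * (\<epsilon> + 1) = 0" using e by (simp add: algebra_simps power2_eq_square)
        hence "\<epsilon> = 1 \<or> \<epsilon> = - 1" by (simp add: eq_neg_iff_add_eq_0)
        thus ?thesis
        proof
          assume "\<epsilon> = 1"
          hence "c_mat n \<mu> \<in> conj_class (Sp n) x" using rest by (intro rank_two_frame[OF n0 p q pq]) simp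
          moreover have "spherical_rep n (c_mat n \<mu>)" unfolding spherical_rep_def using mu by auto
          ultimately show ?thesis by blast
        next
          assume "\<epsilon> = - 1"
          hence "c_mat n (- \<mu>) \<in> conj_class (Sp n) (- x)"
            using rest p q mT by (intro m.rank_two_frame[OF n0 p(1) _ q(1) _ pq]) simp_all
          moreover have "spherical_rep n (c_mat n (- \<mu>))"
          proof -
            have "(- \<mu>)\<^sup>2 \<noteq> 0 \<and> (- \<mu>)\<^sup>2 \<noteq> 1 \<and> c_mat n (- \<mu>) = c_mat n (- \<mu>)" using mu by simp
            thus ?thesis unfolding spherical_rep_def by blast
          qed
          ultimately show ?thesis by blast
        qed
      qed
    qed
  qed
qed

end

theorem theorem3p3:
  fixes n :: nat and x :: "'k :: alg_closed_field mat"
  assumes "odd CHAR('k)"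
    and "n \<ge> 2"
    and "x \<in> carrier (Sp n) - group_center (Sp n)"
  shows "spherical_class n (conj_class (Sp n) x) \<longleftrightarrow>
    (\<exists>y. (conjugate_in (Sp n) x y \<or> conjugate_in (Sp n) (- x) y) \<and>
      ((\<exists>l\<in>{1..n div 2}. y = sigma_mat n l)
     \<or> (\<exists>c. c\<^sup>2 \<noteq> 0 \<and> c\<^sup>2 \<noteq> 1 \<and> y = a_mat n c)
     \<or> (\<exists>c. c\<^sup>2 \<noteq> 0 \<and> c\<^sup>2 \<noteq> 1 \<and> y = c_mat n c)
     \<or> (\<exists>m\<in>{1..n}. y \<in> carrier (Sp n) \<and> unipotent_mat y \<and>
          has_jordan_type y (replicate_mset m 2 + replicate_mset (2 * n - 2 * m) 1))
     \<or> (\<exists>l\<in>{1..n div 2}. \<exists>u\<in>centralizer (Sp n) (sigma_mat n l).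
          unipotent_mat u \<and>
          has_jordan_type u (replicate_mset 1 2 + replicate_mset (2 * n - 2) 1) \<and>
          y = sigma_mat n l * u)))"
  unfolding spherical_rep_def[symmetric] conjugate_in_def
proof
  have two: "(2 :: 'k) \<noteq> 0" by (rule two_neq_0[OF assms(1)])
  have x: "x \<in> carrier (Sp n)" using assms(3) by blast
  interpret sp_elem n x using two x by unfold_locales
  {
    assume sph: "spherical_class n (conj_class (Sp n) x)"
    have "1\<^sub>m (2*n) \<in> group_center (Sp n :: 'k mat monoid)"
      unfolding group_center_def using left_mult_one_mat[OF Sp_carrier_mat] right_mult_one_mat[OF Sp_carrier_mat]
      by fastforce
    hence x1: "x \<noteq> 1\<^sub>m (2*n)" using assms(3) by blast
    have "g * (- 1\<^sub>m (2*n)) = (- 1\<^sub>m (2*n)) * g" if "g \<in> carrier (Sp n)" for g :: "'k mat"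
      using that by (intro mat_eq_act[of _ "2*n"]) (auto simp: act_mult)
    hence "- 1\<^sub>m (2*n) \<in> group_center (Sp n :: 'k mat monoid)"
      unfolding group_center_def using uminus_Sp[OF one_Sp, where 'a = 'k] by simp
    hence x2: "x \<noteq> - 1\<^sub>m (2*n)" using assms(3) by blast
    show "\<exists>y. (y \<in> conj_class (Sp n) x \<or> y \<in> conj_class (Sp n) (- x)) \<and> spherical_rep n y"
      using rep_if_spherical[OF assms(2) sph x1 x2] by blast
  }
  assume "\<exists>y. (y \<in> conj_class (Sp n) x \<or> y \<in> conj_class (Sp n) (- x)) \<and> spherical_rep n y"
  then obtain y where y: "y \<in> conj_class (Sp n) x \<or> y \<in> conj_class (Sp n) (- x)" "spherical_rep n y" by blast
  have xm: "- x \<in> carrier (Sp n)" using x by simp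
  have "y \<in> carrier (Sp n)" using y(1) conj_class_sub[OF x] conj_class_sub[OF xm] by blast
  hence sph: "spherical_class n (conj_class (Sp n) y)" by (rule spherical_rep_spherical[OF two assms(2) _ y(2)])
  from y(1) show "spherical_class n (conj_class (Sp n) x)"
  proof
    assume "y \<in> conj_class (Sp n) x"
    thus ?thesis using sph conj_class_eq[OF x] by simp
  next
    assume "y \<in> conj_class (Sp n) (- x)"
    hence "spherical_class n (conj_class (Sp n) (- x))" using sph conj_class_eq[OF xm] by simp
    thus ?thesis by (rule spherical_uminus[OF x])
  qed
qed

end
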